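(* (a) Let $(\mathbf Y_t)_{t\ge0}$ be the state process of a COGARCH$(p,q)$ process with parameters $B$, $\mathbf a$ and $\alpha_0$. Suppose that the Lévy measure $\nu_L$ of the driving Lévy process $L$ is finite and write the compound-Poisson process $[L,L]^{(d)}$ in the form $$[L,L]^{(d)}_t=\sum_{0<s\le t}(\Delta L_s)^2=\sum_{i=1}^{N(t)}Z_i,$$ where $N(t)$ is the number of jumps of $L$ in $(0,t]$ and $Z_i$ is the square of the $i$th jump size. Let $T_1$ be the time at which the first jump occurs and let $T_j$, $j=2,3,\dots$, be the time interval between the $(j-1)$st and $j$th jumps. Let $(T_0,Z_0)$ be independent of $(T_i,Z_i)_{i\in\mathbb N}$ with the same distribution as $(T_1,Z_1)$. For $i\in\mathbb N_0$ let $$C_i=(I+Z_i\mathbf e\mathbf a')e^{BT_i},\qquad \mathbf D_i=\alpha_0Z_i\mathbf e,$$ and let $\Gamma_n=\sum_{i=1}^nT_i$ (with $\Gamma_0:=0$). Then $(\mathbf Y_{\Gamma_n})_{n\in\mathbb N_0}$ satisfies the random recurrence equation $$\mathbf Y_{\Gamma_{n+1}}=C_{n+1}\mathbf Y_{\Gamma_n}+\mathbf D_{n+1},\qquad n\in\mathbb N_0.$$ Furthermore, for any $t>0$, $$\mathbf Y_t=e^{B(t-\Gamma_{N(t)})}\Bigl[\mathbf 1_{\{N(t)\ne0\}}\mathbf D_{N(t)}+\sum_{i=0}^{N(t)-2}C_{N(t)}\cdots C_{N(t)-i}\mathbf D_{N(t)-i-1}+C_{N(t)}\cdots C_1\mathbf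 Y_0\Bigr]$$ $$\stackrel{d}{=}e^{B(t-\Gamma_{N(t)})}\Bigl[\mathbf 1_{\{N(t)\ne0\}}\mathbf D_1+\sum_{i=1}^{N(t)-1}C_1\cdots C_i\mathbf D_{i+1}+C_1\cdots C_{N(t)}\mathbf Y_0\Bigr].$$ (b) Assume additionally that all the eigenvalues of $B$ are distinct and that there are $r\in[1,\infty]$ and a matrix $S\in\mathbb C^{q\times q}$ such that $S^{-1}BS$ is diagonal and $\int_{\mathbb R}\log(1+\|S^{-1}\mathbf e\mathbf a'S\|_r\,y^2)\,d\nu_L(y)<-\lambda(B)$. Then the infinite sum $\sum_{i=0}^\infty C_1\cdots C_i\mathbf D_{i+1}$ converges almost surely absolutely to a random vector $\widehat{\mathbf Y}$, which has the stationary distribution of the sequence $(\mathbf Y_{\Gamma_n})_{n\in\mathbb N_0}$. The stationary state vector $\mathbf Y_\infty$ satisfies $$\mathbf Y_\infty\stackrel{d}{=}e^{BT}\widehat{\mathbf Y},$$ where $T$ is independent of $(T_i,Z_i)_{i\in\mathbb N_0}$ and has the distribution of $T_1$. Furthermore, $\mathbf Y_\infty$ is the unique solution in distribution of the distributional fixed point equation $$\mathbf Y_\infty\stackrel{d}{=}Q\mathbf Y_\infty+\mathbf R,$$ where $\mathbf Y_\infty$ is independent of $(Q,\mathbf R)$ and $$Q:=e^{BT_0}(I+Z_0\mathbf e\mathbf a'),\qquad \mathbf R:=\alpha_0Z_0e^{BT_0}\mathbf e.$$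
   Context: Setting: $q\ge p\ge1$ are integers, $\alpha_0>0$, $\alpha_1,\dots,\alpha_p,\beta_1,\dots,\beta_q\in\mathbb R$, $\alpha_p\ne0$, $\beta_q\neq0$, $\alpha_{p+1}=\dots=\alpha_q=0$; $B$ is the $q\times q$ companion matrix with ones on the superdiagonal, last row $(-\beta_q,-\beta_{q-1},\dots,-\beta_1)$ and zeros elsewhere ($B=-\beta_1$ if $q=1$); $\mathbf a=(\alpha_1,\dots,\alpha_q)'$, $\mathbf e=(0,\dots,0,1)'\in\mathbb R^q$; $I$ is the $q\times q$ identity; a prime denotes transpose. $L=(L_t)_{t\ge0}$ is a real-valued Lévy process with Lévy measure $\nu_L\neq0$, $\Delta L_t=L_t-L_{t-}$ and $[L,L]^{(d)}_t=\sum_{0<s\le t}(\Delta L_s)^2$. The state process $\mathbf Y$ is the unique càdlàg solution of $d\mathbf Y_t=B\mathbf Y_{t-}\,dt+\mathbf e(\alpha_0+\mathbf a'\mathbf Y_{t-})\,d[L,L]^{(d)}_t$, $t>0$, with $\mathbb R^q$-valued initial value $\mathbf Y_0$ independent of $L$. $\lambda(B)$ is the maximum of the real parts of the eigenvalues of $B$. $\|\cdot\|_r$ denotes the $L^r$-norm on $\mathbb C^q$ and also the associated natural (operator) matrix norm. Empty sums are $0$ and empty products of matrices are $I$. $\mathbf Y_\infty$ (the stationary state vector) denotes the limit in distribution of $\mathbf Y_t$ as $t\to\infty$, which exists under the hypotheses of (b). *)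

theory Defs
  imports "HOL-Probability.Probability"
begin

section \<open>Vectors and matrices\<close>

text \<open>
  The index set $\{1,\dots,q\}$ is a finite linearly ordered type \<open>'q\<close>; \<open>pos\<close> is the
  order isomorphism onto $\{1,\dots,q\}$, where $q$ is \<open>CARD('q)\<close>.
\<close>

definition pos :: "'q::{finite,linorder} \<Rightarrow> nat" where
  "pos i = card {..i}"

lemma bij_betw_pos: "bij_betw pos (UNIV :: 'q::{finite,linorder} set) {1..CARD('q)}"
proof -
  have mono: "pos i < pos j" if "i < j" for i j :: 'q
    unfolding pos_def using that by (intro psubset_card_mono) auto
  have inj: "inj (pos :: 'q \<Rightarrow> nat)"
    by (rule injI) (metis linorder_cases mono less_irrefl)
  have "range (pos :: 'q \<Rightarrow> nat) \<subseteq> {1..CARD('q)}"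
    by (auto simp: pos_def Suc_le_eq card_gt_0_iff intro!: card_mono)
  moreover have "card (range (pos :: 'q \<Rightarrow> nat)) = card {1..CARD('q)}"
    using inj by (simp add: card_image)
  ultimately have "range (pos :: 'q \<Rightarrow> nat) = {1..CARD('q)}"
    by (intro card_subset_eq) auto
  with inj show ?thesis by (simp add: bij_betw_def)
qed

definition companion :: "(nat \<Rightarrow> real) \<Rightarrow> real^('q::{finite,linorder})^('q::_)" where
  "companion \<beta> = (\<chi> i j.
     if pos i = CARD('q) then - \<beta> (CARD('q) + 1 - pos j)
     else if pos j = pos i + 1 then 1 else 0)"

definition coeff_vec :: "(nat \<Rightarrow> real) \<Rightarrow> real^('q::{finite,linorder})" where
  "coeff_vec \<alpha> = (\<chi> i. \<alpha> (pos i))"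

definition last_unit :: "real^('q::{finite,linorder})" where
  "last_unit = (\<chi> i. if pos i = CARD('q) then 1 else 0)"

definition outer :: "('a::times)^'m \<Rightarrow> 'a^'n \<Rightarrow> 'a^'n^'m" where
  "outer v w = (\<chi> i j. v $ i * w $ j)"

primrec matpow :: "('a::semiring_1)^'n^'n \<Rightarrow> nat \<Rightarrow> 'a^'n^'n" where
  "matpow A 0 = mat 1"
| "matpow A (Suc n) = A ** matpow A n"

definition mexp :: "real^'n^'n \<Rightarrow> real^'n^'n" where
  "mexp A = (\<Sum>n. (1 / fact n) *\<^sub>R matpow A n)"

text \<open>The product of the listed matrices, from left to right.\<close>

definition mprod :: "(('a::semiring_1)^'n^'n) list \<Rightarrow> 'a^'n^'n" where
  "mprod As = foldr (**) As (mat 1)"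

definition eigenvalues :: "complex^'n^'n \<Rightarrow> complex set" where
  "eigenvalues A = {z. \<exists>v. v \<noteq> 0 \<and> A *v v = z *s v}"

definition spectral_abscissa :: "real^'n^'n \<Rightarrow> real" where
  "spectral_abscissa A = Max (Re ` eigenvalues (map_matrix complex_of_real A))"

definition diagonal_matrix :: "('a::zero)^'n^'n \<Rightarrow> bool" where
  "diagonal_matrix A \<longleftrightarrow> (\<forall>i j. i \<noteq> j \<longrightarrow> A $ i $ j = 0)"

definition vec_Lr_norm :: "ereal \<Rightarrow> complex^'n \<Rightarrow> real" where
  "vec_Lr_norm r v =
     (if r = \<infinity> then Max (range (\<lambda>i. cmod (v $ i)))
      else (\<Sum>i\<in>UNIV. cmod (v $ i) powr real_of_ereal r) powr (1 / real_of_ereal r))"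

definition matrix_Lr_norm :: "ereal \<Rightarrow> complex^'n^'n \<Rightarrow> real" where
  "matrix_Lr_norm r A = (SUP v\<in>-{0}. vec_Lr_norm r (A *v v) / vec_Lr_norm r v)"


section \<open>Cadlag paths and their jumps\<close>

definition left_lim :: "(real \<Rightarrow> 'a::t2_space) \<Rightarrow> real \<Rightarrow> 'a" where
  "left_lim f t = Lim (at_left t) f"

definition cadlag :: "(real \<Rightarrow> 'a::t2_space) \<Rightarrow> bool" where
  "cadlag f \<longleftrightarrow> (\<forall>t\<ge>0. (f \<longlongrightarrow> f t) (at_right t)) \<and> (\<forall>t>0. \<exists>l. (f \<longlongrightarrow> l) (at_left t))"

definition jump :: "(real \<Rightarrow> real) \<Rightarrow> real \<Rightarrow> real" where
  "jump f t = f t - left_lim f t"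

text \<open>The discrete part $[f,f]^{(d)}_t$ of the quadratic variation; it is $0$ for $t\le 0$.\<close>

definition disc_qv :: "(real \<Rightarrow> real) \<Rightarrow> real \<Rightarrow> real" where
  "disc_qv f t = (\<Sum>\<^sub>\<infinity>s\<in>{0<..t}. (jump f s)\<^sup>2)"

definition jump_count :: "(real \<Rightarrow> real) \<Rightarrow> real \<Rightarrow> nat" where
  "jump_count f t = card {s \<in> {0<..t}. jump f s \<noteq> 0}"

primrec jump_time :: "(real \<Rightarrow> real) \<Rightarrow> nat \<Rightarrow> real" where
  "jump_time f 0 = 0"
| "jump_time f (Suc n) = Inf {s. jump_time f n < s \<and> jump f s \<noteq> 0}"


text \<open>
  The library predicate \<open>prob_space.indep_var\<close> for two random variables requires them to have
  the same value type; this is the same notion for different value types.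
\<close>

definition indep_rvs ::
  "'w measure \<Rightarrow> 'b measure \<Rightarrow> ('w \<Rightarrow> 'b) \<Rightarrow> 'c measure \<Rightarrow> ('w \<Rightarrow> 'c) \<Rightarrow> bool" where
  "indep_rvs M M1 X1 M2 X2 \<longleftrightarrow> X1 \<in> measurable M M1 \<and> X2 \<in> measurable M M2 \<and>
     prob_space.indep_set M
       {X1 -` A \<inter> space M | A. A \<in> sets M1} {X2 -` A \<inter> space M | A. A \<in> sets M2}"

section \<open>Levy processes and the COGARCH state process\<close>

definition levy_process :: "'w measure \<Rightarrow> (real \<Rightarrow> 'w \<Rightarrow> real) \<Rightarrow> bool" where
  "levy_process M L \<longleftrightarrow>
     (\<forall>t\<ge>0. L t \<in> borel_measurable M) \<and>
     (AE \<omega> in M. L 0 \<omega> = 0) \<and>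
     (\<forall>n (t :: nat \<Rightarrow> real). 0 \<le> t 0 \<and> (\<forall>i<n. t i < t (Suc i)) \<longrightarrow>
        prob_space.indep_vars M (\<lambda>_. borel) (\<lambda>i \<omega>. L (t (Suc i)) \<omega> - L (t i) \<omega>) {..<n}) \<and>
     (\<forall>s\<ge>0. \<forall>h\<ge>0. distr M borel (\<lambda>\<omega>. L (s + h) \<omega> - L s \<omega>) = distr M borel (\<lambda>\<omega>. L h \<omega> - L 0 \<omega>)) \<and>
     (\<forall>t\<ge>0. \<forall>\<epsilon>>0. ((\<lambda>s. measure M {\<omega> \<in> space M. \<epsilon> < \<bar>L s \<omega> - L t \<omega>\<bar>}) \<longlongrightarrow> 0) (at t within {0..})) \<and>
     (AE \<omega> in M. cadlag (\<lambda>t. L t \<omega>))"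

text \<open>
  The Levy measure of a Borel set is the expected number of jumps per unit time
  whose size lies in that set.
\<close>

definition has_levy_measure :: "'w measure \<Rightarrow> (real \<Rightarrow> 'w \<Rightarrow> real) \<Rightarrow> real measure \<Rightarrow> bool" where
  "has_levy_measure M L \<nu> \<longleftrightarrow> sets \<nu> = sets borel \<and>
     (\<forall>A\<in>sets borel. emeasure \<nu> A =
        (\<integral>\<^sup>+\<omega>. emeasure (count_space UNIV)
           {s \<in> {0<..1}. jump (\<lambda>t. L t \<omega>) s \<noteq> 0 \<and> jump (\<lambda>t. L t \<omega>) s \<in> A} \<partial>M))"

text \<open>
  The stochastic differential equation is read in integrated form; since $[L,L]^{(d)}$ is
  nondecreasing, its integral is a pathwise Lebesgue--Stieltjes integral.
\<close>

definition cogarch_state ::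
  "'w measure \<Rightarrow> real^('q::{finite,linorder})^('q::_) \<Rightarrow> real^('q::_) \<Rightarrow> real \<Rightarrow>
    (real \<Rightarrow> 'w \<Rightarrow> real) \<Rightarrow> (real \<Rightarrow> 'w \<Rightarrow> real^('q::_)) \<Rightarrow> bool" where
  "cogarch_state M B a \<alpha>\<^sub>0 L Y \<longleftrightarrow>
     (\<forall>t\<ge>0. Y t \<in> borel_measurable M) \<and>
     indep_rvs M borel (Y 0)
       (\<Pi>\<^sub>M t\<in>{0..}. borel) (\<lambda>\<omega>. \<lambda>t\<in>{0..}. L t \<omega>) \<and>
     (AE \<omega> in M. cadlag (\<lambda>t. Y t \<omega>)) \<and>
     (AE \<omega> in M. \<forall>t>0. Y t \<omega> = Y 0 \<omega>
        + (LINT s:{0<..t}|lborel. B *v left_lim (\<lambda>u. Y u \<omega>) s)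
        + (LINT s:{0<..t}|interval_measure (disc_qv (\<lambda>u. L u \<omega>)).
             (\<alpha>\<^sub>0 + a \<bullet> left_lim (\<lambda>u. Y u \<omega>) s) *\<^sub>R last_unit))"


section \<open>Distributional notions\<close>

text \<open>
  Path functionals are determined only almost surely, so laws of such functionals are taken
  with respect to the completed measure.
\<close>

definition eq_in_law ::
  "'w measure \<Rightarrow> ('w \<Rightarrow> 'b::topological_space) \<Rightarrow> ('w \<Rightarrow> 'b) \<Rightarrow> bool" where
  "eq_in_law M X X' \<longleftrightarrow>
     X \<in> borel_measurable (completion M) \<and> X' \<in> borel_measurable (completion M) \<and>
     distr (completion M) borel X = distr (completion M) borel X'"

definition strictly_stationary ::
  "'w measure \<Rightarrow> (nat \<Rightarrow> 'w \<Rightarrow> 'b::topological_space) \<Rightarrow> bool" where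
  "strictly_stationary M X \<longleftrightarrow>
     (\<forall>n. X n \<in> borel_measurable (completion M)) \<and>
     (\<forall>k. distr (completion M) (\<Pi>\<^sub>M n\<in>UNIV. borel) (\<lambda>\<omega> n. X (n + k) \<omega>) =
          distr (completion M) (\<Pi>\<^sub>M n\<in>UNIV. borel) (\<lambda>\<omega> n. X n \<omega>))"

definition limit_law_at_top ::
  "'w measure \<Rightarrow> (real \<Rightarrow> 'w \<Rightarrow> 'b::topological_space) \<Rightarrow> 'b measure \<Rightarrow> bool" where
  "limit_law_at_top M X \<mu> \<longleftrightarrow> prob_space \<mu> \<and> sets \<mu> = sets borel \<and>
     (\<forall>f :: 'b \<Rightarrow> real. continuous_on UNIV f \<and> bounded (range f) \<longrightarrow>
        ((\<lambda>t. \<integral>\<omega>. f (X t \<omega>) \<partial>M) \<longlongrightarrow> (\<integral>x. f x \<partial>\<mu>)) at_top)"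

text \<open>
  The law \<open>\<mu>\<close> solves $X \stackrel{d}{=} Q X + R$ with $X$ independent of $(Q,R)$: the product
  measure realises an independent copy of $X$. Equivalently, \<open>\<mu>\<close> is invariant for the Markov
  chain with transition law $x \mapsto \mathcal{L}(Qx+R)$.
\<close>

definition solves_affine_fixed_point ::
  "'w measure \<Rightarrow> ('w \<Rightarrow> real^'n^'n) \<Rightarrow> ('w \<Rightarrow> real^'n) \<Rightarrow> (real^'n) measure \<Rightarrow> bool" where
  "solves_affine_fixed_point M Q R \<mu> \<longleftrightarrow> prob_space \<mu> \<and> sets \<mu> = sets borel \<and>
     distr (\<mu> \<Otimes>\<^sub>M M) borel (\<lambda>(x, \<omega>). Q \<omega> *v x + R \<omega>) = \<mu>"

end

theory Submission
  imports Defs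
begin

text \<open>Between jumps the state follows the linear flow of the matrix \<open>B\<close>, and at a jump it is moved by
  an affine map, so everything reduces to the joint law of the initial state, the waiting times and
  the squared jump sizes. This law is obtained by discretisation: the sums of squared jumps over the
  cells of a grid are i.i.d., being limits of block sums of increments, the index and value of the
  first nonzero term of an i.i.d. sequence are independent, and the mesh then tends to \<open>0\<close>.

  For the identity in law at time \<open>t\<close>, reversing the order of i.i.d. affine maps changes
  neither their composition's law nor the elapsed time. For the limit, the state at time \<open>t\<close> has
  the law of a backward composition of the maps \<open>x \<mapsto> Q x + R\<close>. In the norm that diagonalises \<open>B\<close>
  the logarithm of the operator norm of a factor has negative mean by the integral condition, so
  products decay exponentially (Garsia's argument), backward compositions converge almost surely,
  and by Letac's principle their limit carries the only invariant law.\<close>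

section \<open>Grid sums along cadlag paths\<close>

text \<open>The process is given only through increments at fixed times, and its Levy measure only
  as an expected number of jumps in the unit interval, so no Poisson structure is available at the
  start. Jump times are infima over uncountable sets; replacing them by limits of functions of path
  values makes them measurable on path space, and only then does the independence of
  \<open>Y 0\<close> from \<open>L\<close> pass to the gaps and marks.

  A fixed time t falls inside an incomplete gap, so the state at t is not a composition of complete
  maps. The product of an exponential density and an exponential tail is symmetric in the two
  durations; hence the incomplete gap can be moved to the start, where contraction forgets it. What
  remains are maps that jump first and wait afterwards, which is why \<open>Q\<close> has its
  factors in the opposite order to \<open>C\<close>. The two chains describe the state just before
  and just after a jump, and one additional gap converts the invariant law of the second into that
  of the first.\<close>

lemma cadlag_left_lim:
  fixes f :: "real \<Rightarrow> 'a::t2_space"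
  assumes "cadlag f" "t > 0"
  shows "(f \<longlongrightarrow> left_lim f t) (at_left t)"
proof -
  obtain l where l: "(f \<longlongrightarrow> l) (at_left t)"
    using assms unfolding cadlag_def by blast
  have "left_lim f t = l"
    unfolding left_lim_def by (rule tendsto_Lim[OF _ l]) simp
  with l show ?thesis by simp
qed

lemma cadlag_right: "cadlag f \<Longrightarrow> t \<ge> 0 \<Longrightarrow> (f \<longlongrightarrow> f t) (at_right t)"
  unfolding cadlag_def by blast

text \<open>The bisection principle \<open>Bolzano\<close> applies: near a single point the
  one-sided limits leave only that point as an exception, and exceptional sets of adjacent intervals
  can be merged. The finite set D later captures every jump larger than \<epsilon>.\<close>

lemma cadlag_oscillation:
  fixes f :: "real \<Rightarrow> 'a::metric_space"
  assumes f: "cadlag f" and ab: "0 \<le> a" "a \<le> b" and eps: "0 < \<epsilon>"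
  obtains D where "finite D" "D \<subseteq> {a<..b}"
    "\<And>u v. a \<le> u \<Longrightarrow> u \<le> v \<Longrightarrow> v \<le> b \<Longrightarrow> D \<inter> {u<..v} = {} \<Longrightarrow> dist (f u) (f v) < \<epsilon>"
proof -
  define G where "G a b D \<longleftrightarrow> finite D \<and> D \<subseteq> {a<..b} \<and>
    (\<forall>u v. a \<le> u \<longrightarrow> u \<le> v \<longrightarrow> v \<le> b \<longrightarrow> D \<inter> {u<..v} = {} \<longrightarrow> dist (f u) (f v) < \<epsilon>)" for a b D
  \<comment> \<open>\<open>Bolzano\<close> quantifies over all short intervals around a point,
    including those reaching below 0, where a cadlag path is unconstrained; the clause a < 0 makes
    these harmless.\<close>
  define P where "P a b \<longleftrightarrow> a < 0 \<or> (\<exists>D. G a b D)" for a b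
  have trans: "P a c" if trans: "P a b" "P b c" "a \<le> b" "b \<le> c" for a b c
    proof (cases "a < 0")
      case False
      obtain D1 where G1: "G a b D1"
        using trans(1) False unfolding P_def by blast
      then have D1: "finite D1" "D1 \<subseteq> {a<..b}"
        "\<And>u v. a \<le> u \<Longrightarrow> u \<le> v \<Longrightarrow> v \<le> b \<Longrightarrow> D1 \<inter> {u<..v} = {} \<Longrightarrow> dist (f u) (f v) < \<epsilon>"
        unfolding G_def by simp_all
      have "\<not> b < 0" using False \<open>a \<le> b\<close> by simp
      then obtain D2 where G2: "G b c D2"
        using trans(2) unfolding P_def by blast
      then have D2: "finite D2" "D2 \<subseteq> {b<..c}"
        "\<And>u v. b \<le> u \<Longrightarrow> u \<le> v \<Longrightarrow> v \<le> c \<Longrightarrow> D2 \<inter> {u<..v} = {} \<Longrightarrow> dist (f u) (f v) < \<epsilon>"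
        unfolding G_def by simp_all
      \<comment> \<open>The common endpoint is added so that no pair u < b \<le> v escapes both
        halves; the intersection drops it when a = b, where it would lie outside {a<..c}.\<close>
      let ?D = "D1 \<union> D2 \<union> ({b} \<inter> {a<..c})"
      have "dist (f u) (f v) < \<epsilon>"
        if uv: "a \<le> u" "u \<le> v" "v \<le> c" "?D \<inter> {u<..v} = {}" for u v
      proof -
        have "\<not> (u < b \<and> b \<le> v)" using uv trans by auto
        then consider "v < b" | "b \<le> u" using uv by force
        then show ?thesis
        proof cases
          case 1
          show ?thesis by (rule D1(3)) (use uv 1 in auto)
        next
          case 2
          show ?thesis by (rule D2(3)) (use uv 2 in auto)
        qed
      qed
      moreover have "finite ?D" "?D \<subseteq> {a<..c}" using D1 D2 trans by auto
      ultimately have "G a c ?D" unfolding G_def by simp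
      then show ?thesis unfolding P_def by blast
    qed (simp add: P_def)
  have local: "\<exists>d>0. \<forall>a' b'. a' \<le> x \<and> x \<le> b' \<and> b' - a' < d \<longrightarrow> P a' b'" if x0: "x \<ge> 0" for x
  proof -
    obtain y0 where y0: "y0 > x" "\<forall>y>x. y < y0 \<longrightarrow> dist (f y) (f x) < \<epsilon>/2"
      using cadlag_right[OF f x0, unfolded tendsto_iff, rule_format, of "\<epsilon>/2"] eps
      unfolding eventually_at_right_field by auto
    define d1 where "d1 = y0 - x"
    have d1: "d1 > 0" "\<And>y. x < y \<Longrightarrow> y < x + d1 \<Longrightarrow> dist (f y) (f x) < \<epsilon>/2"
      using y0 by (auto simp: d1_def)
    have "\<exists>l d2. d2 > 0 \<and> (x > 0 \<longrightarrow> (\<forall>y. x - d2 < y \<longrightarrow> y < x \<longrightarrow> dist (f y) l < \<epsilon>/2))"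
    proof (cases "x > 0")
      case True
      obtain b where "b < x" "\<forall>y>b. y < x \<longrightarrow> dist (f y) (left_lim f x) < \<epsilon>/2"
        using cadlag_left_lim[OF f True, unfolded tendsto_iff, rule_format, of "\<epsilon>/2"] eps
        unfolding eventually_at_left_field by auto
      then show ?thesis by (intro exI[of _ "left_lim f x"] exI[of _ "x - b"]) auto
    qed (auto intro: exI[of _ 1])
    then obtain l d2 where d2: "d2 > 0"
      "\<And>y. x > 0 \<Longrightarrow> x - d2 < y \<Longrightarrow> y < x \<Longrightarrow> dist (f y) l < \<epsilon>/2" by blast
    have "P a' b'" if ab': "a' \<le> x" "x \<le> b'" "b' - a' < min d1 d2" for a' b'
    proof (cases "a' < 0")
      case False
      let ?D = "{x} \<inter> {a'<..b'}"
      have "dist (f u) (f v) < \<epsilon>"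
        if uv: "a' \<le> u" "u \<le> v" "v \<le> b'" "?D \<inter> {u<..v} = {}" for u v
      proof (cases "v < x")
        case True
        have "dist (f u) l < \<epsilon>/2" "dist (f v) l < \<epsilon>/2"
          by (rule d2(2); use True uv False ab' in linarith)+
        then show ?thesis by (metis dist_commute dist_triangle_half_l)
      next
        case vx: False
        then have ux: "x \<le> u" using uv by force
        have "dist (f u) (f x) < \<epsilon>/2"
          using d1(2)[of u] ux uv ab' eps by (cases "u = x") auto
        moreover have "dist (f v) (f x) < \<epsilon>/2"
          using d1(2)[of v] vx ux uv ab' eps by (cases "v = x") auto
        ultimately show ?thesis by (metis dist_commute dist_triangle_half_l)
      qed
      then have "G a' b' ?D" unfolding G_def by auto
      then show ?thesis unfolding P_def by blast
    qed (simp add: P_def)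
    then show ?thesis using d1 d2 by (intro exI[of _ "min d1 d2"]) auto
  qed
  have "P a b"
    by (rule Bolzano[of a b P]) (use ab trans local in auto)
  then obtain D where "G a b D"
    using ab unfolding P_def by auto
  then show thesis unfolding G_def by (intro that[of D]) simp_all
qed

text \<open>Every value is within 1 of the value at the last point of the finite oscillation set at
  or before it, or at the left end.\<close>

lemma cadlag_bounded:
  fixes f :: "real \<Rightarrow> 'a::metric_space"
  assumes f: "cadlag f" and ab: "0 \<le> a"
  shows "bounded (f ` {a..b})"
proof (cases "a \<le> b")
  case True
  obtain D where D: "finite D" "D \<subseteq> {a<..b}"
    "\<And>u v. a \<le> u \<Longrightarrow> u \<le> v \<Longrightarrow> v \<le> b \<Longrightarrow> D \<inter> {u<..v} = {} \<Longrightarrow> dist (f u) (f v) < 1"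
    using cadlag_oscillation[OF f ab True, of 1] by auto
  have "f ` {a..b} \<subseteq> (\<Union>s\<in>insert a D. ball (f s) 1)"
  proof safe
    fix v assume v: "v \<in> {a..b}"
    let ?S = "insert a (D \<inter> {..v})"
    define s where "s = Max ?S"
    have s: "s \<in> ?S" unfolding s_def using D by (intro Max_in) auto
    have "w \<le> s" if "w \<in> ?S" for w unfolding s_def using D that by (intro Max_ge) auto
    then have "D \<inter> {s<..v} = {}" by force
    then have "dist (f s) (f v) < 1" using s v D by (intro D(3)) auto
    then show "f v \<in> (\<Union>s\<in>insert a D. ball (f s) 1)" using s by auto
  qed
  moreover have "bounded (\<Union>s\<in>insert a D. ball (f s) 1)" using D by auto
  ultimately show ?thesis using bounded_subset by blast
qed simp

lemma grid_cell_unique: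
  fixes x y :: real
  assumes "real i < x" "x \<le> real i + 1"
  shows "nat (\<lceil>x\<rceil> - 1) = i"
proof -
  have "\<lceil>x\<rceil> = int i + 1" using assms by (intro ceiling_unique) auto
  then show ?thesis by simp
qed

lemma grid_cell_bounds:
  fixes x :: real
  assumes "x > 0"
  shows "real (nat (\<lceil>x\<rceil> - 1)) < x" "x \<le> real (nat (\<lceil>x\<rceil> - 1)) + 1"
proof -
  have "\<lceil>x\<rceil> \<ge> 1" using assms by (simp add: Suc_le_eq)
  then have "real (nat (\<lceil>x\<rceil> - 1)) = of_int \<lceil>x\<rceil> - 1" by simp
  then show "real (nat (\<lceil>x\<rceil> - 1)) < x" "x \<le> real (nat (\<lceil>x\<rceil> - 1)) + 1"
    using ceiling_correct[of x] by linarith+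
qed

text \<open>The grid cell containing s has its left end strictly below s and its right end at or
  beyond s, which is exactly what left limits and right continuity require. The ceiling minus one
  selects this cell because cells are open on the left and closed on the right.\<close>

lemma cadlag_grid_increment:
  fixes f :: "real \<Rightarrow> real"
  assumes f: "cadlag f" and ab: "0 \<le> a" "a < s" "s \<le> b"
  defines "c \<equiv> (\<lambda>m. nat (\<lceil>(s - a) * real m / (b - a)\<rceil> - 1))"
  shows "(\<lambda>m. f (a + (b - a) * real (Suc (c m)) / real m) - f (a + (b - a) * real (c m) / real m))
    \<longlonglongrightarrow> jump f s"
proof -
  have cb: "a + (b - a) * real (c m) / real m < s" "s \<le> a + (b - a) * real (Suc (c m)) / real m"
    if "m > 0" for m
  proof -
    have "(s - a) * real m / (b - a) > 0" using ab that by simp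
    from grid_cell_bounds[OF this] have
      "real (c m) < (s - a) * real m / (b - a)" "(s - a) * real m / (b - a) \<le> real (Suc (c m))"
      unfolding c_def by auto
    then show "a + (b - a) * real (c m) / real m < s" "s \<le> a + (b - a) * real (Suc (c m)) / real m"
      using ab that by (simp_all add: field_simps)
  qed
  have diff: "a + (b - a) * real (Suc (c m)) / real m = (a + (b - a) * real (c m) / real m) + (b - a) / real m" for m
    by (simp add: ring_distribs add_divide_distrib diff_divide_distrib)
  have mesh: "(\<lambda>m. (b - a) / real m) \<longlonglongrightarrow> 0" by (rule lim_const_over_n)
  have ev: "eventually (\<lambda>m::nat. m > 0) sequentially" by (rule eventually_gt_at_top)
  have lo: "(\<lambda>m. a + (b - a) * real (c m) / real m) \<longlonglongrightarrow> s"
  proof (rule tendsto_sandwich)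
    show "eventually (\<lambda>m. s - (b - a) / real m \<le> a + (b - a) * real (c m) / real m) sequentially"
      using ev
    proof eventually_elim
      case (elim m)
      show ?case using cb(2)[OF elim] unfolding diff by linarith
    qed
    show "eventually (\<lambda>m. a + (b - a) * real (c m) / real m \<le> s) sequentially"
      using ev by eventually_elim (rule less_imp_le[OF cb(1)])
    show "(\<lambda>m. s - (b - a) / real m) \<longlonglongrightarrow> s" using tendsto_diff[OF tendsto_const mesh, of s] by simp
  qed simp
  have hi: "(\<lambda>m. a + (b - a) * real (Suc (c m)) / real m) \<longlonglongrightarrow> s"
    unfolding diff using tendsto_add[OF lo mesh] by simp
  have "(\<lambda>m. f (a + (b - a) * real (c m) / real m)) \<longlonglongrightarrow> left_lim f s"
  proof (rule filterlim_compose[OF cadlag_left_lim[OF f]])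
    have "eventually (\<lambda>m. a + (b - a) * real (c m) / real m < s) sequentially"
      using ev by eventually_elim (rule cb(1))
    with lo show "filterlim (\<lambda>m. a + (b - a) * real (c m) / real m) (at_left s) sequentially"
      by (auto simp: filterlim_at elim!: eventually_mono)
  qed (use ab in simp)
  moreover have "(\<lambda>m. f (a + (b - a) * real (Suc (c m)) / real m)) \<longlonglongrightarrow> f s"
  proof -
    have "(f \<longlongrightarrow> f s) (at s within {s..})"
      using cadlag_right[OF f, of s] ab
      by (simp add: at_within_Ici_at_right)
    then show ?thesis
    proof (rule continuous_within_tendsto_compose[of s "{s..}" f, unfolded continuous_within])
      show "eventually (\<lambda>m. a + (b - a) * real (Suc (c m)) / real m \<in> {s..}) sequentially"
        using ev by eventually_elim (use cb(2) in simp)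
    qed (rule hi)
  qed
  ultimately show ?thesis unfolding jump_def by (intro tendsto_diff)
qed

text \<open>As g vanishes on [-\<epsilon>, \<epsilon>], only cells meeting the oscillation set D can
  contribute. On a fine grid distinct points of D lie in distinct cells, and the increment over each
  such cell tends to the jump. A sum over jump times thus becomes a limit of functions of path
  values.\<close>

lemma cadlag_grid_sum:
  fixes f g :: "real \<Rightarrow> real"
  assumes f: "cadlag f" and ab: "0 \<le> a" "a < b"
    and g: "continuous_on UNIV g" and eps: "0 < \<epsilon>" and g0: "\<And>x. \<bar>x\<bar> \<le> \<epsilon> \<Longrightarrow> g x = 0"
  shows "finite {s\<in>{a<..b}. g (jump f s) \<noteq> 0}"
    and "(\<lambda>m. \<Sum>i<m. g (f (a + (b - a) * real (Suc i) / real m) - f (a + (b - a) * real i / real m)))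
           \<longlonglongrightarrow> (\<Sum>s\<in>{s\<in>{a<..b}. g (jump f s) \<noteq> 0}. g (jump f s))"
proof -
  let ?J = "{s\<in>{a<..b}. g (jump f s) \<noteq> 0}"
  obtain D where D: "finite D" "D \<subseteq> {a<..b}"
    "\<And>u v. a \<le> u \<Longrightarrow> u \<le> v \<Longrightarrow> v \<le> b \<Longrightarrow> D \<inter> {u<..v} = {} \<Longrightarrow> dist (f u) (f v) < \<epsilon>"
    using cadlag_oscillation[OF f, of a b \<epsilon>] ab eps by auto
  have JD: "?J \<subseteq> D"
  proof (safe, rule ccontr)
    fix s assume s: "s \<in> {a<..b}" "s \<notin> D" "g (jump f s) \<noteq> 0"
    \<comment> \<open>Between the last point of D below s (or a) and s the path moves by less than
      \<epsilon>, so the jump at s is at most \<epsilon> and g kills it.\<close>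
    let ?m = "Max (insert a (D \<inter> {..<s}))"
    have m1: "w \<le> ?m" if "w \<in> insert a (D \<inter> {..<s})" for w using D that by (intro Max_ge) auto
    have "?m \<in> insert a (D \<inter> {..<s})" using D by (intro Max_in) auto
    then have m2: "?m < s" "a \<le> ?m" using s m1[of a] by auto
    have "((\<lambda>u. dist (f s) (f u)) \<longlongrightarrow> dist (f s) (left_lim f s)) (at_left s)"
      using cadlag_left_lim[OF f, of s] s ab by (intro tendsto_intros) auto
    moreover have "eventually (\<lambda>u. dist (f s) (f u) \<le> \<epsilon>) (at_left s)"
      unfolding eventually_at_left_field
    proof (intro exI[of _ ?m] conjI allI impI)
      fix u assume u: "?m < u" "u < s"
      have "D \<inter> {u<..s} = {}"
      proof (rule ccontr)
        assume "D \<inter> {u<..s} \<noteq> {}"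
        then obtain w where w: "w \<in> D" "u < w" "w \<le> s" by auto
        then have "w \<le> ?m" using s by (intro m1) (auto simp: less_le)
        then show False using w u by simp
      qed
      then have "dist (f u) (f s) < \<epsilon>" using u m2 s by (intro D(3)) auto
      then show "dist (f s) (f u) \<le> \<epsilon>" by (simp add: dist_commute)
    qed (use m2 in auto)
    ultimately have "dist (f s) (left_lim f s) \<le> \<epsilon>"
      by (intro tendsto_upperbound[of _ _ "at_left s"]) auto
    then show False using s g0[of "jump f s"] by (simp add: jump_def dist_real_def)
  qed
  then show "finite ?J" using D(1) finite_subset by blast
  define c where "c = (\<lambda>s m. nat (\<lceil>(s - a) * real m / (b - a)\<rceil> - 1))"
  let ?incr = "\<lambda>m i. f (a + (b - a) * real (Suc i) / real m) - f (a + (b - a) * real i / real m)"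
  have cell: "(a + (b - a) * real i / real m < s \<and> s \<le> a + (b - a) * real (Suc i) / real m) \<longleftrightarrow> c s m = i"
    if "m > 0" "a < s" for m i s
  proof -
    have pos: "(s - a) * real m / (b - a) > 0" using ab that by simp
    have eq: "(a + (b - a) * real i / real m < s \<and> s \<le> a + (b - a) * real (Suc i) / real m) \<longleftrightarrow>
      real i < (s - a) * real m / (b - a) \<and> (s - a) * real m / (b - a) \<le> real i + 1"
      using ab that by (auto simp: field_simps)
    show ?thesis unfolding eq c_def using grid_cell_bounds[OF pos] grid_cell_unique by metis
  qed
  have c_less: "c s m < m" if "m > 0" "s \<in> D" for s m
  proof -
    have s: "a < s" "s \<le> b" using that D by auto
    have "a + (b - a) * real (c s m) / real m < b" using cell[OF that(1) s(1)] s by force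
    then have "(b - a) * (real (c s m) / real m) < (b - a) * 1" by simp
    then have "real (c s m) / real m < 1" using ab by (subst (asm) mult_less_cancel_left_pos) auto
    then show ?thesis using that by (simp add: field_simps)
  qed
  have inj: "eventually (\<lambda>m. inj_on (\<lambda>s. c s m) D) sequentially"
  proof -
    have "eventually (\<lambda>m. \<forall>s\<in>D. \<forall>s'\<in>D. s \<noteq> s' \<longrightarrow> c s m \<noteq> c s' m) sequentially"
      unfolding eventually_ball_finite_distrib[OF D(1)]
    proof (intro ballI)
      fix s s' assume ss: "s \<in> D" "s' \<in> D"
      show "eventually (\<lambda>m. s \<noteq> s' \<longrightarrow> c s m \<noteq> c s' m) sequentially"
      proof (cases "s = s'")
        case False
        have "(\<lambda>m. (b - a) / real m) \<longlonglongrightarrow> 0" by (rule lim_const_over_n)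
        then have "eventually (\<lambda>m. (b - a) / real m < \<bar>s - s'\<bar>) sequentially"
          by (rule order_tendstoD) (use False in auto)
        moreover have "eventually (\<lambda>m::nat. m > 0) sequentially" by (rule eventually_gt_at_top)
        ultimately show ?thesis
        proof eventually_elim
          case (elim m)
          show ?case
          proof (intro impI notI)
            assume eq: "c s m = c s' m"
            have "a + (b - a) * real (Suc (c s m)) / real m = a + (b - a) * real (c s m) / real m + (b - a) / real m"
              by (simp add: ring_distribs add_divide_distrib diff_divide_distrib)
            moreover have "a < s" "a < s'" using ss D by auto
            moreover note cell[OF elim(2) \<open>a < s\<close>, of "c s m"] cell[OF elim(2) \<open>a < s'\<close>, of "c s m"]
            ultimately show False using eq elim by auto
          qed
        qed
      qed simp
    qed
    then show ?thesis by eventually_elim (auto simp: inj_on_def)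
  qed
  have "eventually (\<lambda>m. (\<Sum>s\<in>D. g (?incr m (c s m))) = (\<Sum>i<m. g (?incr m i))) sequentially"
    using inj eventually_gt_at_top[of 0]
  proof eventually_elim
    case (elim m)
    have "(\<Sum>i<m. g (?incr m i)) = (\<Sum>i\<in>(\<lambda>s. c s m) ` D. g (?incr m i))"
    proof (rule sum.mono_neutral_right)
      show "\<forall>i\<in>{..<m} - (\<lambda>s. c s m) ` D. g (?incr m i) = 0"
      proof
        fix i assume i: "i \<in> {..<m} - (\<lambda>s. c s m) ` D"
        have "real (Suc i) / real m \<le> 1" using i elim by (simp add: field_simps)
        then have le: "(b - a) * real (Suc i) / real m \<le> b - a"
          using ab mult_left_mono[of "real (Suc i) / real m" 1 "b - a"] by simp
        have "D \<inter> {a + (b - a) * real i / real m <.. a + (b - a) * real (Suc i) / real m} = {}"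
        proof (rule ccontr)
          assume "\<not> ?thesis"
          then obtain s where s: "s \<in> D" "a + (b - a) * real i / real m < s" "s \<le> a + (b - a) * real (Suc i) / real m"
            by auto
          then have "c s m = i" using cell[OF elim(2), of s i] D by auto
          then show False using s i by auto
        qed
        then have "dist (f (a + (b - a) * real i / real m)) (f (a + (b - a) * real (Suc i) / real m)) < \<epsilon>"
        proof (intro D(3))
          show "a \<le> a + (b - a) * real i / real m" using ab by simp
          show "a + (b - a) * real i / real m \<le> a + (b - a) * real (Suc i) / real m"
            using ab by (intro add_left_mono divide_right_mono mult_left_mono) auto
          show "a + (b - a) * real (Suc i) / real m \<le> b" using le by linarith
        qed
        then show "g (?incr m i) = 0" by (intro g0) (auto simp: dist_real_def)
      qed
    qed (use c_less elim in auto)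
    also have "\<dots> = (\<Sum>s\<in>D. g (?incr m (c s m)))" using elim by (simp add: sum.reindex)
    finally show ?case by simp
  qed
  moreover have "(\<lambda>m. \<Sum>s\<in>D. g (?incr m (c s m))) \<longlonglongrightarrow> (\<Sum>s\<in>D. g (jump f s))"
  proof (rule tendsto_sum)
    fix s assume "s \<in> D"
    then have "(\<lambda>m. ?incr m (c s m)) \<longlonglongrightarrow> jump f s"
      unfolding c_def using D ab by (intro cadlag_grid_increment[OF f]) auto
    then show "(\<lambda>m. g (?incr m (c s m))) \<longlonglongrightarrow> g (jump f s)"
      by (rule continuous_on_tendsto_compose[OF g]) auto
  qed
  ultimately have "(\<lambda>m. \<Sum>i<m. g (?incr m i)) \<longlonglongrightarrow> (\<Sum>s\<in>D. g (jump f s))"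
    using Lim_transform_eventually by fast
  also have "(\<Sum>s\<in>D. g (jump f s)) = (\<Sum>s\<in>?J. g (jump f s))"
    using JD D by (intro sum.mono_neutral_right) auto
  finally show "(\<lambda>m. \<Sum>i<m. g (?incr m i)) \<longlonglongrightarrow> (\<Sum>s\<in>?J. g (jump f s))" .
qed

section \<open>Limits of independent families\<close>

text \<open>Lipschitz functions decreasing to the indicator of a closed set. The empty set is
  treated apart, since \<open>infdist\<close> to it is 0 by convention and the formula would give
  1.\<close>

definition bump :: "'a::metric_space set \<Rightarrow> nat \<Rightarrow> 'a \<Rightarrow> real" where
  "bump F n x = (if F = {} then 0 else max 0 (1 - real n * infdist x F))"

lemma bump_bounds: "0 \<le> bump F n x" "bump F n x \<le> 1"
  by (auto simp: bump_def infdist_nonneg)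

lemma continuous_on_bump: "continuous_on A (bump F n)"
  unfolding bump_def by (cases "F = {}") (auto intro!: continuous_intros)

lemma bump_tendsto:
  assumes "closed F"
  shows "(\<lambda>n. bump F n x) \<longlonglongrightarrow> indicator F x"
proof (cases "F = {}")
  case False
  show ?thesis
  proof (cases "x \<in> F")
    case True
    then show ?thesis using False by (simp add: bump_def)
  next
    case xF: False
    then have pos: "infdist x F > 0"
      using assms False infdist_pos_not_in_closed by blast
    obtain k :: nat where k: "1 / infdist x F < real k" using reals_Archimedean2 by blast
    have "bump F n x = 0" if "n \<ge> k" for n
    proof -
      have "1 / infdist x F < real n" using k that by linarith
      then show ?thesis using pos False by (simp add: bump_def field_simps)
    qed
    then have "eventually (\<lambda>n. bump F n x = indicator F x) sequentially"
      using xF by (auto simp: eventually_sequentially)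
    then show ?thesis by (rule tendsto_eventually)
  qed
qed (simp add: bump_def)

lemma borel_measurable_bump [measurable]: "bump F n \<in> borel_measurable borel"
  by (intro borel_measurable_continuous_onI continuous_on_bump)

text \<open>Closed sets form an intersection-stable generator, and the bumps recover their measure
  by dominated convergence.\<close>

lemma measure_eqI_bounded_continuous:
  fixes M N :: "'a::metric_space measure"
  assumes M: "prob_space M" "sets M = sets borel" and N: "prob_space N" "sets N = sets borel"
    and eq: "\<And>f :: 'a \<Rightarrow> real. continuous_on UNIV f \<Longrightarrow> (\<And>x. 0 \<le> f x) \<Longrightarrow> (\<And>x. f x \<le> 1) \<Longrightarrow>
      integral\<^sup>L M f = integral\<^sup>L N f"
  shows "M = N"
proof (rule measure_eqI_generator_eq[where \<Omega>=UNIV and E="Collect closed" and A="\<lambda>_. UNIV"])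
  interpret M: prob_space M by fact
  interpret N: prob_space N by fact
  note [measurable_cong] = M(2) N(2)
  show "Int_stable (Collect closed :: 'a set set)" by (auto simp: Int_stable_def)
  show "sets M = sigma_sets UNIV (Collect closed)" "sets N = sigma_sets UNIV (Collect closed)"
    using M N by (simp_all add: borel_eq_closed)
  show "emeasure M F = emeasure N F" if "F \<in> Collect closed" for F
  proof -
    have F: "closed F" using that by simp
    have [measurable]: "F \<in> sets borel" using F by auto
    have "(\<lambda>n. integral\<^sup>L M (bump F n)) \<longlonglongrightarrow> integral\<^sup>L M (indicator F)"
      by (rule integral_dominated_convergence[where w="\<lambda>_. 1"])
         (use bump_tendsto[OF F] in \<open>auto simp: bump_bounds\<close>)
    moreover have "(\<lambda>n. integral\<^sup>L N (bump F n)) \<longlonglongrightarrow> integral\<^sup>L N (indicator F)"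
      by (rule integral_dominated_convergence[where w="\<lambda>_. 1"])
         (use bump_tendsto[OF F] in \<open>auto simp: bump_bounds\<close>)
    moreover have "integral\<^sup>L M (bump F n) = integral\<^sup>L N (bump F n)" for n
      by (intro eq continuous_on_bump bump_bounds)
    ultimately have "integral\<^sup>L M (indicator F) = (integral\<^sup>L N (indicator F) :: real)"
      using LIMSEQ_unique by auto
    then show ?thesis
      using M N F by (simp add: M.emeasure_eq_measure N.emeasure_eq_measure sets_eq_imp_space_eq[OF M(2)] sets_eq_imp_space_eq[OF N(2)])
  qed
  show "emeasure M UNIV \<noteq> \<infinity>" using M.emeasure_finite by simp
qed auto

text \<open>Independence is reduced to product formulas for continuous test functions with values in
  [0, 1], because these, unlike statements about events, pass to almost sure limits.\<close>

lemma (in prob_space) indep_vars_bounded_continuous: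
  fixes X :: "'i \<Rightarrow> 'a \<Rightarrow> 'b::metric_space"
  assumes X: "\<And>i. i \<in> I \<Longrightarrow> X i \<in> borel_measurable M"
    and eq: "\<And>J f. finite J \<Longrightarrow> J \<subseteq> I \<Longrightarrow> J \<noteq> {} \<Longrightarrow> (\<And>i. continuous_on UNIV (f i)) \<Longrightarrow>
      (\<And>i x. 0 \<le> f i x) \<Longrightarrow> (\<And>i x. f i x \<le> (1::real)) \<Longrightarrow>
      expectation (\<lambda>\<omega>. \<Prod>i\<in>J. f i (X i \<omega>)) = (\<Prod>i\<in>J. expectation (\<lambda>\<omega>. f i (X i \<omega>)))"
  shows "indep_vars (\<lambda>_. borel) X I"
proof -
  let ?E = "\<lambda>i. {X i -` F \<inter> space M | F. closed F}"
  have "indep_sets ?E I"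
  proof (rule indep_setsI)
    show "?E i \<subseteq> events" if "i \<in> I" for i using X[OF that] by (auto intro!: measurable_sets)
    fix A J assume J: "J \<noteq> {}" "J \<subseteq> I" "finite J" and A: "\<forall>j\<in>J. A j \<in> ?E j"
    then have "\<forall>j\<in>J. \<exists>F. closed F \<and> A j = X j -` F \<inter> space M" by auto
    then obtain F where F: "\<And>j. j \<in> J \<Longrightarrow> closed (F j)" "\<And>j. j \<in> J \<Longrightarrow> A j = X j -` F j \<inter> space M"
      by metis
    have [measurable]: "X i \<in> borel_measurable M" if "i \<in> J" for i using X J that by auto
    have [measurable]: "F i \<in> sets borel" if "i \<in> J" for i using F(1)[OF that] by simp
    have lim1: "(\<lambda>n. expectation (\<lambda>\<omega>. \<Prod>i\<in>J. bump (F i) n (X i \<omega>)))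
        \<longlonglongrightarrow> expectation (\<lambda>\<omega>. \<Prod>i\<in>J. indicator (F i) (X i \<omega>))"
      by (rule integral_dominated_convergence[where w="\<lambda>_. 1"])
         (use bump_tendsto F in \<open>auto simp: prod_nonneg bump_bounds abs_prod intro!: prod_le_1 AE_I2 tendsto_prod borel_measurable_prod\<close>)
    have lim2: "(\<lambda>n. \<Prod>i\<in>J. expectation (\<lambda>\<omega>. bump (F i) n (X i \<omega>)))
        \<longlonglongrightarrow> (\<Prod>i\<in>J. expectation (\<lambda>\<omega>. indicator (F i) (X i \<omega>)))"
      by (intro tendsto_prod integral_dominated_convergence[where w="\<lambda>_. 1"])
         (use bump_tendsto F in \<open>auto simp: bump_bounds\<close>)
    have "expectation (\<lambda>\<omega>. \<Prod>i\<in>J. bump (F i) n (X i \<omega>)) = (\<Prod>i\<in>J. expectation (\<lambda>\<omega>. bump (F i) n (X i \<omega>)))" for n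
      by (rule eq) (use J in \<open>auto simp: continuous_on_bump bump_bounds\<close>)
    with lim1 lim2 have "expectation (\<lambda>\<omega>. \<Prod>i\<in>J. indicator (F i) (X i \<omega>)) =
        (\<Prod>i\<in>J. expectation (\<lambda>\<omega>. indicator (F i) (X i \<omega>)) :: real)"
      by (simp add: LIMSEQ_unique)
    moreover have "(\<Prod>i\<in>J. indicator (F i) (X i \<omega>)) = (indicator (\<Inter>j\<in>J. A j) \<omega> :: real)" if "\<omega> \<in> space M" for \<omega>
    proof (cases "\<forall>i\<in>J. X i \<omega> \<in> F i")
      case True
      then show ?thesis using that F(2) by simp
    next
      case False
      then obtain k where k: "k \<in> J" "X k \<omega> \<notin> F k" by auto
      then have "\<omega> \<notin> (\<Inter>j\<in>J. A j)" using F(2)[OF k(1)] by auto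
      moreover have "(\<Prod>i\<in>J. indicator (F i) (X i \<omega>)) = (0::real)"
        using k J by (intro prod_zero) (auto intro!: bexI[of _ k])
      ultimately show ?thesis by simp
    qed
    moreover have "indicator (F i) (X i \<omega>) = (indicator (A i) \<omega> :: real)" if "\<omega> \<in> space M" "i \<in> J" for \<omega> i
      using that F(2) by (auto simp: indicator_def)
    ultimately have "expectation (indicator (\<Inter>j\<in>J. A j)) = (\<Prod>i\<in>J. expectation (indicator (A i)) :: real)"
      by (simp cong: Bochner_Integration.integral_cong prod.cong)
    moreover have "A i \<in> events" if "i \<in> J" for i using F(2)[OF that] that by simp
    moreover have "(\<Inter>j\<in>J. A j) \<in> events" using J F(2) by (intro sets.finite_INT) auto
    ultimately show "prob (\<Inter>j\<in>J. A j) = (\<Prod>j\<in>J. prob (A j))"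
      using sets.sets_into_space by (simp add: Int_absorb2 cong: prod.cong)
  qed
  then have "indep_sets (\<lambda>i. sigma_sets (space M) (?E i)) I"
  proof (rule indep_sets_sigma)
    show "Int_stable (?E i)" if "i \<in> I" for i
    proof (safe intro!: Int_stableI)
      fix F G :: "'b set" assume "closed F" "closed G"
      then show "\<exists>H. X i -` F \<inter> space M \<inter> (X i -` G \<inter> space M) = X i -` H \<inter> space M \<and> closed H"
        by (intro exI[of _ "F \<inter> G"]) auto
    qed
  qed
  moreover have "{X i -` A \<inter> space M | A. A \<in> sets borel} = sigma_sets (space M) (?E i)" for i
    using sigma_sets_vimage_commute[of "X i" "space M" UNIV "Collect closed"]
    by (auto simp: borel_eq_closed)
  ultimately show ?thesis unfolding indep_vars_def2 using X by auto
qed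

lemma measurable_PiM_UNIV [measurable (raw)]:
  assumes "\<And>i. X i \<in> M \<rightarrow>\<^sub>M N i"
  shows "(\<lambda>\<omega> i. X i \<omega>) \<in> M \<rightarrow>\<^sub>M Pi\<^sub>M UNIV N"
  by (rule measurable_PiM_single') (use assms measurable_space[OF assms] in auto)

definition iid :: "'w measure \<Rightarrow> 'b measure \<Rightarrow> (nat \<Rightarrow> 'w \<Rightarrow> 'b) \<Rightarrow> bool" where
  "iid M N X \<longleftrightarrow> prob_space.indep_vars M (\<lambda>_. N) X UNIV \<and> (\<forall>i. distr M N (X i) = distr M N (X 0))"

context prob_space
begin

lemma indep_vars_measurable: "indep_vars M' X I \<Longrightarrow> i \<in> I \<Longrightarrow> X i \<in> M \<rightarrow>\<^sub>M M' i"
  by (simp add: indep_vars_def2)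

lemma iid_measurable: "iid M N X \<Longrightarrow> X i \<in> M \<rightarrow>\<^sub>M N"
  using indep_vars_measurable[of "\<lambda>_. N" X UNIV i] by (simp add: iid_def)

text \<open>Dominated convergence on both sides of the product formula: the test functions are
  continuous and bounded by 1, so the almost sure limit passes through them.\<close>

lemma indep_vars_limit:
  fixes X :: "nat \<Rightarrow> 'i \<Rightarrow> 'a \<Rightarrow> 'b::metric_space"
  assumes ind: "\<And>n. indep_vars (\<lambda>_. borel) (X n) I"
    and Y: "\<And>i. i \<in> I \<Longrightarrow> Y i \<in> borel_measurable M"
    and lim: "\<And>i. i \<in> I \<Longrightarrow> AE \<omega> in M. (\<lambda>n. X n i \<omega>) \<longlonglongrightarrow> Y i \<omega>"
  shows "indep_vars (\<lambda>_. borel) Y I"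
proof (rule indep_vars_bounded_continuous[OF Y])
  fix J :: "'i set" and f :: "'i \<Rightarrow> 'b \<Rightarrow> real"
  assume J: "finite J" "J \<subseteq> I" "J \<noteq> {}" and f: "\<And>i. continuous_on UNIV (f i)" "\<And>i x. 0 \<le> f i x" "\<And>i x. f i x \<le> 1"
  have [measurable]: "X n i \<in> borel_measurable M" "Y i \<in> borel_measurable M" if "i \<in> J" for n i
    using indep_vars_measurable[OF ind] Y J that by auto
  have [measurable]: "f i \<in> borel_measurable borel" for i
    using f by (intro borel_measurable_continuous_onI)
  have "AE \<omega> in M. \<forall>i\<in>J. (\<lambda>n. X n i \<omega>) \<longlonglongrightarrow> Y i \<omega>"
    using lim J by (subst AE_finite_all) auto
  then have AE: "AE \<omega> in M. \<forall>i\<in>J. (\<lambda>n. f i (X n i \<omega>)) \<longlonglongrightarrow> f i (Y i \<omega>)"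
    by eventually_elim (auto intro!: continuous_on_tendsto_compose[OF f(1)])
  have "(\<lambda>n. expectation (\<lambda>\<omega>. \<Prod>i\<in>J. f i (X n i \<omega>))) \<longlonglongrightarrow> expectation (\<lambda>\<omega>. \<Prod>i\<in>J. f i (Y i \<omega>))"
  proof (rule integral_dominated_convergence[where w="\<lambda>_. 1"])
    show "AE \<omega> in M. (\<lambda>n. \<Prod>i\<in>J. f i (X n i \<omega>)) \<longlonglongrightarrow> (\<Prod>i\<in>J. f i (Y i \<omega>))"
      using AE by eventually_elim (auto intro: tendsto_prod)
  qed (use f in \<open>auto simp: abs_prod intro!: prod_le_1 borel_measurable_prod\<close>)
  moreover have "(\<lambda>n. \<Prod>i\<in>J. expectation (\<lambda>\<omega>. f i (X n i \<omega>))) \<longlonglongrightarrow> (\<Prod>i\<in>J. expectation (\<lambda>\<omega>. f i (Y i \<omega>)))"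
  proof (rule tendsto_prod, rule integral_dominated_convergence[where w="\<lambda>_. 1"])
    fix i assume "i \<in> J"
    then show "AE \<omega> in M. (\<lambda>n. f i (X n i \<omega>)) \<longlonglongrightarrow> f i (Y i \<omega>)"
      using AE by auto
  qed (use f in auto)
  moreover have "expectation (\<lambda>\<omega>. \<Prod>i\<in>J. f i (X n i \<omega>)) = (\<Prod>i\<in>J. expectation (\<lambda>\<omega>. f i (X n i \<omega>)))" for n
  proof (rule indep_vars_lebesgue_integral[OF J(1)])
    show "indep_vars (\<lambda>_. borel) (\<lambda>i \<omega>. f i (X n i \<omega>)) J"
      by (rule indep_vars_compose2[OF indep_vars_subset[OF ind J(2)]]) simp
    show "integrable M (\<lambda>\<omega>. f i (X n i \<omega>))" if "i \<in> J" for i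
      using that f by (intro integrable_const_bound[where B=1]) auto
  qed
  ultimately show "expectation (\<lambda>\<omega>. \<Prod>i\<in>J. f i (Y i \<omega>)) = (\<Prod>i\<in>J. expectation (\<lambda>\<omega>. f i (Y i \<omega>)))"
    using LIMSEQ_unique by auto
qed

lemma distr_eq_limit:
  fixes X X' :: "nat \<Rightarrow> 'a \<Rightarrow> 'b::metric_space"
  assumes X: "\<And>n. X n \<in> borel_measurable M" "\<And>n. X' n \<in> borel_measurable M"
    and Y: "Y \<in> borel_measurable M" "Y' \<in> borel_measurable M"
    and eq: "\<And>n. distr M borel (X n) = distr M borel (X' n)"
    and lim: "AE \<omega> in M. (\<lambda>n. X n \<omega>) \<longlonglongrightarrow> Y \<omega>" "AE \<omega> in M. (\<lambda>n. X' n \<omega>) \<longlonglongrightarrow> Y' \<omega>"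
  shows "distr M borel Y = distr M borel Y'"
proof (rule measure_eqI_bounded_continuous)
  fix f :: "'b \<Rightarrow> real"
  assume f: "continuous_on UNIV f" "\<And>x. 0 \<le> f x" "\<And>x. f x \<le> 1"
  have [measurable]: "f \<in> borel_measurable borel" using f by (intro borel_measurable_continuous_onI)
  note [measurable] = X Y
  have "(\<lambda>n. expectation (\<lambda>\<omega>. f (X n \<omega>))) \<longlonglongrightarrow> expectation (\<lambda>\<omega>. f (Y \<omega>))"
  proof (rule integral_dominated_convergence[where w="\<lambda>_. 1"])
    show "AE \<omega> in M. (\<lambda>n. f (X n \<omega>)) \<longlonglongrightarrow> f (Y \<omega>)"
      using lim(1) by eventually_elim (auto intro!: continuous_on_tendsto_compose[OF f(1)])
  qed (use f in auto)
  moreover have "(\<lambda>n. expectation (\<lambda>\<omega>. f (X' n \<omega>))) \<longlonglongrightarrow> expectation (\<lambda>\<omega>. f (Y' \<omega>))"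
  proof (rule integral_dominated_convergence[where w="\<lambda>_. 1"])
    show "AE \<omega> in M. (\<lambda>n. f (X' n \<omega>)) \<longlonglongrightarrow> f (Y' \<omega>)"
      using lim(2) by eventually_elim (auto intro!: continuous_on_tendsto_compose[OF f(1)])
  qed (use f in auto)
  moreover have "expectation (\<lambda>\<omega>. f (X n \<omega>)) = expectation (\<lambda>\<omega>. f (X' n \<omega>))" for n
    using eq[of n] integral_distr[of "X n" M borel f] integral_distr[of "X' n" M borel f] by simp
  ultimately show "integral\<^sup>L (distr M borel Y) f = integral\<^sup>L (distr M borel Y') f"
    using LIMSEQ_unique by (simp add: integral_distr)
qed (use Y in \<open>auto intro: prob_space_distr\<close>)

lemma iid_limit:
  fixes X :: "nat \<Rightarrow> nat \<Rightarrow> 'a \<Rightarrow> 'b::metric_space"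
  assumes iid: "\<And>n. iid M borel (X n)"
    and Y: "\<And>i. Y i \<in> borel_measurable M"
    and lim: "\<And>i. AE \<omega> in M. (\<lambda>n. X n i \<omega>) \<longlonglongrightarrow> Y i \<omega>"
  shows "iid M borel Y"
  unfolding iid_def
proof (intro conjI allI)
  show "indep_vars (\<lambda>_. borel) Y UNIV"
    by (rule indep_vars_limit[of X]) (use iid Y lim in \<open>auto simp: iid_def\<close>)
  show "distr M borel (Y i) = distr M borel (Y 0)" for i
    by (rule distr_eq_limit[of "\<lambda>n. X n i" "\<lambda>n. X n 0"])
       (use iid Y lim in \<open>auto simp: iid_measurable, auto simp: iid_def\<close>)
qed

lemma iid_distr_PiM:
  assumes "iid M N X"
  shows "distr M (Pi\<^sub>M UNIV (\<lambda>_. N)) (\<lambda>\<omega> i. X i \<omega>) = Pi\<^sub>M UNIV (\<lambda>_. distr M N (X 0))"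
proof -
  have "distr M (Pi\<^sub>M UNIV (\<lambda>_. N)) (\<lambda>\<omega>. \<lambda>i\<in>UNIV. X i \<omega>) = Pi\<^sub>M UNIV (\<lambda>i. distr M N (X i))"
    by (rule indep_vars_iff_distr_eq_PiM'[THEN iffD1])
       (use assms iid_measurable in \<open>auto simp: iid_def\<close>)
  also have "(\<lambda>i. distr M N (X i)) = (\<lambda>i. distr M N (X 0))"
    using assms unfolding iid_def by blast
  finally show ?thesis by simp
qed

lemma iidI_distr_PiM:
  assumes X: "\<And>i. X i \<in> M \<rightarrow>\<^sub>M N" and \<rho>: "prob_space \<rho>" "sets \<rho> = sets N"
    and eq: "distr M (Pi\<^sub>M UNIV (\<lambda>_. N)) (\<lambda>\<omega> i. X i \<omega>) = Pi\<^sub>M UNIV (\<lambda>_::nat. \<rho>)"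
  shows "iid M N X" "distr M N (X i) = \<rho>"
proof -
  note [measurable] = X
  have d: "distr M N (X i) = \<rho>" for i
  proof -
    have "distr M N (X i) = distr (distr M (Pi\<^sub>M UNIV (\<lambda>_. N)) (\<lambda>\<omega> i. X i \<omega>)) N (\<lambda>x. x i)"
      by (subst distr_distr) (auto simp: comp_def)
    also have "\<dots> = distr (Pi\<^sub>M UNIV (\<lambda>_::nat. \<rho>)) \<rho> (\<lambda>x. x i)"
      unfolding eq using \<rho> by (intro distr_cong) auto
    also have "\<dots> = \<rho>" using \<rho> by (intro distr_PiM_component) auto
    finally show ?thesis .
  qed
  then show "distr M N (X i) = \<rho>" .
  have "indep_vars (\<lambda>_. N) X UNIV"
    by (rule indep_vars_iff_distr_eq_PiM'[THEN iffD2]) (simp_all add: d eq restrict_UNIV)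
  then show "iid M N X" unfolding iid_def using d by simp
qed

text \<open>Disjoint index blocks give independence; equality of the laws comes from the invariance
  of the product measure under reindexing.\<close>

lemma iid_blocks:
  fixes X :: "nat \<Rightarrow> 'a \<Rightarrow> real" and g :: "real \<Rightarrow> real"
  assumes iid: "iid M borel X" and g[measurable]: "g \<in> borel_measurable borel" and m: "m > 0"
  shows "iid M borel (\<lambda>k \<omega>. \<Sum>i<m. g (X (k * m + i) \<omega>))"
  unfolding iid_def
proof (intro conjI allI)
  let ?K = "\<lambda>k. {k * m..<k * m + m}"
  have dis: "disjoint_family_on ?K UNIV"
  proof -
    have "x div m = k" if "x \<in> ?K k" for x k
    proof (rule div_nat_eqI)
      show "m * k \<le> x" "x < m * Suc k" using that by (auto simp: mult.commute)
    qed
    then show ?thesis unfolding disjoint_family_on_def by blast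
  qed
  have [measurable]: "X i \<in> borel_measurable M" for i by (rule iid_measurable[OF iid])
  have "indep_vars (\<lambda>j. PiM (?K j) (\<lambda>_. borel)) (\<lambda>j \<omega>. restrict (\<lambda>i. X i \<omega>) (?K j)) UNIV"
    by (rule indep_vars_restrict) (use iid dis in \<open>auto simp: iid_def\<close>)
  then have "indep_vars (\<lambda>j. borel) (\<lambda>j \<omega>. (\<lambda>x. \<Sum>i<m. g (x (j * m + i))) (restrict (\<lambda>i. X i \<omega>) (?K j))) UNIV"
    by (rule indep_vars_compose2) auto
  then show "indep_vars (\<lambda>_. borel) (\<lambda>k \<omega>. \<Sum>i<m. g (X (k * m + i) \<omega>)) UNIV"
    by simp
  define \<rho> where "\<rho> = distr M borel (X 0)"
  have \<rho>: "prob_space \<rho>" "sets \<rho> = sets borel" unfolding \<rho>_def by (auto intro: prob_space_distr)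
  note [measurable_cong] = \<rho>(2)
  have "distr M borel (\<lambda>\<omega>. \<Sum>i<m. g (X (k * m + i) \<omega>)) =
     distr (Pi\<^sub>M UNIV (\<lambda>_. \<rho>)) borel (\<lambda>x. \<Sum>i<m. g (x i))" for k
  proof -
    have "distr M borel (\<lambda>\<omega>. \<Sum>i<m. g (X (k * m + i) \<omega>)) =
      distr (distr M (Pi\<^sub>M UNIV (\<lambda>_. borel)) (\<lambda>\<omega> i. X i \<omega>)) borel (\<lambda>x. \<Sum>i<m. g (x (k * m + i)))"
      by (subst distr_distr) (auto simp: comp_def)
    also have "\<dots> = distr (Pi\<^sub>M UNIV (\<lambda>_. \<rho>)) borel (\<lambda>x. \<Sum>i<m. g (x (k * m + i)))"
      unfolding iid_distr_PiM[OF iid] \<rho>_def by simp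
    also have "\<dots> = distr (distr (Pi\<^sub>M UNIV (\<lambda>_. \<rho>)) (Pi\<^sub>M UNIV (\<lambda>_. \<rho>)) (\<lambda>x. \<lambda>n\<in>UNIV. x (k * m + n))) borel (\<lambda>x. \<Sum>i<m. g (x i))"
      by (subst distr_distr) (auto simp: comp_def)
    also have "distr (Pi\<^sub>M UNIV (\<lambda>_. \<rho>)) (Pi\<^sub>M UNIV (\<lambda>_. \<rho>)) (\<lambda>x. \<lambda>n\<in>UNIV. x (k * m + n)) = Pi\<^sub>M UNIV (\<lambda>_. \<rho>)"
      by (rule distr_PiM_reindex) (use \<rho> in auto)
    finally show ?thesis .
  qed
  then show "distr M borel (\<lambda>\<omega>. \<Sum>i<m. g (X (i' * m + i) \<omega>)) =
    distr M borel (\<lambda>\<omega>. \<Sum>i<m. g (X (0 * m + i) \<omega>))" for i'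
    by metis
qed

end

section \<open>Squared jumps in grid cells\<close>

lemma (in prob_space) indep_vars_finite_index:
  assumes "\<And>n. indep_vars M' X {..<n::nat}"
  shows "indep_vars M' X UNIV"
proof -
  have "indep_sets (\<lambda>i. {X i -` A \<inter> space M |A. A \<in> sets (M' i)}) J" if J: "finite J" for J
  proof -
    obtain n where "J \<subseteq> {..<n}" using finite_nat_bounded[OF J] by auto
    then have "indep_vars M' X J" using indep_vars_subset[OF assms] by blast
    then show ?thesis unfolding indep_vars_def2 by simp
  qed
  then have "indep_sets (\<lambda>i. {X i -` A \<inter> space M |A. A \<in> sets (M' i)}) UNIV"
    using indep_sets_finite_index_sets by blast
  moreover have "random_variable (M' i) (X i)" for i
    using indep_vars_measurable[OF assms[of "Suc i"], of i] by simp
  ultimately show ?thesis unfolding indep_vars_def2 by simp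
qed

lemma levy_increments_iid:
  assumes M: "prob_space M" and L: "levy_process M L" and h: "h > 0"
  shows "iid M borel (\<lambda>i \<omega>. L (h * real (Suc i)) \<omega> - L (h * real i) \<omega>)"
  unfolding iid_def
proof (intro conjI allI)
  interpret prob_space M by fact
  show "indep_vars (\<lambda>_. borel) (\<lambda>i \<omega>. L (h * real (Suc i)) \<omega> - L (h * real i) \<omega>) UNIV"
  proof (rule indep_vars_finite_index)
    fix n
    have "0 \<le> h * real 0 \<and> (\<forall>i<n. h * real i < h * real (Suc i))" using h by auto
    then show "indep_vars (\<lambda>_. borel) (\<lambda>i \<omega>. L (h * real (Suc i)) \<omega> - L (h * real i) \<omega>) {..<n}"
      by (rule L[unfolded levy_process_def, THEN conjunct2, THEN conjunct2, THEN conjunct1, THEN spec, THEN spec, THEN mp])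
  qed
  have "distr M borel (\<lambda>\<omega>. L (h * real (Suc i)) \<omega> - L (h * real i) \<omega>) = distr M borel (\<lambda>\<omega>. L h \<omega> - L 0 \<omega>)" for i
  proof -
    have stat: "\<forall>s\<ge>0. \<forall>h\<ge>0. distr M borel (\<lambda>\<omega>. L (s + h) \<omega> - L s \<omega>) = distr M borel (\<lambda>\<omega>. L h \<omega> - L 0 \<omega>)"
      using L unfolding levy_process_def by simp
    have "h * real (Suc i) = h * real i + h" by (simp add: algebra_simps)
    then show ?thesis using stat[rule_format, of "h * real i" h] h by simp
  qed
  then show "distr M borel (\<lambda>\<omega>. L (h * real (Suc i)) \<omega> - L (h * real i) \<omega>) =
    distr M borel (\<lambda>\<omega>. L (h * real (Suc 0)) \<omega> - L (h * real 0) \<omega>)" for i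
    by metis
qed

text \<open>Cell k of width h is cut into m pieces. Numbering the pieces by k * m + i makes the sums
  over all cells consecutive blocks of one increment sequence with step h / m, as
  \<open>iid_blocks\<close> requires.\<close>

definition grid_sum :: "(real \<Rightarrow> real) \<Rightarrow> real \<Rightarrow> nat \<Rightarrow> nat \<Rightarrow> (real \<Rightarrow> real) \<Rightarrow> real" where
  "grid_sum g h m k f = (\<Sum>i<m. g (f (h / real m * real (Suc (k * m + i))) - f (h / real m * real (k * m + i))))"

text \<open>A limit of functions of path values at grid points, so that measurability is automatic;
  its meaning as a sum over jumps is established for cadlag paths. \<open>Suc m\<close> avoids a
  grid of zero pieces.\<close>

definition cell_sum :: "(real \<Rightarrow> real) \<Rightarrow> real \<Rightarrow> nat \<Rightarrow> (real \<Rightarrow> real) \<Rightarrow> real" where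
  "cell_sum g h k f = lim (\<lambda>m. grid_sum g h (Suc m) k f)"

definition cell :: "real \<Rightarrow> nat \<Rightarrow> real set" where
  "cell h k = {h * real k<..h * real (Suc k)}"

text \<open>Weights for which the sum over the jumps of a cadlag path in a bounded interval has
  finitely many nonzero terms.\<close>

definition vanishes_near_0 :: "(real \<Rightarrow> real) \<Rightarrow> bool" where
  "vanishes_near_0 g \<longleftrightarrow> continuous_on UNIV g \<and> (\<exists>\<epsilon>>0. \<forall>x. \<bar>x\<bar> \<le> \<epsilon> \<longrightarrow> g x = 0)"

lemma vanishes_near_0_measurable: "vanishes_near_0 g \<Longrightarrow> g \<in> borel_measurable borel"
  unfolding vanishes_near_0_def by (auto intro: borel_measurable_continuous_onI)

lemma grid_sum_measurable:
  assumes g: "g \<in> borel_measurable borel" and h: "h \<ge> 0"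
    and X: "\<And>t. t \<ge> 0 \<Longrightarrow> (\<lambda>\<omega>. X \<omega> t) \<in> borel_measurable M"
  shows "(\<lambda>\<omega>. grid_sum g h m k (X \<omega>)) \<in> borel_measurable M"
proof -
  note [measurable] = g
  have [measurable]: "(\<lambda>\<omega>. X \<omega> (h / real m * real i)) \<in> borel_measurable M" for i
    using h by (intro X) auto
  show ?thesis unfolding grid_sum_def by measurable
qed

lemma cell_sum_measurable:
  assumes "g \<in> borel_measurable borel" "h \<ge> 0" "\<And>t. t \<ge> 0 \<Longrightarrow> (\<lambda>\<omega>. X \<omega> t) \<in> borel_measurable M"
  shows "(\<lambda>\<omega>. cell_sum g h k (X \<omega>)) \<in> borel_measurable M"
  unfolding cell_sum_def
  by (intro borel_measurable_lim_metric grid_sum_measurable assms)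

lemma cell_sum_cadlag:
  assumes f: "cadlag f" and g: "vanishes_near_0 g" and h: "h > 0"
  shows "finite {s\<in>cell h k. g (jump f s) \<noteq> 0}"
    and "(\<lambda>m. grid_sum g h (Suc m) k f) \<longlonglongrightarrow> (\<Sum>s\<in>{s\<in>cell h k. g (jump f s) \<noteq> 0}. g (jump f s))"
    and "cell_sum g h k f = (\<Sum>s\<in>{s\<in>cell h k. g (jump f s) \<noteq> 0}. g (jump f s))"
proof -
  obtain \<epsilon> where eps: "\<epsilon> > 0" "\<And>x. \<bar>x\<bar> \<le> \<epsilon> \<Longrightarrow> g x = 0" "continuous_on UNIV g"
    using g unfolding vanishes_near_0_def by blast
  have ab: "0 \<le> h * real k" "h * real k < h * real (Suc k)" using h by auto
  note G = cadlag_grid_sum[OF f ab eps(3,1,2), folded cell_def]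
  show "finite {s\<in>cell h k. g (jump f s) \<noteq> 0}" using G(1) by simp
  have eq: "h * real k + (h * real (Suc k) - h * real k) * real i / real (Suc m) = h / real (Suc m) * real (k * Suc m + i)" for i m
  proof -
    have "h * x + (h * (x + 1) - h * x) * y / z = h / z * (x * z + y)" if "z \<noteq> 0" for x y z :: real
      using that by (simp add: field_simps)
    from this[of "real (Suc m)" "real k" "real i"] show ?thesis
      by (simp add: add.commute distrib_left)
  qed
  have "(\<lambda>m. \<Sum>i<Suc m. g (f (h * real k + (h * real (Suc k) - h * real k) * real (Suc i) / real (Suc m)) - f (h * real k + (h * real (Suc k) - h * real k) * real i / real (Suc m)))) \<longlonglongrightarrow>
     (\<Sum>s\<in>{s\<in>cell h k. g (jump f s) \<noteq> 0}. g (jump f s))"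
    by (rule LIMSEQ_Suc[OF G(2)])
  then show lim: "(\<lambda>m. grid_sum g h (Suc m) k f) \<longlonglongrightarrow> (\<Sum>s\<in>{s\<in>cell h k. g (jump f s) \<noteq> 0}. g (jump f s))"
    unfolding eq grid_sum_def by simp
  show "cell_sum g h k f = (\<Sum>s\<in>{s\<in>cell h k. g (jump f s) \<noteq> 0}. g (jump f s))"
    unfolding cell_sum_def using lim by (rule limI)
qed

text \<open>For every subdivision the grid sums are block sums of i.i.d. increments, and refining
  the subdivision is an almost sure limit.\<close>

lemma cell_sum_iid:
  assumes M: "prob_space M" and L: "levy_process M L" and g: "vanishes_near_0 g" and h: "h > 0"
  shows "iid M borel (\<lambda>k \<omega>. cell_sum g h k (\<lambda>t. L t \<omega>))"
proof -
  interpret prob_space M by fact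
  have Lm: "\<And>t. t \<ge> 0 \<Longrightarrow> L t \<in> borel_measurable M" and cad: "AE \<omega> in M. cadlag (\<lambda>t. L t \<omega>)"
    using L unfolding levy_process_def by auto
  note gm = vanishes_near_0_measurable[OF g]
  show ?thesis
  proof (rule iid_limit)
    fix n
    show "iid M borel (\<lambda>k \<omega>. grid_sum g h (Suc n) k (\<lambda>t. L t \<omega>))"
      using iid_blocks[OF levy_increments_iid[OF M L, of "h / real (Suc n)"] gm, of "Suc n"] h
      unfolding grid_sum_def by simp
  next
    fix k
    show "(\<lambda>\<omega>. cell_sum g h k (\<lambda>t. L t \<omega>)) \<in> borel_measurable M"
      using gm h Lm by (intro cell_sum_measurable) auto
    show "AE \<omega> in M. (\<lambda>n. grid_sum g h (Suc n) k (\<lambda>t. L t \<omega>)) \<longlonglongrightarrow> cell_sum g h k (\<lambda>t. L t \<omega>)"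
      using cad
    proof eventually_elim
      case (elim \<omega>)
      show ?case using cell_sum_cadlag(2,3)[OF elim g h] by simp
    qed
  qed
qed

text \<open>Zero for |x| \<le> 1 / (j + 1), one for |x| \<ge> 2 / (j + 1), linear in between: a
  continuous weight that ignores small jumps and gives every fixed nonzero jump weight 1 once j is
  large.\<close>

definition cutoff :: "nat \<Rightarrow> real \<Rightarrow> real" where
  "cutoff j x = min 1 (max 0 (real (Suc j) * \<bar>x\<bar> - 1))"

lemma cutoff_bounds: "0 \<le> cutoff j x" "cutoff j x \<le> 1"
  by (auto simp: cutoff_def)

lemma cutoff_0 [simp]: "cutoff j 0 = 0"
  by (simp add: cutoff_def)

lemma vanishes_near_0_cutoff:
  assumes "continuous_on UNIV \<phi>"
  shows "vanishes_near_0 (\<lambda>x. \<phi> x * cutoff j x)"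
  unfolding vanishes_near_0_def
proof (intro conjI exI[of _ "1 / real (Suc j)"] allI impI)
  show "continuous_on UNIV (\<lambda>x. \<phi> x * cutoff j x)"
    unfolding cutoff_def by (intro continuous_intros assms)
  fix x :: real assume "\<bar>x\<bar> \<le> 1 / real (Suc j)"
  then have "real (Suc j) * \<bar>x\<bar> \<le> real (Suc j) * (1 / real (Suc j))" by (intro mult_left_mono) auto
  then show "\<phi> x * cutoff j x = 0" by (simp add: cutoff_def)
qed simp

lemma cutoff_eventually_1:
  assumes "x \<noteq> 0"
  shows "eventually (\<lambda>j. cutoff j x = 1) sequentially"
proof -
  obtain k :: nat where k: "2 / \<bar>x\<bar> < real k" using reals_Archimedean2 by blast
  have "cutoff j x = 1" if "j \<ge> k" for j
  proof -
    have "2 / \<bar>x\<bar> \<le> real (Suc j)" using k that by linarith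
    then have "2 \<le> real (Suc j) * \<bar>x\<bar>" using assms by (simp add: divide_le_eq)
    then show ?thesis by (simp add: cutoff_def)
  qed
  then show ?thesis by (auto simp: eventually_sequentially)
qed

text \<open>Restricted to positive times, since at 0 there is no left limit from within the time
  axis.\<close>

definition jumps :: "(real \<Rightarrow> real) \<Rightarrow> real set" where
  "jumps f = {s. s > 0 \<and> jump f s \<noteq> 0}"

text \<open>The Levy measure bounds the expected weighted number of jumps in the first unit cell
  uniformly in the cutoff, the i.i.d. property carries the bound to every other cell, and Fatou's
  lemma removes the cutoff. The detour through cell 0 is forced by the definition of the Levy
  measure, which speaks of (0, 1] only.\<close>

lemma AE_finite_jumps_cell:
  assumes M: "prob_space M" and L: "levy_process M L" and \<nu>: "has_levy_measure M L \<nu>" "emeasure \<nu> UNIV < \<infinity>"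
  shows "AE \<omega> in M. finite (jumps (\<lambda>t. L t \<omega>) \<inter> cell 1 k)"
proof -
  interpret prob_space M by fact
  have Lm: "\<And>t. t \<ge> 0 \<Longrightarrow> L t \<in> borel_measurable M" and cad: "AE \<omega> in M. cadlag (\<lambda>t. L t \<omega>)"
    using L unfolding levy_process_def by auto
  have g: "vanishes_near_0 (cutoff j)" for j
    using vanishes_near_0_cutoff[of "\<lambda>_. 1" j] by simp
  define c where "c j k \<omega> = cell_sum (cutoff j) 1 k (\<lambda>t. L t \<omega>)" for j k \<omega>
  have iid: "iid M borel (c j)" for j
    unfolding c_def by (rule cell_sum_iid[OF M L g]) simp
  have [measurable]: "c j k \<in> borel_measurable M" for j k by (rule iid_measurable[OF iid])
  have "(\<integral>\<^sup>+\<omega>. ennreal (c j 0 \<omega>) \<partial>M) \<le> emeasure \<nu> UNIV" for j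
  proof -
    have "emeasure \<nu> UNIV = (\<integral>\<^sup>+\<omega>. emeasure (count_space UNIV)
           {s \<in> {0<..1}. jump (\<lambda>t. L t \<omega>) s \<noteq> 0 \<and> jump (\<lambda>t. L t \<omega>) s \<in> UNIV} \<partial>M)"
      by (rule bspec[OF conjunct2[OF \<nu>(1)[unfolded has_levy_measure_def]]]) simp
    also have "(\<integral>\<^sup>+\<omega>. ennreal (c j 0 \<omega>) \<partial>M) \<le> \<dots>"
    proof (rule nn_integral_mono_AE, use cad in eventually_elim)
      case (elim \<omega>)
      let ?F = "{s\<in>cell 1 0. cutoff j (jump (\<lambda>t. L t \<omega>) s) \<noteq> 0}"
      note F = cell_sum_cadlag(1,3)[OF elim g[of j] zero_less_one, of 0]
      have "ennreal (c j 0 \<omega>) \<le> ennreal (real (card ?F))"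
        unfolding c_def F(2) using sum_mono[of ?F "\<lambda>s. cutoff j (jump (\<lambda>t. L t \<omega>) s)" "\<lambda>_. 1"] cutoff_bounds
        by (intro ennreal_leI) auto
      also have "\<dots> = emeasure (count_space UNIV) ?F"
        using F(1) by (simp add: ennreal_of_nat_eq_real_of_nat)
      also have "\<dots> \<le> emeasure (count_space UNIV) {s \<in> {0<..1}. jump (\<lambda>t. L t \<omega>) s \<noteq> 0 \<and> jump (\<lambda>t. L t \<omega>) s \<in> UNIV}"
        by (rule emeasure_mono) (auto simp: cell_def intro: ccontr)
      finally show ?case .
    qed
    finally show ?thesis .
  qed
  moreover have "(\<integral>\<^sup>+\<omega>. ennreal (c j k \<omega>) \<partial>M) = (\<integral>\<^sup>+\<omega>. ennreal (c j 0 \<omega>) \<partial>M)" for j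
  proof -
    have "distr M borel (c j k) = distr M borel (c j 0)" using iid unfolding iid_def by blast
    then show ?thesis
      using nn_integral_distr[of "c j k" M borel ennreal] nn_integral_distr[of "c j 0" M borel ennreal] by simp
  qed
  ultimately have le: "(\<integral>\<^sup>+\<omega>. ennreal (c j k \<omega>) \<partial>M) \<le> emeasure \<nu> UNIV" for j by metis
  have "(\<integral>\<^sup>+\<omega>. liminf (\<lambda>j. ennreal (c j k \<omega>)) \<partial>M) \<le> liminf (\<lambda>j. \<integral>\<^sup>+\<omega>. ennreal (c j k \<omega>) \<partial>M)"
    by (rule nn_integral_liminf) simp
  also have "\<dots> \<le> liminf (\<lambda>j. emeasure \<nu> UNIV)"
    by (rule Liminf_mono, rule always_eventually, rule allI, rule le)
  also have "\<dots> = emeasure \<nu> UNIV" by (rule Liminf_const) simp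
  also have "\<dots> < \<infinity>" by fact
  finally have "AE \<omega> in M. liminf (\<lambda>j. ennreal (c j k \<omega>)) \<noteq> \<infinity>"
    by (intro nn_integral_PInf_AE) auto
  with cad show ?thesis
  proof eventually_elim
    case (elim \<omega>)
    let ?J = "jumps (\<lambda>t. L t \<omega>) \<inter> cell 1 k"
    show ?case
    proof (rule ccontr)
      assume inf: "infinite ?J"
      \<comment> \<open>Any n jumps in the cell are eventually counted with weight 1, so infinitely
        many of them make the lower limit infinite.\<close>
      have "of_nat n \<le> liminf (\<lambda>j. ennreal (c j k \<omega>))" for n
      proof -
        obtain F where F: "finite F" "card F = n" "F \<subseteq> ?J" using infinite_arbitrarily_large[OF inf] by blast
        have "eventually (\<lambda>j. \<forall>s\<in>F. cutoff j (jump (\<lambda>t. L t \<omega>) s) = 1) sequentially"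
          using F by (auto simp: eventually_ball_finite_distrib jumps_def intro!: cutoff_eventually_1)
        then have "eventually (\<lambda>j. of_nat n \<le> ennreal (c j k \<omega>)) sequentially"
        proof eventually_elim
          case (elim j)
          let ?G = "{s\<in>cell 1 k. cutoff j (jump (\<lambda>t. L t \<omega>) s) \<noteq> 0}"
          note G = cell_sum_cadlag(1,3)[OF \<open>cadlag (\<lambda>t. L t \<omega>)\<close> g[of j] zero_less_one, of k]
          have "F \<subseteq> ?G"
          proof
            fix s assume "s \<in> F"
            with F(3) elim show "s \<in> ?G" by auto
          qed
          have "real n = (\<Sum>s\<in>F. cutoff j (jump (\<lambda>t. L t \<omega>) s))" using F elim by simp
          also have "\<dots> \<le> (\<Sum>s\<in>?G. cutoff j (jump (\<lambda>t. L t \<omega>) s))"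
            by (rule sum_mono2[OF G(1) \<open>F \<subseteq> ?G\<close>]) (rule cutoff_bounds)
          finally have "real n \<le> c j k \<omega>" unfolding c_def G(2) .
          then show ?case by (simp add: ennreal_of_nat_eq_real_of_nat ennreal_leI)
        qed
        then show ?thesis by (rule Liminf_bounded)
      qed
      then have "liminf (\<lambda>j. ennreal (c j k \<omega>)) = \<infinity>"
        by (metis ennreal_Ex_less_of_nat infinity_ennreal_def less_top linorder_not_le)
      then show False using elim by simp
    qed
  qed
qed

lemma cell_cover:
  assumes "h > 0" "0 < s"
  shows "\<exists>k. s \<in> cell h k" 
proof -
  have "s / h > 0" using assms by simp
  from grid_cell_bounds[OF this] obtain k where "real k < s / h" "s / h \<le> real k + 1" by blast
  then have "s \<in> cell h k" using assms by (auto simp: cell_def field_simps)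
  then show ?thesis by blast
qed

lemma AE_finite_jumps:
  assumes M: "prob_space M" and L: "levy_process M L" and \<nu>: "has_levy_measure M L \<nu>" "emeasure \<nu> UNIV < \<infinity>"
  shows "AE \<omega> in M. \<forall>t. finite (jumps (\<lambda>t. L t \<omega>) \<inter> {..t})"
proof -
  have "AE \<omega> in M. \<forall>k. finite (jumps (\<lambda>t. L t \<omega>) \<inter> cell 1 k)"
    unfolding AE_all_countable using AE_finite_jumps_cell[OF assms] by blast
  then show ?thesis
  proof eventually_elim
    case (elim \<omega>)
    show ?case
    proof
      fix t :: real
      have "jumps (\<lambda>t. L t \<omega>) \<inter> {..t} \<subseteq> (\<Union>k\<in>{..nat \<lceil>t\<rceil>}. jumps (\<lambda>t. L t \<omega>) \<inter> cell 1 k)"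
      proof
        fix s assume s: "s \<in> jumps (\<lambda>t. L t \<omega>) \<inter> {..t}"
        then obtain k where k: "s \<in> cell 1 k" using cell_cover[of 1 s] by (auto simp: jumps_def)
        then have "real k < t" using s by (auto simp: cell_def)
        then have "k \<le> nat \<lceil>t\<rceil>" by linarith
        with s k show "s \<in> (\<Union>k\<in>{..nat \<lceil>t\<rceil>}. jumps (\<lambda>t. L t \<omega>) \<inter> cell 1 k)" by blast
      qed
      then show "finite (jumps (\<lambda>t. L t \<omega>) \<inter> {..t})"
        by (rule finite_subset, intro finite_UN_I) (use elim in simp_all)
    qed
  qed
qed

text \<open>The square does not vanish near 0, so the cutoff is inserted first and removed by a
  second limit; with finitely many jumps in the cell nothing is lost.\<close>

definition sq_cell :: "real \<Rightarrow> nat \<Rightarrow> (real \<Rightarrow> real) \<Rightarrow> real" where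
  "sq_cell h k f = lim (\<lambda>j. cell_sum (\<lambda>x. x\<^sup>2 * cutoff j x) h k f)"

lemma vanishes_near_0_sq_cutoff: "vanishes_near_0 (\<lambda>x. x\<^sup>2 * cutoff j x)"
  by (intro vanishes_near_0_cutoff continuous_intros)

lemma sq_cell_measurable:
  assumes "h \<ge> 0" "\<And>t. t \<ge> 0 \<Longrightarrow> (\<lambda>\<omega>. X \<omega> t) \<in> borel_measurable M"
  shows "(\<lambda>\<omega>. sq_cell h k (X \<omega>)) \<in> borel_measurable M"
  unfolding sq_cell_def
  by (intro borel_measurable_lim_metric cell_sum_measurable assms
      vanishes_near_0_measurable[OF vanishes_near_0_sq_cutoff])

lemma sq_cell_cadlag:
  assumes f: "cadlag f" and fin: "\<And>t. finite (jumps f \<inter> {..t})" and h: "h > 0"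
  shows "(\<lambda>j. cell_sum (\<lambda>x. x\<^sup>2 * cutoff j x) h k f) \<longlonglongrightarrow> (\<Sum>s\<in>jumps f \<inter> cell h k. (jump f s)\<^sup>2)"
    and "sq_cell h k f = (\<Sum>s\<in>jumps f \<inter> cell h k. (jump f s)\<^sup>2)"
proof -
  let ?J = "jumps f \<inter> cell h k"
  have "?J \<subseteq> jumps f \<inter> {..h * real (Suc k)}" by (auto simp: cell_def)
  then have J: "finite ?J" using fin finite_subset by blast
  have pos: "s > 0" if "s \<in> cell h k" for s
  proof -
    have "0 \<le> h * real k" using h by simp
    then show ?thesis using that unfolding cell_def by (auto simp del: of_nat_Suc)
  qed
  have eq: "cell_sum (\<lambda>x. x\<^sup>2 * cutoff j x) h k f = (\<Sum>s\<in>?J. (jump f s)\<^sup>2 * cutoff j (jump f s))" for j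
    unfolding cell_sum_cadlag(3)[OF f vanishes_near_0_sq_cutoff h]
    using J pos by (intro sum.mono_neutral_left) (auto simp: jumps_def)
  show lim: "(\<lambda>j. cell_sum (\<lambda>x. x\<^sup>2 * cutoff j x) h k f) \<longlonglongrightarrow> (\<Sum>s\<in>?J. (jump f s)\<^sup>2)"
    unfolding eq
  proof (rule tendsto_sum)
    fix s assume "s \<in> ?J"
    then have "eventually (\<lambda>j. (jump f s)\<^sup>2 * cutoff j (jump f s) = (jump f s)\<^sup>2) sequentially"
      using cutoff_eventually_1[of "jump f s"] by (auto simp: jumps_def elim!: eventually_mono)
    then show "(\<lambda>j. (jump f s)\<^sup>2 * cutoff j (jump f s)) \<longlonglongrightarrow> (jump f s)\<^sup>2"
      by (rule tendsto_eventually)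
  qed
  show "sq_cell h k f = (\<Sum>s\<in>?J. (jump f s)\<^sup>2)" unfolding sq_cell_def using lim by (rule limI)
qed

lemma sq_cell_iid:
  assumes M: "prob_space M" and L: "levy_process M L" and \<nu>: "has_levy_measure M L \<nu>" "emeasure \<nu> UNIV < \<infinity>"
    and h: "h > 0"
  shows "iid M borel (\<lambda>k \<omega>. sq_cell h k (\<lambda>t. L t \<omega>))"
proof -
  interpret prob_space M by fact
  have Lm: "\<And>t. t \<ge> 0 \<Longrightarrow> L t \<in> borel_measurable M" and cad: "AE \<omega> in M. cadlag (\<lambda>t. L t \<omega>)"
    using L unfolding levy_process_def by auto
  show ?thesis
  proof (rule iid_limit)
    fix n
    show "iid M borel (\<lambda>k \<omega>. cell_sum (\<lambda>x. x\<^sup>2 * cutoff n x) h k (\<lambda>t. L t \<omega>))"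
      by (rule cell_sum_iid[OF M L vanishes_near_0_sq_cutoff h])
  next
    fix k
    show "(\<lambda>\<omega>. sq_cell h k (\<lambda>t. L t \<omega>)) \<in> borel_measurable M"
      using h Lm by (intro sq_cell_measurable) auto
    show "AE \<omega> in M. (\<lambda>n. cell_sum (\<lambda>x. x\<^sup>2 * cutoff n x) h k (\<lambda>t. L t \<omega>)) \<longlonglongrightarrow> sq_cell h k (\<lambda>t. L t \<omega>)"
      using cad AE_finite_jumps[OF M L \<nu>]
    proof eventually_elim
      case (elim \<omega>)
      then show ?case using sq_cell_cadlag[of "\<lambda>t. L t \<omega>" h k] h by simp
    qed
  qed
qed

section \<open>Waiting times in independent sequences\<close>

lemma (in prob_space) distr_Pair_eqI:
  assumes X: "X \<in> M \<rightarrow>\<^sub>M S" and Y: "Y \<in> M \<rightarrow>\<^sub>M T"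
    and eq: "\<And>A B. A \<in> sets S \<Longrightarrow> B \<in> sets T \<Longrightarrow>
      emeasure M {\<omega>\<in>space M. X \<omega> \<in> A \<and> Y \<omega> \<in> B} = emeasure M {\<omega>\<in>space M. X \<omega> \<in> A} * emeasure M {\<omega>\<in>space M. Y \<omega> \<in> B}"
  shows "distr M (S \<Otimes>\<^sub>M T) (\<lambda>\<omega>. (X \<omega>, Y \<omega>)) = distr M S X \<Otimes>\<^sub>M distr M T Y"
proof (rule pair_measure_eqI[symmetric])
  interpret X: prob_space "distr M S X" by (rule prob_space_distr) fact
  interpret Y: prob_space "distr M T Y" by (rule prob_space_distr) fact
  show "sigma_finite_measure (distr M S X)" "sigma_finite_measure (distr M T Y)" by unfold_locales
  show "sets (distr M S X \<Otimes>\<^sub>M distr M T Y) = sets (distr M (S \<Otimes>\<^sub>M T) (\<lambda>\<omega>. (X \<omega>, Y \<omega>)))"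
    by (simp cong: sets_pair_measure_cong)
  fix A B assume "A \<in> sets (distr M S X)" "B \<in> sets (distr M T Y)"
  then have AB: "A \<in> sets S" "B \<in> sets T" by auto
  note [measurable] = X Y AB
  have "emeasure (distr M (S \<Otimes>\<^sub>M T) (\<lambda>\<omega>. (X \<omega>, Y \<omega>))) (A \<times> B) = emeasure M {\<omega>\<in>space M. X \<omega> \<in> A \<and> Y \<omega> \<in> B}"
    by (subst emeasure_distr) (auto intro!: arg_cong[where f="emeasure M"])
  moreover have "emeasure (distr M S X) A = emeasure M {\<omega>\<in>space M. X \<omega> \<in> A}"
    by (subst emeasure_distr) (auto intro!: arg_cong[where f="emeasure M"])
  moreover have "emeasure (distr M T Y) B = emeasure M {\<omega>\<in>space M. Y \<omega> \<in> B}"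
    by (subst emeasure_distr) (auto intro!: arg_cong[where f="emeasure M"])
  ultimately show "emeasure (distr M S X) A * emeasure (distr M T Y) B =
      emeasure (distr M (S \<Otimes>\<^sub>M T) (\<lambda>\<omega>. (X \<omega>, Y \<omega>))) (A \<times> B)"
    using eq[OF AB] by simp
qed

text \<open>Fubini with the first coordinate split off, the form in which recursions over i.i.d.
  sequences are carried out below.\<close>

lemma nn_integral_PiM_iter:
  assumes \<rho>: "prob_space \<rho>" and F: "F \<in> borel_measurable (Pi\<^sub>M UNIV (\<lambda>_::nat. \<rho>))"
  shows "(\<integral>\<^sup>+\<omega>. F \<omega> \<partial>Pi\<^sub>M UNIV (\<lambda>_::nat. \<rho>)) = (\<integral>\<^sup>+x. \<integral>\<^sup>+\<omega>. F (case_nat x \<omega>) \<partial>Pi\<^sub>M UNIV (\<lambda>_::nat. \<rho>) \<partial>\<rho>)"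
proof -
  interpret S: prob_space "Pi\<^sub>M UNIV (\<lambda>_::nat. \<rho>)" by (rule prob_space_PiM) (rule \<rho>)
  interpret prob_space \<rho> by fact
  interpret sequence_space \<rho> by unfold_locales
  note [measurable] = F
  have "(\<integral>\<^sup>+\<omega>. F \<omega> \<partial>S) = (\<integral>\<^sup>+\<omega>. F \<omega> \<partial>distr (\<rho> \<Otimes>\<^sub>M S) S (\<lambda>(s, \<omega>). case_nat s \<omega>))"
    by (simp only: PiM_iter)
  also have "\<dots> = (\<integral>\<^sup>+p. F (case p of (s, \<omega>) \<Rightarrow> case_nat s \<omega>) \<partial>(\<rho> \<Otimes>\<^sub>M S))"
    by (rule nn_integral_distr) measurable
  also have "\<dots> = (\<integral>\<^sup>+x. \<integral>\<^sup>+\<omega>. F (case_nat x \<omega>) \<partial>S \<partial>\<rho>)"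
    by (subst S.nn_integral_fst[symmetric]) auto
  finally show ?thesis .
qed

text \<open>Taking f = 1 in the hypothesis shows that \<open>sh\<close> preserves the law, and the
  full hypothesis makes the remainder independent of the first observation. This is regeneration:
  events along the orbit factor one step at a time.\<close>

lemma (in prob_space) iid_of_shift:
  assumes F[measurable]: "F \<in> M \<rightarrow>\<^sub>M N" and sh[measurable]: "sh \<in> M \<rightarrow>\<^sub>M M"
    and eq: "\<And>f g. f \<in> borel_measurable N \<Longrightarrow> g \<in> borel_measurable M \<Longrightarrow>
      (\<integral>\<^sup>+x. f (F x) * g (sh x) \<partial>M) = (\<integral>\<^sup>+x. f (F x) \<partial>M) * (\<integral>\<^sup>+x. g x \<partial>M)"
  shows "iid M N (\<lambda>i x. F ((sh ^^ i) x))"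
proof -
  define \<eta> where "\<eta> = distr M N F"
  have \<eta>: "prob_space \<eta>" unfolding \<eta>_def by (rule prob_space_distr) fact
  interpret \<eta>: prob_space \<eta> by (rule \<eta>)
  interpret E: product_prob_space "\<lambda>_::nat. \<eta>" UNIV ..
  have [measurable_cong]: "sets \<eta> = sets N" by (simp add: \<eta>_def)
  have [measurable]: "(sh ^^ i) \<in> M \<rightarrow>\<^sub>M M" for i
    by (induction i) (auto simp: o_def)
  have prod: "(\<integral>\<^sup>+x. (\<Prod>i<n. indicator (A i) (F ((sh ^^ i) x))) \<partial>M) = (\<Prod>i<n. emeasure \<eta> (A i))"
    if "\<And>i. A i \<in> sets N" for n A
    using that
  proof (induction n arbitrary: A)
    case 0
    then show ?case by (simp add: emeasure_space_1)
  next
    case (Suc n)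
    note [measurable] = Suc.prems
    have "(\<integral>\<^sup>+x. (\<Prod>i<Suc n. indicator (A i) (F ((sh ^^ i) x))) \<partial>M) =
      (\<integral>\<^sup>+x. indicator (A 0) (F x) * (\<Prod>i<n. indicator (A (Suc i)) (F ((sh ^^ i) (sh x)))) \<partial>M)"
      by (subst prod.lessThan_Suc_shift) (simp add: funpow_swap1)
    also have "\<dots> = (\<integral>\<^sup>+x. indicator (A 0) (F x) \<partial>M) * (\<integral>\<^sup>+x. (\<Prod>i<n. indicator (A (Suc i)) (F ((sh ^^ i) x))) \<partial>M)"
      by (rule eq) measurable
    also have "(\<integral>\<^sup>+x. (\<Prod>i<n. indicator (A (Suc i)) (F ((sh ^^ i) x))) \<partial>M) = (\<Prod>i<n. emeasure \<eta> (A (Suc i)))"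
      by (rule Suc.IH) measurable
    also have "(\<integral>\<^sup>+x. indicator (A 0) (F x) \<partial>M) = emeasure \<eta> (A 0)"
      unfolding \<eta>_def by (subst nn_integral_distr[symmetric, of F M N "indicator (A 0)"]) (auto simp: nn_integral_indicator)
    finally show ?case by (subst prod.lessThan_Suc_shift)
  qed
  have "distr M (Pi\<^sub>M UNIV (\<lambda>_. N)) (\<lambda>x i. F ((sh ^^ i) x)) = Pi\<^sub>M UNIV (\<lambda>_::nat. \<eta>)"
  proof (rule E.PiM_eq)
    show "sets (distr M (Pi\<^sub>M UNIV (\<lambda>_. N)) (\<lambda>x i. F ((sh ^^ i) x))) = sets (Pi\<^sub>M UNIV (\<lambda>_. \<eta>))"
      by (auto simp: \<eta>_def cong: sets_PiM_cong)
    fix J :: "nat set" and A assume J: "finite J" "J \<subseteq> UNIV" "\<And>j. j \<in> J \<Longrightarrow> A j \<in> sets \<eta>"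
    \<comment> \<open>Filling the missing coordinates with the whole space turns a cylinder over J
      into one over an initial segment, to which the product formula applies.\<close>
    define B where "B j = (if j \<in> J then A j else space N)" for j
    have B[measurable]: "B j \<in> sets N" for j using J by (auto simp: B_def \<eta>_def)
    obtain n where n: "J \<subseteq> {..<n}" using finite_nat_bounded[OF J(1)] by auto
    have emb: "prod_emb UNIV (\<lambda>_. \<eta>) J (Pi\<^sub>E J A) = {x \<in> space (Pi\<^sub>M UNIV (\<lambda>_. N)). \<forall>i<n. x i \<in> B i}"
      using n by (auto simp: prod_emb_def space_PiM PiE_iff B_def \<eta>_def split: if_splits) (metis lessThan_iff subset_iff)
    have "emeasure (distr M (Pi\<^sub>M UNIV (\<lambda>_. N)) (\<lambda>x i. F ((sh ^^ i) x))) (prod_emb UNIV (\<lambda>_. \<eta>) J (Pi\<^sub>E J A)) =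
      emeasure M {x\<in>space M. \<forall>i<n. F ((sh ^^ i) x) \<in> B i}"
    proof -
      have meas: "(\<lambda>x i. F ((sh ^^ i) x)) \<in> M \<rightarrow>\<^sub>M Pi\<^sub>M UNIV (\<lambda>_. N)" by measurable
      have "(\<lambda>x i. F ((sh ^^ i) x)) -` {x \<in> space (Pi\<^sub>M UNIV (\<lambda>_. N)). \<forall>i<n. x i \<in> B i} \<inter> space M =
        {x\<in>space M. \<forall>i<n. F ((sh ^^ i) x) \<in> B i}"
        using measurable_space[OF meas] by auto
      then show ?thesis unfolding emb by (subst emeasure_distr[OF meas]) auto
    qed
    also have "\<dots> = (\<integral>\<^sup>+x. indicator {x\<in>space M. \<forall>i<n. F ((sh ^^ i) x) \<in> B i} x \<partial>M)"
      by (simp add: nn_integral_indicator)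
    also have "\<dots> = (\<integral>\<^sup>+x. (\<Prod>i<n. indicator (B i) (F ((sh ^^ i) x))) \<partial>M)"
    proof (rule nn_integral_cong)
      fix x assume x: "x \<in> space M"
      show "indicator {x\<in>space M. \<forall>i<n. F ((sh ^^ i) x) \<in> B i} x = ((\<Prod>i<n. indicator (B i) (F ((sh ^^ i) x))) :: ennreal)"
      proof (cases "\<forall>i<n. F ((sh ^^ i) x) \<in> B i")
        case False
        then obtain i where "i < n" "F ((sh ^^ i) x) \<notin> B i" by blast
        then have "(\<Prod>i<n. indicator (B i) (F ((sh ^^ i) x))) = (0 :: ennreal)"
          by (intro prod_zero bexI[of _ i]) auto
        with False show ?thesis by simp
      qed (use x in simp)
    qed
    also have "\<dots> = (\<Prod>i<n. emeasure \<eta> (B i))" by (rule prod) (rule B)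
    also have "\<dots> = (\<Prod>j\<in>J. emeasure \<eta> (B j))"
    proof (rule prod.mono_neutral_right)
      have "emeasure \<eta> (space N) = 1" using prob_space.emeasure_space_1[OF \<eta>] by (simp add: \<eta>_def)
      then show "\<forall>i\<in>{..<n} - J. emeasure \<eta> (B i) = 1" by (simp add: B_def)
    qed (use n in auto)
    finally show "emeasure (distr M (Pi\<^sub>M UNIV (\<lambda>_. N)) (\<lambda>x i. F ((sh ^^ i) x))) (prod_emb UNIV (\<lambda>_. \<eta>) J (Pi\<^sub>E J A)) =
       (\<Prod>j\<in>J. emeasure \<eta> (A j))" by (simp add: B_def)
  qed
  then show ?thesis
    by (intro iidI_distr_PiM(1)[OF _ \<eta>]) (auto simp: \<eta>_def)
qed

lemma (in prob_space) iid_compose_distr: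
  assumes X: "X \<in> M \<rightarrow>\<^sub>M S" and P: "prob_space P" "distr M S X = P" "sets P = sets S" and F: "iid P N F"
  shows "iid M N (\<lambda>i \<omega>. F i (X \<omega>))"
proof -
  interpret P: prob_space P by fact
  note [measurable] = X
  note [measurable_cong] = P(3)
  have [measurable]: "F i \<in> P \<rightarrow>\<^sub>M N" for i by (rule P.iid_measurable[OF F])
  have "distr M (Pi\<^sub>M UNIV (\<lambda>_. N)) (\<lambda>\<omega> i. F i (X \<omega>)) = distr (distr M S X) (Pi\<^sub>M UNIV (\<lambda>_. N)) (\<lambda>x i. F i x)"
    by (subst distr_distr) (auto simp: comp_def cong: measurable_cong_sets)
  also have "\<dots> = Pi\<^sub>M UNIV (\<lambda>_. distr P N (F 0))"
    unfolding P(2) by (rule P.iid_distr_PiM[OF F])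
  finally show ?thesis
    by (intro iidI_distr_PiM(1)[of _ _ "distr P N (F 0)"]) (auto intro: P.prob_space_distr)
qed

definition first_hit :: "(nat \<Rightarrow> real) \<Rightarrow> nat" where
  "first_hit x = (LEAST k. x k \<noteq> 0)"

definition hit_value :: "(nat \<Rightarrow> real) \<Rightarrow> real" where
  "hit_value x = x (first_hit x)"

definition after_hit :: "(nat \<Rightarrow> real) \<Rightarrow> nat \<Rightarrow> real" where
  "after_hit x = (\<lambda>j. x (Suc (first_hit x) + j))"

text \<open>A first nonzero term of index k is assigned the right end h (k + 1) of its cell, so a
  full cell width is counted even for k = 0.\<close>

definition hit_pair :: "real \<Rightarrow> (nat \<Rightarrow> real) \<Rightarrow> real \<times> real" where
  "hit_pair h x = (h * real (Suc (first_hit x)), hit_value x)"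

context
  fixes \<rho> :: "real measure"
  assumes \<rho>: "prob_space \<rho>" and \<rho>_sets [measurable_cong]: "sets \<rho> = sets borel"
begin

abbreviation (input) "hit_P \<equiv> Pi\<^sub>M UNIV (\<lambda>_::nat. \<rho>)"

lemma first_hit_measurable [measurable]: "first_hit \<in> hit_P \<rightarrow>\<^sub>M count_space UNIV"
  unfolding first_hit_def by measurable

lemma hit_value_measurable [measurable]: "hit_value \<in> borel_measurable hit_P"
  unfolding hit_value_def
  by (rule measurable_compose_countable[where f="\<lambda>i x. x i" and g=first_hit]) measurable

lemma after_hit_measurable [measurable]: "after_hit \<in> hit_P \<rightarrow>\<^sub>M hit_P"
  unfolding after_hit_def
proof (rule measurable_PiM_UNIV)
  fix j
  show "(\<lambda>x. x (Suc (first_hit x) + j)) \<in> hit_P \<rightarrow>\<^sub>M \<rho>"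
    by (rule measurable_compose_countable[where f="\<lambda>i x. x (Suc i + j)" and g=first_hit]) measurable
qed

text \<open>Each leading zero splits off a factor \<open>emeasure \<rho> {0}\<close>; at the first
  nonzero term the value and the remaining sequence are independent coordinates.\<close>

lemma nn_integral_hit_at:
  assumes f[measurable]: "f \<in> borel_measurable borel" and G[measurable]: "G \<in> borel_measurable hit_P"
  shows "(\<integral>\<^sup>+x. indicator {x. (\<forall>j<k. x j = 0) \<and> x k \<noteq> 0} x * (f (x k) * G (\<lambda>j. x (Suc k + j))) \<partial>hit_P) =
    emeasure \<rho> {0} ^ k * ((\<integral>\<^sup>+v. indicator (-{0}) v * f v \<partial>\<rho>) * (\<integral>\<^sup>+x. G x \<partial>hit_P))"
proof (induction k)
  case 0
  have "(\<integral>\<^sup>+x. indicator {x. x 0 \<noteq> 0} x * (f (x 0) * G (\<lambda>j. x (Suc 0 + j))) \<partial>hit_P) =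
    (\<integral>\<^sup>+v. \<integral>\<^sup>+x. (indicator (-{0}) v * f v) * G x \<partial>hit_P \<partial>\<rho>)"
    by (subst nn_integral_PiM_iter[OF \<rho>], measurable)
       (auto intro!: nn_integral_cong simp: indicator_def)
  also have "\<dots> = (\<integral>\<^sup>+v. indicator (-{0}) v * f v \<partial>\<rho>) * (\<integral>\<^sup>+x. G x \<partial>hit_P)"
    by (simp add: nn_integral_cmult nn_integral_multc)
  finally show ?case by simp
next
  case (Suc k)
  have "(\<integral>\<^sup>+x. indicator {x. (\<forall>j<Suc k. x j = 0) \<and> x (Suc k) \<noteq> 0} x * (f (x (Suc k)) * G (\<lambda>j. x (Suc (Suc k) + j))) \<partial>hit_P) =
    (\<integral>\<^sup>+v. \<integral>\<^sup>+x. indicator {0} v * (indicator {x. (\<forall>j<k. x j = 0) \<and> x k \<noteq> 0} x * (f (x k) * G (\<lambda>j. x (Suc k + j)))) \<partial>hit_P \<partial>\<rho>)"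
    by (subst nn_integral_PiM_iter[OF \<rho>], measurable)
       (auto intro!: nn_integral_cong simp: indicator_def All_less_Suc2)
  also have "\<dots> = (\<integral>\<^sup>+v. indicator {0} v * (emeasure \<rho> {0} ^ k * ((\<integral>\<^sup>+v. indicator (-{0}) v * f v \<partial>\<rho>) * (\<integral>\<^sup>+x. G x \<partial>hit_P))) \<partial>\<rho>)"
    by (subst nn_integral_cmult, measurable) (subst Suc.IH, rule refl)
  also have "\<dots> = emeasure \<rho> {0} ^ Suc k * ((\<integral>\<^sup>+v. indicator (-{0}) v * f v \<partial>\<rho>) * (\<integral>\<^sup>+x. G x \<partial>hit_P))"
    by (subst nn_integral_multc) (auto simp: mult.assoc)
  finally show ?case .
qed

lemma emeasure_no_hit:
  "emeasure hit_P {x\<in>space hit_P. \<forall>j<k. x j = 0} = emeasure \<rho> {0} ^ k"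
proof (induction k)
  case 0
  show ?case using prob_space.emeasure_space_1[OF prob_space_PiM, of UNIV "\<lambda>_. \<rho>"] \<rho> by simp
next
  case (Suc k)
  have "emeasure hit_P {x\<in>space hit_P. \<forall>j<Suc k. x j = 0} = (\<integral>\<^sup>+x. indicator {x\<in>space hit_P. \<forall>j<Suc k. x j = 0} x \<partial>hit_P)"
    by (subst nn_integral_indicator) auto
  also have "\<dots> = (\<integral>\<^sup>+v. \<integral>\<^sup>+x. indicator {0} v * indicator {x\<in>space hit_P. \<forall>j<k. x j = 0} x \<partial>hit_P \<partial>\<rho>)"
    by (subst nn_integral_PiM_iter[OF \<rho>], measurable)
       (auto intro!: nn_integral_cong simp: indicator_def All_less_Suc2 space_PiM PiE_iff split: nat.split)
  also have "\<dots> = emeasure \<rho> {0} * emeasure \<rho> {0} ^ k"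
    by (simp add: nn_integral_cmult nn_integral_multc Suc.IH)
  finally show ?case by simp
qed

context
  assumes not0: "emeasure \<rho> {0} < 1"
begin

lemma nn_integral_nonzero_value: "(\<integral>\<^sup>+v. indicator (-{0}) v \<partial>\<rho>) = 1 - emeasure \<rho> {0}"
proof -
  interpret prob_space \<rho> by (rule \<rho>)
  have "(\<integral>\<^sup>+v. indicator (-{0}) v \<partial>\<rho>) = emeasure \<rho> (space \<rho> - {0})"
    by (subst nn_integral_indicator) (auto simp: sets_eq_imp_space_eq[OF \<rho>_sets] Compl_eq_Diff_UNIV \<rho>_sets)
  also have "\<dots> = 1 - emeasure \<rho> {0}"
    by (subst emeasure_compl) (auto simp: emeasure_space_1 \<rho>_sets)
  finally show ?thesis .
qed

text \<open>The position of the first nonzero term has a geometric law; this is its total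
  mass.\<close>

lemma suminf_geometric_hit: "(\<Sum>k. emeasure \<rho> {0} ^ k) * (1 - emeasure \<rho> {0}) = 1"
proof -
  interpret prob_space \<rho> by (rule \<rho>)
  define q where "q = measure \<rho> {0}"
  have q: "emeasure \<rho> {0} = ennreal q" "0 \<le> q" "q < 1"
    using not0 by (auto simp: q_def emeasure_eq_measure)
  have "(\<Sum>k. ennreal (q ^ k)) = ennreal (1 / (1 - q))"
    by (rule suminf_ennreal_eq) (use q geometric_sums[of q] in auto)
  then have "(\<Sum>k. emeasure \<rho> {0} ^ k) = ennreal (1 / (1 - q))"
    using q by (simp add: ennreal_power)
  moreover have "1 - emeasure \<rho> {0} = ennreal (1 - q)" using q by (simp add: ennreal_minus[symmetric])
  ultimately show ?thesis using q by (simp add: ennreal_mult[symmetric])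
qed

text \<open>The first k terms all vanish with probability q^k, which tends to 0.\<close>

lemma AE_hit: "AE x in hit_P. \<exists>k. x k \<noteq> 0"
proof -
  interpret P: prob_space hit_P by (rule prob_space_PiM) (rule \<rho>)
  interpret R: prob_space \<rho> by (rule \<rho>)
  define q where "q = measure \<rho> {0}"
  have q: "emeasure \<rho> {0} = ennreal q" "0 \<le> q" "q < 1"
    using not0 by (auto simp: q_def R.emeasure_eq_measure)
  have "measure hit_P {x\<in>space hit_P. \<forall>k. x k = 0} \<le> q ^ k" for k
  proof -
    have "measure hit_P {x\<in>space hit_P. \<forall>k. x k = 0} \<le> measure hit_P {x\<in>space hit_P. \<forall>j<k. x j = 0}"
      by (intro P.finite_measure_mono) auto
    also have "\<dots> = q ^ k"
      using emeasure_no_hit[of k] q by (simp add: P.emeasure_eq_measure ennreal_power)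
    finally show ?thesis .
  qed
  moreover have "(\<lambda>k. q ^ k) \<longlonglongrightarrow> 0" using q by (intro LIMSEQ_realpow_zero) auto
  ultimately have "measure hit_P {x\<in>space hit_P. \<forall>k. x k = 0} \<le> 0"
    by (intro LIMSEQ_le_const[of "\<lambda>k. q ^ k"]) auto
  then have "{x\<in>space hit_P. \<forall>k. x k = 0} \<in> null_sets hit_P"
    by (simp add: P.emeasure_eq_measure null_sets_def measure_le_0_iff)
  then show ?thesis by (rule AE_I') auto
qed

text \<open>Summation over the position of the first nonzero term. Position and value may enter f
  jointly, while the remainder factors out completely; different choices of f and G yield both the
  regeneration and the independence of position and value.\<close>

lemma nn_integral_hit:
  assumes f[measurable]: "\<And>k. f k \<in> borel_measurable borel" and G[measurable]: "G \<in> borel_measurable hit_P"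
  shows "(\<integral>\<^sup>+x. f (first_hit x) (hit_value x) * G (after_hit x) \<partial>hit_P) =
    (\<Sum>k. emeasure \<rho> {0} ^ k * (\<integral>\<^sup>+v. indicator (-{0}) v * f k v \<partial>\<rho>)) * (\<integral>\<^sup>+x. G x \<partial>hit_P)"
proof -
  have "(\<integral>\<^sup>+x. f (first_hit x) (hit_value x) * G (after_hit x) \<partial>hit_P) =
    (\<integral>\<^sup>+x. (\<Sum>k. indicator {x. (\<forall>j<k. x j = 0) \<and> x k \<noteq> 0} x * (f k (x k) * G (\<lambda>j. x (Suc k + j)))) \<partial>hit_P)"
  proof (rule nn_integral_cong_AE, use AE_hit in eventually_elim)
    case (elim x)
    then have hit: "x (first_hit x) \<noteq> 0" unfolding first_hit_def by (rule LeastI_ex)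
    have before: "x j = 0" if "j < first_hit x" for j
      using not_less_Least[of j "\<lambda>k. x k \<noteq> 0"] that unfolding first_hit_def by auto
    have "(\<Sum>k. indicator {x. (\<forall>j<k. x j = 0) \<and> x k \<noteq> 0} x * (f k (x k) * G (\<lambda>j. x (Suc k + j)))) =
      (\<Sum>k\<in>{first_hit x}. indicator {x. (\<forall>j<k. x j = 0) \<and> x k \<noteq> 0} x * (f k (x k) * G (\<lambda>j. x (Suc k + j))))"
    proof (rule suminf_finite)
      fix k assume "k \<notin> {first_hit x}"
      then have "\<not> ((\<forall>j<k. x j = 0) \<and> x k \<noteq> 0)"
        using hit before by (metis linorder_neqE_nat singletonI)
      then show "indicator {x. (\<forall>j<k. x j = 0) \<and> x k \<noteq> 0} x * (f k (x k) * G (\<lambda>j. x (Suc k + j))) = 0" by simp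
    qed simp
    also have "\<dots> = f (first_hit x) (hit_value x) * G (after_hit x)"
      using hit before by (simp add: hit_value_def after_hit_def)
    finally show ?case by simp
  qed
  also have "\<dots> = (\<Sum>k. \<integral>\<^sup>+x. indicator {x. (\<forall>j<k. x j = 0) \<and> x k \<noteq> 0} x * (f k (x k) * G (\<lambda>j. x (Suc k + j))) \<partial>hit_P)"
    by (rule nn_integral_suminf) measurable
  also have "\<dots> = (\<Sum>k. emeasure \<rho> {0} ^ k * (\<integral>\<^sup>+v. indicator (-{0}) v * f k v \<partial>\<rho>) * (\<integral>\<^sup>+x. G x \<partial>hit_P))"
    by (subst nn_integral_hit_at) (auto simp: mult.assoc)
  also have "\<dots> = (\<Sum>k. emeasure \<rho> {0} ^ k * (\<integral>\<^sup>+v. indicator (-{0}) v * f k v \<partial>\<rho>)) * (\<integral>\<^sup>+x. G x \<partial>hit_P)"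
    by simp
  finally show ?thesis .
qed

lemma hit_pair_measurable [measurable]: "hit_pair h \<in> borel_measurable hit_P"
  unfolding hit_pair_def by measurable

text \<open>Behind the first hit a fresh copy of the sequence begins, independent of the pair
  observed so far.\<close>

lemma hit_pairs_iid: "iid hit_P borel (\<lambda>i x. hit_pair h ((after_hit ^^ i) x))"
proof -
  interpret P: prob_space hit_P by (rule prob_space_PiM) (rule \<rho>)
  show ?thesis
  proof (rule P.iid_of_shift)
    fix f :: "real \<times> real \<Rightarrow> ennreal" and g :: "(nat \<Rightarrow> real) \<Rightarrow> ennreal" assume [measurable]: "f \<in> borel_measurable borel" "g \<in> borel_measurable hit_P"
    have [measurable]: "f \<in> borel_measurable (borel \<Otimes>\<^sub>M borel)" by (simp add: borel_prod)
    have "(\<integral>\<^sup>+x. f (hit_pair h x) * g (after_hit x) \<partial>hit_P) =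
      (\<Sum>k. emeasure \<rho> {0} ^ k * (\<integral>\<^sup>+v. indicator (-{0}) v * f (h * real (Suc k), v) \<partial>\<rho>)) * (\<integral>\<^sup>+x. g x \<partial>hit_P)"
      using nn_integral_hit[of "\<lambda>k v. f (h * real (Suc k), v)" g] unfolding hit_pair_def by simp
    moreover have "(\<integral>\<^sup>+x. f (hit_pair h x) \<partial>hit_P) =
      (\<Sum>k. emeasure \<rho> {0} ^ k * (\<integral>\<^sup>+v. indicator (-{0}) v * f (h * real (Suc k), v) \<partial>\<rho>))"
      using nn_integral_hit[of "\<lambda>k v. f (h * real (Suc k), v)" "\<lambda>_. 1"] unfolding hit_pair_def
      by (simp add: P.emeasure_space_1)
    ultimately show "(\<integral>\<^sup>+x. f (hit_pair h x) * g (after_hit x) \<partial>hit_P) =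
      (\<integral>\<^sup>+x. f (hit_pair h x) \<partial>hit_P) * (\<integral>\<^sup>+x. g x \<partial>hit_P)" by simp
  qed measurable
qed

lemma hit_pair_distr:
  "distr hit_P (borel \<Otimes>\<^sub>M borel) (hit_pair h) =
    distr hit_P borel (\<lambda>x. fst (hit_pair h x)) \<Otimes>\<^sub>M distr hit_P borel (\<lambda>x. snd (hit_pair h x))"
proof -
  interpret P: prob_space hit_P by (rule prob_space_PiM) (rule \<rho>)
  have [measurable]: "(\<lambda>x. fst (hit_pair h x)) \<in> borel_measurable hit_P" "(\<lambda>x. snd (hit_pair h x)) \<in> borel_measurable hit_P"
    unfolding hit_pair_def by simp_all
  have "distr hit_P (borel \<Otimes>\<^sub>M borel) (\<lambda>x. (fst (hit_pair h x), snd (hit_pair h x))) =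
    distr hit_P borel (\<lambda>x. fst (hit_pair h x)) \<Otimes>\<^sub>M distr hit_P borel (\<lambda>x. snd (hit_pair h x))"
  proof (rule P.distr_Pair_eqI)
    fix A B :: "real set" assume [measurable]: "A \<in> sets borel" "B \<in> sets borel"
    let ?a = "\<Sum>k. emeasure \<rho> {0} ^ k * indicator A (h * real (Suc k))"
    let ?b = "\<integral>\<^sup>+v. indicator (-{0}) v * indicator B v \<partial>\<rho>"
    let ?s = "\<Sum>k. emeasure \<rho> {0} ^ k" and ?c = "1 - emeasure \<rho> {0}"
    have gen: "emeasure hit_P {x\<in>space hit_P. fst (hit_pair h x) \<in> A \<and> snd (hit_pair h x) \<in> B} =
        (\<Sum>k. emeasure \<rho> {0} ^ k * indicator A (h * real (Suc k))) * (\<integral>\<^sup>+v. indicator (-{0}) v * indicator B v \<partial>\<rho>)"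
      if [measurable]: "A \<in> sets borel" "B \<in> sets borel" for A B
    proof -
      have "emeasure hit_P {x\<in>space hit_P. fst (hit_pair h x) \<in> A \<and> snd (hit_pair h x) \<in> B} =
        (\<integral>\<^sup>+x. indicator {x\<in>space hit_P. fst (hit_pair h x) \<in> A \<and> snd (hit_pair h x) \<in> B} x \<partial>hit_P)"
        by (subst nn_integral_indicator) auto
      also have "\<dots> = (\<integral>\<^sup>+x. (indicator A (h * real (Suc (first_hit x))) * indicator B (hit_value x)) * 1 \<partial>hit_P)"
        by (rule nn_integral_cong) (auto simp: hit_pair_def indicator_def)
      also have "\<dots> = (\<Sum>k. emeasure \<rho> {0} ^ k * (\<integral>\<^sup>+v. indicator (-{0}) v * (indicator A (h * real (Suc k)) * indicator B v) \<partial>\<rho>))"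
        by (subst nn_integral_hit) (auto simp: P.emeasure_space_1)
      also have "\<dots> = (\<Sum>k. (emeasure \<rho> {0} ^ k * indicator A (h * real (Suc k))) * (\<integral>\<^sup>+v. indicator (-{0}) v * indicator B v \<partial>\<rho>))"
        by (simp add: nn_integral_cmult[symmetric] mult_ac)
      also have "\<dots> = (\<Sum>k. emeasure \<rho> {0} ^ k * indicator A (h * real (Suc k))) * (\<integral>\<^sup>+v. indicator (-{0}) v * indicator B v \<partial>\<rho>)"
        by simp
      finally show ?thesis .
    qed
    \<comment> \<open>Each marginal carries the normalising factor that the other variable leaves
      behind; the product of the two factors is 1, so the joint probability splits.\<close>
    have "emeasure hit_P {x\<in>space hit_P. fst (hit_pair h x) \<in> A} = ?a * ?c"
      using gen[of A UNIV] by (simp add: nn_integral_nonzero_value)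
    moreover have "emeasure hit_P {x\<in>space hit_P. snd (hit_pair h x) \<in> B} = ?s * ?b"
      using gen[of UNIV B] by simp
    moreover have "(?a * ?c) * (?s * ?b) = ?a * ?b * (?s * ?c)" by (simp only: mult_ac)
    ultimately show "emeasure hit_P {x\<in>space hit_P. fst (hit_pair h x) \<in> A \<and> snd (hit_pair h x) \<in> B} =
      emeasure hit_P {x\<in>space hit_P. fst (hit_pair h x) \<in> A} * emeasure hit_P {x\<in>space hit_P. snd (hit_pair h x) \<in> B}"
      using gen[of A B] by (simp add: suminf_geometric_hit)
  qed measurable
  then show ?thesis by simp
qed

end

end

section \<open>Jump times of a path\<close>

definition cell_index :: "real \<Rightarrow> real \<Rightarrow> nat" where
  "cell_index h s = nat (\<lceil>s / h\<rceil> - 1)"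

lemma mem_cell_iff:
  assumes "h > 0" "s > 0"
  shows "s \<in> cell h k \<longleftrightarrow> k = cell_index h s"
proof -
  have "s / h > 0" using assms by simp
  note b = grid_cell_bounds[OF this]
  have eq: "s \<in> cell h k \<longleftrightarrow> real k < s / h \<and> s / h \<le> real k + 1"
    using assms by (simp add: cell_def field_simps)
  show ?thesis unfolding eq cell_index_def using b grid_cell_unique[of k "s / h"] by metis
qed

lemma cell_index_bounds:
  assumes "h > 0" "s > 0"
  shows "h * real (cell_index h s) < s" "s \<le> h * real (Suc (cell_index h s))"
  using mem_cell_iff[OF assms, of "cell_index h s"] by (auto simp: cell_def)

definition sq_cells :: "(real \<Rightarrow> real) \<Rightarrow> real \<Rightarrow> nat \<Rightarrow> real" where
  "sq_cells f h k = (\<Sum>s\<in>jumps f \<inter> cell h k. (jump f s)\<^sup>2)"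

declare jump_time.simps(2) [simp del]

text \<open>Local finiteness makes the infimum in \<open>jump_time\<close> attained, and infinitely
  many jumps keep the set under it nonempty; together they make the jump times, from index 1 on, an
  increasing and unbounded enumeration of \<open>jumps f\<close>.\<close>

locale jump_path =
  fixes f :: "real \<Rightarrow> real"
  assumes finite_jumps: "\<And>t. finite (jumps f \<inter> {..t})" and infinite_jumps: "infinite (jumps f)"
begin

abbreviation "jt \<equiv> jump_time f"

text \<open>The infimum is a minimum: some jump v lies beyond t, and only finitely many jumps lie up
  to v.\<close>

lemma next_jump:
  assumes "t \<ge> 0"
  obtains u where "u \<in> jumps f" "t < u" "Inf {s. t < s \<and> jump f s \<noteq> 0} = u" "\<And>s. s \<in> jumps f \<Longrightarrow> t < s \<Longrightarrow> u \<le> s"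
proof -
  have "\<not> jumps f \<subseteq> jumps f \<inter> {..t}"
    using finite_jumps[of t] infinite_jumps infinite_super by blast
  then obtain v where v: "v \<in> jumps f" "t < v" by force
  let ?A = "jumps f \<inter> {..v} \<inter> {t<..}"
  have A: "finite ?A" "v \<in> ?A" using finite_jumps[of v] v by auto
  define u where "u = Min ?A"
  have uA: "u \<in> ?A" unfolding u_def using A by (intro Min_in) auto
  have le: "u \<le> s" if "s \<in> jumps f" "t < s" for s
  proof (cases "s \<le> v")
    case True
    then show ?thesis unfolding u_def using A that by (intro Min_le) auto
  next
    case False
    then show ?thesis using uA by auto
  qed
  moreover have "Inf {s. t < s \<and> jump f s \<noteq> 0} = u"
  proof (rule cInf_eq_minimum)
    show "u \<in> {s. t < s \<and> jump f s \<noteq> 0}" using uA by (auto simp: jumps_def)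
    show "u \<le> s" if "s \<in> {s. t < s \<and> jump f s \<noteq> 0}" for s
      using that assms by (intro le) (auto simp: jumps_def)
  qed
  ultimately show thesis using that[of u] uA by blast
qed

lemma jt_nonneg: "jt n \<ge> 0"
proof (induction n)
  case (Suc n)
  from next_jump[OF Suc] show ?case using Suc by (metis jump_time.simps(2) less_imp_le order_trans)
qed simp

lemma jt_Suc: "jt (Suc n) \<in> jumps f" "jt n < jt (Suc n)" "\<And>s. s \<in> jumps f \<Longrightarrow> jt n < s \<Longrightarrow> jt (Suc n) \<le> s"
proof -
  from next_jump[OF jt_nonneg[of n]] obtain u where u: "u \<in> jumps f" "jt n < u" "jt (Suc n) = u"
    "\<And>s. s \<in> jumps f \<Longrightarrow> jt n < s \<Longrightarrow> u \<le> s" by (metis jump_time.simps(2))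
  then show "jt (Suc n) \<in> jumps f" "jt n < jt (Suc n)" "\<And>s. s \<in> jumps f \<Longrightarrow> jt n < s \<Longrightarrow> jt (Suc n) \<le> s"
    by simp_all
qed

lemma jt_strict_mono: "strict_mono jt"
  using jt_Suc(2) by (rule strict_mono_Suc_iff[THEN iffD2, rule_format])

lemma jt_less_iff: "jt m < jt n \<longleftrightarrow> m < n" and jt_le_iff: "jt m \<le> jt n \<longleftrightarrow> m \<le> n"
  using jt_strict_mono by (simp_all add: strict_mono_less strict_mono_less_eq)

lemma jt_unbounded: "\<exists>n. t < jt n"
proof (rule ccontr)
  assume "\<not> ?thesis"
  then have "range (\<lambda>n. jt (Suc n)) \<subseteq> jumps f \<inter> {..t}" using jt_Suc(1) by (auto simp: not_less)
  moreover have "infinite (range (\<lambda>n. jt (Suc n)))"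
    by (rule range_inj_infinite) (auto intro!: injI simp: strict_mono_eq[OF jt_strict_mono])
  ultimately show False using finite_jumps finite_subset by blast
qed

lemma jt_bracket:
  assumes "t \<ge> 0"
  obtains n where "jt n \<le> t" "t < jt (Suc n)"
proof -
  define m where "m = (LEAST n. t < jt n)"
  have m: "t < jt m" unfolding m_def using jt_unbounded by (rule LeastI_ex)
  then have "m \<noteq> 0" using assms by (intro notI) auto
  then obtain n where n: "m = Suc n" by (cases m) auto
  have "\<not> t < jt n" using not_less_Least[of n "\<lambda>n. t < jt n"] n unfolding m_def by auto
  then show thesis using that[of n] m n by auto
qed

lemma jumps_upto:
  assumes "jt n \<le> t" "t < jt (Suc n)"
  shows "jumps f \<inter> {..t} = jt ` {1..n}"
proof safe
  fix s assume s: "s \<in> jumps f" "s \<le> t"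
  then have s0: "s > 0" by (auto simp: jumps_def)
  obtain m where m: "jt m \<le> s" "s < jt (Suc m)" using jt_bracket[of s] s0 by auto
  have "\<not> jt m < s" using jt_Suc(3)[OF s(1), of m] m(2) by (metis not_le)
  with m(1) have sm: "s = jt m" by (metis less_le)
  then have "m \<noteq> 0" using s0 by (intro notI) auto
  moreover have "jt m < jt (Suc n)" using sm s assms by auto
  ultimately show "s \<in> jt ` {1..n}" using sm jt_less_iff by auto
next
  fix i assume i: "i \<in> {1..n}"
  then obtain k where k: "i = Suc k" by (cases i) auto
  show "jt i \<in> jumps f" using jt_Suc(1)[of k] k by simp
  show "jt i \<le> t" using i assms jt_le_iff[of i n] by auto
qed

lemma jump_count_eq:
  assumes "jt n \<le> t" "t < jt (Suc n)"
  shows "jump_count f t = n"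
proof -
  have "jump_count f t = card (jumps f \<inter> {..t})"
    unfolding jump_count_def by (rule arg_cong[where f=card]) (auto simp: jumps_def)
  also have "\<dots> = n" unfolding jumps_upto[OF assms]
    by (subst card_image) (auto intro!: inj_onI simp: strict_mono_eq[OF jt_strict_mono])
  finally show ?thesis .
qed

lemma jump_count_bracket:
  assumes "t \<ge> 0"
  shows "jt (jump_count f t) \<le> t" "t < jt (Suc (jump_count f t))"
  using jt_bracket[OF assms] jump_count_eq by metis+

lemma disc_qv_eq_sum:
  assumes "t \<ge> 0"
  shows "disc_qv f t = (\<Sum>i=1..jump_count f t. (jump f (jt i))\<^sup>2)"
proof -
  note b = jump_count_bracket[OF assms]
  have "disc_qv f t = (\<Sum>\<^sub>\<infinity>s\<in>jumps f \<inter> {..t}. (jump f s)\<^sup>2)"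
    unfolding disc_qv_def by (rule infsum_cong_neutral) (auto simp: jumps_def)
  also have "\<dots> = (\<Sum>s\<in>jumps f \<inter> {..t}. (jump f s)\<^sup>2)"
    using finite_jumps by (rule infsum_finite)
  also have "\<dots> = (\<Sum>i=1..jump_count f t. (jump f (jt i))\<^sup>2)"
    unfolding jumps_upto[OF b]
    by (subst sum.reindex) (auto intro!: inj_onI simp: strict_mono_eq[OF jt_strict_mono])
  finally show ?thesis .
qed

text \<open>Index of the first grid point at or after the ith jump time; the time 0 is itself a grid
  point, hence the separate case.\<close>

definition cell_after :: "real \<Rightarrow> nat \<Rightarrow> nat" where
  "cell_after h i = (if i = 0 then 0 else Suc (cell_index h (jt i)))"

lemma cell_after_bounds:
  assumes "h > 0"
  shows "jt i \<le> h * real (cell_after h i)" "h * real (cell_after h i) \<le> jt i + h"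
proof -
  have "jt i \<le> h * real (cell_after h i) \<and> h * real (cell_after h i) \<le> jt i + h"
  proof (cases "i = 0")
    case False
    then obtain k where "i = Suc k" by (cases i) auto
    then have "jt i > 0" using jt_Suc(1)[of k] by (simp add: jumps_def)
    note c = cell_index_bounds[OF assms this]
    show ?thesis using c False by (simp add: cell_after_def algebra_simps)
  qed (use assms in \<open>simp add: cell_after_def\<close>)
  then show "jt i \<le> h * real (cell_after h i)" "h * real (cell_after h i) \<le> jt i + h" by auto
qed

lemma sq_cells_nonzero_iff: "h > 0 \<Longrightarrow> sq_cells f h k \<noteq> 0 \<longleftrightarrow> jumps f \<inter> cell h k \<noteq> {}"
proof -
  have "finite (jumps f \<inter> cell h k)"
    by (rule finite_subset[OF _ finite_jumps[of "h * real (Suc k)"]]) (auto simp: cell_def)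
  then show ?thesis unfolding sq_cells_def
    by (subst sum_nonneg_eq_0_iff) (auto simp: jumps_def)
qed

text \<open>When the mesh is smaller than the gaps, every cell visited holds at most one jump, so
  walking from one nonzero cell sum to the next enumerates the jumps in order. The bound extends to
  the gap behind jump i + 1, since otherwise the cell of that jump could contain the following one
  too.\<close>

lemma hits:
  assumes h: "h > 0" and gap: "\<And>k. k \<le> Suc i \<Longrightarrow> h < jt (Suc k) - jt k"
  shows "(after_hit ^^ i) (sq_cells f h) = (\<lambda>j. sq_cells f h (cell_after h i + j))"
    and "cell_after h i + Suc (first_hit ((after_hit ^^ i) (sq_cells f h))) = cell_after h (Suc i)"
    and "hit_value ((after_hit ^^ i) (sq_cells f h)) = (jump f (jt (Suc i)))\<^sup>2"
proof -
  have one: "cell_after h i + Suc (first_hit (\<lambda>j. sq_cells f h (cell_after h i + j))) = cell_after h (Suc i) \<and>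
    hit_value (\<lambda>j. sq_cells f h (cell_after h i + j)) = (jump f (jt (Suc i)))\<^sup>2"
    if gap: "\<And>k. k \<le> Suc i \<Longrightarrow> h < jt (Suc k) - jt k" for i
  proof -
    let ?c = "cell_after h i" and ?d = "cell_index h (jt (Suc i))"
    have pos: "jt (Suc i) > 0" using jt_Suc(1)[of i] by (simp add: jumps_def)
    note d = cell_index_bounds[OF h pos]
    \<comment> \<open>The next jump lies more than one mesh width beyond the previous one, hence in
      a cell that the restarted sequence still sees.\<close>
    have "h * real ?c \<le> jt i + h" by (rule cell_after_bounds[OF h])
    also have "\<dots> < jt (Suc i)" using gap[of i] by simp
    also have "\<dots> \<le> h * real (Suc ?d)" by (rule d)
    finally have cd: "?c \<le> ?d" using h by (simp add: less_Suc_eq_le)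
    have dJ: "jumps f \<inter> cell h ?d = {jt (Suc i)}"
    proof safe
      show "jt (Suc i) \<in> jumps f" by (rule jt_Suc)
      show "jt (Suc i) \<in> cell h ?d" using mem_cell_iff[OF h pos] by simp
      fix s assume s: "s \<in> jumps f" "s \<in> cell h ?d"
      have "jt i \<le> h * real ?c" by (rule cell_after_bounds[OF h])
      also have "\<dots> \<le> h * real ?d" using cd h by simp
      also have "\<dots> < s" using s by (simp add: cell_def)
      finally have ge: "jt (Suc i) \<le> s" by (rule jt_Suc(3)[OF s(1)])
      have "\<not> jt (Suc i) < s"
      proof
        assume "jt (Suc i) < s"
        then have "jt (Suc (Suc i)) \<le> s" by (rule jt_Suc(3)[OF s(1)])
        also have "s \<le> h * real ?d + h" using s by (simp add: cell_def algebra_simps)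
        also have "\<dots> < jt (Suc i) + h" using d by simp
        finally show False using gap[of "Suc i"] by simp
      qed
      then show "s = jt (Suc i)" using ge by simp
    qed
    have nz: "sq_cells f h ?d \<noteq> 0" using sq_cells_nonzero_iff[OF h] dJ by simp
    have z: "sq_cells f h k = 0" if k: "?c \<le> k" "k < ?d" for k
    proof (rule ccontr)
      assume "sq_cells f h k \<noteq> 0"
      then obtain s where s: "s \<in> jumps f" "s \<in> cell h k" using sq_cells_nonzero_iff[OF h] by auto
      have "jt i \<le> h * real ?c" by (rule cell_after_bounds[OF h])
      also have "\<dots> \<le> h * real k" using k h by simp
      also have "\<dots> < s" using s by (simp add: cell_def)
      finally have "jt (Suc i) \<le> s" by (rule jt_Suc(3)[OF s(1)])
      also have "s \<le> h * real (Suc k)" using s by (simp add: cell_def)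
      also have "\<dots> \<le> h * real ?d" using k h by (intro mult_left_mono) auto
      finally show False using d by simp
    qed
    have fh: "first_hit (\<lambda>j. sq_cells f h (?c + j)) = ?d - ?c"
      unfolding first_hit_def
    proof (rule Least_equality)
      show "sq_cells f h (?c + (?d - ?c)) \<noteq> 0" using nz cd by simp
      show "?d - ?c \<le> j" if "sq_cells f h (?c + j) \<noteq> 0" for j
        using z[of "?c + j"] that by (cases "?c + j < ?d") auto
    qed
    have "hit_value (\<lambda>j. sq_cells f h (?c + j)) = sq_cells f h ?d"
      unfolding hit_value_def fh using cd by simp
    also have "\<dots> = (jump f (jt (Suc i)))\<^sup>2" unfolding sq_cells_def dJ by simp
    finally show ?thesis using fh cd by (simp add: cell_after_def[of h "Suc i"])
  qed
  have "(after_hit ^^ i) (sq_cells f h) = (\<lambda>j. sq_cells f h (cell_after h i + j))"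
    using gap
  proof (induction i)
    case 0
    then show ?case by (simp add: cell_after_def)
  next
    case (Suc i)
    have IH: "(after_hit ^^ i) (sq_cells f h) = (\<lambda>j. sq_cells f h (cell_after h i + j))"
      using Suc.prems by (intro Suc.IH) auto
    have "cell_after h i + Suc (first_hit (\<lambda>j. sq_cells f h (cell_after h i + j))) = cell_after h (Suc i)"
      using one[of i] Suc.prems by auto
    then have "cell_after h i + (Suc (first_hit (\<lambda>j. sq_cells f h (cell_after h i + j))) + j) = cell_after h (Suc i) + j" for j
      by simp
    then have "after_hit (\<lambda>j. sq_cells f h (cell_after h i + j)) = (\<lambda>j. sq_cells f h (cell_after h (Suc i) + j))"
      unfolding after_hit_def by presburger
    then show ?case by (simp add: IH)
  qed
  then show "(after_hit ^^ i) (sq_cells f h) = (\<lambda>j. sq_cells f h (cell_after h i + j))"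
    "cell_after h i + Suc (first_hit ((after_hit ^^ i) (sq_cells f h))) = cell_after h (Suc i)"
    "hit_value ((after_hit ^^ i) (sq_cells f h)) = (jump f (jt (Suc i)))\<^sup>2"
    using one[of i] gap by auto
qed

text \<open>Eventually the hit pairs are differences of jump times rounded up to the grid, together
  with the exact squared jumps.\<close>

lemma hit_pair_tendsto:
  assumes h: "h \<longlonglongrightarrow> 0" "\<And>n. h n > 0"
  shows "(\<lambda>n. hit_pair (h n) ((after_hit ^^ i) (sq_cells f (h n)))) \<longlonglongrightarrow>
    (jt (Suc i) - jt i, (jump f (jt (Suc i)))\<^sup>2)"
proof -
  have "eventually (\<lambda>n. \<forall>k\<in>{..Suc i}. h n < jt (Suc k) - jt k) sequentially"
    by (subst eventually_ball_finite_distrib) (use order_tendstoD(2)[OF h(1)] jt_Suc(2) in auto)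
  then have ev: "eventually (\<lambda>n. (h n * real (cell_after (h n) (Suc i)) - h n * real (cell_after (h n) i), (jump f (jt (Suc i)))\<^sup>2) =
      hit_pair (h n) ((after_hit ^^ i) (sq_cells f (h n)))) sequentially"
  proof eventually_elim
    case (elim n)
    have "real (cell_after (h n) (Suc i)) = real (cell_after (h n) i) + real (Suc (first_hit ((after_hit ^^ i) (sq_cells f (h n)))))"
      using hits(2)[OF h(2), of i n] elim by (metis atMost_iff of_nat_add)
    moreover have "hit_value ((after_hit ^^ i) (sq_cells f (h n))) = (jump f (jt (Suc i)))\<^sup>2"
      using hits(3)[OF h(2), of i n] elim by auto
    ultimately show ?case by (simp add: hit_pair_def algebra_simps)
  qed
  have lim: "(\<lambda>n. h n * real (cell_after (h n) i)) \<longlonglongrightarrow> jt i" for i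
  proof (rule tendsto_sandwich[of "\<lambda>_. jt i" _ _ "\<lambda>n. jt i + h n"])
    show "(\<lambda>n. jt i + h n) \<longlonglongrightarrow> jt i" using tendsto_add[OF tendsto_const h(1), of "jt i"] by simp
  qed (use cell_after_bounds[OF h(2)] in auto)
  have "(\<lambda>n. (h n * real (cell_after (h n) (Suc i)) - h n * real (cell_after (h n) i), (jump f (jt (Suc i)))\<^sup>2))
     \<longlonglongrightarrow> (jt (Suc i) - jt i, (jump f (jt (Suc i)))\<^sup>2)"
    by (intro tendsto_intros lim)
  from Lim_transform_eventually[OF this ev] show ?thesis .
qed

text \<open>Exact for every mesh and not only in the limit, which gives the tail of the first
  waiting time at grid points; the strict inequality matches cells closed on the right.\<close>

lemma no_early_jump_iff:
  assumes "h > 0"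
  shows "(\<forall>j<k. sq_cells f h j = 0) \<longleftrightarrow> h * real k < jt (Suc 0)"
proof
  have pos: "jt (Suc 0) > 0" using jt_Suc(1)[of 0] by (simp add: jumps_def)
  assume z: "\<forall>j<k. sq_cells f h j = 0"
  have "jt (Suc 0) \<in> jumps f \<inter> cell h (cell_index h (jt (Suc 0)))"
    using mem_cell_iff[OF assms pos] jt_Suc(1)[of 0] by auto
  then have "sq_cells f h (cell_index h (jt (Suc 0))) \<noteq> 0"
    using sq_cells_nonzero_iff[OF assms] by blast
  then have "k \<le> cell_index h (jt (Suc 0))" using z by (meson not_le)
  then have "h * real k \<le> h * real (cell_index h (jt (Suc 0)))" using assms by simp
  also have "\<dots> < jt (Suc 0)" by (rule cell_index_bounds[OF assms pos])
  finally show "h * real k < jt (Suc 0)" .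
next
  assume lt: "h * real k < jt (Suc 0)"
  show "\<forall>j<k. sq_cells f h j = 0"
  proof (intro allI impI, rule ccontr)
    fix j assume j: "j < k" "sq_cells f h j \<noteq> 0"
    then obtain s where s: "s \<in> jumps f" "s \<in> cell h j" using sq_cells_nonzero_iff[OF assms] by auto
    have "jt (Suc 0) \<le> s" using s by (intro jt_Suc(3)) (auto simp: jumps_def)
    also have "s \<le> h * real (Suc j)" using s by (simp add: cell_def)
    also have "\<dots> \<le> h * real k" using j assms by (intro mult_left_mono) auto
    finally show False using lt by simp
  qed
qed

end

section \<open>Jump times and marks of a Levy process\<close>

lemma (in prob_space) iid_shift:
  assumes iid: "iid M N X"
  shows "iid M N (\<lambda>i. X (K + i))"
proof -
  have [measurable]: "X i \<in> M \<rightarrow>\<^sub>M N" for i by (rule iid_measurable[OF iid])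
  define \<rho> where "\<rho> = distr M N (X 0)"
  have \<rho>: "prob_space \<rho>" unfolding \<rho>_def by (rule prob_space_distr) simp
  have [measurable_cong]: "sets \<rho> = sets N" by (simp add: \<rho>_def)
  have "distr M (Pi\<^sub>M UNIV (\<lambda>_. N)) (\<lambda>\<omega> i. X (K + i) \<omega>) =
    distr (distr M (Pi\<^sub>M UNIV (\<lambda>_. N)) (\<lambda>\<omega> i. X i \<omega>)) (Pi\<^sub>M UNIV (\<lambda>_. N)) (\<lambda>x i. x (K + i))"
    by (subst distr_distr) (auto simp: comp_def)
  also have "\<dots> = distr (Pi\<^sub>M UNIV (\<lambda>_. \<rho>)) (Pi\<^sub>M UNIV (\<lambda>_. \<rho>)) (\<lambda>x. \<lambda>n\<in>UNIV. x (K + n))"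
    unfolding iid_distr_PiM[OF iid] \<rho>_def[symmetric] by (intro distr_cong) (auto cong: sets_PiM_cong simp: \<rho>_def)
  also have "\<dots> = Pi\<^sub>M UNIV (\<lambda>_. \<rho>)"
    by (rule distr_PiM_reindex) (use \<rho> in auto)
  finally show ?thesis by (intro iidI_distr_PiM(1)[OF _ \<rho>]) (auto simp: \<rho>_def)
qed

locale levy_finite = prob_space M for M :: "'w measure" +
  fixes L :: "real \<Rightarrow> 'w \<Rightarrow> real" and \<nu> :: "real measure" and T Z :: "nat \<Rightarrow> 'w \<Rightarrow> real"
  assumes levy: "levy_process M L" and levy_measure: "has_levy_measure M L \<nu>"
    and \<nu>_nonzero: "emeasure \<nu> UNIV \<noteq> 0" and \<nu>_finite: "emeasure \<nu> UNIV < \<infinity>"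
    and T_measurable [measurable]: "\<And>i. T i \<in> borel_measurable M"
    and Z_measurable [measurable]: "\<And>i. Z i \<in> borel_measurable M"
    and T_eq: "AE \<omega> in M. \<forall>i\<ge>1. T i \<omega> = jump_time (\<lambda>s. L s \<omega>) i - jump_time (\<lambda>s. L s \<omega>) (i - 1)"
    and Z_eq: "AE \<omega> in M. \<forall>i\<ge>1. Z i \<omega> = (jump (\<lambda>s. L s \<omega>) (jump_time (\<lambda>s. L s \<omega>) i))\<^sup>2"
begin

abbreviation path :: "'w \<Rightarrow> real \<Rightarrow> real" where
  "path \<omega> \<equiv> (\<lambda>t. L t \<omega>)"

lemma AE_cadlag: "AE \<omega> in M. cadlag (path \<omega>)"
  using levy unfolding levy_process_def by auto

abbreviation X :: "real \<Rightarrow> nat \<Rightarrow> 'w \<Rightarrow> real" where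
  "X h k \<omega> \<equiv> sq_cell h k (path \<omega>)"

lemma X_iid: "h > 0 \<Longrightarrow> iid M borel (X h)"
  using sq_cell_iid[OF prob_space_axioms levy levy_measure \<nu>_finite] .

lemma X_measurable: "h > 0 \<Longrightarrow> X h k \<in> borel_measurable M"
  using iid_measurable[OF X_iid] .

lemma AE_X: "AE \<omega> in M. \<forall>h>0. (\<lambda>k. X h k \<omega>) = sq_cells (path \<omega>) h"
  using AE_cadlag AE_finite_jumps[OF prob_space_axioms levy levy_measure \<nu>_finite]
proof eventually_elim
  case (elim \<omega>)
  then show ?case using sq_cell_cadlag(2)[of "path \<omega>"] by (auto simp: sq_cells_def)
qed

definition cell_law :: "real \<Rightarrow> real measure" where
  "cell_law h = distr M borel (X h 0)"

lemma cell_law: "h > 0 \<Longrightarrow> prob_space (cell_law h)" "sets (cell_law h) = sets borel"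
  unfolding cell_law_def using X_measurable by (auto intro: prob_space_distr)

lemma X_distr: "h > 0 \<Longrightarrow> distr M (Pi\<^sub>M UNIV (\<lambda>_. borel)) (\<lambda>\<omega> k. X h k \<omega>) = Pi\<^sub>M UNIV (\<lambda>_. cell_law h)"
  unfolding cell_law_def by (rule iid_distr_PiM[OF X_iid])

lemma X_seq_measurable: "h > 0 \<Longrightarrow> (\<lambda>\<omega> k. X h k \<omega>) \<in> M \<rightarrow>\<^sub>M Pi\<^sub>M UNIV (\<lambda>_. borel)"
  by (intro measurable_PiM_UNIV X_measurable)

lemma emeasure_cell_law_0: "h > 0 \<Longrightarrow> emeasure (cell_law h) {0} = emeasure M {\<omega>\<in>space M. X h 0 \<omega> = 0}"
  unfolding cell_law_def using X_measurable[of h 0]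
  by (subst emeasure_distr) (auto intro!: arg_cong[where f="emeasure M"])

text \<open>If the first unit cell almost surely had sum zero, there would almost surely be no jump
  in (0, 1], and the Levy measure would vanish.\<close>

lemma cell_law_1_not0: "emeasure (cell_law 1) {0} < 1"
proof (rule ccontr)
  assume "\<not> ?thesis"
  then have "emeasure M {\<omega>\<in>space M. X 1 0 \<omega> = 0} = 1"
    using emeasure_cell_law_0[of 1] emeasure_le_1 by (simp add: order.antisym not_less)
  then have "prob {\<omega>\<in>space M. X 1 0 \<omega> = 0} = 1" by (simp add: emeasure_eq_measure)
  then have "AE \<omega> in M. X 1 0 \<omega> = 0"
    using X_measurable[of 1 0] by (subst (asm) prob_Collect_eq_1) auto
  with AE_X AE_finite_jumps[OF prob_space_axioms levy levy_measure \<nu>_finite]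
  have AE0: "AE \<omega> in M. emeasure (count_space UNIV) {s \<in> {0<..1}. jump (path \<omega>) s \<noteq> 0 \<and> jump (path \<omega>) s \<in> UNIV} = 0"
  proof eventually_elim
    case (elim \<omega>)
    then have "X 1 0 \<omega> = sq_cells (path \<omega>) 1 0" by (metis zero_less_one)
    then have "sq_cells (path \<omega>) 1 0 = 0" using elim by simp
    moreover have "finite (jumps (path \<omega>) \<inter> cell 1 0)"
      by (rule finite_subset[of _ "jumps (path \<omega>) \<inter> {..1}"]) (use elim in \<open>auto simp: cell_def\<close>)
    ultimately have "jumps (path \<omega>) \<inter> cell 1 0 = {}"
      unfolding sq_cells_def by (subst (asm) sum_nonneg_eq_0_iff) (auto simp: jumps_def)
    then have "{s \<in> {0<..1}. jump (path \<omega>) s \<noteq> 0 \<and> jump (path \<omega>) s \<in> UNIV} = {}"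
      by (auto simp: jumps_def cell_def)
    then show ?case by (simp only: emeasure_empty)
  qed
  have "emeasure \<nu> UNIV = (\<integral>\<^sup>+\<omega>. emeasure (count_space UNIV)
           {s \<in> {0<..1}. jump (path \<omega>) s \<noteq> 0 \<and> jump (path \<omega>) s \<in> UNIV} \<partial>M)"
    by (rule bspec[OF conjunct2[OF levy_measure[unfolded has_levy_measure_def]]]) simp
  also have "\<dots> = (\<integral>\<^sup>+\<omega>. 0 \<partial>M)" using AE0 by (rule nn_integral_cong_AE)
  finally show False using \<nu>_nonzero by simp
qed

text \<open>Beyond any index the shifted i.i.d. sequence of unit cells again has a nonzero term, so
  the jumps cannot stop.\<close>

lemma AE_jump_path: "AE \<omega> in M. jump_path (path \<omega>)"
proof -
  have "AE \<omega> in M. \<exists>k. X 1 (K + k) \<omega> \<noteq> 0" for K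
  proof -
    have iid: "iid M borel (\<lambda>k. X 1 (K + k))" by (rule iid_shift[OF X_iid]) simp
    have d: "distr M (Pi\<^sub>M UNIV (\<lambda>_. borel)) (\<lambda>\<omega> k. X 1 (K + k) \<omega>) = Pi\<^sub>M UNIV (\<lambda>_. cell_law 1)"
    proof -
      have "distr M borel (X 1 (K + 0)) = cell_law 1"
        using X_iid[of 1] unfolding iid_def cell_law_def by simp
      then show ?thesis using iid_distr_PiM[OF iid] by simp
    qed
    have "AE x in Pi\<^sub>M UNIV (\<lambda>_::nat. cell_law 1). \<exists>k. x k \<noteq> 0"
      by (rule AE_hit) (use cell_law cell_law_1_not0 in auto)
    then have "AE x in distr M (Pi\<^sub>M UNIV (\<lambda>_. borel)) (\<lambda>\<omega> k. X 1 (K + k) \<omega>). \<exists>k. x k \<noteq> 0"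
      unfolding d .
    then show ?thesis
      by (subst (asm) AE_distr_iff) (use X_measurable[of 1] in \<open>auto intro!: measurable_PiM_UNIV\<close>)
  qed
  then have "AE \<omega> in M. \<forall>K. \<exists>k. X 1 (K + k) \<omega> \<noteq> 0" by (simp add: AE_all_countable)
  with AE_X AE_finite_jumps[OF prob_space_axioms levy levy_measure \<nu>_finite] show ?thesis
  proof eventually_elim
    case (elim \<omega>)
    have "infinite (jumps (path \<omega>))"
    proof
      assume fin: "finite (jumps (path \<omega>))"
      obtain b where b: "\<And>s. s \<in> jumps (path \<omega>) \<Longrightarrow> s \<le> b"
        using bdd_above_finite[OF fin] by (auto simp: bdd_above_def)
      obtain K :: nat where K: "b < real K" using reals_Archimedean2 by blast
      obtain k where k: "X 1 (K + k) \<omega> \<noteq> 0" using elim by blast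
      have "X 1 (K + k) \<omega> = sq_cells (path \<omega>) 1 (K + k)" using elim by (metis zero_less_one)
      then have "jumps (path \<omega>) \<inter> cell 1 (K + k) \<noteq> {}" using k by (auto simp: sq_cells_def)
      then obtain s where "s \<in> jumps (path \<omega>)" "real (K + k) < s" by (auto simp: cell_def)
      then show False using b[of s] K by simp
    qed
    then show ?case using elim by (simp add: jump_path_def)
  qed
qed

text \<open>An event of full probability on which later arguments are deterministic; the cell
  identity holds for all mesh widths at once, so h may be chosen after \<omega>.\<close>

definition good :: "'w \<Rightarrow> bool" where
  "good \<omega> \<longleftrightarrow> cadlag (path \<omega>) \<and> jump_path (path \<omega>) \<and>
    (\<forall>h>0. (\<lambda>k. X h k \<omega>) = sq_cells (path \<omega>) h) \<and>
    (\<forall>i. T (Suc i) \<omega> = jump_time (path \<omega>) (Suc i) - jump_time (path \<omega>) i) \<and>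
    (\<forall>i. Z (Suc i) \<omega> = (jump (path \<omega>) (jump_time (path \<omega>) (Suc i)))\<^sup>2)"

lemma AE_good: "AE \<omega> in M. good \<omega>"
  using AE_cadlag AE_jump_path AE_X T_eq Z_eq
proof eventually_elim
  case (elim \<omega>)
  have "T (Suc i) \<omega> = jump_time (path \<omega>) (Suc i) - jump_time (path \<omega>) i" for i
    using elim(4) by (metis One_nat_def Suc_le_mono diff_Suc_1 zero_le)
  moreover have "Z (Suc i) \<omega> = (jump (path \<omega>) (jump_time (path \<omega>) (Suc i)))\<^sup>2" for i
    using elim(5) by (metis One_nat_def Suc_le_mono zero_le)
  ultimately show ?case using elim unfolding good_def by blast
qed

lemma good_Gamma: "good \<omega> \<Longrightarrow> (\<Sum>i=1..n. T i \<omega>) = jump_time (path \<omega>) n"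
  by (induction n) (auto simp: good_def)

lemma good_T_pos: "good \<omega> \<Longrightarrow> T (Suc i) \<omega> > 0"
  using jump_path.jt_Suc(2)[of "path \<omega>" i] by (auto simp: good_def)

lemma good_Z_pos: "good \<omega> \<Longrightarrow> Z (Suc i) \<omega> > 0"
  using jump_path.jt_Suc(1)[of "path \<omega>" i] by (auto simp: good_def jumps_def)

lemma good_count:
  assumes "good \<omega>"
  shows "(\<Sum>i=1..n. T i \<omega>) \<le> t \<Longrightarrow> t < (\<Sum>i=1..Suc n. T i \<omega>) \<Longrightarrow> jump_count (path \<omega>) t = n"
    "t \<ge> 0 \<Longrightarrow> (\<Sum>i=1..jump_count (path \<omega>) t. T i \<omega>) \<le> t"
    "t \<ge> 0 \<Longrightarrow> t < (\<Sum>i=1..Suc (jump_count (path \<omega>) t). T i \<omega>)"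
  unfolding good_Gamma[OF assms]
  using assms jump_path.jump_count_eq jump_path.jump_count_bracket unfolding good_def by auto

section \<open>Exponential law of the first waiting time\<close>

lemma T_tail_power: 
  assumes h: "h > 0"
  shows "emeasure M {\<omega>\<in>space M. h * real k < T 1 \<omega>} = emeasure (cell_law h) {0} ^ k"
proof -
  note [measurable] = X_seq_measurable[OF h] X_measurable[OF h]
  have meas: "{x\<in>space (Pi\<^sub>M UNIV (\<lambda>_::nat. borel :: real measure)). \<forall>j<k. x j = 0} \<in> sets (Pi\<^sub>M UNIV (\<lambda>_. borel))"
    by measurable
  have "emeasure (cell_law h) {0} ^ k = emeasure (Pi\<^sub>M UNIV (\<lambda>_. cell_law h)) {x\<in>space (Pi\<^sub>M UNIV (\<lambda>_::nat. cell_law h)). \<forall>j<k. x j = 0}"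
    by (rule emeasure_no_hit[symmetric]) (use cell_law h in auto)
  also have "\<dots> = emeasure (distr M (Pi\<^sub>M UNIV (\<lambda>_. borel)) (\<lambda>\<omega> k. X h k \<omega>)) {x\<in>space (Pi\<^sub>M UNIV (\<lambda>_::nat. borel)). \<forall>j<k. x j = 0}"
    unfolding X_distr[OF h] by (simp add: space_PiM cell_law_def)
  also have "\<dots> = emeasure M {\<omega>\<in>space M. \<forall>j<k. X h j \<omega> = 0}"
    by (subst emeasure_distr[OF _ meas]) (auto simp: space_PiM intro!: arg_cong[where f="emeasure M"])
  also have "\<dots> = emeasure M {\<omega>\<in>space M. h * real k < T 1 \<omega>}"
  proof (rule emeasure_eq_AE)
    show "AE \<omega> in M. \<omega> \<in> {\<omega>\<in>space M. \<forall>j<k. X h j \<omega> = 0} \<longleftrightarrow> \<omega> \<in> {\<omega>\<in>space M. h * real k < T 1 \<omega>}"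
      using AE_good
    proof eventually_elim
      case (elim \<omega>)
      have "X h j \<omega> = sq_cells (path \<omega>) h j" for j using elim h unfolding good_def by metis
      moreover have "T 1 \<omega> = jump_time (path \<omega>) (Suc 0)" using elim unfolding good_def by (metis One_nat_def diff_zero jump_time.simps(1))
      ultimately show ?case
        using jump_path.no_early_jump_iff[of "path \<omega>" h k] elim h unfolding good_def by simp
    qed
  qed auto
  finally show ?thesis by simp
qed

text \<open>Read off from the tail at time 1, because only probabilities at grid times are known at
  this stage. That it is the mass of \<nu> follows from \<open>levy_measure_sq\<close> with the
  whole line.\<close>

definition rate :: real where
  "rate = - ln (prob {\<omega>\<in>space M. 1 < T 1 \<omega>})"

lemma cell_law_power: "m > 0 \<Longrightarrow> emeasure (cell_law (1 / real m)) {0} ^ m = emeasure M {\<omega>\<in>space M. 1 < T 1 \<omega>}"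
  using T_tail_power[of "1 / real m" m] by simp

lemma cell_law_not0: "m > 0 \<Longrightarrow> emeasure (cell_law (1 / real m)) {0} < 1"
proof (rule ccontr)
  assume m: "m > 0" "\<not> emeasure (cell_law (1 / real m)) {0} < 1"
  interpret C: prob_space "cell_law (1 / real m)" by (rule cell_law) (use m in simp)
  have "emeasure (cell_law (1 / real m)) {0} = 1" using m C.emeasure_le_1 by (simp add: order.antisym not_less)
  then show False using cell_law_power[OF m(1)] cell_law_power[of 1] cell_law_1_not0 by simp
qed

lemma T_tail_1: "0 < prob {\<omega>\<in>space M. 1 < T 1 \<omega>}" "prob {\<omega>\<in>space M. 1 < T 1 \<omega>} < 1"
proof -
  show "prob {\<omega>\<in>space M. 1 < T 1 \<omega>} < 1"
    using cell_law_power[of 1] cell_law_1_not0 by (simp add: emeasure_eq_measure)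
  \<comment> \<open>If the tail at 1 were zero, so would be its m-th root, the tail at 1 / m, for
    every m; but the first waiting time is positive.\<close>
  show "0 < prob {\<omega>\<in>space M. 1 < T 1 \<omega>}"
  proof (rule ccontr)
    assume "\<not> ?thesis"
    then have z: "emeasure M {\<omega>\<in>space M. 1 < T 1 \<omega>} = 0" by (simp add: emeasure_eq_measure zero_less_measure_iff)
    have "AE \<omega> in M. \<not> 1 / real (Suc m) < T 1 \<omega>" for m
    proof -
      have "emeasure (cell_law (1 / real (Suc m))) {0} ^ Suc m = 0" using cell_law_power[of "Suc m"] z by simp
      then have "emeasure (cell_law (1 / real (Suc m))) {0} = 0" by auto
      then have "emeasure M {\<omega>\<in>space M. 1 / real (Suc m) < T 1 \<omega>} = 0" using T_tail_power[of "1 / real (Suc m)" 1] by simp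
      then show ?thesis by (subst AE_iff_null) (auto simp: null_sets_def)
    qed
    then have "AE \<omega> in M. \<forall>m. \<not> 1 / real (Suc m) < T 1 \<omega>" by (simp add: AE_all_countable)
    with AE_good have "AE \<omega> in M. False"
    proof eventually_elim
      case (elim \<omega>)
      have "T 1 \<omega> > 0" using good_T_pos[of \<omega> 0] elim by simp
      then obtain m where "1 / real (Suc m) < T 1 \<omega>" by (metis nat_approx_posE)
      then show False using elim by blast
    qed
    then show False by simp
  qed
qed

lemma rate_pos: "rate > 0"
  using T_tail_1 by (simp add: rate_def)

text \<open>As the cells are i.i.d., the tail is geometric along each grid, and the tail at time 1
  fixes the ratio c through c^m = exp (- rate).\<close>

lemma T_tail_rational:
  assumes "m > 0"
  shows "prob {\<omega>\<in>space M. real k / real m < T 1 \<omega>} = exp (- rate * (real k / real m))"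
proof -
  define c where "c = measure (cell_law (1 / real m)) {0}"
  interpret C: prob_space "cell_law (1 / real m)" by (rule cell_law) (use assms in simp)
  have c: "emeasure (cell_law (1 / real m)) {0} = ennreal c" "c \<ge> 0" by (auto simp: c_def C.emeasure_eq_measure)
  have cm: "c ^ m = prob {\<omega>\<in>space M. 1 < T 1 \<omega>}"
    using cell_law_power[OF assms] c by (simp add: emeasure_eq_measure ennreal_power)
  have "c > 0" using cm T_tail_1 c assms by (metis less_eq_real_def less_irrefl zero_power)
  then have "rate = - real m * ln c" unfolding rate_def cm[symmetric] by (simp add: ln_realpow)
  then have "exp (- rate * (real k / real m)) = exp (real k * ln c)" using assms by simp
  also have "\<dots> = c ^ k" using \<open>c > 0\<close> by (simp add: exp_of_nat_mult)
  also have "\<dots> = prob {\<omega>\<in>space M. real k / real m < T 1 \<omega>}"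
    using T_tail_power[of "1 / real m" k] assms c by (simp add: emeasure_eq_measure ennreal_power)
  finally show ?thesis by simp
qed

lemma T_tail:
  assumes a: "a \<ge> 0"
  shows "prob {\<omega>\<in>space M. a < T 1 \<omega>} = exp (- rate * a)"
proof (rule antisym)
  define k where "k m = nat \<lfloor>a * real (Suc m)\<rfloor>" for m
  have k: "real (k m) / real (Suc m) \<le> a" "a < real (Suc (k m)) / real (Suc m)" for m
  proof -
    have "real (k m) = of_int \<lfloor>a * real (Suc m)\<rfloor>" using a by (simp add: k_def)
    then have "real (k m) \<le> a * real (Suc m)" "a * real (Suc m) < real (k m) + 1" by linarith+
    then show "real (k m) / real (Suc m) \<le> a" "a < real (Suc (k m)) / real (Suc m)"
      by (simp_all add: field_simps)
  qed
  have diff: "real (Suc (k m)) / real (Suc m) = real (k m) / real (Suc m) + 1 / real (Suc m)" for m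
    by (simp add: add_divide_distrib)
  have inv: "(\<lambda>m. 1 / real (Suc m)) \<longlonglongrightarrow> 0" using LIMSEQ_inverse_real_of_nat by (simp add: inverse_eq_divide)
  have lo: "(\<lambda>m. real (k m) / real (Suc m)) \<longlonglongrightarrow> a"
  proof (rule tendsto_sandwich[of "\<lambda>m. a - 1 / real (Suc m)" _ _ "\<lambda>_. a"])
    show "(\<lambda>m. a - 1 / real (Suc m)) \<longlonglongrightarrow> a" using tendsto_diff[OF tendsto_const inv, of a] by simp
    show "eventually (\<lambda>m. a - 1 / real (Suc m) \<le> real (k m) / real (Suc m)) sequentially"
      using k(2) by (intro always_eventually allI) (simp add: diff less_imp_le algebra_simps del: of_nat_Suc)
  qed (use k in auto)
  have hi: "(\<lambda>m. real (Suc (k m)) / real (Suc m)) \<longlonglongrightarrow> a"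
    unfolding diff using tendsto_add[OF lo inv] by simp
  show "prob {\<omega>\<in>space M. a < T 1 \<omega>} \<le> exp (- rate * a)"
  proof (rule LIMSEQ_le_const)
    show "(\<lambda>m. exp (- rate * (real (k m) / real (Suc m)))) \<longlonglongrightarrow> exp (- rate * a)"
      by (intro tendsto_intros lo)
    have "prob {\<omega>\<in>space M. a < T 1 \<omega>} \<le> exp (- rate * (real (k m) / real (Suc m)))" for m
      unfolding T_tail_rational[of "Suc m" "k m", OF zero_less_Suc, symmetric]
      using k(1)[of m] by (intro finite_measure_mono) auto
    then show "\<exists>N. \<forall>m\<ge>N. prob {\<omega>\<in>space M. a < T 1 \<omega>} \<le> exp (- rate * (real (k m) / real (Suc m)))" by blast
  qed
  show "exp (- rate * a) \<le> prob {\<omega>\<in>space M. a < T 1 \<omega>}"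
  proof (rule LIMSEQ_le_const2)
    show "(\<lambda>m. exp (- rate * (real (Suc (k m)) / real (Suc m)))) \<longlonglongrightarrow> exp (- rate * a)"
      by (intro tendsto_intros hi)
    have "exp (- rate * (real (Suc (k m)) / real (Suc m))) \<le> prob {\<omega>\<in>space M. a < T 1 \<omega>}" for m
      unfolding T_tail_rational[of "Suc m" "Suc (k m)", OF zero_less_Suc, symmetric]
      using k(2)[of m] by (intro finite_measure_mono) auto
    then show "\<exists>N. \<forall>m\<ge>N. exp (- rate * (real (Suc (k m)) / real (Suc m))) \<le> prob {\<omega>\<in>space M. a < T 1 \<omega>}" by blast
  qed
qed

lemma T_exponential: "distributed M lborel (T 1) (exponential_density rate)"
proof (subst exponential_distributed_iff[OF rate_pos], intro conjI allI impI)
  fix a :: real assume a: "0 \<le> a"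
  have "{\<omega>\<in>space M. T 1 \<omega> \<le> a} = space M - {\<omega>\<in>space M. a < T 1 \<omega>}" by auto
  then have "prob {\<omega>\<in>space M. T 1 \<omega> \<le> a} = 1 - prob {\<omega>\<in>space M. a < T 1 \<omega>}"
    by (simp add: prob_compl)
  then show "\<P>(\<omega> in M. T 1 \<omega> \<le> a) = 1 - exp (- a * rate)" using T_tail[OF a] by (simp add: mult.commute)
qed simp

section \<open>Joint law of the gaps and the squared jumps\<close>

definition mesh :: "nat \<Rightarrow> real" where
  "mesh n = 1 / real (Suc n)"

lemma mesh: "mesh n > 0" "mesh \<longlonglongrightarrow> 0"
  using LIMSEQ_inverse_real_of_nat unfolding mesh_def by (simp_all add: inverse_eq_divide)

text \<open>A function of the path alone, obtained by limits from countably many path values. It is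
  therefore measurable on path space, which is what carries the independence of \<open>Y 0\<close>
  over to gaps and marks.\<close>

definition approx :: "nat \<Rightarrow> nat \<Rightarrow> (real \<Rightarrow> real) \<Rightarrow> real \<times> real" where
  "approx n i l = hit_pair (mesh n) ((after_hit ^^ i) (\<lambda>k. sq_cell (mesh n) k l))"

lemma approx_iid: "iid M borel (\<lambda>i \<omega>. approx n i (path \<omega>))"
  unfolding approx_def
proof (rule iid_compose_distr[OF X_seq_measurable[OF mesh(1)] _ X_distr[OF mesh(1)]])
  have c: "prob_space (cell_law (mesh n))" "sets (cell_law (mesh n)) = sets borel" by (rule cell_law(1)[OF mesh(1)]) (rule cell_law(2))
  show "prob_space (Pi\<^sub>M UNIV (\<lambda>_::nat. cell_law (mesh n)))" by (rule prob_space_PiM) (rule c)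
  show "sets (Pi\<^sub>M UNIV (\<lambda>_::nat. cell_law (mesh n))) = sets (Pi\<^sub>M UNIV (\<lambda>_. borel))"
    using c by (intro sets_PiM_cong) auto
  show "iid (Pi\<^sub>M UNIV (\<lambda>_::nat. cell_law (mesh n))) borel (\<lambda>i x. hit_pair (mesh n) ((after_hit ^^ i) x))"
    by (rule hit_pairs_iid[OF c]) (use cell_law_not0[of "Suc n"] in \<open>simp add: mesh_def\<close>)
qed

lemma approx_tendsto: "good \<omega> \<Longrightarrow> (\<lambda>n. approx n i (path \<omega>)) \<longlonglongrightarrow> (T (Suc i) \<omega>, Z (Suc i) \<omega>)"
  using jump_path.hit_pair_tendsto[OF _ mesh(2,1), of "path \<omega>" i] mesh(1)
  unfolding good_def approx_def by simp

lemma TZ_iid: "iid M borel (\<lambda>i \<omega>. (T (Suc i) \<omega>, Z (Suc i) \<omega>))"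
proof (rule iid_limit[OF approx_iid])
  show "AE \<omega> in M. (\<lambda>n. approx n i (path \<omega>)) \<longlonglongrightarrow> (T (Suc i) \<omega>, Z (Suc i) \<omega>)" for i
    using AE_good by eventually_elim (rule approx_tendsto)
qed measurable

definition mark_law :: "real measure" where
  "mark_law = distr M borel (Z 1)"

definition gap_law :: "real measure" where
  "gap_law = density lborel (exponential_density rate)"

lemma gap_law: "prob_space gap_law" "sets gap_law = sets borel" "distr M borel (T 1) = gap_law"
proof -
  have "distr M lborel (T 1) = gap_law" using T_exponential unfolding distributed_def gap_law_def by simp
  moreover have "distr M lborel (T 1) = distr M borel (T 1)" by (intro distr_cong) auto
  ultimately show "distr M borel (T 1) = gap_law" by simp
  then show "prob_space gap_law" by (metis T_measurable prob_space_distr)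
qed (simp add: gap_law_def)

lemma mark_law: "prob_space mark_law" "sets mark_law = sets borel"
  unfolding mark_law_def by (auto intro: prob_space_distr)

text \<open>For each mesh the position and the value of the first hit are independent, and
  independence survives the limit. The two variables are indexed by \<open>bool\<close> so that the
  limit theorem for families applies.\<close>

lemma TZ_product: "distr M (borel \<Otimes>\<^sub>M borel) (\<lambda>\<omega>. (T 1 \<omega>, Z 1 \<omega>)) = gap_law \<Otimes>\<^sub>M mark_law"
proof -
  define A where "A n b \<omega> = (if b then fst (approx n 0 (path \<omega>)) else snd (approx n 0 (path \<omega>)))" for n and b :: bool and \<omega>
  define W where "W b = (if b then T 1 else Z 1)" for b
  have Am: "(\<lambda>\<omega>. approx n 0 (path \<omega>)) \<in> borel_measurable M" for n by (rule iid_measurable[OF approx_iid])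
  then have [measurable]: "A n b \<in> borel_measurable M" for n b unfolding A_def by (cases b) (auto simp: borel_prod[symmetric])
  have cb: "case_bool borel borel = (\<lambda>_. borel)" by (auto split: bool.split)
  have "indep_vars (\<lambda>_. borel) (A n) UNIV" for n
  proof -
    define P where "P = Pi\<^sub>M UNIV (\<lambda>_::nat. cell_law (mesh n))"
    have c: "prob_space (cell_law (mesh n))" "sets (cell_law (mesh n)) = sets borel" by (rule cell_law(1)[OF mesh(1)]) (rule cell_law(2))
    have not0: "emeasure (cell_law (mesh n)) {0} < 1" using cell_law_not0[of "Suc n"] by (simp add: mesh_def)
    note [measurable_cong] = c(2)
    note [measurable] = X_seq_measurable[OF mesh(1)] hit_pair_measurable[OF c not0]
    have hp: "hit_pair (mesh n) \<in> borel_measurable (Pi\<^sub>M UNIV (\<lambda>_::nat. borel))"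
      using hit_pair_measurable[OF c not0] c(2) by (subst measurable_cong_sets[OF sets_PiM_cong[OF refl] refl]) auto
    then have [measurable]: "hit_pair (mesh n) \<in> Pi\<^sub>M UNIV (\<lambda>_::nat. borel) \<rightarrow>\<^sub>M borel \<Otimes>\<^sub>M borel" by (simp add: borel_prod)
    have A_eq: "A n True = (\<lambda>\<omega>. fst (hit_pair (mesh n) (\<lambda>k. X (mesh n) k \<omega>)))" "A n False = (\<lambda>\<omega>. snd (hit_pair (mesh n) (\<lambda>k. X (mesh n) k \<omega>)))"
      by (auto simp: A_def approx_def)
    have "distr M (borel \<Otimes>\<^sub>M borel) (\<lambda>\<omega>. (A n True \<omega>, A n False \<omega>)) = distr P (borel \<Otimes>\<^sub>M borel) (hit_pair (mesh n))"
      unfolding P_def X_distr[OF mesh(1), symmetric] A_eq by (subst distr_distr) (auto simp: comp_def)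
    also have "\<dots> = distr P borel (\<lambda>x. fst (hit_pair (mesh n) x)) \<Otimes>\<^sub>M distr P borel (\<lambda>x. snd (hit_pair (mesh n) x))"
      unfolding P_def by (rule hit_pair_distr[OF c not0])
    also have "distr P borel (\<lambda>x. fst (hit_pair (mesh n) x)) = distr M borel (A n True)"
      unfolding P_def X_distr[OF mesh(1), symmetric] A_eq by (subst distr_distr) (auto simp: comp_def)
    also have "distr P borel (\<lambda>x. snd (hit_pair (mesh n) x)) = distr M borel (A n False)"
      unfolding P_def X_distr[OF mesh(1), symmetric] A_eq by (subst distr_distr) (auto simp: comp_def)
    finally have "indep_var borel (A n True) borel (A n False)"
      by (subst indep_var_distribution_eq) auto
    moreover have "case_bool (A n True) (A n False) = A n" by (rule ext) (simp split: bool.split)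
    ultimately show ?thesis unfolding indep_var_def cb by simp
  qed
  then have "indep_vars (\<lambda>_. borel) W UNIV"
  proof (rule indep_vars_limit)
    show "AE \<omega> in M. (\<lambda>n. A n b \<omega>) \<longlonglongrightarrow> W b \<omega>" for b
      using AE_good
    proof eventually_elim
      case (elim \<omega>)
      from tendsto_fst[OF approx_tendsto[OF elim, of 0]] tendsto_snd[OF approx_tendsto[OF elim, of 0]]
      show ?case by (cases b) (auto simp: A_def W_def)
    qed
  qed (auto simp: W_def)
  moreover have "case_bool (T 1) (Z 1) = W" by (rule ext) (simp add: W_def split: bool.split)
  ultimately have "indep_var borel (T 1) borel (Z 1)" unfolding indep_var_def cb by simp
  then have "distr M borel (T 1) \<Otimes>\<^sub>M distr M borel (Z 1) = distr M (borel \<Otimes>\<^sub>M borel) (\<lambda>\<omega>. (T 1 \<omega>, Z 1 \<omega>))"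
    by (subst (asm) indep_var_distribution_eq) blast
  then show ?thesis unfolding gap_law(3) mark_law_def[symmetric] by (rule sym)
qed

definition pair_law :: "(real \<times> real) measure" where
  "pair_law = gap_law \<Otimes>\<^sub>M mark_law"

lemma pair_law: "prob_space pair_law" "sets pair_law = sets (borel \<Otimes>\<^sub>M borel)" "sets pair_law = sets borel"
  "distr M borel (\<lambda>\<omega>. (T 1 \<omega>, Z 1 \<omega>)) = pair_law"
proof -
  have "distr M borel (\<lambda>\<omega>. (T 1 \<omega>, Z 1 \<omega>)) = distr M (borel \<Otimes>\<^sub>M borel) (\<lambda>\<omega>. (T 1 \<omega>, Z 1 \<omega>))"
    by (simp only: borel_prod)
  then show *: "distr M borel (\<lambda>\<omega>. (T 1 \<omega>, Z 1 \<omega>)) = pair_law" unfolding pair_law_def TZ_product .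
  show "prob_space pair_law" unfolding *[symmetric] by (rule prob_space_distr) simp
  show "sets pair_law = sets borel" unfolding *[symmetric] by simp
  then show "sets pair_law = sets (borel \<Otimes>\<^sub>M borel)" by (simp only: borel_prod)
qed

lemma TZ_distr: "distr M (Pi\<^sub>M UNIV (\<lambda>_. borel)) (\<lambda>\<omega> i. (T (Suc i) \<omega>, Z (Suc i) \<omega>)) = Pi\<^sub>M UNIV (\<lambda>_. pair_law)"
  using iid_distr_PiM[OF TZ_iid] pair_law(4) by simp

end

text \<open>Only values at nonnegative times enter, so a path may be replaced by its restriction to
  {0..}, the object that the independence hypothesis speaks of.\<close>

lemma sq_cell_cong:
  assumes "\<And>t. t \<ge> 0 \<Longrightarrow> f t = g t" "h \<ge> 0"
  shows "sq_cell h k f = sq_cell h k g"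
proof -
  have "f (h / real m * real i) = g (h / real m * real i)" for m i
    using assms by auto
  then show ?thesis unfolding sq_cell_def cell_sum_def grid_sum_def by presburger
qed

text \<open>Measurability depends on a law only through its sigma-algebra, so a point mass serves as
  an instance of the earlier lemmas.\<close>

lemma borel_measurable_hits:
  "hit_pair h \<in> borel_measurable (Pi\<^sub>M UNIV (\<lambda>_. borel))"
  "after_hit \<in> Pi\<^sub>M UNIV (\<lambda>_. borel) \<rightarrow>\<^sub>M Pi\<^sub>M UNIV (\<lambda>_. borel)"
proof -
  have r: "prob_space (return borel (0::real))" "sets (return borel (0::real)) = sets borel"
    by (auto intro: prob_space_return)
  have eq: "sets (Pi\<^sub>M UNIV (\<lambda>_::nat. return borel (0::real))) = sets (Pi\<^sub>M UNIV (\<lambda>_::nat. borel))"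
    by (intro sets_PiM_cong) auto
  note [measurable_cong] = eq
  have [measurable]: "first_hit \<in> Pi\<^sub>M UNIV (\<lambda>_. borel) \<rightarrow>\<^sub>M count_space UNIV" "hit_value \<in> borel_measurable (Pi\<^sub>M UNIV (\<lambda>_. borel))"
    using first_hit_measurable[OF r] hit_value_measurable[OF r]
    by (simp_all cong: measurable_cong_sets add: measurable_cong_sets[OF eq refl])
  show "hit_pair h \<in> borel_measurable (Pi\<^sub>M UNIV (\<lambda>_. borel))"
    unfolding hit_pair_def by measurable
  show "after_hit \<in> Pi\<^sub>M UNIV (\<lambda>_. borel) \<rightarrow>\<^sub>M Pi\<^sub>M UNIV (\<lambda>_. borel)"
    using after_hit_measurable[OF r] by (simp add: measurable_cong_sets[OF eq eq])
qed

lemma indep_rvsD: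
  assumes "prob_space M" "indep_rvs M M1 X1 M2 X2"
  shows "X1 \<in> M \<rightarrow>\<^sub>M M1" "X2 \<in> M \<rightarrow>\<^sub>M M2"
    "A \<in> sets M1 \<Longrightarrow> B \<in> sets M2 \<Longrightarrow>
      emeasure M {\<omega>\<in>space M. X1 \<omega> \<in> A \<and> X2 \<omega> \<in> B} = emeasure M {\<omega>\<in>space M. X1 \<omega> \<in> A} * emeasure M {\<omega>\<in>space M. X2 \<omega> \<in> B}"
proof -
  interpret prob_space M by fact
  show X: "X1 \<in> M \<rightarrow>\<^sub>M M1" "X2 \<in> M \<rightarrow>\<^sub>M M2" using assms(2) unfolding indep_rvs_def by auto
  have ind: "indep_set {X1 -` A \<inter> space M | A. A \<in> sets M1} {X2 -` A \<inter> space M | A. A \<in> sets M2}"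
    using assms(2) unfolding indep_rvs_def by auto
  assume AB: "A \<in> sets M1" "B \<in> sets M2"
  have "prob ((X1 -` A \<inter> space M) \<inter> (X2 -` B \<inter> space M)) = prob (X1 -` A \<inter> space M) * prob (X2 -` B \<inter> space M)"
    by (rule indep_setD[OF ind]) (use AB in auto)
  moreover have "(X1 -` A \<inter> space M) \<inter> (X2 -` B \<inter> space M) = {\<omega>\<in>space M. X1 \<omega> \<in> A \<and> X2 \<omega> \<in> B}"
    "X1 -` A \<inter> space M = {\<omega>\<in>space M. X1 \<omega> \<in> A}" "X2 -` B \<inter> space M = {\<omega>\<in>space M. X2 \<omega> \<in> B}" by auto
  ultimately show "emeasure M {\<omega>\<in>space M. X1 \<omega> \<in> A \<and> X2 \<omega> \<in> B} = emeasure M {\<omega>\<in>space M. X1 \<omega> \<in> A} * emeasure M {\<omega>\<in>space M. X2 \<omega> \<in> B}"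
    by (simp add: emeasure_eq_measure ennreal_mult')
qed

section \<open>Independence from the initial state, and the marks in terms of the Levy
  measure\<close>

context levy_finite
begin

definition marks :: "'w \<Rightarrow> nat \<Rightarrow> real \<times> real" where
  "marks \<omega> = (\<lambda>i. (T (Suc i) \<omega>, Z (Suc i) \<omega>))"

abbreviation seq_law :: "(nat \<Rightarrow> real \<times> real) measure" where
  "seq_law \<equiv> Pi\<^sub>M UNIV (\<lambda>_. pair_law)"

lemma seq_law: "prob_space seq_law" "sets seq_law = sets (Pi\<^sub>M UNIV (\<lambda>_. borel))"
  using pair_law by (auto intro!: prob_space_PiM sets_PiM_cong)

lemma marks_measurable: "marks \<in> M \<rightarrow>\<^sub>M Pi\<^sub>M UNIV (\<lambda>_. borel)" "marks \<in> M \<rightarrow>\<^sub>M seq_law"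
proof -
  show m: "marks \<in> M \<rightarrow>\<^sub>M Pi\<^sub>M UNIV (\<lambda>_. borel)" unfolding marks_def by measurable
  show "marks \<in> M \<rightarrow>\<^sub>M seq_law" using m by (simp add: measurable_cong_sets[OF refl seq_law(2)])
qed

lemma marks_distr: "distr M seq_law marks = seq_law"
proof -
  have "distr M seq_law marks = distr M (Pi\<^sub>M UNIV (\<lambda>_. borel)) marks"
    by (intro distr_cong) (auto simp: seq_law)
  then show ?thesis unfolding marks_def using TZ_distr by simp
qed

text \<open>The marks are almost surely a measurable function \<Psi> of the restricted path, namely
  the limit of \<open>approx\<close>, and Y0 is independent of that path. Measurability of T and Z
  on M alone would not relate them to the path.\<close>

lemma joint_law:
  assumes ind: "indep_rvs M S Y0 (\<Pi>\<^sub>M t\<in>{0..}. borel) (\<lambda>\<omega>. \<lambda>t\<in>{0..}. L t \<omega>)"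
  shows "distr M (S \<Otimes>\<^sub>M seq_law) (\<lambda>\<omega>. (Y0 \<omega>, marks \<omega>)) = distr M S Y0 \<Otimes>\<^sub>M seq_law"
proof -
  note D = indep_rvsD[OF prob_space_axioms ind]
  note [measurable] = D(1,2) borel_measurable_hits
  define \<Psi> where "\<Psi> l = (\<lambda>i. lim (\<lambda>n. approx n i l))" for l :: "real \<Rightarrow> real"
  have ap: "approx n i \<in> borel_measurable (\<Pi>\<^sub>M t\<in>{0..}. borel)" for n i
  proof -
    have [measurable]: "(\<lambda>l k. sq_cell (mesh n) k l) \<in> (\<Pi>\<^sub>M t\<in>{0..}. borel) \<rightarrow>\<^sub>M Pi\<^sub>M UNIV (\<lambda>_. borel)"
      using mesh(1)[of n] by (intro measurable_PiM_UNIV sq_cell_measurable) auto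
    have [measurable]: "(after_hit ^^ i) \<in> Pi\<^sub>M UNIV (\<lambda>_. borel) \<rightarrow>\<^sub>M Pi\<^sub>M UNIV (\<lambda>_. borel)"
      by (induction i) (auto simp: comp_def)
    show ?thesis unfolding approx_def by measurable
  qed
  have \<Psi>[measurable]: "\<Psi> \<in> (\<Pi>\<^sub>M t\<in>{0..}. borel) \<rightarrow>\<^sub>M seq_law"
    unfolding \<Psi>_def measurable_cong_sets[OF refl seq_law(2)]
    by (intro measurable_PiM_UNIV borel_measurable_lim_metric ap)
  have AE: "AE \<omega> in M. \<Psi> (\<lambda>t\<in>{0..}. L t \<omega>) = marks \<omega>"
    using AE_good
  proof eventually_elim
    case (elim \<omega>)
    have "approx n i (\<lambda>t\<in>{0..}. L t \<omega>) = approx n i (path \<omega>)" for n i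
    proof -
      have "sq_cell (mesh n) k (\<lambda>t\<in>{0..}. L t \<omega>) = sq_cell (mesh n) k (path \<omega>)" for k
        using mesh(1)[of n] by (intro sq_cell_cong) auto
      then show ?thesis unfolding approx_def by presburger
    qed
    then show ?case unfolding \<Psi>_def marks_def using limI[OF approx_tendsto[OF elim]] by auto
  qed
  have "distr M (S \<Otimes>\<^sub>M seq_law) (\<lambda>\<omega>. (Y0 \<omega>, marks \<omega>)) = distr M (S \<Otimes>\<^sub>M seq_law) (\<lambda>\<omega>. (Y0 \<omega>, \<Psi> (\<lambda>t\<in>{0..}. L t \<omega>)))"
    using AE by (intro distr_cong_AE) (auto intro!: marks_measurable measurable_Pair)
  also have "\<dots> = distr M S Y0 \<Otimes>\<^sub>M distr M seq_law (\<lambda>\<omega>. \<Psi> (\<lambda>t\<in>{0..}. L t \<omega>))"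
  proof (rule distr_Pair_eqI)
    fix A B assume A: "A \<in> sets S" and B: "B \<in> sets seq_law"
    have pre: "\<Psi> -` B \<inter> space (\<Pi>\<^sub>M t\<in>{0..}. borel) \<in> sets (\<Pi>\<^sub>M t\<in>{0..}. borel)"
      by (rule measurable_sets[OF \<Psi> B])
    have mem: "(\<lambda>t\<in>{0..}. L t \<omega>) \<in> \<Psi> -` B \<inter> space (\<Pi>\<^sub>M t\<in>{0..}. borel) \<longleftrightarrow> \<Psi> (\<lambda>t\<in>{0..}. L t \<omega>) \<in> B" if "\<omega> \<in> space M" for \<omega>
      using measurable_space[OF D(2) that] by auto
    show "emeasure M {\<omega> \<in> space M. Y0 \<omega> \<in> A \<and> \<Psi> (\<lambda>t\<in>{0..}. L t \<omega>) \<in> B} =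
      emeasure M {\<omega> \<in> space M. Y0 \<omega> \<in> A} * emeasure M {\<omega> \<in> space M. \<Psi> (\<lambda>t\<in>{0..}. L t \<omega>) \<in> B}"
    proof -
      have "{\<omega> \<in> space M. Y0 \<omega> \<in> A \<and> (\<lambda>t\<in>{0..}. L t \<omega>) \<in> \<Psi> -` B \<inter> space (\<Pi>\<^sub>M t\<in>{0..}. borel)} =
          {\<omega> \<in> space M. Y0 \<omega> \<in> A \<and> \<Psi> (\<lambda>t\<in>{0..}. L t \<omega>) \<in> B}"
        "{\<omega> \<in> space M. (\<lambda>t\<in>{0..}. L t \<omega>) \<in> \<Psi> -` B \<inter> space (\<Pi>\<^sub>M t\<in>{0..}. borel)} =
          {\<omega> \<in> space M. \<Psi> (\<lambda>t\<in>{0..}. L t \<omega>) \<in> B}"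
        using mem by blast+
      then show ?thesis using D(3)[OF A pre] by argo
    qed
  qed measurable
  also have "distr M seq_law (\<lambda>\<omega>. \<Psi> (\<lambda>t\<in>{0..}. L t \<omega>)) = distr M seq_law marks"
    using AE by (intro distr_cong_AE) (auto intro!: marks_measurable)
  finally show ?thesis unfolding marks_distr .
qed

text \<open>The arrival time is a function of the gaps only. The induction splits off the first pair
  and subtracts its gap from t, which is why t is generalised.\<close>

lemma emeasure_mark_indep:
  assumes A: "A \<in> sets borel"
  shows "emeasure seq_law {x\<in>space seq_law. (\<Sum>j<Suc i. fst (x j)) \<le> t \<and> snd (x i) \<in> A} =
    emeasure seq_law {x\<in>space seq_law. (\<Sum>j<Suc i. fst (x j)) \<le> t} * emeasure mark_law A"
proof -
  interpret G: prob_space gap_law by (rule gap_law)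
  interpret R: prob_space mark_law by (rule mark_law)
  interpret S: prob_space seq_law by (rule seq_law)
  have eqs: "sets pair_law = sets (borel \<Otimes>\<^sub>M borel)" by (rule pair_law)
  note [measurable_cong] = eqs gap_law(2) mark_law(2)
  note [measurable] = A
  have gen: "(\<integral>\<^sup>+x. indicator {x. (\<Sum>j<Suc i. fst (x j)) \<le> t} x * indicator A (snd (x i)) \<partial>seq_law) =
    (\<integral>\<^sup>+x. indicator {x. (\<Sum>j<Suc i. fst (x j)) \<le> t} x \<partial>seq_law) * emeasure mark_law A"
  proof (induction i arbitrary: t)
    case 0
    have "(\<integral>\<^sup>+x. indicator {x. (\<Sum>j<Suc 0. fst (x j)) \<le> t} x * indicator A (snd (x 0)) \<partial>seq_law) =
      (\<integral>\<^sup>+p. indicator {..t} (fst p) * indicator A (snd p) \<partial>pair_law)"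
      by (subst nn_integral_PiM_iter[OF pair_law(1)], measurable)
         (auto simp: S.emeasure_space_1 indicator_def intro!: nn_integral_cong)
    also have "\<dots> = (\<integral>\<^sup>+s. \<integral>\<^sup>+z. indicator {..t} s * indicator A z \<partial>mark_law \<partial>gap_law)"
      unfolding pair_law_def by (subst R.nn_integral_fst[symmetric]) auto
    also have "\<dots> = (\<integral>\<^sup>+s. indicator {..t} s \<partial>gap_law) * emeasure mark_law A"
      by (simp add: nn_integral_cmult nn_integral_multc mark_law)
    also have "(\<integral>\<^sup>+s. indicator {..t} s \<partial>gap_law) = (\<integral>\<^sup>+p. indicator {..t} (fst p) \<partial>pair_law)"
      unfolding pair_law_def by (subst R.nn_integral_fst[symmetric]) (auto simp: R.emeasure_space_1)
    also have "\<dots> = (\<integral>\<^sup>+x. indicator {x. (\<Sum>j<Suc 0. fst (x j)) \<le> t} x \<partial>seq_law)"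
      by (subst nn_integral_PiM_iter[OF pair_law(1)], measurable)
         (auto simp: S.emeasure_space_1 indicator_def intro!: nn_integral_cong)
    finally show ?case .
  next
    case (Suc i)
    have shift: "(\<Sum>j<Suc (Suc i). fst ((case j of 0 \<Rightarrow> p | Suc x \<Rightarrow> \<omega> x))) = fst p + (\<Sum>j<Suc i. fst (\<omega> j))" for p :: "real \<times> real" and \<omega>
      by (subst sum.lessThan_Suc_shift) simp
    have "(\<integral>\<^sup>+x. indicator {x. (\<Sum>j<Suc (Suc i). fst (x j)) \<le> t} x * indicator A (snd (x (Suc i))) \<partial>seq_law) =
      (\<integral>\<^sup>+p. \<integral>\<^sup>+x. indicator {x. (\<Sum>j<Suc i. fst (x j)) \<le> t - fst p} x * indicator A (snd (x i)) \<partial>seq_law \<partial>pair_law)"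
      by (subst nn_integral_PiM_iter[OF pair_law(1)], measurable)
         (auto simp: shift indicator_def le_diff_eq add.commute simp del: sum.lessThan_Suc intro!: nn_integral_cong)
    also have "\<dots> = (\<integral>\<^sup>+p. \<integral>\<^sup>+x. indicator {x. (\<Sum>j<Suc i. fst (x j)) \<le> t - fst p} x \<partial>seq_law \<partial>pair_law) * emeasure mark_law A"
      unfolding Suc.IH by (rule nn_integral_multc) (unfold indicator_def mem_Collect_eq of_bool_def, measurable)
    also have "(\<integral>\<^sup>+p. \<integral>\<^sup>+x. indicator {x. (\<Sum>j<Suc i. fst (x j)) \<le> t - fst p} x \<partial>seq_law \<partial>pair_law) =
      (\<integral>\<^sup>+x. indicator {x. (\<Sum>j<Suc (Suc i). fst (x j)) \<le> t} x \<partial>seq_law)"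
    proof (rule sym)
      show "(\<integral>\<^sup>+x. indicator {x. (\<Sum>j<Suc (Suc i). fst (x j)) \<le> t} x \<partial>seq_law) =
        (\<integral>\<^sup>+p. \<integral>\<^sup>+x. indicator {x. (\<Sum>j<Suc i. fst (x j)) \<le> t - fst p} x \<partial>seq_law \<partial>pair_law)"
        by (subst nn_integral_PiM_iter[OF pair_law(1)], measurable)
           (auto simp: shift indicator_def le_diff_eq add.commute simp del: sum.lessThan_Suc intro!: nn_integral_cong)
    qed
    finally show ?case .
  qed
  have ind: "emeasure seq_law {x\<in>space seq_law. Q x} = (\<integral>\<^sup>+x. f x \<partial>seq_law)"
    if "Measurable.pred seq_law Q" "\<And>x. f x = of_bool (Q x)" for Q and f :: "(nat \<Rightarrow> real \<times> real) \<Rightarrow> ennreal"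
  proof -
    have "(\<integral>\<^sup>+x. f x \<partial>seq_law) = (\<integral>\<^sup>+x. indicator {x\<in>space seq_law. Q x} x \<partial>seq_law)"
      by (rule nn_integral_cong) (simp add: that indicator_def)
    also have "\<dots> = emeasure seq_law {x\<in>space seq_law. Q x}"
      by (rule nn_integral_indicator) (use that in measurable)
    finally show ?thesis by simp
  qed
  have "emeasure seq_law {x\<in>space seq_law. (\<Sum>j<Suc i. fst (x j)) \<le> t \<and> snd (x i) \<in> A} =
    (\<integral>\<^sup>+x. indicator {x. (\<Sum>j<Suc i. fst (x j)) \<le> t} x * indicator A (snd (x i)) \<partial>seq_law)"
    by (rule ind) (measurable, simp add: indicator_def)
  moreover have "emeasure seq_law {x\<in>space seq_law. (\<Sum>j<Suc i. fst (x j)) \<le> t} =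
    (\<integral>\<^sup>+x. indicator {x. (\<Sum>j<Suc i. fst (x j)) \<le> t} x \<partial>seq_law)"
  proof (rule ind[of "\<lambda>x. (\<Sum>j<Suc i. fst (x j)) \<le> t"])
    have "(\<lambda>x. \<Sum>j<Suc i. fst (x j)) \<in> borel_measurable seq_law" by measurable
    then show "Measurable.pred seq_law (\<lambda>x. (\<Sum>j<Suc i. fst (x j)) \<le> t)"
      unfolding pred_def by (intro borel_measurable_le) auto
  qed (simp add: indicator_def)
  ultimately show ?thesis using gen by simp
qed

text \<open>The arrival times have Erlang densities, and the Erlang densities of all orders add up
  to the constant \<open>rate\<close> on the nonnegative axis, because the exponential series
  cancels \<open>exp (- rate * x)\<close>.\<close>

lemma expected_count:
  "(\<Sum>i. emeasure M {\<omega>\<in>space M. (\<Sum>j<Suc i. T (Suc j) \<omega>) \<le> 1}) = ennreal rate"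
proof -
  have "distributed M lborel (\<lambda>\<omega>. \<Sum>j<Suc i. T (Suc j) \<omega>) (erlang_density (card {..<Suc i} - 1) rate)" for i
  proof (rule exponential_distributed_sum[OF _ _ rate_pos])
    show "distributed M lborel (T (Suc j)) (exponential_density rate)" for j
    proof -
      have "distr M borel (\<lambda>\<omega>. (T (Suc j) \<omega>, Z (Suc j) \<omega>)) = distr M borel (\<lambda>\<omega>. (T (Suc 0) \<omega>, Z (Suc 0) \<omega>))"
        using TZ_iid unfolding iid_def by blast
      then have "distr (distr M borel (\<lambda>\<omega>. (T (Suc j) \<omega>, Z (Suc j) \<omega>))) borel fst = distr (distr M borel (\<lambda>\<omega>. (T (Suc 0) \<omega>, Z (Suc 0) \<omega>))) borel fst"
        by simp
      then have "distr M borel (T (Suc j)) = distr M borel (T (Suc 0))"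
        by (subst (asm) (1 2) distr_distr) (auto simp: comp_def borel_prod[symmetric])
      moreover have "distr M lborel (T k) = distr M borel (T k)" for k by (intro distr_cong) auto
      ultimately have "distr M lborel (T (Suc j)) = distr M lborel (T 1)" by simp
      then show ?thesis using T_exponential unfolding distributed_def by simp
    qed
    have ind: "indep_vars (\<lambda>_. borel) (\<lambda>j \<omega>. (T (Suc j) \<omega>, Z (Suc j) \<omega>)) {..<Suc i}"
      by (rule indep_vars_subset[of _ _ UNIV]) (use TZ_iid in \<open>auto simp: iid_def\<close>)
    have "indep_vars (\<lambda>_. borel) (\<lambda>j \<omega>. fst (T (Suc j) \<omega>, Z (Suc j) \<omega>)) {..<Suc i}"
      by (rule indep_vars_compose2[OF ind]) (simp add: borel_prod[symmetric])
    then show "indep_vars (\<lambda>_. borel) (\<lambda>j. T (Suc j)) {..<Suc i}" by simp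
  qed auto
  then have dist: "distributed M lborel (\<lambda>\<omega>. \<Sum>j<Suc i. T (Suc j) \<omega>) (erlang_density i rate)" for i by simp
  have "emeasure M {\<omega>\<in>space M. (\<Sum>j<Suc i. T (Suc j) \<omega>) \<le> 1} =
    (\<integral>\<^sup>+x. ennreal (erlang_density i rate x) * indicator {..1} x \<partial>lborel)" for i
  proof -
    have "{\<omega>\<in>space M. (\<Sum>j<Suc i. T (Suc j) \<omega>) \<le> 1} = (\<lambda>\<omega>. \<Sum>j<Suc i. T (Suc j) \<omega>) -` {..1} \<inter> space M" by auto
    then show ?thesis using distributed_emeasure[OF dist, of "{..1}" i] by simp
  qed
  then have "(\<Sum>i. emeasure M {\<omega>\<in>space M. (\<Sum>j<Suc i. T (Suc j) \<omega>) \<le> 1}) =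
    (\<Sum>i. \<integral>\<^sup>+x. ennreal (erlang_density i rate x) * indicator {..1} x \<partial>lborel)" by simp
  also have "\<dots> = (\<integral>\<^sup>+x. (\<Sum>i. ennreal (erlang_density i rate x) * indicator {..1} x) \<partial>lborel)"
    by (rule nn_integral_suminf[symmetric]) measurable
  also have "\<dots> = (\<integral>\<^sup>+x. ennreal rate * indicator {0..1::real} x \<partial>lborel)"
  proof (rule nn_integral_cong)
    fix x :: real
    show "(\<Sum>i. ennreal (erlang_density i rate x) * indicator {..1} x) = ennreal rate * indicator {0..1} x"
    proof (cases "x < 0")
      case True
      then show ?thesis by (simp add: erlang_density_def)
    next
      case False
      have "(\<lambda>i. (rate * x) ^ i /\<^sub>R fact i) sums exp (rate * x)" by (rule exp_converges)
      then have "(\<lambda>i. rate * exp (- rate * x) * ((rate * x) ^ i /\<^sub>R fact i)) sums (rate * exp (- rate * x) * exp (rate * x))"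
        by (rule sums_mult)
      moreover have "rate * exp (- rate * x) * ((rate * x) ^ i /\<^sub>R fact i) = erlang_density i rate x" for i
        using False by (simp add: erlang_density_def power_mult_distrib field_simps)
      moreover have "rate * exp (- rate * x) * exp (rate * x) = rate" by (simp add: exp_minus)
      ultimately have "(\<lambda>i. erlang_density i rate x) sums rate" by (simp only:)
      then have "(\<Sum>i. ennreal (erlang_density i rate x)) = ennreal rate"
        using rate_pos by (intro suminf_ennreal_eq) auto
      then show ?thesis using False by (auto simp: indicator_def)
    qed
  qed
  also have "\<dots> = ennreal rate" by (simp add: nn_integral_cmult)
  finally show ?thesis .
qed

text \<open>Jumps in (0, 1] with square in A are counted one by one: the ith contributes if its
  arrival time is at most 1 and its mark lies in A, and these two events are independent.\<close>

lemma levy_measure_sq: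
  assumes A[measurable]: "A \<in> sets borel"
  shows "emeasure \<nu> {y. y\<^sup>2 \<in> A} = ennreal rate * emeasure mark_law A"
proof -
  have eqs: "sets pair_law = sets (borel \<Otimes>\<^sub>M borel)" by (rule pair_law)
  note [measurable_cong] = eqs
  note [measurable] = marks_measurable(2)
  have "emeasure \<nu> {y. y\<^sup>2 \<in> A} = (\<integral>\<^sup>+\<omega>. emeasure (count_space UNIV)
           {s \<in> {0<..1}. jump (path \<omega>) s \<noteq> 0 \<and> jump (path \<omega>) s \<in> {y. y\<^sup>2 \<in> A}} \<partial>M)"
    by (rule bspec[OF conjunct2[OF levy_measure[unfolded has_levy_measure_def]]]) measurable
  also have "\<dots> = (\<integral>\<^sup>+\<omega>. (\<Sum>i. indicator {\<omega>\<in>space M. (\<Sum>j<Suc i. T (Suc j) \<omega>) \<le> 1 \<and> Z (Suc i) \<omega> \<in> A} \<omega>) \<partial>M)"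
  proof (rule nn_integral_cong_AE, use AE_good AE_space in eventually_elim)
    case (elim \<omega>)
    interpret jump_path "path \<omega>" using elim by (simp add: good_def)
    have G: "(\<Sum>j<Suc i. T (Suc j) \<omega>) = jt (Suc i)" for i
      using good_Gamma[OF elim(1), of "Suc i"] by (simp only: One_nat_def sum.atLeast1_atMost_eq)
    have Zi: "Z (Suc i) \<omega> = (jump (path \<omega>) (jt (Suc i)))\<^sup>2" for i using elim by (simp add: good_def)
    let ?I = "{i. jt (Suc i) \<le> 1 \<and> Z (Suc i) \<omega> \<in> A}"
    have fin: "finite ?I"
    proof -
      obtain n where "1 < jt n" using jt_unbounded by blast
      then have "?I \<subseteq> {..<n}" using jt_less_iff by (auto intro: ccontr) (meson Suc_lessD le_less_trans)
      then show ?thesis using finite_subset by blast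
    qed
    have img: "{s \<in> {0<..1}. jump (path \<omega>) s \<noteq> 0 \<and> jump (path \<omega>) s \<in> {y. y\<^sup>2 \<in> A}} = (\<lambda>i. jt (Suc i)) ` ?I"
    proof safe
      fix s assume s: "s \<in> {0<..1}" "jump (path \<omega>) s \<noteq> 0" "(jump (path \<omega>) s)\<^sup>2 \<in> A"
      then have "s \<in> jumps (path \<omega>) \<inter> {..s}" by (auto simp: jumps_def)
      moreover obtain n where n: "jt n \<le> s" "s < jt (Suc n)" using jt_bracket[of s] s by auto
      ultimately obtain i where "s = jt i" "i \<in> {1..n}" using jumps_upto[OF n] by auto
      then obtain k where "s = jt (Suc k)" by (cases i) auto
      then show "s \<in> (\<lambda>i. jt (Suc i)) ` ?I" using s Zi by auto
    next
      fix i assume "jt (Suc i) \<le> 1" "Z (Suc i) \<omega> \<in> A"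
      then show "jt (Suc i) \<in> {0<..1}" "(jump (path \<omega>) (jt (Suc i)))\<^sup>2 \<in> A"
        "jump (path \<omega>) (jt (Suc i)) = 0 \<Longrightarrow> False"
        using jt_Suc(1)[of i] Zi[of i] by (auto simp: jumps_def)
    qed
    have inj: "inj_on (\<lambda>i. jt (Suc i)) ?I"
      by (auto intro!: inj_onI simp: strict_mono_eq[OF jt_strict_mono])
    have "emeasure (count_space UNIV) {s \<in> {0<..1}. jump (path \<omega>) s \<noteq> 0 \<and> jump (path \<omega>) s \<in> {y. y\<^sup>2 \<in> A}} = of_nat (card ?I)"
      unfolding img using fin inj by (simp add: card_image)
    also have "\<dots> = (\<Sum>i\<in>?I. indicator {\<omega>\<in>space M. (\<Sum>j<Suc i. T (Suc j) \<omega>) \<le> 1 \<and> Z (Suc i) \<omega> \<in> A} \<omega>)"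
      using elim(2) by (simp add: G del: sum.lessThan_Suc)
    also have "\<dots> = (\<Sum>i. indicator {\<omega>\<in>space M. (\<Sum>j<Suc i. T (Suc j) \<omega>) \<le> 1 \<and> Z (Suc i) \<omega> \<in> A} \<omega>)"
      by (rule suminf_finite[symmetric, OF fin]) (auto simp: G simp del: sum.lessThan_Suc)
    finally show ?case .
  qed
  also have "\<dots> = (\<Sum>i. emeasure M {\<omega>\<in>space M. (\<Sum>j<Suc i. T (Suc j) \<omega>) \<le> 1 \<and> Z (Suc i) \<omega> \<in> A})"
    by (subst nn_integral_suminf) auto
  also have "\<dots> = (\<Sum>i. emeasure M {\<omega>\<in>space M. (\<Sum>j<Suc i. T (Suc j) \<omega>) \<le> 1} * emeasure mark_law A)"
  proof (rule arg_cong[where f=suminf], rule ext)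
    fix i
    have "emeasure M {\<omega>\<in>space M. (\<Sum>j<Suc i. T (Suc j) \<omega>) \<le> 1 \<and> Z (Suc i) \<omega> \<in> A} =
      emeasure (distr M seq_law marks) {x\<in>space seq_law. (\<Sum>j<Suc i. fst (x j)) \<le> 1 \<and> snd (x i) \<in> A}"
      by (subst emeasure_distr) (use measurable_space[OF marks_measurable(2)] in \<open>auto simp: marks_def intro!: arg_cong[where f="emeasure M"]\<close>)
    also have "\<dots> = emeasure (distr M seq_law marks) {x\<in>space seq_law. (\<Sum>j<Suc i. fst (x j)) \<le> 1} * emeasure mark_law A"
      unfolding marks_distr by (rule emeasure_mark_indep) fact
    also have "emeasure (distr M seq_law marks) {x\<in>space seq_law. (\<Sum>j<Suc i. fst (x j)) \<le> 1} =
      emeasure M {\<omega>\<in>space M. (\<Sum>j<Suc i. T (Suc j) \<omega>) \<le> 1}"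
      by (subst emeasure_distr) (use measurable_space[OF marks_measurable(2)] in \<open>auto simp: marks_def intro!: arg_cong[where f="emeasure M"]\<close>)
    finally show "emeasure M {\<omega>\<in>space M. (\<Sum>j<Suc i. T (Suc j) \<omega>) \<le> 1 \<and> Z (Suc i) \<omega> \<in> A} =
      emeasure M {\<omega>\<in>space M. (\<Sum>j<Suc i. T (Suc j) \<omega>) \<le> 1} * emeasure mark_law A" .
  qed
  also have "\<dots> = ennreal rate * emeasure mark_law A"
    using expected_count by simp
  finally show ?thesis .
qed

text \<open>The image of \<nu> under squaring is \<open>rate\<close> times the mark law, which
  translates the integral condition into a mean of the marks.\<close>

lemma nn_integral_levy_measure:
  assumes g[measurable]: "g \<in> borel_measurable borel"
  shows "(\<integral>\<^sup>+y. g (y\<^sup>2) \<partial>\<nu>) = ennreal rate * (\<integral>\<^sup>+z. g z \<partial>mark_law)"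
proof -
  have \<nu>s[measurable_cong]: "sets \<nu> = sets borel" using levy_measure unfolding has_levy_measure_def by auto
  have "distr \<nu> borel (\<lambda>y. y\<^sup>2) = density mark_law (\<lambda>_. ennreal rate)"
  proof (rule measure_eqI)
    fix A assume "A \<in> sets (distr \<nu> borel (\<lambda>y. y\<^sup>2))"
    then have A[measurable]: "A \<in> sets borel" by simp
    have "emeasure (distr \<nu> borel (\<lambda>y. y\<^sup>2)) A = emeasure \<nu> {y. y\<^sup>2 \<in> A}"
      by (subst emeasure_distr) (auto simp: sets_eq_imp_space_eq[OF \<nu>s] vimage_def)
    then show "emeasure (distr \<nu> borel (\<lambda>y. y\<^sup>2)) A = emeasure (density mark_law (\<lambda>_. ennreal rate)) A"
      using levy_measure_sq[OF A] A by (simp add: emeasure_density_const mark_law)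
  qed (simp add: mark_law)
  then have "(\<integral>\<^sup>+z. g z \<partial>distr \<nu> borel (\<lambda>y. y\<^sup>2)) = (\<integral>\<^sup>+z. ennreal rate * g z \<partial>mark_law)"
    using mark_law(2) by (simp add: nn_integral_density cong: measurable_cong_sets)
  then show ?thesis
    using mark_law(2) by (simp add: nn_integral_distr nn_integral_cmult cong: measurable_cong_sets)
qed

end

section \<open>Iterated random maps\<close>

primrec fwd :: "('s \<Rightarrow> 'a \<Rightarrow> 'a) \<Rightarrow> nat \<Rightarrow> (nat \<Rightarrow> 's) \<Rightarrow> 'a \<Rightarrow> 'a" where
  "fwd \<phi> 0 \<omega> x = x"
| "fwd \<phi> (Suc n) \<omega> x = \<phi> (\<omega> n) (fwd \<phi> n \<omega> x)"

text \<open>Each new map is inserted innermost. Under contraction the values then converge for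
  almost every sequence, whereas \<open>fwd\<close>, which applies the new map outermost, in general
  converges in law only.\<close>

primrec bwd :: "('s \<Rightarrow> 'a \<Rightarrow> 'a) \<Rightarrow> nat \<Rightarrow> (nat \<Rightarrow> 's) \<Rightarrow> 'a \<Rightarrow> 'a" where
  "bwd \<phi> 0 \<omega> x = x"
| "bwd \<phi> (Suc n) \<omega> x = bwd \<phi> n \<omega> (\<phi> (\<omega> n) x)"

lemma fwd_case_nat: "fwd \<phi> (Suc n) (case_nat s \<omega>) x = fwd \<phi> n \<omega> (\<phi> s x)"
  by (induction n arbitrary: x) auto

lemma bwd_case_nat: "bwd \<phi> (Suc n) (case_nat s \<omega>) x = \<phi> s (bwd \<phi> n \<omega> x)"
  by (induction n arbitrary: x) auto

lemma fwd_measurable: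
  assumes \<phi>: "(\<lambda>(s, x). \<phi> s x) \<in> \<rho> \<Otimes>\<^sub>M N \<rightarrow>\<^sub>M N"
    and f: "f \<in> K \<rightarrow>\<^sub>M Pi\<^sub>M UNIV (\<lambda>_::nat. \<rho>)" and g: "g \<in> K \<rightarrow>\<^sub>M N"
  shows "(\<lambda>w. fwd \<phi> n (f w) (g w)) \<in> K \<rightarrow>\<^sub>M N"
proof (induction n)
  case (Suc n)
  note [measurable] = Suc f
  have "(\<lambda>w. (\<lambda>(s, x). \<phi> s x) (f w n, fwd \<phi> n (f w) (g w))) \<in> K \<rightarrow>\<^sub>M N"
    by (rule measurable_compose[OF _ \<phi>]) measurable
  then show ?case by simp
qed (simp add: g)

lemma bwd_measurable:
  assumes \<phi>: "(\<lambda>(s, x). \<phi> s x) \<in> \<rho> \<Otimes>\<^sub>M N \<rightarrow>\<^sub>M N"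
    and f: "f \<in> K \<rightarrow>\<^sub>M Pi\<^sub>M UNIV (\<lambda>_::nat. \<rho>)" and g: "g \<in> K \<rightarrow>\<^sub>M N"
  shows "(\<lambda>w. bwd \<phi> n (f w) (g w)) \<in> K \<rightarrow>\<^sub>M N"
  using g
proof (induction n arbitrary: g)
  case (Suc n)
  note [measurable] = Suc.prems f
  have "(\<lambda>w. (\<lambda>(s, x). \<phi> s x) (f w n, g w)) \<in> K \<rightarrow>\<^sub>M N"
    by (rule measurable_compose[OF _ \<phi>]) measurable
  then show ?case using Suc.IH by simp
qed simp

lemma distr_case_nat:
  assumes "prob_space \<rho>"
  shows "distr (\<rho> \<Otimes>\<^sub>M Pi\<^sub>M UNIV (\<lambda>_::nat. \<rho>)) (Pi\<^sub>M UNIV (\<lambda>_::nat. \<rho>)) (\<lambda>(s, \<omega>). case_nat s \<omega>) = Pi\<^sub>M UNIV (\<lambda>_::nat. \<rho>)"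
proof -
  interpret prob_space \<rho> by fact
  interpret sequence_space \<rho> by unfold_locales
  show ?thesis by (rule PiM_iter)
qed

locale random_maps =
  fixes \<rho> :: "'s measure" and N :: "'a measure" and \<phi> :: "'s \<Rightarrow> 'a \<Rightarrow> 'a"
  assumes \<rho>: "prob_space \<rho>" and \<phi>: "(\<lambda>(s, x). \<phi> s x) \<in> \<rho> \<Otimes>\<^sub>M N \<rightarrow>\<^sub>M N"
begin

abbreviation S :: "(nat \<Rightarrow> 's) measure" where
  "S \<equiv> Pi\<^sub>M UNIV (\<lambda>_::nat. \<rho>)"

sublocale R: prob_space \<rho> by (rule \<rho>)

lemma prob_space_S: "prob_space S" by (rule prob_space_PiM) (rule \<rho>)

lemma \<phi>_measurable [measurable (raw)]:
  "f \<in> K \<rightarrow>\<^sub>M \<rho> \<Longrightarrow> g \<in> K \<rightarrow>\<^sub>M N \<Longrightarrow> (\<lambda>w. \<phi> (f w) (g w)) \<in> K \<rightarrow>\<^sub>M N"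
  using measurable_compose[OF measurable_Pair \<phi>, of f K g] by simp

lemmas fwd_meas [measurable (raw)] = fwd_measurable[OF \<phi>]
lemmas bwd_meas [measurable (raw)] = bwd_measurable[OF \<phi>]

lemma nn_integral_fwd_Suc:
  assumes [measurable]: "g \<in> borel_measurable N" "x \<in> space N"
  shows "(\<integral>\<^sup>+\<omega>. g (fwd \<phi> (Suc n) \<omega> x) \<partial>S) = (\<integral>\<^sup>+s. \<integral>\<^sup>+\<omega>. g (fwd \<phi> n \<omega> (\<phi> s x)) \<partial>S \<partial>\<rho>)"
  by (subst nn_integral_PiM_iter[OF \<rho>], measurable) (simp only: fwd_case_nat)

lemma nn_integral_bwd_Suc:
  assumes [measurable]: "g \<in> borel_measurable N" "x \<in> space N"
  shows "(\<integral>\<^sup>+\<omega>. g (bwd \<phi> (Suc n) \<omega> x) \<partial>S) = (\<integral>\<^sup>+s. \<integral>\<^sup>+\<omega>. g (\<phi> s (bwd \<phi> n \<omega> x)) \<partial>S \<partial>\<rho>)"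
  by (subst nn_integral_PiM_iter[OF \<rho>], measurable) (simp only: bwd_case_nat)

lemma \<phi>_space: "s \<in> space \<rho> \<Longrightarrow> x \<in> space N \<Longrightarrow> \<phi> s x \<in> space N"
  using measurable_space[OF \<phi>, of "(s, x)"] by (simp add: space_pair_measure)

text \<open>The first coordinate is the innermost map of \<open>fwd\<close> and the outermost map of
  \<open>bwd\<close>. Splitting off one on each side and exchanging the two integrals leaves
  compositions of length n - 1 and n - 2, so the induction starts with 0 and 1.\<close>

lemma nn_integral_fwd_eq_bwd:
  assumes "g \<in> borel_measurable N" "x \<in> space N"
  shows "(\<integral>\<^sup>+\<omega>. g (fwd \<phi> n \<omega> x) \<partial>S) = (\<integral>\<^sup>+\<omega>. g (bwd \<phi> n \<omega> x) \<partial>S)"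
  using assms
proof (induction n arbitrary: g x rule: less_induct)
  case (less n)
  note [measurable] = less.prems
  interpret S: prob_space S by (rule prob_space_S)
  interpret RR: pair_sigma_finite \<rho> \<rho> by unfold_locales
  consider "n = 0" | "n = 1" | m where "n = Suc (Suc m)"
    by (metis One_nat_def not0_implies_Suc)
  then show ?case
  proof cases
    case 3
    have "(\<integral>\<^sup>+\<omega>. g (fwd \<phi> n \<omega> x) \<partial>S) = (\<integral>\<^sup>+s. \<integral>\<^sup>+\<omega>. g (fwd \<phi> (Suc m) \<omega> (\<phi> s x)) \<partial>S \<partial>\<rho>)"
      unfolding 3 by (rule nn_integral_fwd_Suc) fact+
    also have "\<dots> = (\<integral>\<^sup>+s. \<integral>\<^sup>+\<omega>. g (bwd \<phi> (Suc m) \<omega> (\<phi> s x)) \<partial>S \<partial>\<rho>)"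
      by (intro nn_integral_cong less.IH) (use 3 less.prems \<phi>_space in auto)
    also have "\<dots> = (\<integral>\<^sup>+s. \<integral>\<^sup>+s'. \<integral>\<^sup>+\<omega>. g (\<phi> s' (bwd \<phi> m \<omega> (\<phi> s x))) \<partial>S \<partial>\<rho> \<partial>\<rho>)"
      by (intro nn_integral_cong nn_integral_bwd_Suc) (use less.prems \<phi>_space in auto)
    also have "\<dots> = (\<integral>\<^sup>+s'. \<integral>\<^sup>+s. \<integral>\<^sup>+\<omega>. g (\<phi> s' (bwd \<phi> m \<omega> (\<phi> s x))) \<partial>S \<partial>\<rho> \<partial>\<rho>)"
      by (rule RR.Fubini') measurable
    also have "\<dots> = (\<integral>\<^sup>+s'. \<integral>\<^sup>+s. \<integral>\<^sup>+\<omega>. g (\<phi> s' (fwd \<phi> m \<omega> (\<phi> s x))) \<partial>S \<partial>\<rho> \<partial>\<rho>)"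
    proof (rule nn_integral_cong, rule nn_integral_cong)
      fix s' s assume s: "s' \<in> space \<rho>" "s \<in> space \<rho>"
      note [measurable] = s
      show "(\<integral>\<^sup>+\<omega>. g (\<phi> s' (bwd \<phi> m \<omega> (\<phi> s x))) \<partial>S) = (\<integral>\<^sup>+\<omega>. g (\<phi> s' (fwd \<phi> m \<omega> (\<phi> s x))) \<partial>S)"
      proof (rule less.IH[of m "\<lambda>x. g (\<phi> s' x)" "\<phi> s x", symmetric])
        show "\<phi> s x \<in> space N" using s less.prems \<phi>_space by auto
      qed (use 3 in simp_all)
    qed
    also have "\<dots> = (\<integral>\<^sup>+s'. \<integral>\<^sup>+\<omega>. g (\<phi> s' (fwd \<phi> (Suc m) \<omega> x)) \<partial>S \<partial>\<rho>)"
    proof (rule nn_integral_cong)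
      fix s' assume [measurable]: "s' \<in> space \<rho>"
      show "(\<integral>\<^sup>+s. \<integral>\<^sup>+\<omega>. g (\<phi> s' (fwd \<phi> m \<omega> (\<phi> s x))) \<partial>S \<partial>\<rho>) = (\<integral>\<^sup>+\<omega>. g (\<phi> s' (fwd \<phi> (Suc m) \<omega> x)) \<partial>S)"
        by (rule nn_integral_fwd_Suc[of "\<lambda>x. g (\<phi> s' x)", symmetric]) measurable
    qed
    also have "\<dots> = (\<integral>\<^sup>+s'. \<integral>\<^sup>+\<omega>. g (\<phi> s' (bwd \<phi> (Suc m) \<omega> x)) \<partial>S \<partial>\<rho>)"
    proof (rule nn_integral_cong)
      fix s' assume [measurable]: "s' \<in> space \<rho>"
      show "(\<integral>\<^sup>+\<omega>. g (\<phi> s' (fwd \<phi> (Suc m) \<omega> x)) \<partial>S) = (\<integral>\<^sup>+\<omega>. g (\<phi> s' (bwd \<phi> (Suc m) \<omega> x)) \<partial>S)"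
        by (rule less.IH[of "Suc m" "\<lambda>x. g (\<phi> s' x)" x]) (use 3 less.prems in simp_all)
    qed
    also have "\<dots> = (\<integral>\<^sup>+\<omega>. g (bwd \<phi> n \<omega> x) \<partial>S)"
      unfolding 3 by (rule nn_integral_bwd_Suc[symmetric]) fact+
    finally show ?thesis .
  qed auto
qed

text \<open>The first n maps involve only coordinates below n, so coordinate n may be integrated
  separately.\<close>

lemma nn_integral_fwd_next:
  assumes [measurable]: "(\<lambda>(y, s). h y s) \<in> borel_measurable (N \<Otimes>\<^sub>M \<rho>)" and "x \<in> space N"
  shows "(\<integral>\<^sup>+\<omega>. h (fwd \<phi> n \<omega> x) (\<omega> n) \<partial>S) = (\<integral>\<^sup>+\<omega>. \<integral>\<^sup>+s. h (fwd \<phi> n \<omega> x) s \<partial>\<rho> \<partial>S)"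
  using assms(2)
proof (induction n arbitrary: x)
  case 0
  interpret S: prob_space S by (rule prob_space_S)
  note [measurable] = 0
  show ?case by (subst nn_integral_PiM_iter[OF \<rho>], measurable) (simp add: S.emeasure_space_1)
next
  case (Suc n)
  note [measurable] = Suc.prems
  have "(\<integral>\<^sup>+\<omega>. h (fwd \<phi> (Suc n) \<omega> x) (\<omega> (Suc n)) \<partial>S) = (\<integral>\<^sup>+s'. \<integral>\<^sup>+\<omega>. h (fwd \<phi> n \<omega> (\<phi> s' x)) (\<omega> n) \<partial>S \<partial>\<rho>)"
    by (subst nn_integral_PiM_iter[OF \<rho>], measurable) (simp only: fwd_case_nat old.nat.case)
  also have "\<dots> = (\<integral>\<^sup>+s'. \<integral>\<^sup>+\<omega>. \<integral>\<^sup>+s. h (fwd \<phi> n \<omega> (\<phi> s' x)) s \<partial>\<rho> \<partial>S \<partial>\<rho>)"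
    by (intro nn_integral_cong Suc.IH) (use Suc.prems \<phi>_space in auto)
  also have "\<dots> = (\<integral>\<^sup>+\<omega>. \<integral>\<^sup>+s. h (fwd \<phi> (Suc n) \<omega> x) s \<partial>\<rho> \<partial>S)"
    by (rule nn_integral_fwd_Suc[symmetric]) measurable
  finally show ?case .
qed

lemma nn_integral_bwd_next:
  assumes [measurable]: "(\<lambda>(y, s). h y s) \<in> borel_measurable (N \<Otimes>\<^sub>M \<rho>)" and [measurable]: "x \<in> space N"
  shows "(\<integral>\<^sup>+\<omega>. h (bwd \<phi> n \<omega> x) (\<omega> n) \<partial>S) = (\<integral>\<^sup>+\<omega>. \<integral>\<^sup>+s. h (bwd \<phi> n \<omega> x) s \<partial>\<rho> \<partial>S)"
  using assms(1)
proof (induction n arbitrary: h)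
  case 0
  interpret S: prob_space S by (rule prob_space_S)
  note [measurable] = 0
  show ?case by (subst nn_integral_PiM_iter[OF \<rho>], measurable) (simp add: S.emeasure_space_1)
next
  case (Suc n)
  note [measurable] = Suc.prems
  have "(\<integral>\<^sup>+\<omega>. h (bwd \<phi> (Suc n) \<omega> x) (\<omega> (Suc n)) \<partial>S) = (\<integral>\<^sup>+s'. \<integral>\<^sup>+\<omega>. h (\<phi> s' (bwd \<phi> n \<omega> x)) (\<omega> n) \<partial>S \<partial>\<rho>)"
    by (subst nn_integral_PiM_iter[OF \<rho>], measurable) (simp only: bwd_case_nat old.nat.case)
  also have "\<dots> = (\<integral>\<^sup>+s'. \<integral>\<^sup>+\<omega>. \<integral>\<^sup>+s. h (\<phi> s' (bwd \<phi> n \<omega> x)) s \<partial>\<rho> \<partial>S \<partial>\<rho>)"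
  proof (rule nn_integral_cong)
    fix s' assume [measurable]: "s' \<in> space \<rho>"
    show "(\<integral>\<^sup>+\<omega>. h (\<phi> s' (bwd \<phi> n \<omega> x)) (\<omega> n) \<partial>S) = (\<integral>\<^sup>+\<omega>. \<integral>\<^sup>+s. h (\<phi> s' (bwd \<phi> n \<omega> x)) s \<partial>\<rho> \<partial>S)"
      by (rule Suc.IH[of "\<lambda>y s. h (\<phi> s' y) s"]) simp
  qed
  also have "\<dots> = (\<integral>\<^sup>+\<omega>. \<integral>\<^sup>+s. h (bwd \<phi> (Suc n) \<omega> x) s \<partial>\<rho> \<partial>S)"
    by (rule nn_integral_bwd_Suc[symmetric]) measurable
  finally show ?case .
qed

text \<open>Whether a fixed time falls into the current gap depends on coordinate n too, so the
  reversal is needed jointly with this fresh coordinate, which is independent of the first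
  n.\<close>

lemma nn_integral_fwd_eq_bwd_next:
  assumes [measurable]: "(\<lambda>(y, s). h y s) \<in> borel_measurable (N \<Otimes>\<^sub>M \<rho>)" and x: "x \<in> space N"
  shows "(\<integral>\<^sup>+\<omega>. h (fwd \<phi> n \<omega> x) (\<omega> n) \<partial>S) = (\<integral>\<^sup>+\<omega>. h (bwd \<phi> n \<omega> x) (\<omega> n) \<partial>S)"
  unfolding nn_integral_fwd_next[OF assms] nn_integral_bwd_next[OF assms]
  by (rule nn_integral_fwd_eq_bwd[OF _ x]) measurable

definition invariant :: "'a measure \<Rightarrow> bool" where
  "invariant \<pi> \<longleftrightarrow> prob_space \<pi> \<and> sets \<pi> = sets N \<and>
    (\<forall>g\<in>borel_measurable N. (\<integral>\<^sup>+x. \<integral>\<^sup>+s. g (\<phi> s x) \<partial>\<rho> \<partial>\<pi>) = (\<integral>\<^sup>+x. g x \<partial>\<pi>))"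

lemma invariant_iff_distr:
  assumes \<pi>: "prob_space \<pi>" "sets \<pi> = sets N"
  shows "invariant \<pi> \<longleftrightarrow> distr (\<pi> \<Otimes>\<^sub>M \<rho>) N (\<lambda>(x, s). \<phi> s x) = \<pi>"
proof -
  note [measurable_cong] = \<pi>(2)
  have m: "(\<lambda>(x, s). \<phi> s x) \<in> \<pi> \<Otimes>\<^sub>M \<rho> \<rightarrow>\<^sub>M N" by measurable
  have eq: "(\<integral>\<^sup>+x. \<integral>\<^sup>+s. g (\<phi> s x) \<partial>\<rho> \<partial>\<pi>) = (\<integral>\<^sup>+x. g x \<partial>distr (\<pi> \<Otimes>\<^sub>M \<rho>) N (\<lambda>(x, s). \<phi> s x))"
    if [measurable]: "g \<in> borel_measurable N" for g
  proof -
    have "(\<integral>\<^sup>+x. g x \<partial>distr (\<pi> \<Otimes>\<^sub>M \<rho>) N (\<lambda>(x, s). \<phi> s x)) = (\<integral>\<^sup>+p. g (case p of (x, s) \<Rightarrow> \<phi> s x) \<partial>(\<pi> \<Otimes>\<^sub>M \<rho>))"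
      by (subst nn_integral_distr[OF m]) auto
    also have "\<dots> = (\<integral>\<^sup>+x. \<integral>\<^sup>+s. g (\<phi> s x) \<partial>\<rho> \<partial>\<pi>)"
      by (subst R.nn_integral_fst[symmetric]) auto
    finally show ?thesis by simp
  qed
  show ?thesis
  proof
    assume inv: "invariant \<pi>"
    show "distr (\<pi> \<Otimes>\<^sub>M \<rho>) N (\<lambda>(x, s). \<phi> s x) = \<pi>"
    proof (rule measure_eqI)
      fix A assume "A \<in> sets (distr (\<pi> \<Otimes>\<^sub>M \<rho>) N (\<lambda>(x, s). \<phi> s x))"
      then have A[measurable]: "A \<in> sets N" by simp
      have "(\<integral>\<^sup>+x. indicator A x \<partial>distr (\<pi> \<Otimes>\<^sub>M \<rho>) N (\<lambda>(x, s). \<phi> s x)) = (\<integral>\<^sup>+x. indicator A x \<partial>\<pi>)"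
        using inv eq[of "indicator A"] unfolding invariant_def by simp
      then show "emeasure (distr (\<pi> \<Otimes>\<^sub>M \<rho>) N (\<lambda>(x, s). \<phi> s x)) A = emeasure \<pi> A"
        using \<pi>(2) by simp
    qed (simp add: \<pi>)
  next
    assume "distr (\<pi> \<Otimes>\<^sub>M \<rho>) N (\<lambda>(x, s). \<phi> s x) = \<pi>"
    then show "invariant \<pi>" unfolding invariant_def using \<pi> eq by simp
  qed
qed

text \<open>Started from an invariant law, the composition keeps this law at every stage, also when
  the maps are applied in backward order.\<close>

lemma invariant_bwd:
  assumes inv: "invariant \<pi>" and g: "g \<in> borel_measurable N"
  shows "(\<integral>\<^sup>+x. \<integral>\<^sup>+\<omega>. g (bwd \<phi> n \<omega> x) \<partial>S \<partial>\<pi>) = (\<integral>\<^sup>+x. g x \<partial>\<pi>)"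
  using g
proof (induction n arbitrary: g)
  case 0
  interpret S: prob_space S by (rule prob_space_S)
  show ?case by (simp add: S.emeasure_space_1)
next
  case (Suc n)
  note [measurable] = Suc.prems
  have \<pi>: "prob_space \<pi>" "sets \<pi> = sets N" using inv unfolding invariant_def by auto
  interpret \<pi>: prob_space \<pi> by (rule \<pi>)
  interpret S: prob_space S by (rule prob_space_S)
  note [measurable_cong] = \<pi>(2)
  interpret PR: pair_sigma_finite \<pi> \<rho> by unfold_locales
  have "(\<integral>\<^sup>+x. \<integral>\<^sup>+\<omega>. g (bwd \<phi> (Suc n) \<omega> x) \<partial>S \<partial>\<pi>) = (\<integral>\<^sup>+x. \<integral>\<^sup>+s. \<integral>\<^sup>+\<omega>. g (\<phi> s (bwd \<phi> n \<omega> x)) \<partial>S \<partial>\<rho> \<partial>\<pi>)"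
    by (intro nn_integral_cong nn_integral_bwd_Suc) (use Suc.prems sets_eq_imp_space_eq[OF \<pi>(2)] in auto)
  also have "\<dots> = (\<integral>\<^sup>+s. \<integral>\<^sup>+x. \<integral>\<^sup>+\<omega>. g (\<phi> s (bwd \<phi> n \<omega> x)) \<partial>S \<partial>\<pi> \<partial>\<rho>)"
    by (rule PR.Fubini'[symmetric]) measurable
  also have "\<dots> = (\<integral>\<^sup>+s. \<integral>\<^sup>+x. g (\<phi> s x) \<partial>\<pi> \<partial>\<rho>)"
  proof (rule nn_integral_cong)
    fix s assume [measurable]: "s \<in> space \<rho>"
    show "(\<integral>\<^sup>+x. \<integral>\<^sup>+\<omega>. g (\<phi> s (bwd \<phi> n \<omega> x)) \<partial>S \<partial>\<pi>) = (\<integral>\<^sup>+x. g (\<phi> s x) \<partial>\<pi>)"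
      by (rule Suc.IH[of "\<lambda>x. g (\<phi> s x)"]) simp
  qed
  also have "\<dots> = (\<integral>\<^sup>+x. \<integral>\<^sup>+s. g (\<phi> s x) \<partial>\<rho> \<partial>\<pi>)"
    by (rule PR.Fubini') measurable
  also have "\<dots> = (\<integral>\<^sup>+x. g x \<partial>\<pi>)" using inv Suc.prems unfolding invariant_def by blast
  finally show ?case .
qed

end

lemma integral_eq_enn2real:
  fixes f :: "'a \<Rightarrow> real"
  assumes "f \<in> borel_measurable M" "\<And>x. 0 \<le> f x"
  shows "integral\<^sup>L M f = enn2real (\<integral>\<^sup>+x. ennreal (f x) \<partial>M)"
  using assms by (intro integral_eq_nn_integral) auto

text \<open>Letac's principle: an almost sure limit of the backward iteration carries the only
  invariant law.\<close>

theorem letac: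
  fixes \<phi> :: "'s \<Rightarrow> 'a::metric_space \<Rightarrow> 'a"
  assumes maps: "random_maps \<rho> borel \<phi>"
    and cont: "\<And>s. s \<in> space \<rho> \<Longrightarrow> continuous_on UNIV (\<phi> s)"
    and W[measurable]: "W \<in> borel_measurable (Pi\<^sub>M UNIV (\<lambda>_::nat. \<rho>))"
    and lim: "AE \<omega> in Pi\<^sub>M UNIV (\<lambda>_::nat. \<rho>). \<forall>x. (\<lambda>n. bwd \<phi> n \<omega> x) \<longlonglongrightarrow> W \<omega>"
  shows "random_maps.invariant \<rho> borel \<phi> \<pi> \<longleftrightarrow> \<pi> = distr (Pi\<^sub>M UNIV (\<lambda>_::nat. \<rho>)) borel W"
proof -
  interpret random_maps \<rho> borel \<phi> by (rule maps)
  interpret S: prob_space S by (rule prob_space_S)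
  have WI: "prob_space (distr S borel W)" by (rule S.prob_space_distr) simp
  have "invariant (distr S borel W)"
    unfolding invariant_def
  proof (intro conjI ballI)
    fix g :: "'a \<Rightarrow> ennreal" assume [measurable]: "g \<in> borel_measurable borel"
    interpret RS: pair_sigma_finite \<rho> S by unfold_locales
    have "AE \<omega> in distr (\<rho> \<Otimes>\<^sub>M S) S (\<lambda>(s, \<omega>). case_nat s \<omega>). \<forall>x. (\<lambda>n. bwd \<phi> n \<omega> x) \<longlonglongrightarrow> W \<omega>"
      using lim unfolding distr_case_nat[OF \<rho>] .
    then have "AE p in \<rho> \<Otimes>\<^sub>M S. \<forall>x. (\<lambda>n. bwd \<phi> n (case p of (s, \<omega>) \<Rightarrow> case_nat s \<omega>) x) \<longlonglongrightarrow> W (case p of (s, \<omega>) \<Rightarrow> case_nat s \<omega>)"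
      by (rule AE_distrD[rotated]) measurable
    then have "AE p in \<rho> \<Otimes>\<^sub>M S. \<forall>x. (\<lambda>n. bwd \<phi> n (case_nat (fst p) (snd p)) x) \<longlonglongrightarrow> W (case_nat (fst p) (snd p))"
      by (simp add: case_prod_unfold)
    then have 1: "AE s in \<rho>. AE \<omega> in S. \<forall>x. (\<lambda>n. bwd \<phi> n (case_nat s \<omega>) x) \<longlonglongrightarrow> W (case_nat s \<omega>)"
      using RS.AE_pair by force
    \<comment> \<open>Prepending a map to the sequence applies it to the limit, by continuity: this
      is the distributional fixed point equation on the level of sequences.\<close>
    have 2: "AE s in \<rho>. AE \<omega> in S. W (case_nat s \<omega>) = \<phi> s (W \<omega>)"
      using 1 AE_space
    proof eventually_elim
      case (elim s)
      show ?case using elim(1) lim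
      proof eventually_elim
        case (elim \<omega>)
        have "(\<lambda>n. bwd \<phi> (Suc n) (case_nat s \<omega>) undefined) \<longlonglongrightarrow> W (case_nat s \<omega>)"
          using elim by (intro LIMSEQ_Suc) blast
        moreover have "(\<lambda>n. bwd \<phi> (Suc n) (case_nat s \<omega>) undefined) \<longlonglongrightarrow> \<phi> s (W \<omega>)"
          unfolding bwd_case_nat
          by (rule continuous_on_tendsto_compose[OF cont]) (use \<open>s \<in> space \<rho>\<close> elim in auto)
        ultimately show ?case by (rule LIMSEQ_unique)
      qed
    qed
    have "(\<integral>\<^sup>+x. g x \<partial>distr S borel W) = (\<integral>\<^sup>+\<omega>. g (W \<omega>) \<partial>S)" by (rule nn_integral_distr) measurable
    also have "\<dots> = (\<integral>\<^sup>+s. \<integral>\<^sup>+\<omega>. g (W (case_nat s \<omega>)) \<partial>S \<partial>\<rho>)"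
      by (rule nn_integral_PiM_iter[OF \<rho>]) measurable
    also have "\<dots> = (\<integral>\<^sup>+s. \<integral>\<^sup>+\<omega>. g (\<phi> s (W \<omega>)) \<partial>S \<partial>\<rho>)"
      by (rule nn_integral_cong_AE, use 2 in eventually_elim, rule nn_integral_cong_AE) auto
    also have "\<dots> = (\<integral>\<^sup>+\<omega>. \<integral>\<^sup>+s. g (\<phi> s (W \<omega>)) \<partial>\<rho> \<partial>S)"
      by (rule RS.Fubini'[symmetric]) measurable
    also have "\<dots> = (\<integral>\<^sup>+x. \<integral>\<^sup>+s. g (\<phi> s x) \<partial>\<rho> \<partial>distr S borel W)"
      by (rule nn_integral_distr[symmetric]) measurable
    finally show "(\<integral>\<^sup>+x. \<integral>\<^sup>+s. g (\<phi> s x) \<partial>\<rho> \<partial>distr S borel W) = (\<integral>\<^sup>+x. g x \<partial>distr S borel W)" by simp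
  qed (use WI in auto)
  moreover have "\<pi> = distr S borel W" if inv: "invariant \<pi>"
  proof -
    have \<pi>: "prob_space \<pi>" "sets \<pi> = sets borel" using inv unfolding invariant_def by auto
    interpret \<pi>: prob_space \<pi> by (rule \<pi>)
    note [measurable_cong] = \<pi>(2)
    interpret PS: pair_prob_space \<pi> S by unfold_locales
    show ?thesis
    proof (rule measure_eqI_bounded_continuous[OF \<pi> WI])
      fix f :: "'a \<Rightarrow> real"
      assume f: "continuous_on UNIV f" "\<And>x. 0 \<le> f x" "\<And>x. f x \<le> 1"
      have [measurable]: "f \<in> borel_measurable borel" using f by (intro borel_measurable_continuous_onI)
      \<comment> \<open>With an initial point drawn from \<pi> the backward composition has law
        \<pi> for every n, yet it converges to W from every starting point.\<close>
      have "(\<lambda>n. \<integral>\<^sup>+p. ennreal (f (bwd \<phi> n (snd p) (fst p))) \<partial>(\<pi> \<Otimes>\<^sub>M S)) \<longlonglongrightarrow> (\<integral>\<^sup>+p. ennreal (f (W (snd p))) \<partial>(\<pi> \<Otimes>\<^sub>M S))"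
      proof (rule nn_integral_dominated_convergence[where w="\<lambda>_. 1"])
        show "AE p in \<pi> \<Otimes>\<^sub>M S. (\<lambda>n. ennreal (f (bwd \<phi> n (snd p) (fst p)))) \<longlonglongrightarrow> ennreal (f (W (snd p)))"
        proof -
          have "AE \<omega> in distr (\<pi> \<Otimes>\<^sub>M S) S snd. \<forall>x. (\<lambda>n. bwd \<phi> n \<omega> x) \<longlonglongrightarrow> W \<omega>"
          proof -
            have "distr (\<pi> \<Otimes>\<^sub>M S) S snd = S"
            proof (rule measure_eqI)
              fix A assume "A \<in> sets (distr (\<pi> \<Otimes>\<^sub>M S) S snd)"
              then have A[measurable]: "A \<in> sets S" by simp
              have "snd -` A \<inter> space (\<pi> \<Otimes>\<^sub>M S) = space \<pi> \<times> A"
                using sets.sets_into_space[OF A] by (auto simp: space_pair_measure)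
              then show "emeasure (distr (\<pi> \<Otimes>\<^sub>M S) S snd) A = emeasure S A"
                by (subst emeasure_distr) (auto simp: S.emeasure_pair_measure_Times \<pi>.emeasure_space_1)
            qed simp
            then show ?thesis by (simp only: lim)
          qed
          then have "AE p in \<pi> \<Otimes>\<^sub>M S. \<forall>x. (\<lambda>n. bwd \<phi> n (snd p) x) \<longlonglongrightarrow> W (snd p)"
            by (rule AE_distrD[rotated]) measurable
          then show ?thesis
            by eventually_elim (auto intro!: tendsto_ennrealI continuous_on_tendsto_compose[OF f(1)])
        qed
      qed (use f in \<open>auto simp: PS.emeasure_space_1\<close>)
      moreover have "(\<integral>\<^sup>+p. ennreal (f (bwd \<phi> n (snd p) (fst p))) \<partial>(\<pi> \<Otimes>\<^sub>M S)) = (\<integral>\<^sup>+x. ennreal (f x) \<partial>\<pi>)" for n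
        using invariant_bwd[OF inv, of "\<lambda>x. ennreal (f x)" n]
        by (subst S.nn_integral_fst[symmetric]) auto
      ultimately have "(\<lambda>n. \<integral>\<^sup>+x. ennreal (f x) \<partial>\<pi>) \<longlonglongrightarrow> (\<integral>\<^sup>+p. ennreal (f (W (snd p))) \<partial>(\<pi> \<Otimes>\<^sub>M S))"
        by (simp only:)
      from LIMSEQ_unique[OF tendsto_const this]
      have "(\<integral>\<^sup>+x. ennreal (f x) \<partial>\<pi>) = (\<integral>\<^sup>+p. ennreal (f (W (snd p))) \<partial>(\<pi> \<Otimes>\<^sub>M S))" .
      also have "\<dots> = (\<integral>\<^sup>+\<omega>. ennreal (f (W \<omega>)) \<partial>S)"
        by (subst S.nn_integral_fst[symmetric]) (auto simp: \<pi>.emeasure_space_1)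
      also have "\<dots> = (\<integral>\<^sup>+x. ennreal (f x) \<partial>distr S borel W)"
        by (rule nn_integral_distr[symmetric]) measurable
      finally show "integral\<^sup>L \<pi> f = integral\<^sup>L (distr S borel W) f"
        using f by (subst (1 2) integral_eq_enn2real) auto
    qed simp
  qed
  ultimately show ?thesis by blast
qed

section \<open>Random walks with negative drift\<close>

lemma integral_PiM_case_nat:
  fixes F :: "(nat \<Rightarrow> 's) \<Rightarrow> real"
  assumes \<rho>: "prob_space \<rho>" and F[measurable]: "F \<in> borel_measurable (Pi\<^sub>M UNIV (\<lambda>_::nat. \<rho>))"
  shows "(\<integral>\<omega>. F \<omega> \<partial>Pi\<^sub>M UNIV (\<lambda>_::nat. \<rho>)) = (\<integral>p. F (case_nat (fst p) (snd p)) \<partial>(\<rho> \<Otimes>\<^sub>M Pi\<^sub>M UNIV (\<lambda>_::nat. \<rho>)))"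
proof -
  have "(\<integral>\<omega>. F \<omega> \<partial>Pi\<^sub>M UNIV (\<lambda>_::nat. \<rho>)) =
    (\<integral>\<omega>. F \<omega> \<partial>distr (\<rho> \<Otimes>\<^sub>M Pi\<^sub>M UNIV (\<lambda>_::nat. \<rho>)) (Pi\<^sub>M UNIV (\<lambda>_::nat. \<rho>)) (\<lambda>(s, \<omega>). case_nat s \<omega>))"
    by (simp only: distr_case_nat[OF \<rho>])
  also have "\<dots> = (\<integral>p. F (case p of (s, \<omega>) \<Rightarrow> case_nat s \<omega>) \<partial>(\<rho> \<Otimes>\<^sub>M Pi\<^sub>M UNIV (\<lambda>_::nat. \<rho>)))"
    by (rule integral_distr) measurable
  finally show ?thesis by (simp add: case_prod_unfold)
qed

text \<open>The maximum of the partial sums of length 0 to n, in the recursion that exposes the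
  first step.\<close>

primrec max_walk :: "('s \<Rightarrow> real) \<Rightarrow> nat \<Rightarrow> (nat \<Rightarrow> 's) \<Rightarrow> real" where
  "max_walk X 0 \<omega> = 0"
| "max_walk X (Suc n) \<omega> = max 0 (X (\<omega> 0) + max_walk X n (\<lambda>i. \<omega> (Suc i)))"

lemma max_walk_nonneg: "0 \<le> max_walk X n \<omega>"
  by (cases n) auto

lemma walk_le_max_walk: "k \<le> n \<Longrightarrow> (\<Sum>i<k. X (\<omega> i)) \<le> max_walk X n \<omega>"
proof (induction n arbitrary: k \<omega>)
  case (Suc n)
  show ?case
  proof (cases k)
    case 0
    then show ?thesis by (simp add: max_walk_nonneg)
  next
    case (Suc j)
    then have "(\<Sum>i<j. X (\<omega> (Suc i))) \<le> max_walk X n (\<lambda>i. \<omega> (Suc i))" using Suc.prems by (intro Suc.IH) auto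
    then have "(\<Sum>i<k. X (\<omega> i)) \<le> X (\<omega> 0) + max_walk X n (\<lambda>i. \<omega> (Suc i))"
      unfolding Suc by (subst sum.lessThan_Suc_shift) simp
    then show ?thesis by simp
  qed
qed simp

lemma max_walk_mono: "max_walk X n \<omega> \<le> max_walk X (Suc n) \<omega>"
proof (induction n arbitrary: \<omega>)
  case (Suc n)
  show ?case using Suc.IH[of "\<lambda>i. \<omega> (Suc i)"] by (simp add: max_def)
qed (simp add: max_walk_nonneg)

text \<open>Garsia's argument for the maximal ergodic lemma, carried out on the event that the walk is
  unbounded. This event does not depend on the first step, which replaces a zero-one law.\<close>

theorem negative_drift_walk_bounded:
  fixes X :: "'s \<Rightarrow> real"
  assumes \<rho>: "prob_space \<rho>" and X: "integrable \<rho> X" and neg: "integral\<^sup>L \<rho> X < 0"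
  shows "AE \<omega> in Pi\<^sub>M UNIV (\<lambda>_::nat. \<rho>). \<exists>c. \<forall>n. (\<Sum>i<n. X (\<omega> i)) \<le> c"
proof -
  let ?S = "Pi\<^sub>M UNIV (\<lambda>_::nat. \<rho>)"
  interpret R: prob_space \<rho> by fact
  interpret S: prob_space ?S by (rule prob_space_PiM) (rule \<rho>)
  interpret RS: pair_prob_space \<rho> ?S by unfold_locales
  have Xm[measurable]: "X \<in> borel_measurable \<rho>" using X by auto
  have Mm[measurable]: "max_walk X n \<in> borel_measurable ?S" for n
  proof (induction n)
    case (Suc n)
    have [measurable]: "(\<lambda>\<omega>. max_walk X n (\<lambda>i. \<omega> (Suc i))) \<in> borel_measurable ?S"
      by (rule measurable_compose[OF _ Suc]) measurable
    show ?case by simp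
  qed simp
  have abs_le: "\<bar>max_walk X n \<omega>\<bar> \<le> (\<Sum>i<n. \<bar>X (\<omega> i)\<bar>)" for n \<omega>
  proof (induction n arbitrary: \<omega>)
    case (Suc n)
    have "\<bar>max_walk X (Suc n) \<omega>\<bar> \<le> \<bar>X (\<omega> 0)\<bar> + \<bar>max_walk X n (\<lambda>i. \<omega> (Suc i))\<bar>" by simp
    also have "\<dots> \<le> (\<Sum>i<Suc n. \<bar>X (\<omega> i)\<bar>)"
      using Suc[of "\<lambda>i. \<omega> (Suc i)"] by (subst sum.lessThan_Suc_shift) simp
    finally show ?case .
  qed simp
  have Xi: "integrable ?S (\<lambda>\<omega>. \<bar>X (\<omega> i)\<bar>)" for i
  proof -
    have "distr ?S \<rho> (\<lambda>\<omega>. \<omega> i) = \<rho>" by (rule distr_PiM_component) (use \<rho> in auto)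
    then have "integrable (distr ?S \<rho> (\<lambda>\<omega>. \<omega> i)) (\<lambda>s. \<bar>X s\<bar>)" using X by simp
    then show ?thesis by (subst (asm) integrable_distr_eq) auto
  qed
  have Mi: "integrable ?S (max_walk X n)" for n
  proof (rule Bochner_Integration.integrable_bound)
    show "integrable ?S (\<lambda>\<omega>. \<Sum>i<n. \<bar>X (\<omega> i)\<bar>)" using Xi by auto
    show "AE \<omega> in ?S. norm (max_walk X n \<omega>) \<le> norm (\<Sum>i<n. \<bar>X (\<omega> i)\<bar>)"
      using abs_le[of n] by (intro AE_I2) (auto simp: sum_nonneg)
  qed measurable
  \<comment> \<open>Unboundedness is phrased with natural bounds to keep the event a countable
    combination of measurable ones.\<close>
  define A where "A = {\<omega>\<in>space ?S. \<not> (\<exists>c::nat. \<forall>n. (\<Sum>i<n. X (\<omega> i)) \<le> real c)}"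
  have A[measurable]: "A \<in> sets ?S" unfolding A_def by measurable
  \<comment> \<open>One step in front changes the partial sums by a fixed amount and leaves
    boundedness unaffected; this lets the indicator of A be pulled through the recursion.\<close>
  have shift: "case_nat v \<omega> \<in> A \<longleftrightarrow> \<omega> \<in> A" if "v \<in> space \<rho>" "\<omega> \<in> space ?S" for v \<omega>
  proof -
    have sp: "case_nat v \<omega> \<in> space ?S" using that by (auto simp: space_PiM PiE_iff split: nat.split)
    have eq: "(\<Sum>i<Suc n. X (case_nat v \<omega> i)) = X v + (\<Sum>i<n. X (\<omega> i))" for n
      by (subst sum.lessThan_Suc_shift) simp
    have "(\<exists>c::nat. \<forall>n. (\<Sum>i<n. X (case_nat v \<omega> i)) \<le> real c) \<longleftrightarrow> (\<exists>c::nat. \<forall>n. (\<Sum>i<n. X (\<omega> i)) \<le> real c)"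
    proof
      assume "\<exists>c::nat. \<forall>n. (\<Sum>i<n. X (case_nat v \<omega> i)) \<le> real c"
      then obtain c :: nat where c: "\<And>n. (\<Sum>i<n. X (case_nat v \<omega> i)) \<le> real c" by blast
      obtain d :: nat where d: "real c - X v \<le> real d" using real_arch_simple by blast
      have "(\<Sum>i<n. X (\<omega> i)) \<le> real d" for n using c[of "Suc n"] d unfolding eq by linarith
      then show "\<exists>c::nat. \<forall>n. (\<Sum>i<n. X (\<omega> i)) \<le> real c" by blast
    next
      assume "\<exists>c::nat. \<forall>n. (\<Sum>i<n. X (\<omega> i)) \<le> real c"
      then obtain c :: nat where c: "\<And>n. (\<Sum>i<n. X (\<omega> i)) \<le> real c" by blast
      obtain d :: nat where d: "real c + \<bar>X v\<bar> \<le> real d" using real_arch_simple by blast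
      have "(\<Sum>i<n. X (case_nat v \<omega> i)) \<le> real d" for n
      proof (cases n)
        case (Suc m)
        show ?thesis using c[of m] d unfolding Suc eq by linarith
      qed simp
      then show "\<exists>c::nat. \<forall>n. (\<Sum>i<n. X (case_nat v \<omega> i)) \<le> real c" by blast
    qed
    then have "(\<not> (\<exists>c::nat. \<forall>n. (\<Sum>i<n. X (case_nat v \<omega> i)) \<le> real c)) \<longleftrightarrow> (\<not> (\<exists>c::nat. \<forall>n. (\<Sum>i<n. X (\<omega> i)) \<le> real c))"
      by (rule arg_cong)
    then show ?thesis unfolding A_def mem_Collect_eq using sp that by blast
  qed
  \<comment> \<open>On A this is the change of the maximum when a step is put in front, since max 0
    (x + m) - m = max (- m) x. Its mean is nonnegative, as the maximum grows with n.\<close>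
  define G where "G n p = indicator A (snd p) * max (- max_walk X n (snd p)) (X (fst p))" for n and p :: "'s \<times> (nat \<Rightarrow> 's)"
  have Gm[measurable]: "G n \<in> borel_measurable (\<rho> \<Otimes>\<^sub>M ?S)" for n unfolding G_def by measurable
  have XfI: "integrable (\<rho> \<Otimes>\<^sub>M ?S) (\<lambda>p. \<bar>X (fst p)\<bar>)"
  proof -
    have "integrable (distr (\<rho> \<Otimes>\<^sub>M ?S) \<rho> fst) (\<lambda>s. \<bar>X s\<bar>)"
      using X by (simp add: S.distr_pair_fst)
    then show ?thesis by (subst (asm) integrable_distr_eq) auto
  qed
  have G_le: "\<bar>G n p\<bar> \<le> \<bar>X (fst p)\<bar>" for n p
    using max_walk_nonneg[of X n "snd p"] by (auto simp: G_def indicator_def)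
  have pos: "0 \<le> integral\<^sup>L (\<rho> \<Otimes>\<^sub>M ?S) (G n)" for n
  proof -
    have IA: "integrable ?S (\<lambda>\<omega>. indicator A \<omega> * max_walk X k \<omega>)" for k
      using integrable_mult_indicator[OF A Mi[of k]] by simp
    have I1: "integrable (\<rho> \<Otimes>\<^sub>M ?S) (\<lambda>p. indicator A (snd p) * max_walk X n (snd p))"
    proof -
      have "integrable (distr (?S \<Otimes>\<^sub>M \<rho>) ?S fst) (\<lambda>\<omega>. indicator A \<omega> * max_walk X n \<omega>)"
        using IA by (simp add: R.distr_pair_fst)
      then have "integrable (?S \<Otimes>\<^sub>M \<rho>) (\<lambda>p. indicator A (fst p) * max_walk X n (fst p))"
        by (subst (asm) integrable_distr_eq) auto
      then show ?thesis by (subst RS.integrable_product_swap_iff[symmetric]) (simp add: case_prod_unfold)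
    qed
    have E1: "(\<integral>p. indicator A (snd p) * max_walk X n (snd p) \<partial>(\<rho> \<Otimes>\<^sub>M ?S)) = (\<integral>\<omega>. indicator A \<omega> * max_walk X n \<omega> \<partial>?S)"
      using RS.integral_fst'[OF I1] by (simp add: R.prob_space)
    have "(\<integral>\<omega>. indicator A \<omega> * max_walk X (Suc n) \<omega> \<partial>?S) =
      (\<integral>p. indicator A (case_nat (fst p) (snd p)) * max_walk X (Suc n) (case_nat (fst p) (snd p)) \<partial>(\<rho> \<Otimes>\<^sub>M ?S))"
      by (rule integral_PiM_case_nat[OF \<rho>]) measurable
    also have "\<dots> = (\<integral>p. G n p + indicator A (snd p) * max_walk X n (snd p) \<partial>(\<rho> \<Otimes>\<^sub>M ?S))"
    proof (rule Bochner_Integration.integral_cong[OF refl])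
      fix p assume "p \<in> space (\<rho> \<Otimes>\<^sub>M ?S)"
      then have "case_nat (fst p) (snd p) \<in> A \<longleftrightarrow> snd p \<in> A" by (intro shift) (auto simp: space_pair_measure)
      then show "indicator A (case_nat (fst p) (snd p)) * max_walk X (Suc n) (case_nat (fst p) (snd p)) =
         G n p + indicator A (snd p) * max_walk X n (snd p)"
        by (auto simp: G_def indicator_def max_def)
    qed
    also have "\<dots> = integral\<^sup>L (\<rho> \<Otimes>\<^sub>M ?S) (G n) + (\<integral>\<omega>. indicator A \<omega> * max_walk X n \<omega> \<partial>?S)"
      unfolding E1[symmetric]
    proof (rule Bochner_Integration.integral_add[OF _ I1])
      show "integrable (\<rho> \<Otimes>\<^sub>M ?S) (G n)"
        by (rule Bochner_Integration.integrable_bound[OF XfI]) (use G_le in auto)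
    qed
    finally have "integral\<^sup>L (\<rho> \<Otimes>\<^sub>M ?S) (G n) =
      (\<integral>\<omega>. indicator A \<omega> * max_walk X (Suc n) \<omega> \<partial>?S) - (\<integral>\<omega>. indicator A \<omega> * max_walk X n \<omega> \<partial>?S)" by simp
    moreover have "(\<integral>\<omega>. indicator A \<omega> * max_walk X n \<omega> \<partial>?S) \<le> (\<integral>\<omega>. indicator A \<omega> * max_walk X (Suc n) \<omega> \<partial>?S)"
      by (rule integral_mono[OF IA IA]) (intro mult_left_mono max_walk_mono, simp)
    ultimately show ?thesis by simp
  qed
  \<comment> \<open>On A the maximum eventually exceeds - X, so the truncation disappears. The limit
    of the nonnegative means is the probability of A times the negative mean of X, which forces that
    probability to be 0.\<close>
  have lim: "(\<lambda>n. integral\<^sup>L (\<rho> \<Otimes>\<^sub>M ?S) (G n)) \<longlonglongrightarrow> (\<integral>p. indicator A (snd p) * X (fst p) \<partial>(\<rho> \<Otimes>\<^sub>M ?S))"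
  proof (rule integral_dominated_convergence[OF _ _ XfI])
    show "AE p in \<rho> \<Otimes>\<^sub>M ?S. (\<lambda>n. G n p) \<longlonglongrightarrow> indicator A (snd p) * X (fst p)"
    proof (rule AE_I2)
      fix p
      show "(\<lambda>n. G n p) \<longlonglongrightarrow> indicator A (snd p) * X (fst p)"
      proof (cases "snd p \<in> A")
        case True
        obtain c :: nat where c: "- X (fst p) \<le> real c" using real_arch_simple by blast
        obtain k where k: "(\<Sum>i<k. X (snd p i)) > real c" using True unfolding A_def by (auto simp: not_le)
        have "G n p = X (fst p)" if "n \<ge> k" for n
        proof -
          have "real c < max_walk X n (snd p)" using walk_le_max_walk[OF that, of X "snd p"] k by linarith
          then have "- max_walk X n (snd p) \<le> X (fst p)" using c by linarith
          then show ?thesis using True by (simp add: G_def max_absorb2)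
        qed
        then have "eventually (\<lambda>n. G n p = X (fst p)) sequentially" by (auto simp: eventually_sequentially)
        then show ?thesis using True by (simp add: tendsto_eventually)
      qed (simp add: G_def)
    qed
  qed (use G_le in auto)
  have "0 \<le> (\<integral>p. indicator A (snd p) * X (fst p) \<partial>(\<rho> \<Otimes>\<^sub>M ?S))"
    by (rule LIMSEQ_le_const[OF lim]) (use pos in auto)
  also have "\<dots> = (\<integral>s. \<integral>\<omega>. indicator A \<omega> * X s \<partial>?S \<partial>\<rho>)"
  proof -
    have "integrable (\<rho> \<Otimes>\<^sub>M ?S) (\<lambda>p. indicator A (snd p) * X (fst p))"
      by (rule Bochner_Integration.integrable_bound[OF XfI]) (auto simp: indicator_def)
    from RS.integral_fst'[OF this] show ?thesis by simp
  qed
  also have "\<dots> = S.prob A * integral\<^sup>L \<rho> X" by simp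
  finally have "S.prob A = 0" using neg by (simp add: zero_le_mult_iff measure_le_0_iff)
  then have "A \<in> null_sets ?S" by (simp add: null_sets_def S.emeasure_eq_measure)
  then show ?thesis
    by (rule AE_I') (auto simp: A_def)
qed

text \<open>Borel-Cantelli: the tail probabilities at \<epsilon> n sum to at most the mean of |U| /
  \<epsilon> + 1. Finitely many exceptional indices are absorbed in c.\<close>

lemma AE_sublinear:
  fixes U :: "'s \<Rightarrow> real"
  assumes \<rho>: "prob_space \<rho>" and U: "integrable \<rho> U" and eps: "\<epsilon> > 0"
  shows "AE \<omega> in Pi\<^sub>M UNIV (\<lambda>_::nat. \<rho>). \<exists>c. \<forall>n. U (\<omega> n) \<le> c + \<epsilon> * real n"
proof -
  let ?S = "Pi\<^sub>M UNIV (\<lambda>_::nat. \<rho>)"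
  interpret R: prob_space \<rho> by fact
  interpret S: prob_space ?S by (rule prob_space_PiM) (rule \<rho>)
  have [measurable]: "U \<in> borel_measurable \<rho>" using U by auto
  have em: "emeasure ?S {\<omega>\<in>space ?S. \<epsilon> * real n < U (\<omega> n)} = emeasure \<rho> {s\<in>space \<rho>. \<epsilon> * real n < U s}" for n
  proof -
    have "emeasure \<rho> {s\<in>space \<rho>. \<epsilon> * real n < U s} = emeasure (distr ?S \<rho> (\<lambda>\<omega>. \<omega> n)) {s\<in>space \<rho>. \<epsilon> * real n < U s}"
      by (subst distr_PiM_component) (use \<rho> in auto)
    also have "\<dots> = emeasure ?S {\<omega>\<in>space ?S. \<epsilon> * real n < U (\<omega> n)}"
      by (subst emeasure_distr) (auto simp: space_PiM intro!: arg_cong[where f="emeasure ?S"])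
    finally show ?thesis by simp
  qed
  have "(\<Sum>n. emeasure \<rho> {s\<in>space \<rho>. \<epsilon> * real n < U s}) = (\<integral>\<^sup>+s. (\<Sum>n. indicator {s\<in>space \<rho>. \<epsilon> * real n < U s} s) \<partial>\<rho>)"
    by (subst nn_integral_suminf) auto
  also have "\<dots> \<le> (\<integral>\<^sup>+s. ennreal (\<bar>U s\<bar> / \<epsilon> + 1) \<partial>\<rho>)"
  proof (rule nn_integral_mono)
    fix s assume s: "s \<in> space \<rho>"
    let ?k = "nat \<lceil>\<bar>U s\<bar> / \<epsilon>\<rceil>"
    have nn: "0 \<le> \<bar>U s\<bar> / \<epsilon>" using eps by simp
    have sub: "n < ?k" if "\<epsilon> * real n < U s" for n
    proof -
      have "real n < \<bar>U s\<bar> / \<epsilon>" using that eps by (simp add: field_simps)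
      then show ?thesis by linarith
    qed
    have "(\<Sum>n. indicator {s\<in>space \<rho>. \<epsilon> * real n < U s} s) = (\<Sum>n<?k. indicator {s\<in>space \<rho>. \<epsilon> * real n < U s} s :: ennreal)"
    proof (rule suminf_finite)
      fix n assume "n \<notin> {..<?k}"
      then have "\<not> \<epsilon> * real n < U s" using sub[of n] by auto
      then show "indicator {s\<in>space \<rho>. \<epsilon> * real n < U s} s = (0 :: ennreal)" by simp
    qed simp
    also have "\<dots> \<le> (\<Sum>n<?k. 1)" by (intro sum_mono) (auto simp: indicator_def)
    also have "\<dots> = ennreal (real ?k)" by (simp add: ennreal_of_nat_eq_real_of_nat)
    also have "\<dots> \<le> ennreal (\<bar>U s\<bar> / \<epsilon> + 1)"
      using nn by (intro ennreal_leI) linarith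
    finally show "(\<Sum>n. indicator {s\<in>space \<rho>. \<epsilon> * real n < U s} s) \<le> ennreal (\<bar>U s\<bar> / \<epsilon> + 1)" .
  qed
  also have "\<dots> < \<infinity>"
  proof -
    have "integrable \<rho> (\<lambda>s. \<bar>U s\<bar> / \<epsilon> + 1)" using U by auto
    moreover have "AE s in \<rho>. 0 \<le> \<bar>U s\<bar> / \<epsilon> + 1" using eps by (intro AE_I2 add_nonneg_nonneg) auto
    ultimately show ?thesis by (simp add: nn_integral_eq_integral)
  qed
  finally have fin: "(\<Sum>n. emeasure ?S {\<omega>\<in>space ?S. \<epsilon> * real n < U (\<omega> n)}) < \<infinity>" unfolding em .
  have "AE \<omega> in ?S. eventually (\<lambda>n. \<omega> \<in> space ?S - {\<omega>\<in>space ?S. \<epsilon> * real n < U (\<omega> n)}) sequentially"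
  proof (rule borel_cantelli_AE1)
    show "summable (\<lambda>n. S.prob {\<omega>\<in>space ?S. \<epsilon> * real n < U (\<omega> n)})"
      using fin unfolding S.emeasure_eq_measure by (intro summable_suminf_not_top) auto
  qed (auto simp: S.emeasure_eq_measure)
  then show ?thesis
  proof eventually_elim
    case (elim \<omega>)
    then obtain N where N: "\<And>n. n \<ge> N \<Longrightarrow> U (\<omega> n) \<le> \<epsilon> * real n" by (auto simp: eventually_sequentially not_less)
    define c where "c = (\<Sum>n<N. \<bar>U (\<omega> n)\<bar>)"
    have "U (\<omega> n) \<le> c + \<epsilon> * real n" for n
    proof (cases "n < N")
      case True
      have "U (\<omega> n) \<le> \<bar>U (\<omega> n)\<bar>" by simp
      also have "\<dots> \<le> c" unfolding c_def by (rule member_le_sum) (use True in auto)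
      finally show ?thesis using eps by (simp add: add_increasing2)
    next
      case False
      have "c \<ge> 0" unfolding c_def by (rule sum_nonneg) simp
      then show ?thesis using N[of n] False by simp
    qed
    then show ?case by blast
  qed
qed

lemma AE_geometric_decay:
  fixes X U :: "'s \<Rightarrow> real"
  assumes \<rho>: "prob_space \<rho>" and X: "integrable \<rho> X" "integral\<^sup>L \<rho> X < 0" and U: "integrable \<rho> U"
  shows "AE \<omega> in Pi\<^sub>M UNIV (\<lambda>_::nat. \<rho>). \<exists>K \<delta>. 0 < \<delta> \<and>
    (\<forall>n. exp (\<Sum>i<n. X (\<omega> i)) \<le> K * exp (- \<delta> * real n)) \<and>
    (\<forall>n. exp (\<Sum>i<n. X (\<omega> i)) * exp (U (\<omega> n)) \<le> K * exp (- \<delta> * real n))"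
proof -
  interpret R: prob_space \<rho> by fact
  \<comment> \<open>Adding half of the absolute mean to each step keeps the walk drifting down,
    which yields decay at rate \<epsilon>; half of that rate is given up to control U, leaving
    \<epsilon> / 2.\<close>
  define \<epsilon> where "\<epsilon> = - integral\<^sup>L \<rho> X / 2"
  have eps: "\<epsilon> > 0" using X by (simp add: \<epsilon>_def)
  have "integral\<^sup>L \<rho> (\<lambda>s. X s + \<epsilon>) = integral\<^sup>L \<rho> X + \<epsilon>" using X by (simp add: R.prob_space)
  then have "integral\<^sup>L \<rho> (\<lambda>s. X s + \<epsilon>) < 0" using X by (simp add: \<epsilon>_def)
  then have 1: "AE \<omega> in Pi\<^sub>M UNIV (\<lambda>_::nat. \<rho>). \<exists>c. \<forall>n. (\<Sum>i<n. X (\<omega> i) + \<epsilon>) \<le> c"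
    using X by (intro negative_drift_walk_bounded[OF \<rho>]) auto
  have 2: "AE \<omega> in Pi\<^sub>M UNIV (\<lambda>_::nat. \<rho>). \<exists>c. \<forall>n. U (\<omega> n) \<le> c + (\<epsilon> / 2) * real n"
    by (rule AE_sublinear[OF \<rho> U]) (use eps in simp)
  show ?thesis using 1 2
  proof eventually_elim
    case (elim \<omega>)
    obtain c where c: "\<And>n. (\<Sum>i<n. X (\<omega> i) + \<epsilon>) \<le> c" using elim by blast
    obtain d where d: "\<And>n. U (\<omega> n) \<le> d + (\<epsilon> / 2) * real n" using elim by blast
    have s: "(\<Sum>i<n. X (\<omega> i)) \<le> c - \<epsilon> * real n" for n
      using c[of n] by (simp add: sum.distrib mult.commute)
    have "exp (\<Sum>i<n. X (\<omega> i)) \<le> exp (c + \<bar>d\<bar>) * exp (- (\<epsilon>/2) * real n)" for n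
    proof -
      have "0 \<le> \<epsilon> * real n" using eps by simp
      then show ?thesis using s[of n] by (simp add: exp_add[symmetric])
    qed
    moreover have "exp (\<Sum>i<n. X (\<omega> i)) * exp (U (\<omega> n)) \<le> exp (c + \<bar>d\<bar>) * exp (- (\<epsilon>/2) * real n)" for n
      using s[of n] d[of n] by (simp add: exp_add[symmetric])
    moreover have "0 < \<epsilon> / 2" using eps by simp
    ultimately show ?case by blast
  qed
qed

section \<open>Products of matrices and iterated affine maps\<close>

lemma mprod_Nil [simp]: "mprod [] = mat 1"
  by (simp add: mprod_def)

lemma mprod_Cons [simp]: "mprod (A # As) = A ** mprod As"
  by (simp add: mprod_def)

lemma mprod_append: "mprod (As @ Bs) = mprod As ** mprod Bs"
  by (induction As) (auto simp: matrix_mul_assoc)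

lemma mprod_upt_Suc: "mprod (map A [0..<Suc n]) = mprod (map A [0..<n]) ** A n"
  by (simp add: mprod_append)

text \<open>The backward composition is a partial sum of the series in the theorem plus a product
  applied to the starting point, so its convergence follows from summability and decay of the
  products.\<close>

lemma bwd_affine:
  fixes A :: "'s \<Rightarrow> real^'n^'n" and b :: "'s \<Rightarrow> real^'n"
  shows "bwd (\<lambda>s x. A s *v x + b s) n \<omega> x =
    (\<Sum>i<n. mprod (map (\<lambda>j. A (\<omega> j)) [0..<i]) *v b (\<omega> i)) + mprod (map (\<lambda>j. A (\<omega> j)) [0..<n]) *v x"
  by (induction n arbitrary: x)
     (simp_all add: mprod_append matrix_vector_mul_assoc[symmetric] matrix_vector_right_distrib)

lemma matrix_product_decay:
  fixes A :: "nat \<Rightarrow> real^'n^'n" and nrm :: "real^'n \<Rightarrow> real"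
  assumes A: "\<And>i v. nrm (A i *v v) \<le> r i * nrm v" and r: "\<And>i. 0 \<le> r i"
  shows "nrm (mprod (map A [0..<n]) *v v) \<le> (\<Prod>i<n. r i) * nrm v"
proof (induction n arbitrary: v)
  case (Suc n)
  have "nrm (mprod (map A [0..<Suc n]) *v v) = nrm (mprod (map A [0..<n]) *v (A n *v v))"
    unfolding mprod_upt_Suc by (simp add: matrix_vector_mul_assoc)
  also have "\<dots> \<le> (\<Prod>i<n. r i) * nrm (A n *v v)" by (rule Suc)
  also have "\<dots> \<le> (\<Prod>i<n. r i) * (r n * nrm v)" using r by (intro mult_left_mono A prod_nonneg) auto
  finally show ?case by (simp add: mult_ac)
qed simp

section \<open>A flow interrupted by jumps at exponential times\<close>

text \<open>Flow and jump are arbitrary measurable maps here: the reversal rests on the law of gaps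
  and marks alone.\<close>

locale flow_jump =
  fixes lam :: real and \<zeta> :: "real measure" and fl jp :: "real \<Rightarrow> 'a::topological_space \<Rightarrow> 'a"
  assumes lam: "lam > 0" and \<zeta>: "prob_space \<zeta>" "sets \<zeta> = sets borel"
    and fl: "(\<lambda>(s, x). fl s x) \<in> borel \<Otimes>\<^sub>M borel \<rightarrow>\<^sub>M borel"
    and jp: "(\<lambda>(z, x). jp z x) \<in> borel \<Otimes>\<^sub>M borel \<rightarrow>\<^sub>M borel"
    and arrivals: "AE \<omega> in Pi\<^sub>M UNIV (\<lambda>_::nat. density lborel (exponential_density lam) \<Otimes>\<^sub>M \<zeta>).
      (\<forall>i. fst (\<omega> i) > 0) \<and> (\<forall>t. \<exists>n. t < (\<Sum>i<n. fst (\<omega> i)))"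
begin

definition "gap = density lborel (exponential_density lam)"
definition "law = gap \<Otimes>\<^sub>M \<zeta>"

lemma gap: "prob_space gap" "sets gap = sets borel"
  unfolding gap_def using prob_space_exponential_density[OF lam] by auto

sublocale G: prob_space gap by (rule gap)
sublocale Z: prob_space \<zeta> by (rule \<zeta>)

lemma law: "prob_space law" "sets law = sets (borel \<Otimes>\<^sub>M borel)"
proof -
  interpret GZ: pair_prob_space gap \<zeta> by unfold_locales
  show "prob_space law" unfolding law_def by unfold_locales
  show "sets law = sets (borel \<Otimes>\<^sub>M borel)" unfolding law_def by (intro sets_pair_measure_cong gap \<zeta>)
qed

lemmas [measurable_cong] = gap(2) \<zeta>(2) law(2)

lemma fl_measurable [measurable (raw)]:
  "f \<in> borel_measurable K \<Longrightarrow> g \<in> borel_measurable K \<Longrightarrow> (\<lambda>w. fl (f w) (g w)) \<in> borel_measurable K"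
  using measurable_compose[OF measurable_Pair fl, of f K g] by simp

lemma jp_measurable [measurable (raw)]:
  "f \<in> borel_measurable K \<Longrightarrow> g \<in> borel_measurable K \<Longrightarrow> (\<lambda>w. jp (f w) (g w)) \<in> borel_measurable K"
  using measurable_compose[OF measurable_Pair jp, of f K g] by simp

definition cmap :: "real \<times> real \<Rightarrow> 'a \<Rightarrow> 'a" where
  "cmap p x = jp (snd p) (fl (fst p) x)"

text \<open>Jump first, then wait: this leads from just before one jump to just before the next,
  while \<open>cmap\<close> leads from just after one jump to just after the next.\<close>

definition qmap :: "real \<times> real \<Rightarrow> 'a \<Rightarrow> 'a" where
  "qmap p x = fl (fst p) (jp (snd p) x)"

sublocale C: random_maps law borel cmap
  by (rule random_maps.intro[OF law(1)]) (unfold cmap_def, measurable)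

sublocale Q: random_maps law borel qmap
  by (rule random_maps.intro[OF law(1)]) (unfold qmap_def, measurable)

abbreviation P :: "(nat \<Rightarrow> real \<times> real) measure" where
  "P \<equiv> Pi\<^sub>M UNIV (\<lambda>_::nat. law)"

lemma prob_space_P: "prob_space P" by (rule prob_space_PiM) (rule law)

definition arrival :: "nat \<Rightarrow> (nat \<Rightarrow> real \<times> real) \<Rightarrow> real" where
  "arrival n \<omega> = (\<Sum>i<n. fst (\<omega> i))"

lemma arrival_measurable [measurable (raw)]:
  assumes [measurable]: "f \<in> K \<rightarrow>\<^sub>M P"
  shows "(\<lambda>w. arrival n (f w)) \<in> borel_measurable K"
proof -
  have "(\<lambda>w. f w i) \<in> K \<rightarrow>\<^sub>M law" for i
    by (rule measurable_compose[OF assms]) measurable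
  then have [measurable]: "(\<lambda>w. fst (f w i)) \<in> borel_measurable K" for i
    by (rule measurable_compose) measurable
  show ?thesis unfolding arrival_def by measurable
qed

lemma arrival_0 [simp]: "arrival 0 \<omega> = 0"
  by (simp add: arrival_def)

lemma arrival_Suc: "arrival (Suc n) \<omega> = arrival n \<omega> + fst (\<omega> n)"
  by (simp add: arrival_def)

lemma arrival_case_nat: "arrival (Suc n) (case_nat p \<omega>) = fst p + arrival n \<omega>"
  unfolding arrival_def by (subst sum.lessThan_Suc_shift) simp

definition between :: "nat \<Rightarrow> real \<Rightarrow> (nat \<Rightarrow> real \<times> real) \<Rightarrow> bool" where
  "between n t \<omega> \<longleftrightarrow> arrival n \<omega> \<le> t \<and> t < arrival (Suc n) \<omega>"

lemma between_measurable [measurable (raw)]: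
  assumes [measurable]: "f \<in> K \<rightarrow>\<^sub>M P" "g \<in> borel_measurable K"
  shows "Measurable.pred K (\<lambda>w. between n (g w) (f w))"
  unfolding between_def by measurable

lemma between_case_nat: "between (Suc n) t (case_nat p \<omega>) \<longleftrightarrow> between n (t - fst p) \<omega>"
  unfolding between_def arrival_case_nat by (auto simp: le_diff_eq diff_less_eq add.commute)

definition fwd_part :: "nat \<Rightarrow> ('a \<Rightarrow> ennreal) \<Rightarrow> real \<Rightarrow> 'a \<Rightarrow> ennreal" where
  "fwd_part n f t y = (\<integral>\<^sup>+\<omega>. (if between n t \<omega> then f (fl (t - arrival n \<omega>) (fwd cmap n \<omega> y)) else 0) \<partial>P)"

text \<open>The incomplete gap, last in real time, acts first on the starting point, and the n
  complete maps follow, each as a jump and a wait. Equality with \<open>fwd_part\<close> for every n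
  gives equality of the laws at time t.\<close>

definition bwd_part :: "nat \<Rightarrow> ('a \<Rightarrow> ennreal) \<Rightarrow> real \<Rightarrow> 'a \<Rightarrow> ennreal" where
  "bwd_part n f t y = (\<integral>\<^sup>+\<omega>. (if between n t \<omega> then f (bwd qmap n \<omega> (fl (t - arrival n \<omega>) y)) else 0) \<partial>P)"

lemma fwd_part_Suc:
  assumes [measurable]: "f \<in> borel_measurable borel"
  shows "fwd_part (Suc n) f t y = (\<integral>\<^sup>+p. fwd_part n f (t - fst p) (cmap p y) \<partial>law)"
  unfolding fwd_part_def
  by (subst nn_integral_PiM_iter[OF law(1)], measurable)
     (auto simp only: between_case_nat arrival_case_nat fwd_case_nat diff_diff_eq intro!: nn_integral_cong)

lemma bwd_part_Suc:
  assumes [measurable]: "f \<in> borel_measurable borel"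
  shows "bwd_part (Suc n) f t y = (\<integral>\<^sup>+p. bwd_part n (\<lambda>x. f (qmap p x)) (t - fst p) y \<partial>law)"
  unfolding bwd_part_def
  by (subst nn_integral_PiM_iter[OF law(1)], measurable)
     (auto simp only: between_case_nat arrival_case_nat bwd_case_nat diff_diff_eq intro!: nn_integral_cong)

text \<open>The exponential tail, set to 0 for negative arguments so that convolutions over the
  whole line need no limits of integration.\<close>

definition surv :: "real \<Rightarrow> ennreal" where
  "surv u = (if 0 \<le> u then ennreal (exp (- lam * u)) else 0)"

lemma surv_measurable [measurable]: "surv \<in> borel_measurable borel"
  unfolding surv_def by measurable

lemma emeasure_gap: "u \<ge> 0 \<Longrightarrow> emeasure gap {u<..} = ennreal (exp (- lam * u))"
proof -
  assume u: "u \<ge> 0"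
  have "distributed gap lborel (\<lambda>x. x) (exponential_density lam)"
    unfolding distributed_def gap_def
    by (auto simp: distr_id2 exponential_density_def[abs_def] intro!: measure_eqI)
  from G.exponential_distributedD_gt[OF this u] lam
  have "G.prob {x\<in>space gap. u < x} = exp (- u * lam)" by simp
  moreover have "{x\<in>space gap. u < x} = {u<..}" by (auto simp: gap_def)
  ultimately show ?thesis by (simp add: G.emeasure_eq_measure mult.commute)
qed

lemma part_0:
  assumes [measurable]: "f \<in> borel_measurable borel"
  shows "fwd_part 0 f t y = surv t * f (fl t y)" "bwd_part 0 f t y = surv t * f (fl t y)"
proof -
  interpret P: prob_space P by (rule prob_space_P)
  have "(\<integral>\<^sup>+\<omega>. (if between 0 t \<omega> then f (fl t y) else 0) \<partial>P) = (\<integral>\<^sup>+p. (if 0 \<le> t \<and> t < fst p then f (fl t y) else 0) \<partial>law)"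
    unfolding between_def by (subst nn_integral_PiM_iter[OF law(1)], measurable) (simp add: arrival_Suc P.emeasure_space_1)
  also have "\<dots> = (\<integral>\<^sup>+s. (if 0 \<le> t \<and> t < s then f (fl t y) else 0) \<partial>gap)"
    unfolding law_def by (subst Z.nn_integral_fst[symmetric]) (auto simp: Z.emeasure_space_1)
  also have "\<dots> = (\<integral>\<^sup>+s. (if 0 \<le> t then f (fl t y) else 0) * indicator {t<..} s \<partial>gap)"
    by (intro nn_integral_cong) (auto simp: indicator_def)
  also have "\<dots> = (if 0 \<le> t then f (fl t y) else 0) * emeasure gap {t<..}"
    by (rule nn_integral_cmult_indicator) simp
  also have "\<dots> = surv t * f (fl t y)"
    by (auto simp: surv_def emeasure_gap mult.commute)
  finally have *: "(\<integral>\<^sup>+\<omega>. (if between 0 t \<omega> then f (fl t y) else 0) \<partial>P) = surv t * f (fl t y)" .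
  show "fwd_part 0 f t y = surv t * f (fl t y)" "bwd_part 0 f t y = surv t * f (fl t y)"
    using * by (simp_all add: fwd_part_def bwd_part_def cong: if_cong)
qed

text \<open>With a single jump, the weight \<open>exponential_density lam s * surv (t - s)\<close>
  is invariant under replacing s by t - s, and this substitution exchanges the complete gap with the
  incomplete one. This is where the exponential law is decisive.\<close>

lemma part_1:
  assumes [measurable]: "f \<in> borel_measurable borel"
  shows "fwd_part 1 f t y = bwd_part 1 f t y"
proof -
  have fq: "(\<lambda>x. f (qmap p x)) \<in> borel_measurable borel" for p
    unfolding qmap_def by measurable
  define H where "H s = (\<integral>\<^sup>+z. f (fl (t - s) (jp z (fl s y))) \<partial>\<zeta>)" for s
  have [measurable]: "H \<in> borel_measurable borel" unfolding H_def by measurable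
  define w where "w s = ennreal (exponential_density lam s) * surv (t - s)" for s
  have [measurable]: "w \<in> borel_measurable borel" unfolding w_def by measurable
  have sym: "w (t - s) = w s" for s
  proof -
    have "lam * exp (- (t - s) * lam) * exp (- lam * s) = lam * exp (- s * lam) * exp (- lam * (t - s))"
      by (simp add: mult.assoc exp_add[symmetric] algebra_simps)
    then show ?thesis using lam
      by (auto simp: w_def surv_def exponential_density_def ennreal_mult[symmetric])
  qed
  have "fwd_part 1 f t y = (\<integral>\<^sup>+p. surv (t - fst p) * f (fl (t - fst p) (cmap p y)) \<partial>law)"
    unfolding One_nat_def by (subst fwd_part_Suc) (simp_all add: part_0)
  also have "\<dots> = (\<integral>\<^sup>+s. \<integral>\<^sup>+z. surv (t - s) * f (fl (t - s) (jp z (fl s y))) \<partial>\<zeta> \<partial>gap)"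
    unfolding law_def cmap_def by (subst Z.nn_integral_fst[symmetric]) auto
  also have "\<dots> = (\<integral>\<^sup>+s. surv (t - s) * H s \<partial>gap)"
    unfolding H_def by (simp add: nn_integral_cmult)
  also have "\<dots> = (\<integral>\<^sup>+s. w s * H s \<partial>lborel)"
    unfolding gap_def w_def by (subst nn_integral_density) (auto simp: mult.assoc)
  also have "\<dots> = (\<integral>\<^sup>+s. w (t + (-1) * s) * H (t + (-1) * s) \<partial>lborel)"
    by (subst nn_integral_real_affine[where c="-1" and t=t]) auto
  also have "\<dots> = (\<integral>\<^sup>+s. w s * H (t - s) \<partial>lborel)"
    by (simp add: sym)
  also have "\<dots> = (\<integral>\<^sup>+s. surv (t - s) * H (t - s) \<partial>gap)"
    unfolding gap_def w_def by (subst nn_integral_density) (auto simp: mult.assoc)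
  also have "\<dots> = (\<integral>\<^sup>+s. \<integral>\<^sup>+z. surv (t - s) * f (fl s (jp z (fl (t - s) y))) \<partial>\<zeta> \<partial>gap)"
    unfolding H_def by (simp add: nn_integral_cmult)
  also have "\<dots> = (\<integral>\<^sup>+p. surv (t - fst p) * f (qmap p (fl (t - fst p) y)) \<partial>law)"
    unfolding law_def qmap_def by (subst Z.nn_integral_fst[symmetric]) auto
  also have "\<dots> = bwd_part 1 f t y"
    unfolding One_nat_def by (subst bwd_part_Suc) (simp_all add: part_0(2)[OF fq])
  finally show ?thesis .
qed

text \<open>Decomposing at the first jump on one side and at the last jump on the other, the two
  recursions commute by Fubini, so that only the terms with at most one jump have to be compared.\<close>

lemma fwd_part_eq_bwd_part:
  assumes "f \<in> borel_measurable borel"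
  shows "fwd_part n f t y = bwd_part n f t y"
  using assms
proof (induction n arbitrary: f t y rule: less_induct)
  case (less n)
  note [measurable] = less.prems
  interpret P: prob_space P by (rule prob_space_P)
  interpret L: prob_space law by (rule law)
  interpret LL: pair_sigma_finite law law by unfold_locales
  consider "n = 0" | "n = 1" | m where "n = Suc (Suc m)"
    by (metis One_nat_def not0_implies_Suc)
  then show ?case
  proof cases
    case 1
    then show ?thesis by (simp add: part_0)
  next
    case 2
    then show ?thesis using part_1[OF less.prems] by simp
  next
    case 3
    have fq: "(\<lambda>x. f (qmap p x)) \<in> borel_measurable borel" for p
      unfolding qmap_def by measurable
    have "fwd_part n f t y = (\<integral>\<^sup>+p. fwd_part (Suc m) f (t - fst p) (cmap p y) \<partial>law)"
      unfolding 3 by (rule fwd_part_Suc) fact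
    also have "\<dots> = (\<integral>\<^sup>+p. bwd_part (Suc m) f (t - fst p) (cmap p y) \<partial>law)"
      by (intro nn_integral_cong less.IH) (use 3 less.prems in auto)
    also have "\<dots> = (\<integral>\<^sup>+p. \<integral>\<^sup>+p'. bwd_part m (\<lambda>x. f (qmap p' x)) (t - fst p - fst p') (cmap p y) \<partial>law \<partial>law)"
      by (intro nn_integral_cong bwd_part_Suc) (rule less.prems)
    also have "\<dots> = (\<integral>\<^sup>+p'. \<integral>\<^sup>+p. bwd_part m (\<lambda>x. f (qmap p' x)) (t - fst p - fst p') (cmap p y) \<partial>law \<partial>law)"
      unfolding bwd_part_def by (rule LL.Fubini') measurable
    also have "\<dots> = (\<integral>\<^sup>+p'. \<integral>\<^sup>+p. fwd_part m (\<lambda>x. f (qmap p' x)) (t - fst p' - fst p) (cmap p y) \<partial>law \<partial>law)"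
    proof (rule nn_integral_cong, rule nn_integral_cong)
      fix p' p :: "real \<times> real"
      have "t - fst p - fst p' = t - fst p' - fst p" by simp
      show "bwd_part m (\<lambda>x. f (qmap p' x)) (t - fst p - fst p') (cmap p y) =
        fwd_part m (\<lambda>x. f (qmap p' x)) (t - fst p' - fst p) (cmap p y)"
        unfolding \<open>t - fst p - fst p' = t - fst p' - fst p\<close> using less.IH[of m, OF _ fq] 3 by simp
    qed
    also have "\<dots> = (\<integral>\<^sup>+p'. fwd_part (Suc m) (\<lambda>x. f (qmap p' x)) (t - fst p') y \<partial>law)"
      by (intro nn_integral_cong fwd_part_Suc[symmetric] fq)
    also have "\<dots> = (\<integral>\<^sup>+p'. bwd_part (Suc m) (\<lambda>x. f (qmap p' x)) (t - fst p') y \<partial>law)"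
      by (intro nn_integral_cong less.IH fq) (use 3 in auto)
    also have "\<dots> = bwd_part n f t y"
      unfolding 3 by (rule bwd_part_Suc[symmetric]) fact
    finally show ?thesis .
  qed
qed

section \<open>Counting arrivals up to a fixed time\<close>

definition reg :: "(nat \<Rightarrow> real \<times> real) \<Rightarrow> bool" where
  "reg \<omega> \<longleftrightarrow> (\<forall>i. fst (\<omega> i) > 0) \<and> (\<forall>t. \<exists>n. t < arrival n \<omega>)"

lemma AE_reg: "AE \<omega> in P. reg \<omega>"
  using arrivals unfolding reg_def arrival_def law_def gap_def .

definition cnt :: "real \<Rightarrow> (nat \<Rightarrow> real \<times> real) \<Rightarrow> nat" where
  "cnt t \<omega> = (LEAST n. t < arrival (Suc n) \<omega>)"

lemma cnt_measurable [measurable (raw)]: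
  assumes [measurable]: "f \<in> K \<rightarrow>\<^sub>M P"
  shows "(\<lambda>w. cnt t (f w)) \<in> K \<rightarrow>\<^sub>M count_space UNIV"
  unfolding cnt_def by measurable

lemma arrival_strict_mono: "reg \<omega> \<Longrightarrow> strict_mono (\<lambda>n. arrival n \<omega>)"
  by (rule strict_mono_Suc_iff[THEN iffD2]) (simp add: arrival_Suc reg_def)

text \<open>On a regular sequence the arrivals increase strictly and without bound, so exactly one
  index brackets t, and the least index in \<open>cnt\<close> finds it.\<close>

lemma between_iff:
  assumes "reg \<omega>" "t \<ge> 0"
  shows "between n t \<omega> \<longleftrightarrow> n = cnt t \<omega>"
proof -
  note mono = arrival_strict_mono[OF assms(1)]
  have ex: "\<exists>n. t < arrival (Suc n) \<omega>"
  proof -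
    obtain n where "t < arrival n \<omega>" using assms unfolding reg_def by blast
    also have "\<dots> < arrival (Suc n) \<omega>" using strict_monoD[OF mono, of n "Suc n"] by simp
    finally show ?thesis by blast
  qed
  have lt: "t < arrival (Suc (cnt t \<omega>)) \<omega>" unfolding cnt_def using ex by (rule LeastI_ex)
  have le: "arrival (cnt t \<omega>) \<omega> \<le> t"
  proof (cases "cnt t \<omega>")
    case 0
    then show ?thesis using assms by simp
  next
    case (Suc m)
    then have "\<not> t < arrival (Suc m) \<omega>"
      using not_less_Least[of m "\<lambda>n. t < arrival (Suc n) \<omega>"] unfolding cnt_def by simp
    then show ?thesis using Suc by simp
  qed
  show ?thesis
  proof
    assume b: "between n t \<omega>"
    then have "arrival n \<omega> < arrival (Suc (cnt t \<omega>)) \<omega>" "arrival (cnt t \<omega>) \<omega> < arrival (Suc n) \<omega>"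
      using lt le by (auto simp: between_def)
    then show "n = cnt t \<omega>" by (auto simp: strict_mono_less[OF mono])
  next
    assume "n = cnt t \<omega>"
    then show "between n t \<omega>" using lt le by (simp add: between_def)
  qed
qed

lemma nn_integral_by_count:
  assumes t: "t \<ge> 0" and [measurable]: "\<And>n. F n \<in> borel_measurable P"
  shows "(\<integral>\<^sup>+\<omega>. F (cnt t \<omega>) \<omega> \<partial>P) = (\<Sum>n. \<integral>\<^sup>+\<omega>. (if between n t \<omega> then F n \<omega> else 0) \<partial>P)"
proof -
  have "(\<integral>\<^sup>+\<omega>. F (cnt t \<omega>) \<omega> \<partial>P) = (\<integral>\<^sup>+\<omega>. (\<Sum>n. if between n t \<omega> then F n \<omega> else 0) \<partial>P)"
  proof (rule nn_integral_cong_AE, use AE_reg in eventually_elim)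
    case (elim \<omega>)
    have "(\<Sum>n. if between n t \<omega> then F n \<omega> else 0) = (\<Sum>n\<in>{cnt t \<omega>}. if between n t \<omega> then F n \<omega> else 0)"
      by (rule suminf_finite) (use between_iff[OF elim t] in auto)
    then show ?case using between_iff[OF elim t] by simp
  qed
  then show ?thesis by (simp add: nn_integral_suminf)
qed

text \<open>The right side is a backward composition, so under contraction it converges along almost
  every sequence as t grows, and not merely in law.\<close>

lemma nn_integral_state_eq_last_jump:
  assumes t: "t \<ge> 0" and f[measurable]: "f \<in> borel_measurable borel"
  shows "(\<integral>\<^sup>+\<omega>. f (fl (t - arrival (cnt t \<omega>) \<omega>) (fwd cmap (cnt t \<omega>) \<omega> y)) \<partial>P) =
    (\<integral>\<^sup>+\<omega>. f (bwd qmap (cnt t \<omega>) \<omega> (fl (t - arrival (cnt t \<omega>) \<omega>) y)) \<partial>P)"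
proof -
  have "(\<integral>\<^sup>+\<omega>. f (fl (t - arrival (cnt t \<omega>) \<omega>) (fwd cmap (cnt t \<omega>) \<omega> y)) \<partial>P) = (\<Sum>n. fwd_part n f t y)"
    unfolding fwd_part_def by (rule nn_integral_by_count[OF t]) measurable
  also have "\<dots> = (\<Sum>n. bwd_part n f t y)" by (simp add: fwd_part_eq_bwd_part[OF f])
  also have "\<dots> = (\<integral>\<^sup>+\<omega>. f (bwd qmap (cnt t \<omega>) \<omega> (fl (t - arrival (cnt t \<omega>) \<omega>) y)) \<partial>P)"
    unfolding bwd_part_def by (rule nn_integral_by_count[OF t, symmetric]) measurable
  finally show ?thesis .
qed

text \<open>The reversal must keep the elapsed time together with the state, since the final flow
  and the number of jumps depend on it. The clock is therefore made part of the state, and the test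
  function sees the next gap in addition.\<close>

lemma nn_integral_state_eq_bwd:
  assumes t: "t \<ge> 0" and f[measurable]: "f \<in> borel_measurable borel"
  shows "(\<integral>\<^sup>+\<omega>. f (fl (t - arrival (cnt t \<omega>) \<omega>) (fwd cmap (cnt t \<omega>) \<omega> y)) \<partial>P) =
    (\<integral>\<^sup>+\<omega>. f (fl (t - arrival (cnt t \<omega>) \<omega>) (bwd cmap (cnt t \<omega>) \<omega> y)) \<partial>P)"
proof -
  define \<Phi> :: "real \<times> real \<Rightarrow> real \<times> 'a \<Rightarrow> real \<times> 'a" where "\<Phi> p w = (fst w + fst p, cmap p (snd w))" for p w
  interpret A: random_maps law "borel \<Otimes>\<^sub>M borel" \<Phi>
    by (rule random_maps.intro[OF law(1)]) (unfold \<Phi>_def cmap_def, measurable)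
  have fw: "fwd \<Phi> n \<omega> (u, y) = (u + arrival n \<omega>, fwd cmap n \<omega> y)" for n \<omega> u y
    by (induction n arbitrary: u y) (auto simp: \<Phi>_def arrival_Suc)
  have bw: "bwd \<Phi> n \<omega> (u, y) = (u + arrival n \<omega>, bwd cmap n \<omega> y)" for n \<omega> u y
    by (induction n arbitrary: u y) (auto simp: \<Phi>_def arrival_Suc)
  define h where "h w p = (if fst w \<le> t \<and> t < fst w + fst p then f (fl (t - fst w) (snd w)) else 0)" for w :: "real \<times> 'a" and p :: "real \<times> real"
  have eq: "(\<integral>\<^sup>+\<omega>. h (fwd \<Phi> n \<omega> (0, y)) (\<omega> n) \<partial>P) = (\<integral>\<^sup>+\<omega>. h (bwd \<Phi> n \<omega> (0, y)) (\<omega> n) \<partial>P)" for n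
    by (rule A.nn_integral_fwd_eq_bwd_next) (unfold h_def, measurable, simp add: space_pair_measure)
  have "(\<integral>\<^sup>+\<omega>. f (fl (t - arrival (cnt t \<omega>) \<omega>) (fwd cmap (cnt t \<omega>) \<omega> y)) \<partial>P) =
    (\<Sum>n. \<integral>\<^sup>+\<omega>. (if between n t \<omega> then f (fl (t - arrival n \<omega>) (fwd cmap n \<omega> y)) else 0) \<partial>P)"
    by (rule nn_integral_by_count[OF t]) measurable
  also have "\<dots> = (\<Sum>n. \<integral>\<^sup>+\<omega>. (if between n t \<omega> then f (fl (t - arrival n \<omega>) (bwd cmap n \<omega> y)) else 0) \<partial>P)"
    using eq by (simp add: h_def fw bw between_def arrival_Suc cong: if_cong)
  also have "\<dots> = (\<integral>\<^sup>+\<omega>. f (fl (t - arrival (cnt t \<omega>) \<omega>) (bwd cmap (cnt t \<omega>) \<omega> y)) \<partial>P)"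
    by (rule nn_integral_by_count[OF t, symmetric]) measurable
  finally show ?thesis .
qed

end

section \<open>The matrix exponential and the pathwise equation\<close>

lemma matpow_vec_bound:
  fixes B :: "real^'n^'n"
  shows "\<exists>K\<ge>0. \<forall>n x. norm (matpow B n *v x) \<le> K ^ n * norm x"
proof -
  obtain K where K: "K > 0" "\<And>x. norm (B *v x) \<le> norm x * K"
    using bounded_linear.pos_bounded[OF matrix_vector_mul_bounded_linear[of B]] by blast
  have "norm (matpow B n *v x) \<le> K ^ n * norm x" for n x
  proof (induction n)
    case (Suc n)
    have "norm (matpow B (Suc n) *v x) = norm (B *v (matpow B n *v x))"
      by (simp add: matrix_vector_mul_assoc)
    also have "\<dots> \<le> norm (matpow B n *v x) * K" by (rule K)
    also have "\<dots> \<le> K ^ n * norm x * K" using Suc K by (intro mult_right_mono) auto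
    finally show ?case by (simp add: mult_ac)
  qed simp
  then show ?thesis using K(1) by (intro exI[of _ K]) simp
qed

lemma matrix_mult_scaleR:
  fixes A X :: "real^'n^'n"
  shows "(c *\<^sub>R A) ** X = c *\<^sub>R (A ** X)" "A ** (c *\<^sub>R X) = c *\<^sub>R (A ** X)"
  by (simp_all add: vec_eq_iff matrix_matrix_mult_def sum_distrib_left mult_ac)

lemma matpow_scaleR: "matpow (t *\<^sub>R B) n = t ^ n *\<^sub>R matpow (B :: real^'n^'n) n"
  by (induction n) (simp_all add: matrix_mult_scaleR mult.commute)

lemma matpow_entry: "matpow (B :: real^'n^'n) n $ i $ j = (matpow B n *v axis j 1) $ i"
  by (simp add: matrix_vector_mult_basis column_def)

text \<open>Entries are coordinates of powers applied to unit vectors, so a bound K^n for vectors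
  gives one for the norm of the matrix up to a dimension factor, and the exponential series
  dominates.\<close>

lemma summable_mexp: "summable (\<lambda>n. (1 / fact n) *\<^sub>R matpow (B :: real^'n^'n) n)"
proof -
  obtain K where K: "\<And>n x. norm (matpow B n *v x) \<le> K ^ n * norm x"
    using matpow_vec_bound[of B] by metis
  have entry: "\<bar>matpow B n $ i $ j\<bar> \<le> K ^ n" for n i j
    using component_le_norm_cart[of "matpow B n *v axis j 1" i] K[of n "axis j 1"]
    unfolding matpow_entry by simp
  have row: "norm (matpow B n $ i) \<le> real CARD('n) * K ^ n" for n i
  proof -
    have "norm (matpow B n $ i) \<le> (\<Sum>j\<in>UNIV. \<bar>matpow B n $ i $ j\<bar>)" by (rule norm_le_l1_cart)
    also have "\<dots> \<le> (\<Sum>j\<in>(UNIV :: 'n set). K ^ n)" by (intro sum_mono entry)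
    finally show ?thesis by simp
  qed
  have "norm (matpow B n) \<le> real CARD('n) * (real CARD('n) * K ^ n)" for n
  proof -
    have "norm (matpow B n) \<le> (\<Sum>i\<in>UNIV. norm (matpow B n $ i))"
      unfolding norm_vec_def by (rule L2_set_le_sum) simp
    also have "\<dots> \<le> (\<Sum>i\<in>(UNIV :: 'n set). real CARD('n) * K ^ n)" by (intro sum_mono row)
    finally show ?thesis by simp
  qed
  then have "norm ((1 / fact n) *\<^sub>R matpow B n) \<le> (real CARD('n) * real CARD('n)) * (K ^ n /\<^sub>R fact n)" for n
    by (simp add: field_simps)
  then show ?thesis
    by (intro summable_comparison_test'[OF summable_mult[OF sums_summable[OF exp_converges[of K]]]])
qed

lemma mexp_mult_vec:
  fixes B :: "real^'n^'n"
  shows "(\<lambda>n. (t ^ n / fact n) *\<^sub>R (matpow B n *v x)) sums (mexp (t *\<^sub>R B) *v x)"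
proof -
  have "bounded_linear (\<lambda>M :: real^'n^'n. M *v x)"
    by (rule linear_conv_bounded_linear[THEN iffD1], unfold_locales)
       (simp_all add: matrix_vector_mult_add_rdistrib scaleR_matrix_vector_assoc[symmetric])
  from bounded_linear.sums[OF this summable_sums[OF summable_mexp[of "t *\<^sub>R B"]]]
  show ?thesis by (simp add: mexp_def matpow_scaleR scaleR_matrix_vector_assoc[symmetric])
qed

lemma mexp_0 [simp]: "mexp (0 :: real^'n^'n) = mat 1"
proof -
  have "(\<lambda>n. (1 / fact n) *\<^sub>R matpow (0 :: real^'n^'n) n) sums ((1 / fact 0) *\<^sub>R matpow (0 :: real^'n^'n) 0)"
  proof -
    have "matpow (0 :: real^'n^'n) n = 0" if "n \<noteq> 0" for n
      using that by (cases n) auto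
    then show ?thesis by (intro sums_finite[of "{0}", simplified]) auto
  qed
  then show ?thesis unfolding mexp_def by (simp add: sums_iff)
qed

text \<open>Each coordinate is a power series in t that converges everywhere and may be
  differentiated term by term; the shifted coefficients produce the factor B.\<close>

lemma mexp_has_vector_derivative:
  fixes B :: "real^'n^'n"
  shows "((\<lambda>t. mexp (t *\<^sub>R B) *v x) has_vector_derivative B *v (mexp (t *\<^sub>R B) *v x)) (at t within S)"
proof -
  have coord: "((\<lambda>t. (mexp (t *\<^sub>R B) *v x) $ i) has_field_derivative (B *v (mexp (t *\<^sub>R B) *v x)) $ i) (at t)" for i t
  proof -
    define c where "c n = (matpow B n *v x) $ i / fact n" for n
    have s: "(\<lambda>n. c n * u ^ n) sums (mexp (u *\<^sub>R B) *v x) $ i" for u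
      using bounded_linear.sums[OF bounded_linear_vec_nth[of i] mexp_mult_vec[of u B x]]
      by (simp add: c_def mult.commute)
    have d: "(\<lambda>n. diffs c n * t ^ n) sums (B *v (mexp (t *\<^sub>R B) *v x)) $ i"
    proof -
      have "diffs c n * t ^ n = (B *v ((t ^ n / fact n) *\<^sub>R (matpow B n *v x))) $ i" for n
      proof -
        have "diffs c n = (B ** matpow B n *v x) $ i / fact n"
          by (simp add: diffs_def c_def del: of_nat_Suc)
        then show ?thesis by (simp add: matrix_vector_mult_scaleR matrix_vector_mul_assoc)
      qed
      then show ?thesis
        using bounded_linear.sums[OF bounded_linear_vec_nth[of i]
          bounded_linear.sums[OF matrix_vector_mul_bounded_linear[of B] mexp_mult_vec[of t B x]]] by simp
    qed
    have "((\<lambda>u. \<Sum>n. c n * u ^ n) has_field_derivative (\<Sum>n. diffs c n * t ^ n)) (at t)"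
      by (rule termdiffs_strong_converges_everywhere) (rule sums_summable[OF s])
    then show ?thesis using s d by (simp add: sums_iff)
  qed
  show ?thesis
    unfolding has_vector_derivative_def
  proof (subst has_derivative_componentwise_within, rule ballI)
    fix e :: "real^'n" assume "e \<in> Basis"
    then obtain i where e: "e = axis i 1" by (auto simp: Basis_vec_def)
    have "((\<lambda>t. (mexp (t *\<^sub>R B) *v x) $ i) has_derivative (\<lambda>h. h * (B *v (mexp (t *\<^sub>R B) *v x)) $ i)) (at t within S)"
    proof -
      have "(\<lambda>h. h * (B *v (mexp (t *\<^sub>R B) *v x)) $ i) = (*) ((B *v (mexp (t *\<^sub>R B) *v x)) $ i)"
        by (auto simp: mult.commute)
      then show ?thesis using has_field_derivative_at_within[OF coord] by (simp only: has_field_derivative_def)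
    qed
    then show "((\<lambda>t. (mexp (t *\<^sub>R B) *v x) \<bullet> e) has_derivative (\<lambda>h. h *\<^sub>R (B *v (mexp (t *\<^sub>R B) *v x)) \<bullet> e)) (at t within S)"
      by (simp add: e inner_axis)
  qed
qed

lemma mexp_continuous: "continuous_on S (\<lambda>t. mexp (t *\<^sub>R (B :: real^'n^'n)) *v x)"
  unfolding continuous_on_eq_continuous_within
  by (auto intro!: has_vector_derivative_continuous[OF mexp_has_vector_derivative])

text \<open>Joint measurability in time and state comes from the series, whose terms are monomial in
  t and linear in x.\<close>

lemma mexp_measurable:
  fixes B :: "real^'n^'n"
  shows "(\<lambda>(t, x). mexp (t *\<^sub>R B) *v x) \<in> borel \<Otimes>\<^sub>M borel \<rightarrow>\<^sub>M borel"
proof -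
  have "(\<lambda>p. \<Sum>n. (fst p ^ n / fact n) *\<^sub>R (matpow B n *v snd p)) \<in> borel_measurable (borel \<Otimes>\<^sub>M borel)"
  proof (rule borel_measurable_suminf)
    fix n
    have [measurable]: "(\<lambda>x. matpow B n *v x) \<in> borel_measurable borel"
      by (intro borel_measurable_continuous_onI linear_continuous_on matrix_vector_mul_bounded_linear)
    show "(\<lambda>p. (fst p ^ n / fact n) *\<^sub>R (matpow B n *v snd p)) \<in> borel_measurable (borel \<Otimes>\<^sub>M borel)"
      by measurable
  qed
  moreover have "(\<Sum>n. (fst p ^ n / fact n) *\<^sub>R (matpow B n *v snd p)) = mexp (fst p *\<^sub>R B) *v snd p" for p :: "real \<times> (real^'n)"
    using mexp_mult_vec[of "fst p" B "snd p"] by (simp add: sums_iff)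
  ultimately show ?thesis by (simp add: case_prod_unfold)
qed

text \<open>Gronwall in differential form: with K a bound for B, the function exp (- 2 K t) |d t|^2
  does not increase.\<close>

lemma linear_ode_unique:
  fixes B :: "real^'n^'n" and d :: "real \<Rightarrow> real^'n"
  assumes ab: "a \<le> b" and d: "\<And>t. t \<in> {a..b} \<Longrightarrow> (d has_vector_derivative B *v d t) (at t within {a..b})"
    and d0: "d a = 0"
  shows "d b = 0"
proof (cases "a = b")
  case False
  obtain K where K: "K \<ge> 0" "\<And>n x. norm (matpow B n *v x) \<le> K ^ n * norm x"
    using matpow_vec_bound[of B] by metis
  have KB: "norm (B *v x) \<le> K * norm x" for x using K(2)[of 1 x] by simp
  define \<phi> where "\<phi> t = exp (- 2 * K * t) * (d t \<bullet> d t)" for t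
  have der: "(\<phi> has_real_derivative exp (- 2 * K * t) * (2 * (d t \<bullet> (B *v d t)) - 2 * K * (d t \<bullet> d t))) (at t within {a..b})"
    if t: "t \<in> {a..b}" for t
  proof -
    have "((\<lambda>t. d t \<bullet> d t) has_derivative (\<lambda>h. d t \<bullet> (h *\<^sub>R (B *v d t)) + (h *\<^sub>R (B *v d t)) \<bullet> d t)) (at t within {a..b})"
      using d[OF t] unfolding has_vector_derivative_def by (intro has_derivative_inner)
    then have "((\<lambda>t. d t \<bullet> d t) has_real_derivative 2 * (d t \<bullet> (B *v d t))) (at t within {a..b})"
      unfolding has_field_derivative_def by (rule has_derivative_eq_rhs) (auto simp: fun_eq_iff inner_commute)
    then show ?thesis unfolding \<phi>_def[abs_def] by (auto intro!: derivative_eq_intros simp: algebra_simps)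
  qed
  have "\<phi> b \<le> \<phi> a"
  proof (rule DERIV_nonpos_imp_decreasing_open[of a b \<phi>])
    show "a \<le> b" by (rule ab)
    show "continuous_on {a..b} \<phi>" unfolding continuous_on_eq_continuous_within by (intro ballI DERIV_continuous[OF der])
  next
    fix t assume t: "a < t" "t < b"
    have "d t \<bullet> (B *v d t) \<le> norm (d t) * norm (B *v d t)" by (rule norm_cauchy_schwarz)
    also have "\<dots> \<le> norm (d t) * (K * norm (d t))" by (intro mult_left_mono KB) auto
    finally have "2 * (d t \<bullet> (B *v d t)) - 2 * K * (d t \<bullet> d t) \<le> 0"
      by (simp add: power2_norm_eq_inner[symmetric] power2_eq_square mult_ac)
    moreover have "(\<phi> has_real_derivative exp (- 2 * K * t) * (2 * (d t \<bullet> (B *v d t)) - 2 * K * (d t \<bullet> d t))) (at t)"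
      using der[of t] t by (simp add: at_within_Icc_at)
    ultimately show "\<exists>y. (\<phi> has_real_derivative y) (at t) \<and> y \<le> 0"
      by (intro exI conjI) (auto simp: mult_le_0_iff)
  qed
  then have "exp (- 2 * K * b) * (d b \<bullet> d b) \<le> 0" using d0 by (simp add: \<phi>_def)
  then have "d b \<bullet> d b \<le> 0" by (simp add: mult_le_0_iff)
  then have "d b \<bullet> d b = 0" using inner_ge_zero[of "d b"] by linarith
  then show ?thesis by simp
qed (use d0 in simp)

lemma linear_ode_solution:
  fixes B :: "real^'n^'n" and y :: "real \<Rightarrow> real^'n"
  assumes ab: "a \<le> b" and y: "\<And>t. t \<in> {a..b} \<Longrightarrow> (y has_vector_derivative B *v y t) (at t within {a..b})"
  shows "y b = mexp ((b - a) *\<^sub>R B) *v y a"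
proof -
  define d where "d t = y t - mexp ((t - a) *\<^sub>R B) *v y a" for t
  have "d b = 0"
  proof (rule linear_ode_unique[OF ab, of d B])
    fix t assume t: "t \<in> {a..b}"
    have "((\<lambda>u. mexp (u *\<^sub>R B) *v y a) \<circ> (\<lambda>t. t - a) has_vector_derivative (1 *\<^sub>R (B *v (mexp ((t - a) *\<^sub>R B) *v y a)))) (at t within {a..b})"
      by (rule vector_diff_chain_within) (auto intro!: derivative_eq_intros mexp_has_vector_derivative)
    then have "(d has_vector_derivative B *v y t - B *v (mexp ((t - a) *\<^sub>R B) *v y a)) (at t within {a..b})"
      unfolding d_def comp_def using y[OF t] by (auto intro!: derivative_eq_intros)
    then show "(d has_vector_derivative B *v d t) (at t within {a..b})"
      by (simp add: d_def matrix_vector_mult_diff_distrib)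
  qed (simp add: d_def)
  then show ?thesis by (simp add: d_def)
qed

lemma left_lim_grid:
  fixes f :: "real \<Rightarrow> 'a::metric_space"
  assumes f: "cadlag f" and s: "s > 0"
  shows "(\<lambda>n. f (real (nat (\<lceil>s * real (Suc n)\<rceil> - 1)) / real (Suc n))) \<longlonglongrightarrow> left_lim f s"
proof (rule filterlim_compose[OF cadlag_left_lim[OF f s]])
  let ?u = "\<lambda>n. real (nat (\<lceil>s * real (Suc n)\<rceil> - 1)) / real (Suc n)"
  have b: "?u n < s" "s - 1 / real (Suc n) \<le> ?u n" for n
  proof -
    have gen: "r / m < s \<and> s - 1 / m \<le> r / m" if "r < s * m" "s * m \<le> r + 1" "m > 0" for r m :: real
    proof
      show "r / m < s" using that by (simp add: pos_divide_less_eq)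
      have "s \<le> (r + 1) / m" using that by (simp add: pos_le_divide_eq)
      then show "s - 1 / m \<le> r / m" by (simp add: add_divide_distrib)
    qed
    have "s * real (Suc n) > 0" using s by simp
    from gen[OF grid_cell_bounds[OF this]] show "?u n < s" "s - 1 / real (Suc n) \<le> ?u n" by simp_all
  qed
  have "?u \<longlonglongrightarrow> s"
  proof (rule tendsto_sandwich[of "\<lambda>n. s - 1 / real (Suc n)" _ _ "\<lambda>_. s"])
    have "(\<lambda>n. 1 / real (Suc n)) \<longlonglongrightarrow> 0" using LIMSEQ_inverse_real_of_nat by (simp add: inverse_eq_divide)
    from tendsto_diff[OF tendsto_const this, of s] show "(\<lambda>n. s - 1 / real (Suc n)) \<longlonglongrightarrow> s" by simp
    show "eventually (\<lambda>n. s - 1 / real (Suc n) \<le> ?u n) sequentially"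
      by (intro always_eventually allI b)
    show "eventually (\<lambda>n. ?u n \<le> s) sequentially"
      by (intro always_eventually allI less_imp_le b)
  qed simp
  then show "filterlim ?u (at_left s) sequentially" using b(1) by (simp add: filterlim_at less_imp_neq)
qed

text \<open>Left limits are limits of values at grid points strictly to the left, each a function of
  an integer-valued measurable map. The indicator restricts to positive times, where a cadlag path
  has left limits.\<close>

lemma left_lim_measurable:
  fixes f :: "real \<Rightarrow> 'a::{real_normed_vector, second_countable_topology}"
  assumes f: "cadlag f"
  shows "(\<lambda>s. indicator {0<..} s *\<^sub>R left_lim f s) \<in> borel_measurable borel"
proof (rule borel_measurable_LIMSEQ_metric)
  show "(\<lambda>s. indicator {0<..} s *\<^sub>R f (real (nat (\<lceil>s * real (Suc n)\<rceil> - 1)) / real (Suc n))) \<in> borel_measurable borel" for n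
  proof -
    have c: "(\<lambda>s. \<lceil>s * real (Suc n)\<rceil>) \<in> borel \<rightarrow>\<^sub>M count_space UNIV"
      by (rule measurable_compose[OF _ measurable_real_ceiling]) simp
    have "(\<lambda>s. f (real (nat (\<lceil>s * real (Suc n)\<rceil> - 1)) / real (Suc n))) \<in> borel_measurable borel"
      by (rule measurable_compose[OF c, of "\<lambda>k. f (real (nat (k - 1)) / real (Suc n))"]) simp
    then show ?thesis by (intro borel_measurable_scaleR) auto
  qed
  show "(\<lambda>n. indicator {0<..} s *\<^sub>R f (real (nat (\<lceil>s * real (Suc n)\<rceil> - 1)) / real (Suc n))) \<longlonglongrightarrow>
    indicator {0<..} s *\<^sub>R left_lim f s" for s
    using left_lim_grid[OF f, of s] by (cases "s > 0") auto
qed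

lemma left_lim_bounded:
  fixes f :: "real \<Rightarrow> 'a::real_normed_vector"
  assumes f: "cadlag f"
  shows "\<exists>C. \<forall>s. 0 < s \<longrightarrow> s \<le> t \<longrightarrow> norm (left_lim f s) \<le> C"
proof -
  obtain C where "\<forall>x\<in>f ` {0..t}. norm x \<le> C"
    using cadlag_bounded[OF f order.refl, of t] unfolding bounded_iff by blast
  then have C: "\<And>s. s \<in> {0..t} \<Longrightarrow> norm (f s) \<le> C" by blast
  have "norm (left_lim f s) \<le> C" if s: "0 < s" "s \<le> t" for s
  proof (rule tendsto_upperbound)
    show "((\<lambda>u. norm (f u)) \<longlongrightarrow> norm (left_lim f s)) (at_left s)"
      by (intro tendsto_norm cadlag_left_lim f s)
    show "eventually (\<lambda>u. norm (f u) \<le> C) (at_left s)"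
      unfolding eventually_at_left_field using C s by (intro exI[of _ 0]) auto
  qed simp
  then show ?thesis by blast
qed

section \<open>The Stieltjes integral and the state equation along a path with isolated
  jumps\<close>

context jump_path
begin

lemma disc_qv_step:
  assumes "jt n \<le> t" "t < jt (Suc n)"
  shows "disc_qv f t = (\<Sum>i=1..n. (jump f (jt i))\<^sup>2)"
proof -
  have "t \<ge> 0" using jt_nonneg[of n] assms by simp
  then show ?thesis using disc_qv_eq_sum jump_count_eq[OF assms] by simp
qed

lemma disc_qv_neg: "t \<le> 0 \<Longrightarrow> disc_qv f t = 0"
  by (simp add: disc_qv_def)

lemma disc_qv_mono: "s \<le> t \<Longrightarrow> disc_qv f s \<le> disc_qv f t"
proof -
  assume st: "s \<le> t"
  show ?thesis
  proof (cases "s \<le> 0")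
    case True
    show ?thesis
    proof (cases "t \<le> 0")
      case False
      then show ?thesis using True disc_qv_eq_sum[of t] by (simp add: disc_qv_neg sum_nonneg)
    qed (use True in \<open>simp add: disc_qv_neg\<close>)
  next
    case False
    then have s: "s \<ge> 0" "t \<ge> 0" using st by auto
    have "jt (jump_count f s) < jt (Suc (jump_count f t))"
      using jump_count_bracket(1)[OF s(1)] jump_count_bracket(2)[OF s(2)] st by simp
    then have "jump_count f s \<le> jump_count f t" by (simp add: jt_less_iff)
    then show ?thesis unfolding disc_qv_eq_sum[OF s(1)] disc_qv_eq_sum[OF s(2)]
      by (intro sum_mono2) auto
  qed
qed

lemma disc_qv_right_continuous: "continuous (at_right t) (disc_qv f)"
proof -
  have "eventually (\<lambda>u. disc_qv f u = disc_qv f t) (at_right t)"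
  proof (cases "t < 0")
    case True
    then show ?thesis unfolding eventually_at_right_field
      by (intro exI[of _ 0]) (auto simp: disc_qv_neg)
  next
    case False
    then obtain n where n: "jt n \<le> t" "t < jt (Suc n)" using jt_bracket[of t] by auto
    have "disc_qv f u = disc_qv f t" if "t < u" "u < jt (Suc n)" for u
      using that n disc_qv_step[of n u] disc_qv_step[of n t] by simp
    then show ?thesis unfolding eventually_at_right_field
      using n by (intro exI[of _ "jt (Suc n)"]) auto
  qed
  then have "(disc_qv f \<longlongrightarrow> disc_qv f t) (at_right t)" by (rule tendsto_eventually)
  then show ?thesis by (simp add: continuous_within)
qed

abbreviation "qv_measure \<equiv> interval_measure (disc_qv f)"

lemma emeasure_qv_Ioc: "a \<le> b \<Longrightarrow> emeasure qv_measure {a<..b} = ennreal (disc_qv f b - disc_qv f a)"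
  by (rule emeasure_interval_measure_Ioc[OF _ disc_qv_mono disc_qv_right_continuous])

text \<open>The open gap is exhausted by half-open intervals on which \<open>disc_qv f\<close> is
  constant; the right end is kept out because it carries an atom.\<close>

lemma qv_gap_null: "{jt i<..<jt (Suc i)} \<in> null_sets qv_measure"
proof -
  have "{jt i<..jt (Suc i) - 1 / real (Suc k)} \<in> null_sets qv_measure" for k
  proof (cases "jt i \<le> jt (Suc i) - 1 / real (Suc k)")
    case True
    let ?u = "jt (Suc i) - 1 / real (Suc k)"
    have "disc_qv f ?u = disc_qv f (jt i)"
      using disc_qv_step[of i ?u] disc_qv_step[of i "jt i"] True jt_Suc(2)[of i] by simp
    then show ?thesis using emeasure_qv_Ioc[OF True] by (simp add: null_sets_def)
  qed simp
  then have U: "(\<Union>k. {jt i<..jt (Suc i) - 1 / real (Suc k)}) \<in> null_sets qv_measure" by (rule null_sets_UN)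
  have sub: "{jt i<..<jt (Suc i)} \<subseteq> (\<Union>k. {jt i<..jt (Suc i) - 1 / real (Suc k)})"
  proof
    fix x assume x: "x \<in> {jt i<..<jt (Suc i)}"
    then obtain k where "1 / real (Suc k) < jt (Suc i) - x" using nat_approx_posE[of "jt (Suc i) - x"] by auto
    then show "x \<in> (\<Union>k. {jt i<..jt (Suc i) - 1 / real (Suc k)})" using x by (auto intro!: exI[of _ k])
  qed
  show ?thesis by (rule null_sets_subset[OF U _ sub]) simp
qed

lemma qv_atom: "emeasure qv_measure {jt (Suc i)} = ennreal ((jump f (jt (Suc i)))\<^sup>2)"
proof -
  have "emeasure qv_measure {jt i<..jt (Suc i)} = ennreal ((jump f (jt (Suc i)))\<^sup>2)"
    using emeasure_qv_Ioc[of "jt i" "jt (Suc i)"] disc_qv_step[of i "jt i"] disc_qv_step[of "Suc i" "jt (Suc i)"]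
      jt_Suc(2)[of i] jt_Suc(2)[of "Suc i"] by simp
  moreover have "{jt i<..jt (Suc i)} = {jt (Suc i)} \<union> {jt i<..<jt (Suc i)}" using jt_Suc(2)[of i] by auto
  moreover have "emeasure qv_measure ({jt (Suc i)} \<union> {jt i<..<jt (Suc i)}) = emeasure qv_measure {jt (Suc i)}"
    by (rule emeasure_Un_null_set[OF _ qv_gap_null]) simp
  ultimately show ?thesis by simp
qed

text \<open>Off the open gaps, which are null sets, only jump times remain, so the integral is a
  finite sum over atoms.\<close>

lemma qv_integral:
  fixes h :: "real \<Rightarrow> real^'q"
  assumes n: "jt n \<le> t" "t < jt (Suc n)" and h: "(\<lambda>s. indicator {0<..} s *\<^sub>R h s) \<in> borel_measurable borel"
  shows "(LINT s:{0<..t}|qv_measure. h s) = (\<Sum>i=1..n. (jump f (jt i))\<^sup>2 *\<^sub>R h (jt i))"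
proof -
  have pos: "jt i > 0" if "i \<in> {1..n}" for i
    using jt_less_iff[of 0 i] that by simp
  have hm: "(\<lambda>s. indicator {0<..t} s *\<^sub>R h s) \<in> borel_measurable borel"
  proof -
    have eq: "(\<lambda>s. indicator {0<..t} s *\<^sub>R h s) = (\<lambda>s. indicator {0<..t} s *\<^sub>R (indicator {0<..} s *\<^sub>R h s))"
      by (auto simp: indicator_def)
    show ?thesis by (subst eq, intro borel_measurable_scaleR h) auto
  qed
  have "AE s in qv_measure. s \<notin> (\<Union>i\<in>{..n}. {jt i<..<jt (Suc i)})"
    by (intro AE_not_in null_sets.finite_UN) (auto intro: qv_gap_null)
  then have AE: "AE s in qv_measure. indicator {0<..t} s *\<^sub>R h s = (\<Sum>i=1..n. indicator {jt i} s *\<^sub>R h (jt i))"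
  proof eventually_elim
    case (elim s)
    show ?case
    proof (cases "s \<in> {0<..t}")
      case True
      obtain m where m: "jt m \<le> s" "s < jt (Suc m)" using jt_bracket[of s] True by auto
      have "jt m < jt (Suc n)" using m True n by simp
      then have "m \<le> n" by (simp add: jt_less_iff)
      then have "s = jt m" using elim m by (cases "s = jt m") auto
      moreover from this True have "m \<noteq> 0" by (intro notI) auto
      ultimately have sm: "s = jt m" "m \<in> {1..n}" using \<open>m \<le> n\<close> by auto
      have "(\<Sum>i=1..n. indicator {jt i} s *\<^sub>R h (jt i)) = (\<Sum>i\<in>{m}. indicator {jt i} s *\<^sub>R h (jt i))"
        by (rule sum.mono_neutral_right) (use sm strict_mono_eq[OF jt_strict_mono] in \<open>auto simp: indicator_def\<close>)
      then show ?thesis using True sm by simp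
    next
      case False
      have "indicator {jt i} s = (0::real)" if "i \<in> {1..n}" for i
      proof -
        have "jt i \<le> t" using that n jt_le_iff[of i n] by simp
        then have "s \<noteq> jt i" using False pos[OF that] by auto
        then show ?thesis by simp
      qed
      then show ?thesis using False by simp
    qed
  qed
  have "(LINT s:{0<..t}|qv_measure. h s) = (\<integral>s. (\<Sum>i=1..n. indicator {jt i} s *\<^sub>R h (jt i)) \<partial>qv_measure)"
    unfolding set_lebesgue_integral_def
  proof (rule integral_cong_AE[OF _ _ AE])
    show "(\<lambda>s. indicator {0<..t} s *\<^sub>R h s) \<in> borel_measurable qv_measure" using hm by simp
    show "(\<lambda>s. \<Sum>i=1..n. indicator {jt i} s *\<^sub>R h (jt i)) \<in> borel_measurable qv_measure"
      by (intro borel_measurable_sum borel_measurable_scaleR) auto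
  qed
  also have "\<dots> = (\<Sum>i=1..n. measure qv_measure {jt i} *\<^sub>R h (jt i))"
  proof -
    have int: "integrable qv_measure (indicator {jt i} :: real \<Rightarrow> real)" if "i \<in> {1..n}" for i
    proof -
      obtain k where "i = Suc k" using \<open>i \<in> {1..n}\<close> by (cases i) auto
      then have "emeasure qv_measure {jt i} < \<infinity>" using qv_atom[of k] by simp
      then show ?thesis by (intro integrable_real_indicator) auto
    qed
    have "(\<integral>s. (\<Sum>i=1..n. indicator {jt i} s *\<^sub>R h (jt i)) \<partial>qv_measure) =
      (\<Sum>i=1..n. \<integral>s. indicator {jt i} s *\<^sub>R h (jt i) \<partial>qv_measure)"
      by (rule Bochner_Integration.integral_sum) (intro integrable_scaleR_left int)
    also have "\<dots> = (\<Sum>i=1..n. measure qv_measure {jt i} *\<^sub>R h (jt i))"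
      by (intro sum.cong refl) (simp add: int)
    finally show ?thesis .
  qed
  also have "\<dots> = (\<Sum>i=1..n. (jump f (jt i))\<^sup>2 *\<^sub>R h (jt i))"
  proof (rule sum.cong[OF refl])
    fix i assume "i \<in> {1..n}"
    then obtain k where "i = Suc k" by (cases i) auto
    then show "measure qv_measure {jt i} *\<^sub>R h (jt i) = (jump f (jt i))\<^sup>2 *\<^sub>R h (jt i)"
      using qv_atom[of k] by (simp add: measure_def)
  qed
  finally show ?thesis .
qed

text \<open>Within a gap the Stieltjes term is constant, so y differs from a constant by the
  integral of B y and solves the linear equation; at a jump time one atom is added, with the
  integrand evaluated at the left limit.\<close>

theorem cogarch_path:
  fixes B :: "real^'q^'q" and a e :: "real^'q" and y :: "real \<Rightarrow> real^'q"
  assumes y: "cadlag y"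
    and eq: "\<And>t. t > 0 \<Longrightarrow> y t = y 0 + (LINT s:{0<..t}|lborel. B *v left_lim y s)
        + (LINT s:{0<..t}|qv_measure. (\<alpha> + a \<bullet> left_lim y s) *\<^sub>R e)"
  shows "jt n \<le> t \<Longrightarrow> t < jt (Suc n) \<Longrightarrow> y t = mexp ((t - jt n) *\<^sub>R B) *v y (jt n)"
    and "y (jt (Suc n)) = mexp ((jt (Suc n) - jt n) *\<^sub>R B) *v y (jt n) +
      ((jump f (jt (Suc n)))\<^sup>2 * (\<alpha> + a \<bullet> (mexp ((jt (Suc n) - jt n) *\<^sub>R B) *v y (jt n)))) *\<^sub>R e"
proof -
  define g where "g s = B *v left_lim y s" for s
  define h where "h s = (\<alpha> + a \<bullet> left_lim y s) *\<^sub>R e" for s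
  define J where "J n = (\<Sum>i=1..n. (jump f (jt i))\<^sup>2 *\<^sub>R h (jt i))" for n
  have lm: "(\<lambda>s. indicator {0<..} s *\<^sub>R left_lim y s) \<in> borel_measurable borel"
    by (rule left_lim_measurable[OF y])
  have [measurable]: "(\<lambda>x. B *v x) \<in> borel_measurable borel"
    by (intro borel_measurable_continuous_onI linear_continuous_on matrix_vector_mul_bounded_linear)
  have gm: "(\<lambda>s. indicator {0<..} s *\<^sub>R g s) \<in> borel_measurable borel"
  proof -
    have "(\<lambda>s. indicator {0<..} s *\<^sub>R g s) = (\<lambda>s. B *v (indicator {0<..} s *\<^sub>R left_lim y s))"
      by (auto simp: g_def indicator_def)
    also have "\<dots> \<in> borel_measurable borel" by (rule measurable_compose[OF lm]) measurable
    finally show ?thesis .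
  qed
  have hm: "(\<lambda>s. indicator {0<..} s *\<^sub>R h s) \<in> borel_measurable borel"
  proof -
    have "(\<lambda>s. indicator {0<..} s *\<^sub>R h s) =
      (\<lambda>s. (indicator {0<..} s * (\<alpha> + a \<bullet> (indicator {0<..} s *\<^sub>R left_lim y s))) *\<^sub>R e)"
      by (auto simp: h_def indicator_def)
    also have "\<dots> \<in> borel_measurable borel" using lm by measurable
    finally show ?thesis .
  qed
  have gi: "set_integrable lborel {0<..t} g" for t
  proof -
    obtain C where C: "\<And>s. 0 < s \<Longrightarrow> s \<le> t \<Longrightarrow> norm (left_lim y s) \<le> C" using left_lim_bounded[OF y, of t] by blast
    obtain K where K: "K > 0" "\<And>x. norm (B *v x) \<le> norm x * K"
      using bounded_linear.pos_bounded[OF matrix_vector_mul_bounded_linear[of B]] by blast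
    show ?thesis unfolding set_integrable_def
    proof (rule Bochner_Integration.integrable_bound)
      have "emeasure lborel {0<..t} < \<infinity>" by (cases "0 \<le> t") auto
      then show "integrable lborel (\<lambda>s. indicator {0<..t} s *\<^sub>R (\<bar>C\<bar> * K))"
        by (intro integrable_scaleR_left integrable_real_indicator) auto
      have eq: "(\<lambda>s. indicator {0<..t} s *\<^sub>R g s) = (\<lambda>s. indicator {0<..t} s *\<^sub>R (indicator {0<..} s *\<^sub>R g s))"
        by (auto simp: indicator_def)
      have "(\<lambda>s. indicator {0<..t} s *\<^sub>R g s) \<in> borel_measurable borel"
        by (subst eq, intro borel_measurable_scaleR gm) auto
      then show "(\<lambda>s. indicator {0<..t} s *\<^sub>R g s) \<in> borel_measurable lborel" by simp
      show "AE s in lborel. norm (indicator {0<..t} s *\<^sub>R g s) \<le> norm (indicator {0<..t} s *\<^sub>R (\<bar>C\<bar> * K))"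
      proof (rule AE_I2)
        fix s
        show "norm (indicator {0<..t} s *\<^sub>R g s) \<le> norm (indicator {0<..t} s *\<^sub>R (\<bar>C\<bar> * K))"
        proof (cases "s \<in> {0<..t}")
          case True
          have "norm (g s) \<le> norm (left_lim y s) * K" unfolding g_def by (rule K)
          also have "\<dots> \<le> \<bar>C\<bar> * K" using C[of s] True K by (intro mult_right_mono) auto
          finally show ?thesis using True K by simp
        qed simp
      qed
    qed
  qed
  \<comment> \<open>The gauge integral makes continuity, additivity and differentiation in the upper
    limit available.\<close>
  define I where "I t = integral {0..t} g" for t
  have gint: "g integrable_on {0<..t}" "(LINT s:{0<..t}|lborel. g s) = integral {0<..t} g" for t
    using set_borel_integral_eq_integral[OF gi] by auto
  have gI: "g integrable_on {0..t}" "(LINT s:{0<..t}|lborel. g s) = I t" for t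
  proof -
    show "g integrable_on {0..t}"
      by (rule integrable_spike_set[OF gint(1)]) (rule negligible_subset[of "{0}"], auto)+
    show "(LINT s:{0<..t}|lborel. g s) = I t" unfolding gint I_def by (rule integral_spike_set) (rule negligible_subset[of "{0}"], auto)+
  qed
  have Icont: "continuous_on {0..t} I" for t
    unfolding I_def by (rule indefinite_integral_continuous_1[OF gI(1)])
  have yt: "y t = y 0 + I t + J n" if "jt n \<le> t" "t < jt (Suc n)" for n t
  proof (cases "t > 0")
    case True
    show ?thesis using eq[OF True] qv_integral[OF that hm] gI(2)[of t] unfolding g_def h_def J_def by simp
  next
    case False
    then have "t = 0" using jt_nonneg[of n] that by simp
    moreover from this have "n = 0" using that jt_le_iff[of n 0] by simp
    ultimately show ?thesis by (simp add: I_def J_def)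
  qed
  have part1: "y t = mexp ((t - jt n) *\<^sub>R B) *v y (jt n)" if t: "jt n \<le> t" "t < jt (Suc n)" for n t
  proof (rule linear_ode_solution[OF t(1)])
    have ycont: "continuous_on {jt n..t} y"
    proof (rule continuous_on_eq)
      show "continuous_on {jt n..t} (\<lambda>u. y 0 + I u + J n)"
        by (intro continuous_intros continuous_on_subset[OF Icont[of t]]) (use jt_nonneg in auto)
    qed (use yt t in auto)
    \<comment> \<open>Inside the gap y is continuous, so its left limit is its value; the left end
      point is excluded and forms a null set.\<close>
    have gB: "g s = B *v y s" if s: "jt n < s" "s \<le> t" for s
    proof -
      have "continuous (at s within {jt n..t}) y" using ycont s by (simp add: continuous_on_eq_continuous_within)
      then have "(y \<longlongrightarrow> y s) (at s within {jt n..s})"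
        unfolding continuous_within by (rule tendsto_within_subset) (use s in auto)
      then have "(y \<longlongrightarrow> y s) (at_left s)" using s by (simp add: at_within_Icc_at_left)
      moreover have "s > 0" using s jt_nonneg[of n] by simp
      ultimately have "left_lim y s = y s" unfolding left_lim_def by (intro tendsto_Lim) auto
      then show ?thesis by (simp add: g_def)
    qed
    have yint: "y u = y (jt n) + integral {jt n..u} (\<lambda>s. B *v y s)" if u: "u \<in> {jt n..t}" for u
    proof -
      have "I (jt n) + integral {jt n..u} g = I u"
        unfolding I_def by (rule Henstock_Kurzweil_Integration.integral_combine) (use u jt_nonneg gI in auto)
      moreover have "integral {jt n..u} g = integral {jt n..u} (\<lambda>s. B *v y s)"
        by (rule integral_spike[of "{jt n}"]) (use gB u in auto)
      moreover have "y u = y 0 + I u + J n" "y (jt n) = y 0 + I (jt n) + J n"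
        using yt u t jt_Suc(2)[of n] by auto
      ultimately show ?thesis by (simp add: algebra_simps)
    qed
    fix u assume u: "u \<in> {jt n..t}"
    have "((\<lambda>u. integral {jt n..u} (\<lambda>s. B *v y s)) has_vector_derivative B *v y u) (at u within {jt n..t})"
      by (rule integral_has_vector_derivative[OF _ u])
         (intro continuous_on_compose2[OF linear_continuous_on[OF matrix_vector_mul_bounded_linear] ycont], auto)
    then have "((\<lambda>u. y (jt n) + integral {jt n..u} (\<lambda>s. B *v y s)) has_vector_derivative B *v y u) (at u within {jt n..t})"
      by (auto intro!: derivative_eq_intros)
    then show "(y has_vector_derivative B *v y u) (at u within {jt n..t})"
      by (rule has_vector_derivative_transform[OF u, rotated]) (rule yint)
  qed
  show "jt n \<le> t \<Longrightarrow> t < jt (Suc n) \<Longrightarrow> y t = mexp ((t - jt n) *\<^sub>R B) *v y (jt n)" by (rule part1)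
  let ?\<tau> = "jt (Suc n)"
  let ?w = "mexp ((?\<tau> - jt n) *\<^sub>R B) *v y (jt n)"
  have pos: "?\<tau> > 0" using jt_less_iff[of 0 "Suc n"] by simp
  have ev: "eventually (\<lambda>t. jt n \<le> t \<and> t < ?\<tau>) (at_left ?\<tau>)"
    unfolding eventually_at_left_field using jt_Suc(2)[of n] by (intro exI[of _ "jt n"]) auto
  \<comment> \<open>The left limit at the jump is computed twice: from the integral equation, to
    isolate the atom, and from the exponential, to express it by the state after the previous
    jump.\<close>
  have left: "left_lim y ?\<tau> = y 0 + I ?\<tau> + J n"
  proof -
    have "(I \<longlongrightarrow> I ?\<tau>) (at ?\<tau> within {0..?\<tau>})"
      using Icont[of ?\<tau>] pos by (auto simp: continuous_on_def)
    then have "(I \<longlongrightarrow> I ?\<tau>) (at_left ?\<tau>)" using pos by (simp add: at_within_Icc_at_left)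
    then have "((\<lambda>t. y 0 + I t + J n) \<longlongrightarrow> y 0 + I ?\<tau> + J n) (at_left ?\<tau>)" by (intro tendsto_intros)
    then have "(y \<longlongrightarrow> y 0 + I ?\<tau> + J n) (at_left ?\<tau>)"
      by (rule Lim_transform_eventually) (use ev in \<open>eventually_elim, use yt in auto\<close>)
    then show ?thesis unfolding left_lim_def by (intro tendsto_Lim) auto
  qed
  have left': "left_lim y ?\<tau> = ?w"
  proof -
    have "continuous_on UNIV (\<lambda>t. mexp ((t - jt n) *\<^sub>R B) *v y (jt n))"
      by (rule continuous_on_compose2[OF mexp_continuous[of UNIV]]) (auto intro!: continuous_intros)
    then have "((\<lambda>t. mexp ((t - jt n) *\<^sub>R B) *v y (jt n)) \<longlongrightarrow> ?w) (at_left ?\<tau>)"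
      by (auto simp: continuous_on_def intro: tendsto_within_subset)
    then have "(y \<longlongrightarrow> ?w) (at_left ?\<tau>)"
      by (rule Lim_transform_eventually) (use ev in \<open>eventually_elim, use part1 in auto\<close>)
    then show ?thesis unfolding left_lim_def by (intro tendsto_Lim) auto
  qed
  have "y ?\<tau> = y 0 + I ?\<tau> + J (Suc n)" using jt_Suc(2)[of "Suc n"] by (intro yt) auto
  also have "\<dots> = left_lim y ?\<tau> + (jump f ?\<tau>)\<^sup>2 *\<^sub>R h ?\<tau>" by (simp add: left J_def)
  finally show "y ?\<tau> = ?w + ((jump f ?\<tau>)\<^sup>2 * (\<alpha> + a \<bullet> ?w)) *\<^sub>R e"
    by (simp add: h_def left')
qed

end

section \<open>The norm adapted to a diagonalisation\<close>

lemma powr_convex_nonneg: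
  fixes x y p s t :: real
  assumes p: "p \<ge> 1" and xy: "x \<ge> 0" "y \<ge> 0" and st: "s \<ge> 0" "t \<ge> 0" "s + t = 1"
  shows "(s * x + t * y) powr p \<le> s * x powr p + t * y powr p"
proof -
  \<comment> \<open>Vanishing arguments are covered by \<open>u powr p \<le> u\<close> for u in
    [0, 1]; the convexity of powers is applied where both arguments are positive.\<close>
  have scale: "(u * z) powr p \<le> u * z powr p" if "0 \<le> u" "u \<le> 1" "z \<ge> 0" for u z :: real
  proof (cases "u = 0")
    case False
    have "(u * z) powr p = u powr p * z powr p" using that by (simp add: powr_mult)
    also have "\<dots> \<le> u powr 1 * z powr p" using that p by (intro mult_right_mono powr_mono') auto
    finally show ?thesis using that by simp
  qed (use p in simp)
  show ?thesis
  proof (cases "x = 0 \<or> y = 0")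
    case True
    then show ?thesis using scale[of s x] scale[of t y] xy st p by auto
  next
    case False
    then have "((1 - t) * x + t * y) powr p \<le> (1 - t) * x powr p + t * y powr p"
      using convex_onD[OF powr_convex[OF p], of t x y] xy st by simp
    moreover have "s = 1 - t" using st by simp
    ultimately show ?thesis by (simp only:)
  qed
qed

text \<open>After division by the two norms, convexity of the power with weights a / (a + b) and b /
  (a + b) bounds each summand, and these bounds add up to 1.\<close>

lemma Lr_sum_minkowski:
  fixes u v :: "'i::finite \<Rightarrow> real"
  assumes p: "p \<ge> 1" and uv: "\<And>i. u i \<ge> 0" "\<And>i. v i \<ge> 0"
  shows "(\<Sum>i\<in>UNIV. (u i + v i) powr p) powr (1 / p) \<le>
    (\<Sum>i\<in>UNIV. u i powr p) powr (1 / p) + (\<Sum>i\<in>UNIV. v i powr p) powr (1 / p)"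
proof -
  define N where "N w = (\<Sum>i\<in>UNIV. w i powr p) powr (1 / p)" for w :: "'i \<Rightarrow> real"
  have Np: "N w powr p = (\<Sum>i\<in>UNIV. w i powr p)" for w
    using p by (simp add: N_def powr_powr sum_nonneg)
  have zero: "w i = 0" if "N w = 0" "\<And>i. w i \<ge> 0" for w i
  proof -
    have "(\<Sum>i\<in>UNIV. w i powr p) = 0" using Np[of w] that p by simp
    then show ?thesis by (subst (asm) sum_nonneg_eq_0_iff) auto
  qed
  have nn: "N w \<ge> 0" for w by (simp add: N_def)
  consider "N u = 0" | "N v = 0" | "N u > 0" "N v > 0" using nn[of u] nn[of v] by linarith
  then have "N (\<lambda>i. u i + v i) \<le> N u + N v"
  proof cases
    case 1
    then have "u = (\<lambda>i. 0)" using zero[of u] uv by auto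
    then show ?thesis using nn[of u] by simp
  next
    case 2
    then have "v = (\<lambda>i. 0)" using zero[of v] uv by auto
    then show ?thesis using nn[of v] by simp
  next
    case 3
    define a b where "a = N u" and "b = N v"
    have ab: "a > 0" "b > 0" using 3 by (auto simp: a_def b_def)
    have ua: "(\<Sum>i\<in>UNIV. (u i / a) powr p) = 1"
    proof -
      have "(\<Sum>i\<in>UNIV. (u i / a) powr p) = (\<Sum>i\<in>UNIV. u i powr p) / a powr p"
        using uv ab by (simp add: powr_divide sum_divide_distrib)
      then show ?thesis using Np[of u] ab(1) powr_gt_zero[of "N u" p] unfolding a_def by (metis divide_self less_irrefl)
    qed
    have vb: "(\<Sum>i\<in>UNIV. (v i / b) powr p) = 1"
    proof -
      have "(\<Sum>i\<in>UNIV. (v i / b) powr p) = (\<Sum>i\<in>UNIV. v i powr p) / b powr p"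
        using uv ab by (simp add: powr_divide sum_divide_distrib)
      then show ?thesis using Np[of v] ab(2) powr_gt_zero[of "N v" p] unfolding b_def by (metis divide_self less_irrefl)
    qed
    have "(\<Sum>i\<in>UNIV. ((u i + v i) / (a + b)) powr p) \<le>
      (\<Sum>i\<in>UNIV. a / (a + b) * (u i / a) powr p + b / (a + b) * (v i / b) powr p)"
    proof (rule sum_mono)
      fix i
      have "(u i + v i) / (a + b) = a / (a + b) * (u i / a) + b / (a + b) * (v i / b)"
        using ab by (simp add: add_divide_distrib)
      then show "((u i + v i) / (a + b)) powr p \<le> a / (a + b) * (u i / a) powr p + b / (a + b) * (v i / b) powr p"
        using powr_convex_nonneg[OF p, of "u i / a" "v i / b" "a / (a + b)" "b / (a + b)"] uv ab
        by (simp add: add_divide_distrib[symmetric])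
    qed
    also have "\<dots> = a / (a + b) * (\<Sum>i\<in>UNIV. (u i / a) powr p) + b / (a + b) * (\<Sum>i\<in>UNIV. (v i / b) powr p)"
      by (simp add: sum.distrib sum_distrib_left)
    also have "\<dots> = 1" unfolding ua vb using ab by (simp add: add_divide_distrib[symmetric])
    finally have "(\<Sum>i\<in>UNIV. (u i + v i) powr p) / (a + b) powr p \<le> 1"
      using uv ab by (simp add: powr_divide sum_divide_distrib)
    then have "(\<Sum>i\<in>UNIV. (u i + v i) powr p) \<le> (a + b) powr p"
      using ab by (simp add: divide_le_eq)
    then have "N (\<lambda>i. u i + v i) \<le> ((a + b) powr p) powr (1 / p)"
      unfolding N_def using p by (intro powr_mono2) (auto simp: sum_nonneg)
    also have "\<dots> = a + b" using ab p by (simp add: powr_powr)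
    finally show ?thesis by (simp add: a_def b_def)
  qed
  then show ?thesis by (simp add: N_def)
qed

section \<open>L^r norms of complex vectors and the induced operator norm\<close>

context
  fixes r :: ereal
  assumes r: "1 \<le> r"
begin

lemma real_of_r: "r \<noteq> \<infinity> \<Longrightarrow> real_of_ereal r \<ge> 1"
  using r by (cases r) auto

lemma vec_Lr_norm_mono:
  assumes "\<And>i. cmod (u $ i) \<le> cmod (v $ i)"
  shows "vec_Lr_norm r u \<le> vec_Lr_norm r v"
proof (cases "r = \<infinity>")
  case True
  have "Max (range (\<lambda>i. cmod (u $ i))) \<le> Max (range (\<lambda>i. cmod (v $ i)))"
  proof (rule Max.boundedI)
    fix x assume "x \<in> range (\<lambda>i. cmod (u $ i))"
    then obtain i where "x = cmod (u $ i)" by auto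
    also have "\<dots> \<le> cmod (v $ i)" by (rule assms)
    also have "\<dots> \<le> Max (range (\<lambda>i. cmod (v $ i)))" by (intro Max_ge) auto
    finally show "x \<le> Max (range (\<lambda>i. cmod (v $ i)))" .
  qed auto
  then show ?thesis using True by (simp add: vec_Lr_norm_def)
next
  case False
  then show ?thesis using real_of_r assms
    by (auto simp: vec_Lr_norm_def intro!: powr_mono2 sum_mono sum_nonneg)
qed

lemma vec_Lr_norm_triangle: "vec_Lr_norm r (u + v) \<le> vec_Lr_norm r u + vec_Lr_norm r v"
proof (cases "r = \<infinity>")
  case True
  have "Max (range (\<lambda>i. cmod ((u + v) $ i))) \<le> Max (range (\<lambda>i. cmod (u $ i))) + Max (range (\<lambda>i. cmod (v $ i)))"
  proof (rule Max.boundedI)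
    fix x assume "x \<in> range (\<lambda>i. cmod ((u + v) $ i))"
    then obtain i where "x = cmod (u $ i + v $ i)" by auto
    also have "\<dots> \<le> cmod (u $ i) + cmod (v $ i)" by (rule norm_triangle_ineq)
    also have "\<dots> \<le> Max (range (\<lambda>i. cmod (u $ i))) + Max (range (\<lambda>i. cmod (v $ i)))"
      by (intro add_mono Max_ge) auto
    finally show "x \<le> Max (range (\<lambda>i. cmod (u $ i))) + Max (range (\<lambda>i. cmod (v $ i)))" .
  qed auto
  then show ?thesis using True by (simp add: vec_Lr_norm_def)
next
  case False
  let ?p = "real_of_ereal r"
  have p: "?p \<ge> 1" by (rule real_of_r[OF False])
  have "(\<Sum>i\<in>UNIV. cmod ((u + v) $ i) powr ?p) powr (1 / ?p) \<le>
    (\<Sum>i\<in>UNIV. (cmod (u $ i) + cmod (v $ i)) powr ?p) powr (1 / ?p)"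
    using p by (intro powr_mono2 sum_mono sum_nonneg) (auto intro: norm_triangle_ineq)
  also have "\<dots> \<le> (\<Sum>i\<in>UNIV. cmod (u $ i) powr ?p) powr (1 / ?p) + (\<Sum>i\<in>UNIV. cmod (v $ i) powr ?p) powr (1 / ?p)"
    by (rule Lr_sum_minkowski[OF p]) auto
  finally show ?thesis using False by (simp add: vec_Lr_norm_def)
qed

text \<open>Phrased through moduli, so that real and complex scalars are covered alike.\<close>

lemma vec_Lr_norm_scale:
  assumes "c \<ge> 0" "\<And>i. cmod (u $ i) = c * cmod (v $ i)"
  shows "vec_Lr_norm r u = c * vec_Lr_norm r v"
proof (cases "r = \<infinity>")
  case True
  have "Max (range (\<lambda>i. c * cmod (v $ i))) = c * Max (range (\<lambda>i. cmod (v $ i)))"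
    using mono_Max_commute[of "\<lambda>x. c * x" "range (\<lambda>i. cmod (v $ i))"] assms(1)
    by (simp add: image_image mono_def mult_left_mono)
  then show ?thesis using True assms by (simp add: vec_Lr_norm_def)
next
  case False
  then have "real_of_ereal r \<ge> 1" by (rule real_of_r)
  then show ?thesis using False assms
    by (simp add: vec_Lr_norm_def powr_mult sum_distrib_left[symmetric] sum_nonneg powr_powr)
qed

lemma component_le_vec_Lr_norm: "cmod (v $ i) \<le> vec_Lr_norm r v"
proof (cases "r = \<infinity>")
  case True
  then show ?thesis by (simp add: vec_Lr_norm_def)
next
  case False
  let ?p = "real_of_ereal r"
  have p: "?p \<ge> 1" by (rule real_of_r[OF False])
  have "cmod (v $ i) = (cmod (v $ i) powr ?p) powr (1 / ?p)" using p by (simp add: powr_powr)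
  also have "\<dots> \<le> (\<Sum>i\<in>UNIV. cmod (v $ i) powr ?p) powr (1 / ?p)"
    using p by (intro powr_mono2) (auto intro: member_le_sum)
  finally show ?thesis using False by (simp add: vec_Lr_norm_def)
qed

lemma vec_Lr_norm_nonneg: "0 \<le> vec_Lr_norm r v"
  using component_le_vec_Lr_norm[of v undefined] norm_ge_zero[of "v $ undefined"] by linarith

lemma vec_Lr_norm_bound:
  fixes v :: "complex^'n"
  assumes "\<And>i. cmod (v $ i) \<le> c"
  shows "vec_Lr_norm r v \<le> real CARD('n) * c"
proof -
  have c: "c \<ge> 0" using assms[of undefined] norm_ge_zero order_trans by blast
  define w :: "complex^'n" where "w = (\<chi> i. complex_of_real c)"
  have 1: "vec_Lr_norm r v \<le> vec_Lr_norm r w" using assms c by (intro vec_Lr_norm_mono) (simp add: w_def)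
  have 2: "vec_Lr_norm r w = c * vec_Lr_norm r (\<chi> i::'n. 1)"
    using c by (intro vec_Lr_norm_scale) (auto simp: w_def)
  have 3: "vec_Lr_norm r (\<chi> i::'n. 1) \<le> real CARD('n)"
  proof (cases "r = \<infinity>")
    case True
    then show ?thesis by (simp add: vec_Lr_norm_def Suc_le_eq)
  next
    case False
    have p: "real_of_ereal r \<ge> 1" by (rule real_of_r[OF False])
    have "real CARD('n) powr (1 / real_of_ereal r) \<le> real CARD('n) powr 1"
      using p by (intro powr_mono) (auto simp: Suc_le_eq)
    then show ?thesis using False by (simp add: vec_Lr_norm_def)
  qed
  show ?thesis using 1 mult_left_mono[OF 3 c] unfolding 2 by (simp add: mult.commute)
qed

text \<open>A supremum of reals is informative only for a bounded set; a crude bound by the sum of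
  the moduli of all entries is enough.\<close>

lemma matrix_Lr_norm_bdd:
  fixes A :: "complex^'n^'n"
  shows "bdd_above ((\<lambda>v. vec_Lr_norm r (A *v v) / vec_Lr_norm r v) ` (-{0}))"
proof (rule bdd_aboveI2)
  fix v :: "complex^'n" assume v: "v \<in> -{0}"
  let ?K = "\<Sum>i\<in>UNIV. \<Sum>j\<in>UNIV. cmod (A $ i $ j)"
  have "cmod ((A *v v) $ i) \<le> ?K * vec_Lr_norm r v" for i
  proof -
    have "cmod ((A *v v) $ i) \<le> (\<Sum>j\<in>UNIV. cmod (A $ i $ j * v $ j))"
      by (simp add: matrix_vector_mult_def norm_sum)
    also have "\<dots> \<le> (\<Sum>j\<in>UNIV. cmod (A $ i $ j) * vec_Lr_norm r v)"
      by (intro sum_mono) (simp add: norm_mult mult_left_mono component_le_vec_Lr_norm)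
    also have "\<dots> = (\<Sum>j\<in>UNIV. cmod (A $ i $ j)) * vec_Lr_norm r v" by (simp add: sum_distrib_right)
    also have "\<dots> \<le> ?K * vec_Lr_norm r v"
      by (intro mult_right_mono vec_Lr_norm_nonneg member_le_sum[of i UNIV "\<lambda>i. \<Sum>j\<in>UNIV. cmod (A $ i $ j)"])
         (auto intro: sum_nonneg)
    finally show ?thesis .
  qed
  then have "vec_Lr_norm r (A *v v) \<le> real CARD('n) * (?K * vec_Lr_norm r v)" by (rule vec_Lr_norm_bound)
  moreover have "vec_Lr_norm r v > 0"
  proof -
    obtain i where "v $ i \<noteq> 0" using v by (auto simp: vec_eq_iff)
    then show ?thesis using component_le_vec_Lr_norm[of v i] by (metis less_le_trans zero_less_norm_iff)
  qed
  ultimately show "vec_Lr_norm r (A *v v) / vec_Lr_norm r v \<le> real CARD('n) * ?K"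
    by (simp add: divide_le_eq mult.assoc)
qed

lemma vec_Lr_norm_pos: "v \<noteq> 0 \<Longrightarrow> vec_Lr_norm r v > 0"
proof -
  assume "v \<noteq> 0"
  then obtain i where "v $ i \<noteq> 0" by (auto simp: vec_eq_iff)
  then show ?thesis using component_le_vec_Lr_norm[of v i] by (metis less_le_trans zero_less_norm_iff)
qed

lemma vec_Lr_norm_0: "vec_Lr_norm r (0 :: complex^'n) = 0"
  using vec_Lr_norm_bound[of "0 :: complex^'n" 0] vec_Lr_norm_nonneg[of "0 :: complex^'n"] by simp

lemma matrix_Lr_norm:
  fixes A :: "complex^'n^'n"
  shows "vec_Lr_norm r (A *v v) \<le> matrix_Lr_norm r A * vec_Lr_norm r v"
proof (cases "v = 0")
  case True
  then show ?thesis by (simp add: vec_Lr_norm_0)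
next
  case False
  have "vec_Lr_norm r (A *v v) / vec_Lr_norm r v \<le> matrix_Lr_norm r A"
    unfolding matrix_Lr_norm_def by (rule cSUP_upper[OF _ matrix_Lr_norm_bdd]) (use False in simp)
  then show ?thesis using vec_Lr_norm_pos[OF False] by (simp add: divide_le_eq)
qed

lemma matrix_Lr_norm_pos:
  fixes A :: "complex^'n^'n"
  assumes "A \<noteq> 0"
  shows "matrix_Lr_norm r A > 0"
proof -
  obtain v where v: "A *v v \<noteq> 0" using assms by (metis matrix_eq matrix_vector_mult_0)
  then have "v \<noteq> 0" by auto
  then show ?thesis
    using matrix_Lr_norm[of A v] vec_Lr_norm_pos[OF v] vec_Lr_norm_pos[of v]
    by (metis less_le_trans zero_less_mult_pos2)
qed

end

definition cvec :: "real^'n \<Rightarrow> complex^'n" where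
  "cvec v = (\<chi> i. complex_of_real (v $ i))"

lemma cvec_simps: "cvec (v + w) = cvec v + cvec w" "cvec (c *\<^sub>R v) = complex_of_real c *s cvec v"
  "map_matrix complex_of_real A *v cvec v = cvec (A *v v)"
  by (simp_all add: cvec_def vec_eq_iff map_matrix_def matrix_vector_mult_def)

lemma matrix_inv_mult:
  fixes A :: "'a::semiring_1^'n^'n"
  assumes "invertible A"
  shows "matrix_inv A ** A = mat 1" "A ** matrix_inv A = mat 1"
  using someI_ex[OF assms[unfolded invertible_def]] by (simp_all add: matrix_inv_def)

text \<open>In the coordinates S^{-1} v the exponential multiplies the ith entry by the exponential
  of t times the ith eigenvalue, of modulus at most exp (t \<lambda>(B)), and the L^r norm is
  monotone in the moduli. Hence the flow contracts with constant 1, which long products of factors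
  require.\<close>

theorem diagonalizing_norm:
  fixes B F :: "real^'q^'q" and S :: "complex^'q^'q"
  assumes r: "1 \<le> r" and S: "invertible S"
    and diag: "diagonal_matrix (matrix_inv S ** map_matrix complex_of_real B ** S)"
    and fin: "finite (eigenvalues (map_matrix complex_of_real B))"
  defines "nrm \<equiv> (\<lambda>v. vec_Lr_norm r (matrix_inv S *v cvec v))"
    and "c \<equiv> matrix_Lr_norm r (matrix_inv S ** map_matrix complex_of_real F ** S)"
  shows "0 \<le> nrm v" "nrm (v + w) \<le> nrm v + nrm w" "nrm (s *\<^sub>R v) = \<bar>s\<bar> * nrm v"
    "nrm (F *v v) \<le> c * nrm v" "F \<noteq> 0 \<Longrightarrow> c > 0"
    "0 \<le> t \<Longrightarrow> nrm (mexp (t *\<^sub>R B) *v v) \<le> exp (spectral_abscissa B * t) * nrm v"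
    "\<exists>k>0. \<forall>v. norm v \<le> k * nrm v"
proof -
  let ?T = "matrix_inv S"
  have TS: "?T ** S = mat 1" "S ** ?T = mat 1" using S by (simp_all add: matrix_inv_mult)
  have STv: "S *v (?T *v w) = w" for w by (simp add: matrix_vector_mul_assoc TS)
  show "0 \<le> nrm v" for v unfolding nrm_def by (rule vec_Lr_norm_nonneg[OF r])
  show tri: "nrm (v + w) \<le> nrm v + nrm w" for v w
    unfolding nrm_def by (simp add: cvec_simps matrix_vector_right_distrib vec_Lr_norm_triangle[OF r])
  have lin: "?T *v (z *s w) = z *s (?T *v w)" for z w
    by (simp add: vec_eq_iff matrix_vector_mult_def sum_distrib_left mult_ac)
  show sc: "nrm (s *\<^sub>R v) = \<bar>s\<bar> * nrm v" for s v
    unfolding nrm_def by (rule vec_Lr_norm_scale[OF r]) (auto simp: cvec_simps lin norm_mult)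
  show "nrm (F *v v) \<le> c * nrm v" for v
  proof -
    have "?T *v cvec (F *v v) = (?T ** map_matrix complex_of_real F ** S) *v (?T *v cvec v)"
      by (simp add: cvec_simps(3)[symmetric] matrix_vector_mul_assoc[symmetric] STv)
    then show ?thesis unfolding nrm_def c_def by (simp only: matrix_Lr_norm[OF r])
  qed
  show "c > 0" if "F \<noteq> 0"
  proof -
    obtain i j where ij: "F $ i $ j \<noteq> 0" using \<open>F \<noteq> 0\<close> by (auto simp: vec_eq_iff)
    have "map_matrix complex_of_real F \<noteq> 0"
    proof
      assume "map_matrix complex_of_real F = 0"
      then have "map_matrix complex_of_real F $ i $ j = 0" by simp
      then show False using ij by (simp add: map_matrix_def)
    qed
    moreover have "map_matrix complex_of_real F = S ** (?T ** map_matrix complex_of_real F ** S) ** ?T"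
      by (metis TS(2) matrix_mul_assoc matrix_mul_lid matrix_mul_rid)
    moreover have "S ** 0 ** ?T = 0" by (simp add: vec_eq_iff matrix_matrix_mult_def)
    ultimately have "?T ** map_matrix complex_of_real F ** S \<noteq> 0" by metis
    then show ?thesis unfolding c_def by (rule matrix_Lr_norm_pos[OF r])
  qed
  define \<Lambda> where "\<Lambda> = ?T ** map_matrix complex_of_real B ** S"
  have SL: "map_matrix complex_of_real B ** S = S ** \<Lambda>"
    unfolding \<Lambda>_def by (metis TS(2) matrix_mul_assoc matrix_mul_lid)
  have diag_vec: "(\<Lambda> *v w) $ i = \<Lambda> $ i $ i * w $ i" for w i
  proof -
    have "(\<Lambda> *v w) $ i = (\<Sum>j\<in>UNIV. \<Lambda> $ i $ j * w $ j)" by (simp add: matrix_vector_mult_def)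
    also have "\<dots> = (\<Sum>j\<in>{i}. \<Lambda> $ i $ j * w $ j)"
      by (rule sum.mono_neutral_right) (use diag in \<open>auto simp: diagonal_matrix_def \<Lambda>_def\<close>)
    finally show ?thesis by simp
  qed
  \<comment> \<open>The columns of S are eigenvectors, so each diagonal entry is an eigenvalue and
    is covered by the maximum over the finite set of eigenvalues.\<close>
  have Re_le: "Re (\<Lambda> $ i $ i) \<le> spectral_abscissa B" for i
  proof -
    let ?v = "S *v axis i 1"
    have "?v \<noteq> 0"
    proof
      assume "?v = 0"
      then have "?T *v ?v = 0" by simp
      then have "axis i (1::complex) = 0" by (simp add: matrix_vector_mul_assoc TS)
      then show False by (simp add: axis_eq_0_iff)
    qed
    moreover have "map_matrix complex_of_real B *v ?v = \<Lambda> $ i $ i *s ?v"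
    proof -
      have "\<Lambda> *v axis i 1 = \<Lambda> $ i $ i *s axis i 1"
        by (simp add: vec_eq_iff diag_vec axis_def)
      then have "S *v (\<Lambda> *v axis i 1) = \<Lambda> $ i $ i *s ?v"
        by (simp add: vec_eq_iff matrix_vector_mult_def sum_distrib_left mult_ac)
      then show ?thesis by (simp add: matrix_vector_mul_assoc SL)
    qed
    ultimately have "\<Lambda> $ i $ i \<in> eigenvalues (map_matrix complex_of_real B)"
      unfolding eigenvalues_def by blast
    then show ?thesis unfolding spectral_abscissa_def using fin by (intro Max_ge) auto
  qed
  \<comment> \<open>The ith coordinate in the eigenbasis; it is real-linear in v and may be applied
    termwise to the exponential series.\<close>
  define l where "l i v = (?T *v cvec v) $ i" for i v
  have lB: "l i (B *v v) = \<Lambda> $ i $ i * l i v" for i v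
  proof -
    have "?T *v cvec (B *v v) = \<Lambda> *v (?T *v cvec v)"
      by (simp add: \<Lambda>_def cvec_simps(3)[symmetric] matrix_vector_mul_assoc[symmetric] STv)
    then show ?thesis by (simp add: l_def diag_vec)
  qed
  have lpow: "l i (matpow B n *v v) = (\<Lambda> $ i $ i) ^ n * l i v" for i n v
    by (induction n) (simp_all add: matrix_vector_mul_assoc[symmetric] lB)
  have lbl: "bounded_linear (l i)" for i
    by (rule linear_conv_bounded_linear[THEN iffD1], unfold_locales)
       (simp_all add: l_def cvec_simps matrix_vector_right_distrib lin scaleR_conv_of_real[where 'a=complex])
  have lexp: "l i (mexp (t *\<^sub>R B) *v v) = exp (complex_of_real t * \<Lambda> $ i $ i) * l i v" for i t v
  proof -
    have "(\<lambda>n. l i ((t ^ n / fact n) *\<^sub>R (matpow B n *v v))) sums l i (mexp (t *\<^sub>R B) *v v)"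
      by (rule bounded_linear.sums[OF lbl mexp_mult_vec])
    moreover have "l i ((t ^ n / fact n) *\<^sub>R (matpow B n *v v)) = ((complex_of_real t * \<Lambda> $ i $ i) ^ n /\<^sub>R fact n) * l i v" for n
      by (simp add: linear_cmul[OF bounded_linear.linear[OF lbl]] lpow scaleR_conv_of_real[where 'a=complex] power_mult_distrib field_simps)
    moreover have "(\<lambda>n. ((complex_of_real t * \<Lambda> $ i $ i) ^ n /\<^sub>R fact n) * l i v) sums (exp (complex_of_real t * \<Lambda> $ i $ i) * l i v)"
      by (rule sums_mult2[OF exp_converges])
    ultimately show ?thesis using sums_unique2 by force
  qed
  show "nrm (mexp (t *\<^sub>R B) *v v) \<le> exp (spectral_abscissa B * t) * nrm v" if t: "0 \<le> t" for t v
  proof -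
    define u where "u = complex_of_real (exp (spectral_abscissa B * t)) *s (?T *v cvec v)"
    have "vec_Lr_norm r (?T *v cvec (mexp (t *\<^sub>R B) *v v)) \<le> vec_Lr_norm r u"
    proof (rule vec_Lr_norm_mono[OF r])
      fix i
      have "cmod ((?T *v cvec (mexp (t *\<^sub>R B) *v v)) $ i) = exp (t * Re (\<Lambda> $ i $ i)) * cmod (l i v)"
        unfolding l_def[symmetric] lexp by (simp add: norm_mult)
      also have "\<dots> \<le> exp (spectral_abscissa B * t) * cmod (l i v)"
        using Re_le[of i] t by (intro mult_right_mono) (auto simp: mult.commute mult_left_mono)
      finally show "cmod ((?T *v cvec (mexp (t *\<^sub>R B) *v v)) $ i) \<le> cmod (u $ i)"
        by (simp add: u_def l_def norm_mult)
    qed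
    also have "\<dots> = exp (spectral_abscissa B * t) * vec_Lr_norm r (?T *v cvec v)"
      by (rule vec_Lr_norm_scale[OF r]) (auto simp: u_def norm_mult)
    finally show ?thesis unfolding nrm_def .
  qed
  \<comment> \<open>Decay in \<open>nrm\<close> thereby becomes decay in the Euclidean norm; the
    summand 1 in the constant used below keeps it positive.\<close>
  show "\<exists>k>0. \<forall>v. norm v \<le> k * nrm v"
  proof -
    let ?K = "\<Sum>i\<in>UNIV. \<Sum>j\<in>UNIV. cmod (S $ i $ j)"
    have "norm v \<le> (?K + 1) * nrm v" for v
    proof -
      have "norm v \<le> (\<Sum>i\<in>UNIV. \<bar>v $ i\<bar>)" by (rule norm_le_l1_cart)
      also have "\<dots> = (\<Sum>i\<in>UNIV. cmod ((S *v (?T *v cvec v)) $ i))" unfolding STv by (simp add: cvec_def)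
      also have "\<dots> \<le> (\<Sum>i\<in>UNIV. \<Sum>j\<in>UNIV. cmod (S $ i $ j) * nrm v)"
      proof (rule sum_mono)
        fix i
        have "cmod ((S *v (?T *v cvec v)) $ i) \<le> (\<Sum>j\<in>UNIV. cmod (S $ i $ j * (?T *v cvec v) $ j))"
          by (simp add: matrix_vector_mult_def[of S] norm_sum)
        also have "\<dots> \<le> (\<Sum>j\<in>UNIV. cmod (S $ i $ j) * nrm v)"
          unfolding nrm_def by (intro sum_mono) (simp add: norm_mult mult_left_mono component_le_vec_Lr_norm[OF r])
        finally show "cmod ((S *v (?T *v cvec v)) $ i) \<le> (\<Sum>j\<in>UNIV. cmod (S $ i $ j) * nrm v)" .
      qed
      also have "\<dots> = ?K * nrm v" by (simp add: sum_distrib_right)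
      also have "\<dots> \<le> (?K + 1) * nrm v"
        unfolding nrm_def by (intro mult_right_mono vec_Lr_norm_nonneg[OF r]) simp
      finally show ?thesis .
    qed
    moreover have "?K + 1 > 0" by (intro add_nonneg_pos sum_nonneg) auto
    ultimately show ?thesis by blast
  qed
qed

section \<open>The state process between and at its jumps\<close>

text \<open>Jump counts and states at random times are known to agree with measurable functions
  almost surely; in the completion this suffices for measurability and determines the law.\<close>

lemma completion_AE_eq:
  assumes g: "g \<in> M \<rightarrow>\<^sub>M K" and eq: "AE x in M. f x = g x" and K: "space K = UNIV"
  shows "f \<in> completion M \<rightarrow>\<^sub>M K" "distr (completion M) K f = distr M K g"
proof -
  have g': "g \<in> completion M \<rightarrow>\<^sub>M K" by (rule measurable_completion[OF g])
  have eq': "AE x in completion M. f x = g x" using AE_completion[OF eq] .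
  show f: "f \<in> completion M \<rightarrow>\<^sub>M K"
  proof (rule measurableI)
    fix A assume A: "A \<in> sets K"
    show "f -` A \<inter> space (completion M) \<in> sets (completion M)"
    proof (rule completion.in_sets_AE[OF _ measurable_sets[OF g' A]])
      show "AE x in completion M. (x \<in> g -` A \<inter> space (completion M)) = (x \<in> f -` A \<inter> space (completion M))"
        using eq' by eventually_elim simp
    qed simp
  qed (simp add: K)
  have "distr (completion M) K f = distr (completion M) K g"
    by (rule distr_cong_AE[OF refl refl eq' f g'])
  then show "distr (completion M) K f = distr M K g" by (simp add: distr_completion[OF g])
qed

text \<open>The induction is run with the sum over k of products applied to D k, where one step
  multiplies everything by a matrix on the left. The substitution k = n - i - 1 then gives the
  displayed form, the term k = n with its empty product being the separate summand. The condition i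
  + 2 \<le> n leaves no index for n < 2, where truncated subtraction would give n - 2 = 0.\<close>

lemma affine_recurrence_solution:
  fixes C :: "nat \<Rightarrow> real^'n^'n" and D y :: "nat \<Rightarrow> real^'n"
  assumes "\<And>n. y (Suc n) = C (Suc n) *v y n + D (Suc n)"
  shows "y n = (if n \<noteq> 0 then D n else 0)
      + (\<Sum>i\<in>{i. i + 2 \<le> n}. mprod (map C (rev [n - i ..< n + 1])) *v D (n - i - 1))
      + mprod (map C (rev [1 ..< n + 1])) *v y 0"
proof -
  have "y n = (\<Sum>k\<in>{1..n}. mprod (map C (rev [k + 1 ..< n + 1])) *v D k) + mprod (map C (rev [1 ..< n + 1])) *v y 0"
  proof (induction n)
    case (Suc n)
    have st: "mprod (map C (rev [k ..< Suc n + 1])) = C (Suc n) ** mprod (map C (rev [k ..< n + 1]))" if "k \<le> n + 1" for k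
      using that by simp
    have "(\<Sum>k\<in>{1..Suc n}. mprod (map C (rev [k + 1 ..< Suc n + 1])) *v D k) =
        (\<Sum>k\<in>{1..n}. mprod (map C (rev [k + 1 ..< Suc n + 1])) *v D k) + D (Suc n)"
      by simp
    also have "(\<Sum>k\<in>{1..n}. mprod (map C (rev [k + 1 ..< Suc n + 1])) *v D k) =
        C (Suc n) *v (\<Sum>k\<in>{1..n}. mprod (map C (rev [k + 1 ..< n + 1])) *v D k)"
      unfolding linear_sum[OF matrix_vector_mul_linear]
      by (rule sum.cong[OF refl], subst st) (auto simp: matrix_vector_mul_assoc)
    finally have "(\<Sum>k\<in>{1..Suc n}. mprod (map C (rev [k + 1 ..< Suc n + 1])) *v D k) =
        C (Suc n) *v (\<Sum>k\<in>{1..n}. mprod (map C (rev [k + 1 ..< n + 1])) *v D k) + D (Suc n)" .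
    moreover have "mprod (map C (rev [1 ..< Suc n + 1])) = C (Suc n) ** mprod (map C (rev [1 ..< n + 1]))"
      by (rule st) simp
    ultimately show ?case
      unfolding assms Suc.IH by (simp only: matrix_vector_right_distrib matrix_vector_mul_assoc add_ac)
  qed simp
  moreover have "(\<Sum>k\<in>{1..n}. mprod (map C (rev [k + 1 ..< n + 1])) *v D k) = (if n \<noteq> 0 then D n else 0)
      + (\<Sum>i\<in>{i. i + 2 \<le> n}. mprod (map C (rev [n - i ..< n + 1])) *v D (n - i - 1))"
  proof (cases n)
    case (Suc m)
    have "(\<Sum>i\<in>{i. i + 2 \<le> n}. mprod (map C (rev [n - i ..< n + 1])) *v D (n - i - 1)) =
        (\<Sum>k\<in>{1..m}. mprod (map C (rev [k + 1 ..< n + 1])) *v D k)"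
      by (rule sum.reindex_bij_witness[of _ "\<lambda>k. n - k - 1" "\<lambda>i. n - i - 1"]) (auto simp: Suc Suc_diff_le simp del: upt_Suc)
    then show ?thesis using Suc by simp
  qed simp
  ultimately show ?thesis by simp
qed

lemma bwd_affine':
  fixes A :: "'s \<Rightarrow> real^'n^'n" and b :: "'s \<Rightarrow> real^'n"
  shows "bwd (\<lambda>s x. A s *v x + b s) n (\<lambda>i. s (Suc i)) x =
    (if n \<noteq> 0 then b (s 1) else 0)
      + (\<Sum>i\<in>{1..n - 1}. mprod (map (\<lambda>j. A (s j)) [1 ..< i + 1]) *v b (s (i + 1)))
      + mprod (map (\<lambda>j. A (s j)) [1 ..< n + 1]) *v x"
proof -
  have sh: "map (\<lambda>j. A (s (Suc j))) [0..<i] = map (\<lambda>j. A (s j)) [1..<i+1]" for i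
    by (simp add: map_Suc_upt[symmetric] del: upt_Suc)
  have "(\<Sum>i<n. mprod (map (\<lambda>j. A (s j)) [1..<i+1]) *v b (s (Suc i))) = (if n \<noteq> 0 then b (s 1) else 0)
      + (\<Sum>i\<in>{1..n - 1}. mprod (map (\<lambda>j. A (s j)) [1 ..< i + 1]) *v b (s (i + 1)))"
  proof (cases n)
    case (Suc m)
    show ?thesis unfolding Suc lessThan_Suc_atMost atMost_atLeast0
      by (subst sum.atLeast_Suc_atMost) (simp_all del: upt_Suc)
  qed simp
  then show ?thesis unfolding bwd_affine sh by simp
qed

locale cogarch_finite = levy_finite M L \<nu> T Z
  for M :: "'w measure" and L \<nu> T Z +
  fixes B :: "real^('q::{finite,linorder})^('q::_)" and a :: "real^('q::_)" and \<alpha>\<^sub>0 :: real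
    and Y :: "real \<Rightarrow> 'w \<Rightarrow> real^('q::_)"
  assumes state: "cogarch_state M B a \<alpha>\<^sub>0 L Y"
begin

abbreviation e :: "real^('q::_)" where "e \<equiv> last_unit"

definition flow :: "real \<Rightarrow> real^('q::_) \<Rightarrow> real^('q::_)" where
  "flow s x = mexp (s *\<^sub>R B) *v x"

definition kick :: "real \<Rightarrow> real^('q::_) \<Rightarrow> real^('q::_)" where
  "kick z x = x + (z * (\<alpha>\<^sub>0 + a \<bullet> x)) *\<^sub>R e"

text \<open>The coefficients are functions of a pair (gap, squared jump), so that the same maps act
  on the sequence space and, after inserting the marks, on M.\<close>

definition C_mat :: "real \<times> real \<Rightarrow> real^('q::_)^('q::_)" where
  "C_mat p = (mat 1 + snd p *\<^sub>R outer e a) ** mexp (fst p *\<^sub>R B)"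

definition D_vec :: "real \<times> real \<Rightarrow> real^('q::_)" where
  "D_vec p = (\<alpha>\<^sub>0 * snd p) *\<^sub>R e"

definition Q_mat :: "real \<times> real \<Rightarrow> real^('q::_)^('q::_)" where
  "Q_mat p = mexp (fst p *\<^sub>R B) ** (mat 1 + snd p *\<^sub>R outer e a)"

definition R_vec :: "real \<times> real \<Rightarrow> real^('q::_)" where
  "R_vec p = (\<alpha>\<^sub>0 * snd p) *\<^sub>R (mexp (fst p *\<^sub>R B) *v e)"

lemma outer_mult_vec: "outer v w *v x = (w \<bullet> x) *\<^sub>R v" for v w x :: "real^'n"
  by (simp add: vec_eq_iff outer_def matrix_vector_mult_def inner_vec_def sum_distrib_left mult_ac)

lemma kick_affine: "kick z x = (mat 1 + z *\<^sub>R outer e a) *v x + (\<alpha>\<^sub>0 * z) *\<^sub>R e"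
  by (simp add: kick_def matrix_vector_mult_add_rdistrib scaleR_matrix_vector_assoc[symmetric] outer_mult_vec algebra_simps)

lemma flow_measurable: "(\<lambda>(s, x). flow s x) \<in> borel \<Otimes>\<^sub>M borel \<rightarrow>\<^sub>M borel"
  unfolding flow_def by (rule mexp_measurable)

lemma kick_measurable: "(\<lambda>(z, x). kick z x) \<in> borel \<Otimes>\<^sub>M borel \<rightarrow>\<^sub>M borel"
  unfolding kick_def by measurable

lemma arrival_sum: "(\<Sum>i<n. fst (marks \<omega> i)) = (\<Sum>i=1..n. T i \<omega>)"
  by (induction n) (simp_all add: marks_def)

lemma good_arrivals:
  assumes "good \<omega>"
  shows "(\<forall>i. fst (marks \<omega> i) > 0) \<and> (\<forall>t. \<exists>n. t < (\<Sum>i<n. fst (marks \<omega> i)))"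
proof (intro conjI allI)
  show "fst (marks \<omega> i) > 0" for i using good_T_pos[OF assms] by (simp add: marks_def)
  show "\<exists>n. t < (\<Sum>i<n. fst (marks \<omega> i))" for t
  proof -
    have "t < (\<Sum>i=1..Suc (jump_count (path \<omega>) (max t 0)). T i \<omega>)"
      using good_count(3)[OF assms, of "max t 0"] by linarith
    then show ?thesis unfolding arrival_sum by blast
  qed
qed

lemma AE_arrivals:
  "AE \<omega> in seq_law. (\<forall>i. fst (\<omega> i) > 0) \<and> (\<forall>t. \<exists>n. t < (\<Sum>i<n. fst (\<omega> i)))"
proof -
  \<comment> \<open>Thresholds are restricted to natural numbers so that the event is a countable
    combination and can be transported from M to the sequence space.\<close>
  define G where "G \<omega> \<longleftrightarrow> (\<forall>i. fst (\<omega> i) > 0) \<and> (\<forall>k::nat. \<exists>n. real k < (\<Sum>i<n. fst (\<omega> i)))" for \<omega> :: "nat \<Rightarrow> real \<times> real"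
  have f: "(\<lambda>\<omega>. fst (\<omega> i)) \<in> borel_measurable (Pi\<^sub>M UNIV (\<lambda>_::nat. borel :: (real \<times> real) measure))" for i
    by (rule measurable_compose[OF measurable_component_singleton]) (simp_all add: borel_prod[symmetric])
  note [measurable] = f
  have G: "{\<omega>\<in>space seq_law. G \<omega>} \<in> sets seq_law"
    unfolding sets_eq_imp_space_eq[OF seq_law(2)] seq_law(2) G_def by measurable
  have "AE \<omega> in distr M seq_law marks. G \<omega>"
    by (subst AE_distr_iff[OF marks_measurable(2) G], use AE_good in eventually_elim)
       (use good_arrivals in \<open>unfold G_def, blast\<close>)
  then have "AE \<omega> in seq_law. G \<omega>" unfolding marks_distr .
  then show ?thesis
  proof eventually_elim
    case (elim \<omega>)
    have "\<exists>n. t < (\<Sum>i<n. fst (\<omega> i))" for t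
    proof -
      obtain k :: nat where "t < real k" using reals_Archimedean2 by blast
      moreover obtain n where "real k < (\<Sum>i<n. fst (\<omega> i))" using elim unfolding G_def by blast
      ultimately show ?thesis by (intro exI[of _ n]) simp
    qed
    then show ?case using elim unfolding G_def by blast
  qed
qed

sublocale F: flow_jump rate mark_law flow kick
proof (rule flow_jump.intro)
  show "AE \<omega> in Pi\<^sub>M UNIV (\<lambda>_::nat. density lborel (exponential_density rate) \<Otimes>\<^sub>M mark_law).
      (\<forall>i. fst (\<omega> i) > 0) \<and> (\<forall>t. \<exists>n. t < (\<Sum>i<n. fst (\<omega> i)))"
    using AE_arrivals unfolding pair_law_def gap_law_def .
qed (fact rate_pos mark_law flow_measurable kick_measurable)+

lemma F_law: "F.law = pair_law"
  by (simp add: F.law_def F.gap_def pair_law_def gap_law_def)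

lemma F_P: "F.P = seq_law"
  by (simp add: F_law)

lemma cmap_affine: "F.cmap = (\<lambda>p x. C_mat p *v x + D_vec p)"
  by (intro ext) (simp add: F.cmap_def kick_affine flow_def C_mat_def D_vec_def matrix_vector_mul_assoc)

lemma qmap_affine: "F.qmap = (\<lambda>p x. Q_mat p *v x + R_vec p)"
  by (intro ext) (simp add: F.qmap_def kick_affine flow_def Q_mat_def R_vec_def matrix_vector_mul_assoc
      matrix_vector_right_distrib matrix_vector_mult_scaleR)

lemma arrival_marks: "F.arrival n (marks \<omega>) = (\<Sum>i=1..n. T i \<omega>)"
  by (simp add: F.arrival_def arrival_sum)

lemma reg_marks: "good \<omega> \<Longrightarrow> F.reg (marks \<omega>)"
  using good_arrivals unfolding F.reg_def F.arrival_def .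

lemma cnt_marks:
  assumes "good \<omega>" "t \<ge> 0"
  shows "F.cnt t (marks \<omega>) = jump_count (path \<omega>) t"
  using F.between_iff[OF reg_marks[OF assms(1)] assms(2)] good_count(2,3)[OF assms]
  unfolding F.between_def arrival_marks by metis

definition solved :: "'w \<Rightarrow> bool" where
  "solved \<omega> \<longleftrightarrow> good \<omega> \<and> (\<forall>n. Y (\<Sum>i=1..n. T i \<omega>) \<omega> = fwd F.cmap n (marks \<omega>) (Y 0 \<omega>)) \<and>
    (\<forall>t\<ge>0. Y t \<omega> = flow (t - (\<Sum>i=1..jump_count (path \<omega>) t. T i \<omega>))
        (fwd F.cmap (jump_count (path \<omega>) t) (marks \<omega>) (Y 0 \<omega>)))"

lemma AE_solved: "AE \<omega> in M. solved \<omega>"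
proof -
  have 1: "AE \<omega> in M. cadlag (\<lambda>t. Y t \<omega>)"
    and 2: "AE \<omega> in M. \<forall>t>0. Y t \<omega> = Y 0 \<omega>
        + (LINT s:{0<..t}|lborel. B *v left_lim (\<lambda>u. Y u \<omega>) s)
        + (LINT s:{0<..t}|interval_measure (disc_qv (\<lambda>u. L u \<omega>)).
             (\<alpha>\<^sub>0 + a \<bullet> left_lim (\<lambda>u. Y u \<omega>) s) *\<^sub>R last_unit)"
    using state unfolding cogarch_state_def by blast+
  show ?thesis using AE_good 1 2
  proof eventually_elim
    case (elim \<omega>)
    interpret jump_path "path \<omega>" using elim(1) unfolding good_def by blast
    have eq: "\<And>t. t > 0 \<Longrightarrow> Y t \<omega> = Y 0 \<omega>
        + (LINT s:{0<..t}|lborel. B *v left_lim (\<lambda>u. Y u \<omega>) s)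
        + (LINT s:{0<..t}|interval_measure (disc_qv (path \<omega>)).
             (\<alpha>\<^sub>0 + a \<bullet> left_lim (\<lambda>u. Y u \<omega>) s) *\<^sub>R e)"
      using elim(3) by blast
    have path: "jt n \<le> t \<Longrightarrow> t < jt (Suc n) \<Longrightarrow> Y t \<omega> = mexp ((t - jt n) *\<^sub>R B) *v Y (jt n) \<omega>"
      "Y (jt (Suc n)) \<omega> = mexp ((jt (Suc n) - jt n) *\<^sub>R B) *v Y (jt n) \<omega> +
        ((jump (path \<omega>) (jt (Suc n)))\<^sup>2 * (\<alpha>\<^sub>0 + a \<bullet> (mexp ((jt (Suc n) - jt n) *\<^sub>R B) *v Y (jt n) \<omega>))) *\<^sub>R e" for n t
      by (rule cogarch_path(1)[OF elim(2)], rule eq, assumption+) (rule cogarch_path(2)[OF elim(2)], rule eq)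
    have TZ: "T (Suc n) \<omega> = jt (Suc n) - jt n" "Z (Suc n) \<omega> = (jump (path \<omega>) (jt (Suc n)))\<^sup>2" for n
      using elim(1) unfolding good_def by blast+
    have at: "Y (jt n) \<omega> = fwd F.cmap n (marks \<omega>) (Y 0 \<omega>)" for n
    proof (induction n)
      case (Suc n)
      define w where "w = fwd F.cmap n (marks \<omega>) (Y 0 \<omega>)"
      have "F.cmap (marks \<omega> n) w = Y (jt (Suc n)) \<omega>"
        using path(2)[of n] unfolding TZ[symmetric] Suc w_def[symmetric]
        by (simp add: F.cmap_def kick_def flow_def marks_def)
      then show ?case by (simp add: w_def)
    qed simp
    have "Y t \<omega> = flow (t - jt (jump_count (path \<omega>) t)) (fwd F.cmap (jump_count (path \<omega>) t) (marks \<omega>) (Y 0 \<omega>))"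
      if "t \<ge> 0" for t
      using path(1)[OF jump_count_bracket[OF that]] unfolding at flow_def .
    then show ?case unfolding solved_def good_Gamma[OF elim(1)] using at elim(1) by blast
  qed
qed

lemma Y0_measurable [measurable]: "Y 0 \<in> borel_measurable M"
  and Y_measurable: "t \<ge> 0 \<Longrightarrow> Y t \<in> borel_measurable M"
  using state unfolding cogarch_state_def by blast+

lemma joint_initial_law:
  "distr M (borel \<Otimes>\<^sub>M seq_law) (\<lambda>\<omega>. (Y 0 \<omega>, marks \<omega>)) = distr M borel (Y 0) \<Otimes>\<^sub>M seq_law"
  using state unfolding cogarch_state_def by (intro joint_law) blast

lemma nn_integral_initial_marks:
  assumes h[measurable]: "h \<in> borel_measurable (borel \<Otimes>\<^sub>M seq_law)"
  shows "(\<integral>\<^sup>+\<omega>. h (Y 0 \<omega>, marks \<omega>) \<partial>M) = (\<integral>\<^sup>+y. \<integral>\<^sup>+\<omega>. h (y, \<omega>) \<partial>seq_law \<partial>distr M borel (Y 0))"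
proof -
  interpret S: prob_space seq_law by (rule seq_law)
  note [measurable] = marks_measurable(2)
  have "(\<integral>\<^sup>+\<omega>. h (Y 0 \<omega>, marks \<omega>) \<partial>M) = (\<integral>\<^sup>+p. h p \<partial>distr M (borel \<Otimes>\<^sub>M seq_law) (\<lambda>\<omega>. (Y 0 \<omega>, marks \<omega>)))"
    by (rule nn_integral_distr[symmetric]) measurable
  also have "\<dots> = (\<integral>\<^sup>+y. \<integral>\<^sup>+\<omega>. h (y, \<omega>) \<partial>seq_law \<partial>distr M borel (Y 0))"
    unfolding joint_initial_law by (rule S.nn_integral_fst[symmetric]) measurable
  finally show ?thesis .
qed

definition fwd_state :: "real \<Rightarrow> (nat \<Rightarrow> real \<times> real) \<Rightarrow> real^('q::_) \<Rightarrow> real^('q::_)" where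
  "fwd_state t \<omega> y = flow (t - F.arrival (F.cnt t \<omega>) \<omega>) (fwd F.cmap (F.cnt t \<omega>) \<omega> y)"

definition bwd_state :: "real \<Rightarrow> (nat \<Rightarrow> real \<times> real) \<Rightarrow> real^('q::_) \<Rightarrow> real^('q::_)" where
  "bwd_state t \<omega> y = flow (t - F.arrival (F.cnt t \<omega>) \<omega>) (bwd F.cmap (F.cnt t \<omega>) \<omega> y)"

definition last_jump_state :: "real \<Rightarrow> (nat \<Rightarrow> real \<times> real) \<Rightarrow> real^('q::_) \<Rightarrow> real^('q::_)" where
  "last_jump_state t \<omega> y = bwd F.qmap (F.cnt t \<omega>) \<omega> (flow (t - F.arrival (F.cnt t \<omega>) \<omega>) y)"

lemma state_measurable [measurable]:
  "(\<lambda>(y, \<omega>). fwd_state t \<omega> y) \<in> borel_measurable (borel \<Otimes>\<^sub>M seq_law)"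
  "(\<lambda>(y, \<omega>). bwd_state t \<omega> y) \<in> borel_measurable (borel \<Otimes>\<^sub>M seq_law)"
  "(\<lambda>(y, \<omega>). last_jump_state t \<omega> y) \<in> borel_measurable (borel \<Otimes>\<^sub>M seq_law)"
  unfolding fwd_state_def bwd_state_def last_jump_state_def F_P[symmetric] by measurable

lemma AE_Y_eq:
  assumes t: "t \<ge> 0"
  shows "AE \<omega> in M. Y t \<omega> = fwd_state t (marks \<omega>) (Y 0 \<omega>)"
  using AE_solved
proof eventually_elim
  case (elim \<omega>)
  then have g: "good \<omega>" unfolding solved_def by (elim conjE)
  show ?case using elim t unfolding solved_def fwd_state_def arrival_marks cnt_marks[OF g t] by (elim conjE) blast
qed

end

section \<open>Stability\<close>

lemma distr_eqI_nn_integral: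
  assumes X: "X \<in> M \<rightarrow>\<^sub>M K" and X': "X' \<in> M' \<rightarrow>\<^sub>M K"
    and eq: "\<And>f. f \<in> borel_measurable K \<Longrightarrow> (\<integral>\<^sup>+\<omega>. f (X \<omega>) \<partial>M) = (\<integral>\<^sup>+\<omega>. f (X' \<omega>) \<partial>M')"
  shows "distr M K X = distr M' K X'"
proof (rule measure_eqI)
  fix A assume "A \<in> sets (distr M K X)"
  then have A[measurable]: "A \<in> sets K" by simp
  have "emeasure (distr M K X) A = (\<integral>\<^sup>+x. indicator A x \<partial>distr M K X)" by simp
  also have "\<dots> = (\<integral>\<^sup>+\<omega>. indicator A (X \<omega>) \<partial>M)" by (rule nn_integral_distr[OF X]) simp
  also have "\<dots> = (\<integral>\<^sup>+\<omega>. indicator A (X' \<omega>) \<partial>M')" by (rule eq) simp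
  also have "\<dots> = (\<integral>\<^sup>+x. indicator A x \<partial>distr M' K X')" by (rule nn_integral_distr[OF X', symmetric]) simp
  finally show "emeasure (distr M K X) A = emeasure (distr M' K X') A" by simp
qed simp

context cogarch_finite
begin

text \<open>Integrating over the independent initial state reduces both claims to the reversals on
  the sequence space. The first form gives the identity in law at time t, the second the composition
  that converges as t grows.\<close>

lemma state_law_eq:
  assumes t: "t \<ge> 0"
  shows "distr M borel (Y t) = distr M borel (\<lambda>\<omega>. bwd_state t (marks \<omega>) (Y 0 \<omega>))"
    "distr M borel (Y t) = distr M borel (\<lambda>\<omega>. last_jump_state t (marks \<omega>) (Y 0 \<omega>))"
proof -
  note [measurable] = marks_measurable(2) Y_measurable[OF t]
  have st: "(\<lambda>\<omega>. g (marks \<omega>) (Y 0 \<omega>)) \<in> borel_measurable M"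
    if "(\<lambda>(y, \<omega>). g \<omega> y) \<in> borel_measurable (borel \<Otimes>\<^sub>M seq_law)" for g :: "(nat \<Rightarrow> real \<times> real) \<Rightarrow> real^('q::_) \<Rightarrow> real^('q::_)"
  proof -
    have "(\<lambda>\<omega>. (Y 0 \<omega>, marks \<omega>)) \<in> M \<rightarrow>\<^sub>M borel \<Otimes>\<^sub>M seq_law" by measurable
    from measurable_compose[OF this that] show ?thesis by simp
  qed
  have int: "(\<integral>\<^sup>+\<omega>. f (g (marks \<omega>) (Y 0 \<omega>)) \<partial>M) = (\<integral>\<^sup>+y. \<integral>\<^sup>+\<omega>. f (g \<omega> y) \<partial>seq_law \<partial>distr M borel (Y 0))"
    if g: "(\<lambda>(y, \<omega>). g \<omega> y) \<in> borel_measurable (borel \<Otimes>\<^sub>M seq_law)" and f: "f \<in> borel_measurable borel"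
    for g :: "(nat \<Rightarrow> real \<times> real) \<Rightarrow> real^('q::_) \<Rightarrow> real^('q::_)" and f :: "real^('q::_) \<Rightarrow> ennreal"
    using nn_integral_initial_marks[OF measurable_compose[OF g f]] by simp
  have "distr M borel (Y t) = distr M borel (\<lambda>\<omega>. fwd_state t (marks \<omega>) (Y 0 \<omega>))"
    by (rule distr_cong_AE[OF refl refl AE_Y_eq[OF t]]) (use st[OF state_measurable(1)] in measurable)
  moreover have "distr M borel (\<lambda>\<omega>. fwd_state t (marks \<omega>) (Y 0 \<omega>)) = distr M borel (\<lambda>\<omega>. bwd_state t (marks \<omega>) (Y 0 \<omega>))"
  proof (rule distr_eqI_nn_integral[OF st[OF state_measurable(1)] st[OF state_measurable(2)]])
    fix f :: "real^('q::_) \<Rightarrow> ennreal" assume f: "f \<in> borel_measurable borel"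
    show "(\<integral>\<^sup>+\<omega>. f (fwd_state t (marks \<omega>) (Y 0 \<omega>)) \<partial>M) = (\<integral>\<^sup>+\<omega>. f (bwd_state t (marks \<omega>) (Y 0 \<omega>)) \<partial>M)"
      using F.nn_integral_state_eq_bwd[OF t f]
      by (subst (1 2) int[OF _ f]) (simp_all only: state_measurable fwd_state_def[symmetric] bwd_state_def[symmetric] F_P)
  qed
  moreover have "distr M borel (\<lambda>\<omega>. fwd_state t (marks \<omega>) (Y 0 \<omega>)) = distr M borel (\<lambda>\<omega>. last_jump_state t (marks \<omega>) (Y 0 \<omega>))"
  proof (rule distr_eqI_nn_integral[OF st[OF state_measurable(1)] st[OF state_measurable(3)]])
    fix f :: "real^('q::_) \<Rightarrow> ennreal" assume f: "f \<in> borel_measurable borel"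
    show "(\<integral>\<^sup>+\<omega>. f (fwd_state t (marks \<omega>) (Y 0 \<omega>)) \<partial>M) = (\<integral>\<^sup>+\<omega>. f (last_jump_state t (marks \<omega>) (Y 0 \<omega>)) \<partial>M)"
      using F.nn_integral_state_eq_last_jump[OF t f]
      by (subst (1 2) int[OF _ f]) (simp_all only: state_measurable fwd_state_def[symmetric] last_jump_state_def[symmetric] F_P)
  qed
  ultimately show "distr M borel (Y t) = distr M borel (\<lambda>\<omega>. bwd_state t (marks \<omega>) (Y 0 \<omega>))"
    "distr M borel (Y t) = distr M borel (\<lambda>\<omega>. last_jump_state t (marks \<omega>) (Y 0 \<omega>))" by simp_all
qed

lemma eq_in_law_bwd_state:
  assumes t: "t \<ge> 0" and V: "AE \<omega> in M. V \<omega> = bwd_state t (marks \<omega>) (Y 0 \<omega>)"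
  shows "eq_in_law M (Y t) V"
proof -
  note [measurable] = marks_measurable(2)
  have "(\<lambda>\<omega>. (Y 0 \<omega>, marks \<omega>)) \<in> M \<rightarrow>\<^sub>M borel \<Otimes>\<^sub>M seq_law" by measurable
  from measurable_compose[OF this state_measurable(2)]
  have m: "(\<lambda>\<omega>. bwd_state t (marks \<omega>) (Y 0 \<omega>)) \<in> borel_measurable M" by simp
  show ?thesis
    unfolding eq_in_law_def
    using completion_AE_eq[OF m V space_borel] state_law_eq(1)[OF t] Y_measurable[OF t]
    by (simp add: distr_completion measurable_completion)
qed

end

text \<open>The estimates on which stability rests; c and l will be the operator norm of S^{-1} e a'
  S and the spectral abscissa. The constant in \<open>norm_le_nrm\<close> may be large, as it enters
  once and not once per factor.\<close>

locale cogarch_stable = cogarch_finite M L \<nu> T Z B a \<alpha>\<^sub>0 Y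
  for M :: "'w measure" and L \<nu> T Z and B :: "real^('q::{finite,linorder})^('q::_)" and a \<alpha>\<^sub>0 Y +
  fixes nrm :: "real^('q::_) \<Rightarrow> real" and c l :: real
  assumes nrm_nonneg: "\<And>v. 0 \<le> nrm v" and nrm_triangle: "\<And>v w. nrm (v + w) \<le> nrm v + nrm w"
    and nrm_scale: "\<And>s v. nrm (s *\<^sub>R v) = \<bar>s\<bar> * nrm v"
    and nrm_outer: "\<And>v. nrm (outer e a *v v) \<le> c * nrm v" and c_pos: "c > 0"
    and nrm_mexp: "\<And>t v. 0 \<le> t \<Longrightarrow> nrm (mexp (t *\<^sub>R B) *v v) \<le> exp (l * t) * nrm v"
    and norm_le_nrm: "\<exists>k>0. \<forall>v. norm v \<le> k * nrm v"
    and drift: "enn2ereal (\<integral>\<^sup>+y. ennreal (ln (1 + c * y\<^sup>2)) \<partial>\<nu>) < ereal (- l)"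
begin

section \<open>Contraction estimates and geometric decay\<close>

lemma l_neg: "l < 0"
proof -
  have "0 \<le> enn2ereal (\<integral>\<^sup>+y. ennreal (ln (1 + c * y\<^sup>2)) \<partial>\<nu>)" by simp
  then have "0 < ereal (- l)" using drift by (rule order_le_less_trans)
  then show ?thesis by simp
qed

text \<open>One bound for both \<open>C_mat p\<close> and \<open>Q_mat p\<close>, which differ only
  in the order of flow and jump.\<close>

definition factor :: "real \<times> real \<Rightarrow> real" where
  "factor p = exp (l * fst p) * (1 + c * snd p)"

definition positive :: "(nat \<Rightarrow> real \<times> real) \<Rightarrow> bool" where
  "positive \<omega> \<longleftrightarrow> (\<forall>i. fst (\<omega> i) > 0 \<and> snd (\<omega> i) > 0)"

lemma AE_positive: "AE \<omega> in seq_law. positive \<omega>"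
proof -
  have [measurable]: "(\<lambda>\<omega>. fst (\<omega> i)) \<in> borel_measurable (Pi\<^sub>M UNIV (\<lambda>_::nat. borel :: (real \<times> real) measure))"
    "(\<lambda>\<omega>. snd (\<omega> i)) \<in> borel_measurable (Pi\<^sub>M UNIV (\<lambda>_::nat. borel :: (real \<times> real) measure))" for i
    by (rule measurable_compose[OF measurable_component_singleton], simp_all add: borel_prod[symmetric])+
  have G: "{\<omega>\<in>space seq_law. positive \<omega>} \<in> sets seq_law"
    unfolding sets_eq_imp_space_eq[OF seq_law(2)] seq_law(2) positive_def by measurable
  have "AE \<omega> in distr M seq_law marks. positive \<omega>"
    by (subst AE_distr_iff[OF marks_measurable(2) G], use AE_good in eventually_elim)
       (simp add: positive_def marks_def good_T_pos good_Z_pos)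
  then show ?thesis unfolding marks_distr .
qed

lemma nrm_jump_part:
  assumes "z \<ge> 0"
  shows "nrm ((mat 1 + z *\<^sub>R outer e a) *v v) \<le> (1 + c * z) * nrm v"
proof -
  have "nrm ((mat 1 + z *\<^sub>R outer e a) *v v) = nrm (v + z *\<^sub>R (outer e a *v v))"
    by (simp add: matrix_vector_mult_add_rdistrib scaleR_matrix_vector_assoc[symmetric])
  also have "\<dots> \<le> nrm v + z * nrm (outer e a *v v)"
    using nrm_triangle[of v "z *\<^sub>R (outer e a *v v)"] assms by (simp add: nrm_scale)
  also have "\<dots> \<le> nrm v + z * (c * nrm v)" using nrm_outer[of v] assms by (simp add: mult_left_mono)
  finally show ?thesis by (simp add: algebra_simps)
qed

lemma nrm_C_mat:
  assumes "fst p \<ge> 0" "snd p \<ge> 0"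
  shows "nrm (C_mat p *v v) \<le> factor p * nrm v"
proof -
  have "nrm (C_mat p *v v) \<le> (1 + c * snd p) * nrm (mexp (fst p *\<^sub>R B) *v v)"
    unfolding C_mat_def matrix_vector_mul_assoc[symmetric] by (rule nrm_jump_part[OF assms(2)])
  also have "\<dots> \<le> (1 + c * snd p) * (exp (l * fst p) * nrm v)"
    using c_pos assms by (intro mult_left_mono nrm_mexp) auto
  finally show ?thesis by (simp add: factor_def mult_ac)
qed

lemma nrm_Q_mat:
  assumes "fst p \<ge> 0" "snd p \<ge> 0"
  shows "nrm (Q_mat p *v v) \<le> factor p * nrm v"
proof -
  have "nrm (Q_mat p *v v) \<le> exp (l * fst p) * nrm ((mat 1 + snd p *\<^sub>R outer e a) *v v)"
    unfolding Q_mat_def matrix_vector_mul_assoc[symmetric] by (rule nrm_mexp[OF assms(1)])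
  also have "\<dots> \<le> exp (l * fst p) * ((1 + c * snd p) * nrm v)"
    by (intro mult_left_mono nrm_jump_part[OF assms(2)]) auto
  finally show ?thesis by (simp add: factor_def mult_ac)
qed

text \<open>Bounded by a multiple of 1 + c z rather than of z, so that the logarithm controlled by
  the integral condition also controls the inhomogeneous terms; the division by c uses c >
  0.\<close>

lemma nrm_D_vec:
  assumes "snd p \<ge> 0"
  shows "nrm (D_vec p) \<le> \<bar>\<alpha>\<^sub>0\<bar> * nrm e / c * (1 + c * snd p)"
proof -
  have "nrm (D_vec p) = \<bar>\<alpha>\<^sub>0\<bar> * nrm e / c * (c * snd p)"
    using assms c_pos by (simp add: D_vec_def nrm_scale abs_mult)
  also have "\<dots> \<le> \<bar>\<alpha>\<^sub>0\<bar> * nrm e / c * (1 + c * snd p)"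
    using c_pos nrm_nonneg[of e] by (intro mult_left_mono) auto
  finally show ?thesis .
qed

lemma nrm_R_vec:
  assumes "fst p \<ge> 0" "snd p \<ge> 0"
  shows "nrm (R_vec p) \<le> \<bar>\<alpha>\<^sub>0\<bar> * nrm e / c * (1 + c * snd p)"
proof -
  have "R_vec p = mexp (fst p *\<^sub>R B) *v D_vec p"
    by (simp add: R_vec_def D_vec_def matrix_vector_mult_scaleR)
  then have "nrm (R_vec p) \<le> exp (l * fst p) * nrm (D_vec p)" using nrm_mexp[OF assms(1)] by simp
  also have "\<dots> \<le> 1 * nrm (D_vec p)"
    using l_neg assms(1) by (intro mult_right_mono nrm_nonneg) (simp add: mult_nonpos_nonneg)
  also have "\<dots> \<le> \<bar>\<alpha>\<^sub>0\<bar> * nrm e / c * (1 + c * snd p)" using nrm_D_vec[OF assms(2)] by simp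
  finally show ?thesis .
qed

text \<open>The integral over \<nu> equals \<open>rate\<close> times the mean of ln (1 + c Z), and
  the mean gap is 1 / \<open>rate\<close>; dividing the condition by \<open>rate\<close> gives l E T
  + E ln (1 + c Z) < 0.\<close>

lemma drift_negative:
  defines "U \<equiv> \<lambda>p :: real \<times> real. ln (1 + c * snd p)"
  shows "integrable pair_law U" "integrable pair_law (\<lambda>p. l * fst p + U p)"
    "integral\<^sup>L pair_law (\<lambda>p. l * fst p + U p) < 0"
proof -
  have TZm: "(\<lambda>\<omega>. (T 1 \<omega>, Z 1 \<omega>)) \<in> borel_measurable M" by measurable
  have Um: "U \<in> borel_measurable borel" and fm: "(fst :: real \<times> real \<Rightarrow> real) \<in> borel_measurable borel"
    unfolding U_def by (simp_all add: borel_prod[symmetric])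
  have pos: "AE \<omega> in M. 0 \<le> ln (1 + c * Z 1 \<omega>)"
    using AE_good by eventually_elim (use good_Z_pos[of _ 0] c_pos in \<open>simp add: less_imp_le\<close>)
  define u where "u = (\<integral>\<^sup>+\<omega>. ennreal (ln (1 + c * Z 1 \<omega>)) \<partial>M)"
  have I: "(\<integral>\<^sup>+y. ennreal (ln (1 + c * y\<^sup>2)) \<partial>\<nu>) = ennreal rate * u"
    unfolding u_def mark_law_def
    by (subst nn_integral_levy_measure[of "\<lambda>z. ennreal (ln (1 + c * z))"]) (simp_all add: mark_law_def nn_integral_distr)
  \<comment> \<open>As - l is positive, the comparison can be moved from \<open>ereal\<close> to
    \<open>ennreal\<close>, where finiteness of u follows.\<close>
  have lt: "ennreal rate * u < ennreal (- l)"
  proof -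
    have "enn2ereal (ennreal rate * u) < enn2ereal (ennreal (- l))" using drift l_neg unfolding I by simp
    then show ?thesis by (simp add: less_ennreal.rep_eq)
  qed
  have fin: "u < \<infinity>"
  proof (rule ccontr)
    assume "\<not> u < \<infinity>"
    then have "ennreal rate * u = \<infinity>" using rate_pos by (simp add: not_less top_unique ennreal_mult_top)
    then show False using lt by simp
  qed
  have iU: "integrable M (\<lambda>\<omega>. U (T 1 \<omega>, Z 1 \<omega>))"
    unfolding U_def snd_conv by (rule integrableI_nonneg[OF _ pos]) (use fin in \<open>simp_all add: u_def\<close>)
  have iT: "integrable M (T 1)"
    using erlang_ith_moment_integrable[OF rate_pos T_exponential, of 1] by simp
  show "integrable pair_law U" unfolding pair_law(4)[symmetric] integrable_distr_eq[OF TZm Um] by (rule iU)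
  moreover have "integrable pair_law fst"
    unfolding pair_law(4)[symmetric] integrable_distr_eq[OF TZm fm] using iT by simp
  ultimately show iX: "integrable pair_law (\<lambda>p. l * fst p + U p)" by simp
  have "integral\<^sup>L pair_law (\<lambda>p. l * fst p + U p) = l * (\<integral>p. fst p \<partial>pair_law) + integral\<^sup>L pair_law U"
    using \<open>integrable pair_law fst\<close> \<open>integrable pair_law U\<close> by simp
  also have "(\<integral>p. fst p \<partial>pair_law) = 1 / rate"
    unfolding pair_law(4)[symmetric] integral_distr[OF TZm fm]
    using exponential_distributed_expectation[OF rate_pos T_exponential] by simp
  also have "integral\<^sup>L pair_law U = enn2real u"
    unfolding pair_law(4)[symmetric] integral_distr[OF TZm Um] unfolding U_def snd_conv u_def
    by (rule integral_eq_nn_integral[OF _ pos]) simp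
  also have "l * (1 / rate) + enn2real u < 0"
  proof -
    have "u = ennreal (enn2real u)" using fin by simp
    then have "ennreal (rate * enn2real u) < ennreal (- l)"
      using lt rate_pos by (metis ennreal_mult' less_imp_le)
    then have "rate * enn2real u < - l" using rate_pos by (simp add: ennreal_less_iff)
    then show ?thesis using rate_pos by (simp add: field_simps)
  qed
  finally show "integral\<^sup>L pair_law (\<lambda>p. l * fst p + U p) < 0" .
qed

lemma AE_decay:
  "AE \<omega> in seq_law. positive \<omega> \<and> (\<exists>K \<delta>. 0 < \<delta> \<and> (\<forall>n. (\<Prod>i<n. factor (\<omega> i)) \<le> K * exp (- \<delta> * real n)) \<and>
    (\<forall>n. (\<Prod>i<n. factor (\<omega> i)) * (1 + c * snd (\<omega> n)) \<le> K * exp (- \<delta> * real n)))"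
  using AE_geometric_decay[OF pair_law(1) drift_negative(2,3,1)] AE_positive
proof eventually_elim
  case (elim \<omega>)
  have u: "exp (ln (1 + c * snd (\<omega> i))) = 1 + c * snd (\<omega> i)" for i
  proof -
    have "0 < 1 + c * snd (\<omega> i)" using elim(2) c_pos unfolding positive_def by (simp add: add_pos_pos)
    then show ?thesis by (rule exp_ln)
  qed
  have "exp (\<Sum>i<n. l * fst (\<omega> i) + ln (1 + c * snd (\<omega> i))) = (\<Prod>i<n. factor (\<omega> i))" for n
    by (simp only: exp_sum[OF finite_lessThan] exp_add u factor_def)
  then show ?case using elim unfolding u by simp
qed

text \<open>Stated for an arbitrary affine pair so as to serve both (C, D) and (Q, R). Geometric
  decay of the products makes the series absolutely convergent and removes the influence of the
  starting point.\<close>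

lemma affine_convergence:
  fixes A :: "real \<times> real \<Rightarrow> real^('q::_)^('q::_)" and b :: "real \<times> real \<Rightarrow> real^('q::_)"
  assumes A: "\<And>p v. fst p \<ge> 0 \<Longrightarrow> snd p \<ge> 0 \<Longrightarrow> nrm (A p *v v) \<le> factor p * nrm v"
    and b: "\<And>p. fst p \<ge> 0 \<Longrightarrow> snd p \<ge> 0 \<Longrightarrow> nrm (b p) \<le> k * (1 + c * snd p)" and k: "k \<ge> 0"
  shows "AE \<omega> in seq_law. summable (\<lambda>i. norm (mprod (map (\<lambda>j. A (\<omega> j)) [0..<i]) *v b (\<omega> i))) \<and>
    (\<forall>x. (\<lambda>n. mprod (map (\<lambda>j. A (\<omega> j)) [0..<n]) *v x) \<longlonglongrightarrow> 0) \<and>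
    (\<forall>x. (\<lambda>n. bwd (\<lambda>p x. A p *v x + b p) n \<omega> x) \<longlonglongrightarrow> (\<Sum>i. mprod (map (\<lambda>j. A (\<omega> j)) [0..<i]) *v b (\<omega> i)))"
  using AE_decay
proof eventually_elim
  case (elim \<omega>)
  obtain K \<delta> where \<delta>: "0 < \<delta>" and d1: "\<And>n. (\<Prod>i<n. factor (\<omega> i)) \<le> K * exp (- \<delta> * real n)"
    and d2: "\<And>n. (\<Prod>i<n. factor (\<omega> i)) * (1 + c * snd (\<omega> n)) \<le> K * exp (- \<delta> * real n)"
    using elim by blast
  obtain k' where k': "k' > 0" "\<And>v. norm v \<le> k' * nrm v" using norm_le_nrm by blast
  have pos: "fst (\<omega> i) \<ge> 0" "snd (\<omega> i) \<ge> 0" for i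
    using elim unfolding positive_def by (auto simp: less_imp_le)
  have f0: "factor (\<omega> i) \<ge> 0" for i unfolding factor_def using pos[of i] c_pos by simp
  have prod: "nrm (mprod (map (\<lambda>j. A (\<omega> j)) [0..<n]) *v v) \<le> (\<Prod>i<n. factor (\<omega> i)) * nrm v" for n v
    by (rule matrix_product_decay[of nrm "\<lambda>j. A (\<omega> j)" "\<lambda>i. factor (\<omega> i)"]) (use A pos f0 in auto)
  have geo: "(\<lambda>n. exp (- \<delta> * real n)) = (\<lambda>n. exp (- \<delta>) ^ n)" by (simp add: exp_of_nat_mult[symmetric] mult_ac)
  have sg: "summable (\<lambda>n. exp (- \<delta> * real n))" unfolding geo using \<delta> by (intro summable_geometric) simp
  have bd: "norm (mprod (map (\<lambda>j. A (\<omega> j)) [0..<i]) *v b (\<omega> i)) \<le> k' * k * K * exp (- \<delta> * real i)" for i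
  proof -
    have "nrm (mprod (map (\<lambda>j. A (\<omega> j)) [0..<i]) *v b (\<omega> i)) \<le> (\<Prod>i<i. factor (\<omega> i)) * (k * (1 + c * snd (\<omega> i)))"
      using prod[of i "b (\<omega> i)"] mult_left_mono[OF b[OF pos(1,2)[of i]] prod_nonneg[of "{..<i}" "\<lambda>i. factor (\<omega> i)"]] f0
      by fastforce
    also have "\<dots> = k * ((\<Prod>i<i. factor (\<omega> i)) * (1 + c * snd (\<omega> i)))" by simp
    also have "\<dots> \<le> k * (K * exp (- \<delta> * real i))" by (rule mult_left_mono[OF d2 k])
    finally have "k' * nrm (mprod (map (\<lambda>j. A (\<omega> j)) [0..<i]) *v b (\<omega> i)) \<le> k' * (k * (K * exp (- \<delta> * real i)))"
      using k'(1) by (simp add: mult_left_mono)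
    then show ?thesis using k'(2) order_trans by (fastforce simp: mult.assoc)
  qed
  have sum: "summable (\<lambda>i. norm (mprod (map (\<lambda>j. A (\<omega> j)) [0..<i]) *v b (\<omega> i)))"
    by (rule summable_comparison_test_ev[OF _ summable_mult[OF sg, of "k' * k * K"]])
       (intro always_eventually allI, use bd in simp)
  have zero: "(\<lambda>n. mprod (map (\<lambda>j. A (\<omega> j)) [0..<n]) *v x) \<longlonglongrightarrow> 0" for x
  proof (rule Lim_null_comparison)
    show "\<forall>\<^sub>F n in sequentially. norm (mprod (map (\<lambda>j. A (\<omega> j)) [0..<n]) *v x) \<le> k' * nrm x * K * exp (- \<delta> * real n)"
    proof (rule always_eventually, rule allI)
      fix n
      have "norm (mprod (map (\<lambda>j. A (\<omega> j)) [0..<n]) *v x) \<le> k' * ((\<Prod>i<n. factor (\<omega> i)) * nrm x)"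
        using k'(2) mult_left_mono[OF prod less_imp_le[OF k'(1)]] order_trans by blast
      also have "\<dots> \<le> k' * (K * exp (- \<delta> * real n) * nrm x)"
        using k'(1) by (intro mult_left_mono mult_right_mono d1 nrm_nonneg) auto
      finally show "norm (mprod (map (\<lambda>j. A (\<omega> j)) [0..<n]) *v x) \<le> k' * nrm x * K * exp (- \<delta> * real n)"
        by (simp add: mult_ac)
    qed
    show "(\<lambda>n. k' * nrm x * K * exp (- \<delta> * real n)) \<longlonglongrightarrow> 0"
      using tendsto_mult_left[OF summable_LIMSEQ_zero[OF sg], of "k' * nrm x * K"] by simp
  qed
  have "(\<lambda>n. bwd (\<lambda>p x. A p *v x + b p) n \<omega> x) \<longlonglongrightarrow> (\<Sum>i. mprod (map (\<lambda>j. A (\<omega> j)) [0..<i]) *v b (\<omega> i))" for x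
    unfolding bwd_affine
    using tendsto_add[OF summable_LIMSEQ[OF summable_norm_cancel[OF sum]] zero[of x]] by simp
  then show ?case using sum zero by blast
qed

text \<open>The stationary state just after a jump as a function of a mark sequence; inserting
  \<open>marks\<close> gives the random vector of the theorem.\<close>

definition C_limit :: "(nat \<Rightarrow> real \<times> real) \<Rightarrow> real^('q::_)" where
  "C_limit \<omega> = (\<Sum>i. mprod (map (\<lambda>j. C_mat (\<omega> j)) [0..<i]) *v D_vec (\<omega> i))"

definition Q_limit :: "(nat \<Rightarrow> real \<times> real) \<Rightarrow> real^('q::_)" where
  "Q_limit \<omega> = (\<Sum>i. mprod (map (\<lambda>j. Q_mat (\<omega> j)) [0..<i]) *v R_vec (\<omega> i))"

lemma bound_nonneg: "\<bar>\<alpha>\<^sub>0\<bar> * nrm e / c \<ge> 0"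
  using nrm_nonneg c_pos by simp

lemma AE_C_limit:
  "AE \<omega> in seq_law. summable (\<lambda>i. norm (mprod (map (\<lambda>j. C_mat (\<omega> j)) [0..<i]) *v D_vec (\<omega> i)))"
  "AE \<omega> in seq_law. \<forall>x. (\<lambda>n. bwd F.cmap n \<omega> x) \<longlonglongrightarrow> C_limit \<omega>"
proof -
  note * = affine_convergence[of C_mat D_vec, OF nrm_C_mat nrm_D_vec bound_nonneg]
  show "AE \<omega> in seq_law. summable (\<lambda>i. norm (mprod (map (\<lambda>j. C_mat (\<omega> j)) [0..<i]) *v D_vec (\<omega> i)))"
    using * by (rule AE_mp) (auto intro!: AE_I2)
  show "AE \<omega> in seq_law. \<forall>x. (\<lambda>n. bwd F.cmap n \<omega> x) \<longlonglongrightarrow> C_limit \<omega>"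
    unfolding cmap_affine C_limit_def using * by (rule AE_mp) (auto intro!: AE_I2)
qed

lemma AE_Q_limit:
  "AE \<omega> in seq_law. \<forall>x. (\<lambda>n. mprod (map (\<lambda>j. Q_mat (\<omega> j)) [0..<n]) *v x) \<longlonglongrightarrow> 0"
  "AE \<omega> in seq_law. \<forall>x. (\<lambda>n. bwd F.qmap n \<omega> x) \<longlonglongrightarrow> Q_limit \<omega>"
proof -
  note * = affine_convergence[of Q_mat R_vec, OF nrm_Q_mat nrm_R_vec bound_nonneg]
  show "AE \<omega> in seq_law. \<forall>x. (\<lambda>n. mprod (map (\<lambda>j. Q_mat (\<omega> j)) [0..<n]) *v x) \<longlonglongrightarrow> 0"
    using * by (rule AE_mp) (auto intro!: AE_I2)
  show "AE \<omega> in seq_law. \<forall>x. (\<lambda>n. bwd F.qmap n \<omega> x) \<longlonglongrightarrow> Q_limit \<omega>"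
    unfolding qmap_affine Q_limit_def using * by (rule AE_mp) (auto intro!: AE_I2)
qed

lemma limit_measurable [measurable]:
  "C_limit \<in> borel_measurable seq_law" "Q_limit \<in> borel_measurable seq_law"
proof -
  \<comment> \<open>Each summand is a difference of successive backward compositions, whose
    measurability is known.\<close>
  have C: "mprod (map (\<lambda>j. C_mat (\<omega> j)) [0..<i]) *v D_vec (\<omega> i) = bwd F.cmap (Suc i) \<omega> 0 - bwd F.cmap i \<omega> 0" for \<omega> i
    unfolding cmap_affine bwd_affine by simp
  have Q: "mprod (map (\<lambda>j. Q_mat (\<omega> j)) [0..<i]) *v R_vec (\<omega> i) = bwd F.qmap (Suc i) \<omega> 0 - bwd F.qmap i \<omega> 0" for \<omega> i
    unfolding qmap_affine bwd_affine by simp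
  show "C_limit \<in> borel_measurable seq_law"
    unfolding C_limit_def[abs_def] C F_P[symmetric]
    by (intro borel_measurable_suminf borel_measurable_diff F.C.bwd_meas) simp_all
  show "Q_limit \<in> borel_measurable seq_law"
    unfolding Q_limit_def[abs_def] Q F_P[symmetric]
    by (intro borel_measurable_suminf borel_measurable_diff F.Q.bwd_meas) simp_all
qed

lemma continuous_affine: "continuous_on UNIV (\<lambda>x. A *v x + b)" for A :: "real^'n^'n" and b
  by (intro continuous_on_add continuous_on_const linear_continuous_on matrix_vector_mul_bounded_linear)

lemma C_invariant_iff: "F.C.invariant \<pi> \<longleftrightarrow> \<pi> = distr seq_law borel C_limit"
  unfolding F_P[symmetric]
  by (rule letac[OF F.C.random_maps_axioms])
     (use AE_C_limit(2) limit_measurable(1) in \<open>simp_all only: F_P cmap_affine continuous_affine\<close>)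

lemma Q_invariant_iff: "F.Q.invariant \<pi> \<longleftrightarrow> \<pi> = distr seq_law borel Q_limit"
  unfolding F_P[symmetric]
  by (rule letac[OF F.Q.random_maps_axioms])
     (use AE_Q_limit(2) limit_measurable(2) in \<open>simp_all only: F_P qmap_affine continuous_affine\<close>)

end

section \<open>Invariant laws, stationary paths and one additional gap\<close>

context random_maps
begin

text \<open>Attaching an independent realisation W of the map to a point drawn from \<pi> reproduces
  the product law, so invariance can be tested on any probability space carrying such a W.\<close>

lemma invariant_iff_realised:
  assumes \<pi>: "prob_space \<pi>" "sets \<pi> = sets N" and K: "prob_space K" and W: "W \<in> K \<rightarrow>\<^sub>M \<rho>" "distr K \<rho> W = \<rho>"
  shows "invariant \<pi> \<longleftrightarrow> distr (\<pi> \<Otimes>\<^sub>M K) N (\<lambda>(x, \<omega>). \<phi> (W \<omega>) x) = \<pi>"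
proof -
  interpret \<pi>: prob_space \<pi> by fact
  interpret K: prob_space K by fact
  note [measurable_cong] = \<pi>(2)
  note [measurable] = W(1)
  have "sigma_finite_measure (distr K \<rho> W)" unfolding W(2) by unfold_locales
  then have "distr \<pi> \<pi> (\<lambda>x. x) \<Otimes>\<^sub>M distr K \<rho> W = distr (\<pi> \<Otimes>\<^sub>M K) (\<pi> \<Otimes>\<^sub>M \<rho>) (\<lambda>(x, \<omega>). (x, W \<omega>))"
    by (intro pair_measure_distr) (use W in auto)
  then have "\<pi> \<Otimes>\<^sub>M \<rho> = distr (\<pi> \<Otimes>\<^sub>M K) (\<pi> \<Otimes>\<^sub>M \<rho>) (\<lambda>(x, \<omega>). (x, W \<omega>))"
    unfolding W(2) by (simp add: distr_id)
  then have "distr (\<pi> \<Otimes>\<^sub>M \<rho>) N (\<lambda>(x, s). \<phi> s x) =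
      distr (distr (\<pi> \<Otimes>\<^sub>M K) (\<pi> \<Otimes>\<^sub>M \<rho>) (\<lambda>(x, \<omega>). (x, W \<omega>))) N (\<lambda>(x, s). \<phi> s x)" by simp
  also have "\<dots> = distr (\<pi> \<Otimes>\<^sub>M K) N ((\<lambda>(x, s). \<phi> s x) \<circ> (\<lambda>(x, \<omega>). (x, W \<omega>)))"
    by (rule distr_distr) measurable
  also have "(\<lambda>(x, s). \<phi> s x) \<circ> (\<lambda>(x, \<omega>). (x, W \<omega>)) = (\<lambda>(x, \<omega>). \<phi> (W \<omega>) x)" by auto
  finally show ?thesis unfolding invariant_iff_distr[OF \<pi>] by simp
qed

lemma invariantD:
  "invariant \<pi> \<Longrightarrow> g \<in> borel_measurable N \<Longrightarrow> (\<integral>\<^sup>+x. \<integral>\<^sup>+s. g (\<phi> s x) \<partial>\<rho> \<partial>\<pi>) = (\<integral>\<^sup>+x. g x \<partial>\<pi>)"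
  unfolding invariant_def by blast

lemma fwd_path_measurable [measurable (raw)]:
  assumes "f \<in> K \<rightarrow>\<^sub>M S" "g \<in> K \<rightarrow>\<^sub>M N"
  shows "(\<lambda>w n. fwd \<phi> (n + k) (f w) (g w)) \<in> K \<rightarrow>\<^sub>M Pi\<^sub>M UNIV (\<lambda>_::nat. N)"
  by (intro measurable_PiM_UNIV fwd_meas assms)

lemma nn_integral_fwd_path_next:
  assumes G: "G \<in> borel_measurable (Pi\<^sub>M UNIV (\<lambda>_::nat. N))" and x: "x \<in> space N"
  shows "(\<integral>\<^sup>+\<omega>. G (\<lambda>n. fwd \<phi> (n + 1) \<omega> x) \<partial>S) = (\<integral>\<^sup>+s. \<integral>\<^sup>+\<omega>. G (\<lambda>n. fwd \<phi> n \<omega> (\<phi> s x)) \<partial>S \<partial>\<rho>)"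
proof -
  note [measurable] = G
  have [measurable]: "(\<lambda>\<omega> n. fwd \<phi> (n + 1) \<omega> x) \<in> S \<rightarrow>\<^sub>M Pi\<^sub>M UNIV (\<lambda>_::nat. N)"
    by (rule fwd_path_measurable) (use x in auto)
  have "(\<integral>\<^sup>+\<omega>. G (\<lambda>n. fwd \<phi> (n + 1) \<omega> x) \<partial>S) = (\<integral>\<^sup>+s. \<integral>\<^sup>+\<omega>. G (\<lambda>n. fwd \<phi> (n + 1) (case_nat s \<omega>) x) \<partial>S \<partial>\<rho>)"
    by (rule nn_integral_PiM_iter[OF \<rho>]) measurable
  then show ?thesis by (simp only: Suc_eq_plus1[symmetric] fwd_case_nat)
qed

lemma invariant_fwd_path:
  assumes inv: "invariant \<pi>" and G: "G \<in> borel_measurable (Pi\<^sub>M UNIV (\<lambda>_::nat. N))"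
  shows "(\<integral>\<^sup>+x. \<integral>\<^sup>+\<omega>. G (\<lambda>n. fwd \<phi> (n + k) \<omega> x) \<partial>S \<partial>\<pi>) = (\<integral>\<^sup>+x. \<integral>\<^sup>+\<omega>. G (\<lambda>n. fwd \<phi> n \<omega> x) \<partial>S \<partial>\<pi>)"
  using G
proof (induction k arbitrary: G)
  case (Suc k)
  note [measurable] = Suc.prems
  interpret S: prob_space S by (rule prob_space_S)
  have \<pi>: "sets \<pi> = sets N" using inv unfolding invariant_def by blast
  \<comment> \<open>The shift by k is absorbed into the functional, so that a single step has to be
    split off before invariance applies.\<close>
  define G' where "G' x = G (\<lambda>n. x (n + k))" for x
  have [measurable]: "G' \<in> borel_measurable (Pi\<^sub>M UNIV (\<lambda>_::nat. N))"
    unfolding G'_def by (rule measurable_compose[OF measurable_PiM_UNIV Suc.prems]) measurable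
  have m: "(\<lambda>(x, \<omega>). G' (\<lambda>n. fwd \<phi> n \<omega> x)) \<in> borel_measurable (N \<Otimes>\<^sub>M S)"
    using fwd_path_measurable[of snd "N \<Otimes>\<^sub>M S" fst 0] by (simp add: case_prod_unfold)
  have h: "(\<lambda>x. \<integral>\<^sup>+\<omega>. G' (\<lambda>n. fwd \<phi> n \<omega> x) \<partial>S) \<in> borel_measurable N"
    using S.borel_measurable_nn_integral[OF m] by simp
  have "(\<integral>\<^sup>+x. \<integral>\<^sup>+\<omega>. G (\<lambda>n. fwd \<phi> (n + Suc k) \<omega> x) \<partial>S \<partial>\<pi>) = (\<integral>\<^sup>+x. \<integral>\<^sup>+\<omega>. G' (\<lambda>n. fwd \<phi> (n + 1) \<omega> x) \<partial>S \<partial>\<pi>)"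
    by (simp add: G'_def add_ac)
  also have "\<dots> = (\<integral>\<^sup>+x. \<integral>\<^sup>+s. \<integral>\<^sup>+\<omega>. G' (\<lambda>n. fwd \<phi> n \<omega> (\<phi> s x)) \<partial>S \<partial>\<rho> \<partial>\<pi>)"
    by (intro nn_integral_cong nn_integral_fwd_path_next) (use sets_eq_imp_space_eq[OF \<pi>] in auto)
  also have "\<dots> = (\<integral>\<^sup>+x. \<integral>\<^sup>+\<omega>. G' (\<lambda>n. fwd \<phi> n \<omega> x) \<partial>S \<partial>\<pi>)"
    by (rule invariantD[OF inv h])
  also have "\<dots> = (\<integral>\<^sup>+x. \<integral>\<^sup>+\<omega>. G (\<lambda>n. fwd \<phi> n \<omega> x) \<partial>S \<partial>\<pi>)"
    unfolding G'_def by (rule Suc.IH[OF Suc.prems])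
  finally show ?case .
qed simp

end

context flow_jump
begin

lemma nn_integral_law:
  assumes [measurable]: "h \<in> borel_measurable (borel \<Otimes>\<^sub>M borel)"
  shows "(\<integral>\<^sup>+p. h p \<partial>law) = (\<integral>\<^sup>+s. \<integral>\<^sup>+z. h (s, z) \<partial>\<zeta> \<partial>gap)"
  unfolding law_def by (rule Z.nn_integral_fst[symmetric]) measurable

text \<open>Waiting for one more gap after a jump turns the law of the state just after a jump into
  the law of the state just before one.\<close>

lemma invariant_flow:
  assumes inv: "C.invariant \<eta>"
  shows "Q.invariant (distr (gap \<Otimes>\<^sub>M \<eta>) borel (\<lambda>(u, x). fl u x))"
proof -
  have \<eta>: "prob_space \<eta>" "sets \<eta> = sets borel" using inv unfolding C.invariant_def by blast+
  interpret \<eta>: prob_space \<eta> by (rule \<eta>)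
  note [measurable_cong] = \<eta>(2)
  interpret GE: pair_prob_space gap \<eta> by unfold_locales
  interpret EG: pair_sigma_finite \<eta> gap by unfold_locales
  interpret GG: pair_sigma_finite gap gap by unfold_locales
  interpret L: prob_space law by (rule law)
  let ?\<kappa> = "distr (gap \<Otimes>\<^sub>M \<eta>) borel (\<lambda>(u, x). fl u x)"
  have m: "(\<lambda>(u, x). fl u x) \<in> borel_measurable (gap \<Otimes>\<^sub>M \<eta>)" by measurable
  have int: "(\<integral>\<^sup>+x. g x \<partial>?\<kappa>) = (\<integral>\<^sup>+u. \<integral>\<^sup>+x. g (fl u x) \<partial>\<eta> \<partial>gap)" if [measurable]: "g \<in> borel_measurable borel" for g
    by (subst nn_integral_distr[OF m]) (simp_all add: \<eta>.nn_integral_fst[symmetric] case_prod_unfold)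
  show ?thesis
    unfolding Q.invariant_def
  proof (intro conjI ballI)
    show "prob_space ?\<kappa>" by (rule GE.prob_space_distr[OF m])
    fix g :: "'a \<Rightarrow> ennreal" assume g[measurable]: "g \<in> borel_measurable borel"
    have "(\<integral>\<^sup>+x. \<integral>\<^sup>+p. g (qmap p x) \<partial>law \<partial>?\<kappa>) = (\<integral>\<^sup>+u. \<integral>\<^sup>+x. \<integral>\<^sup>+p. g (qmap p (fl u x)) \<partial>law \<partial>\<eta> \<partial>gap)"
      by (rule int) measurable
    also have "\<dots> = (\<integral>\<^sup>+u. \<integral>\<^sup>+x. \<integral>\<^sup>+s. \<integral>\<^sup>+z. g (fl s (jp z (fl u x))) \<partial>\<zeta> \<partial>gap \<partial>\<eta> \<partial>gap)"
      unfolding qmap_def by (subst nn_integral_law) (simp_all, measurable)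
    also have "\<dots> = (\<integral>\<^sup>+u. \<integral>\<^sup>+s. \<integral>\<^sup>+x. \<integral>\<^sup>+z. g (fl s (jp z (fl u x))) \<partial>\<zeta> \<partial>\<eta> \<partial>gap \<partial>gap)"
    proof (rule nn_integral_cong)
      fix u assume "u \<in> space gap"
      show "(\<integral>\<^sup>+x. \<integral>\<^sup>+s. \<integral>\<^sup>+z. g (fl s (jp z (fl u x))) \<partial>\<zeta> \<partial>gap \<partial>\<eta>) = (\<integral>\<^sup>+s. \<integral>\<^sup>+x. \<integral>\<^sup>+z. g (fl s (jp z (fl u x))) \<partial>\<zeta> \<partial>\<eta> \<partial>gap)"
        by (rule EG.Fubini'[symmetric]) measurable
    qed
    also have "\<dots> = (\<integral>\<^sup>+s. \<integral>\<^sup>+u. \<integral>\<^sup>+x. \<integral>\<^sup>+z. g (fl s (jp z (fl u x))) \<partial>\<zeta> \<partial>\<eta> \<partial>gap \<partial>gap)"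
      by (rule GG.Fubini') measurable
    \<comment> \<open>The gap before the jump and the jump now form one step of \<open>cmap\<close>,
      under which \<eta> is invariant; the final wait s stays outside.\<close>
    also have "\<dots> = (\<integral>\<^sup>+s. \<integral>\<^sup>+x. \<integral>\<^sup>+p. g (fl s (cmap p x)) \<partial>law \<partial>\<eta> \<partial>gap)"
    proof (rule nn_integral_cong)
      fix s assume "s \<in> space gap"
      have "(\<integral>\<^sup>+u. \<integral>\<^sup>+x. \<integral>\<^sup>+z. g (fl s (jp z (fl u x))) \<partial>\<zeta> \<partial>\<eta> \<partial>gap) = (\<integral>\<^sup>+x. \<integral>\<^sup>+u. \<integral>\<^sup>+z. g (fl s (jp z (fl u x))) \<partial>\<zeta> \<partial>gap \<partial>\<eta>)"
        by (rule EG.Fubini') measurable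
      also have "\<dots> = (\<integral>\<^sup>+x. \<integral>\<^sup>+p. g (fl s (cmap p x)) \<partial>law \<partial>\<eta>)"
        unfolding cmap_def by (subst nn_integral_law) (simp_all, measurable)
      finally show "(\<integral>\<^sup>+u. \<integral>\<^sup>+x. \<integral>\<^sup>+z. g (fl s (jp z (fl u x))) \<partial>\<zeta> \<partial>\<eta> \<partial>gap) = (\<integral>\<^sup>+x. \<integral>\<^sup>+p. g (fl s (cmap p x)) \<partial>law \<partial>\<eta>)" .
    qed
    also have "\<dots> = (\<integral>\<^sup>+s. \<integral>\<^sup>+x. g (fl s x) \<partial>\<eta> \<partial>gap)"
    proof (rule nn_integral_cong)
      fix s assume [measurable]: "s \<in> space gap"
      have "(\<lambda>x. g (fl s x)) \<in> borel_measurable borel" by measurable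
      then show "(\<integral>\<^sup>+x. \<integral>\<^sup>+p. g (fl s (cmap p x)) \<partial>law \<partial>\<eta>) = (\<integral>\<^sup>+x. g (fl s x) \<partial>\<eta>)"
        by (rule C.invariantD[OF inv])
    qed
    also have "\<dots> = (\<integral>\<^sup>+x. g x \<partial>?\<kappa>)" by (rule int[symmetric]) measurable
    finally show "(\<integral>\<^sup>+x. \<integral>\<^sup>+p. g (qmap p x) \<partial>law \<partial>?\<kappa>) = (\<integral>\<^sup>+x. g x \<partial>?\<kappa>)" .
  qed simp
qed

lemma cnt_at_top:
  assumes "reg \<omega>"
  shows "filterlim (\<lambda>t. cnt t \<omega>) at_top at_top"
  unfolding filterlim_at_top
proof
  fix n :: nat
  have "n \<le> cnt t \<omega>" if t: "t \<ge> max 0 (arrival n \<omega>)" for t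
  proof -
    have "between (cnt t \<omega>) t \<omega>" using between_iff[OF assms, of t] t by simp
    then have "arrival n \<omega> < arrival (Suc (cnt t \<omega>)) \<omega>" using t by (simp add: between_def)
    then have "n < Suc (cnt t \<omega>)" by (simp only: strict_mono_less[OF arrival_strict_mono[OF assms]])
    then show ?thesis by simp
  qed
  then show "\<forall>\<^sub>F t in at_top. n \<le> cnt t \<omega>" unfolding eventually_at_top_linorder by blast
qed

end

section \<open>Fixed points, stationarity and the limit law\<close>

context cogarch_stable
begin

lemma mark_realised:
  assumes W: "W \<in> borel_measurable M" "distr M borel W = distr M borel (\<lambda>\<omega>. (T 1 \<omega>, Z 1 \<omega>))"
  shows "W \<in> M \<rightarrow>\<^sub>M F.law" "distr M F.law W = F.law"
proof -
  show m: "W \<in> M \<rightarrow>\<^sub>M F.law" using W(1) by (simp add: F_law measurable_cong_sets[OF refl pair_law(3)])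
  have "distr M F.law W = distr M borel W" by (rule distr_cong) (simp_all add: F_law pair_law(3))
  then show "distr M F.law W = F.law" unfolding W(2) pair_law(4) F_law .
qed

text \<open>W is an arbitrary pair with the law of the first one, so that the pairs with index 1 and
  with index 0 are both served.\<close>

lemma fixed_point_iff:
  assumes W: "W \<in> borel_measurable M" "distr M borel W = distr M borel (\<lambda>\<omega>. (T 1 \<omega>, Z 1 \<omega>))"
  shows "solves_affine_fixed_point M (\<lambda>\<omega>. C_mat (W \<omega>)) (\<lambda>\<omega>. D_vec (W \<omega>)) \<pi> \<longleftrightarrow> \<pi> = distr seq_law borel C_limit"
    "solves_affine_fixed_point M (\<lambda>\<omega>. Q_mat (W \<omega>)) (\<lambda>\<omega>. R_vec (W \<omega>)) \<pi> \<longleftrightarrow> \<pi> = distr seq_law borel Q_limit"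
proof -
  note real = mark_realised[OF W]
  have 1: "F.C.invariant \<pi> \<longleftrightarrow> distr (\<pi> \<Otimes>\<^sub>M M) borel (\<lambda>(x, \<omega>). F.cmap (W \<omega>) x) = \<pi>"
    and 2: "F.Q.invariant \<pi> \<longleftrightarrow> distr (\<pi> \<Otimes>\<^sub>M M) borel (\<lambda>(x, \<omega>). F.qmap (W \<omega>) x) = \<pi>"
    if "prob_space \<pi>" "sets \<pi> = sets borel"
    by (rule F.C.invariant_iff_realised F.Q.invariant_iff_realised; fact that real prob_space_axioms)+
  have 3: "F.C.invariant \<pi> \<Longrightarrow> prob_space \<pi> \<and> sets \<pi> = sets borel"
    "F.Q.invariant \<pi> \<Longrightarrow> prob_space \<pi> \<and> sets \<pi> = sets borel"
    unfolding F.C.invariant_def F.Q.invariant_def by blast+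
  show "solves_affine_fixed_point M (\<lambda>\<omega>. C_mat (W \<omega>)) (\<lambda>\<omega>. D_vec (W \<omega>)) \<pi> \<longleftrightarrow> \<pi> = distr seq_law borel C_limit"
    unfolding C_invariant_iff[symmetric] solves_affine_fixed_point_def using 1 3(1) unfolding cmap_affine by blast
  show "solves_affine_fixed_point M (\<lambda>\<omega>. Q_mat (W \<omega>)) (\<lambda>\<omega>. R_vec (W \<omega>)) \<pi> \<longleftrightarrow> \<pi> = distr seq_law borel Q_limit"
    unfolding Q_invariant_iff[symmetric] solves_affine_fixed_point_def using 2 3(2) unfolding qmap_affine by blast
qed

lemma limit_distr:
  "distr M borel (\<lambda>\<omega>. C_limit (marks \<omega>)) = distr seq_law borel C_limit"
  "distr M borel (\<lambda>\<omega>. Q_limit (marks \<omega>)) = distr seq_law borel Q_limit"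
  using distr_distr[OF limit_measurable(1) marks_measurable(2)] distr_distr[OF limit_measurable(2) marks_measurable(2)]
  unfolding marks_distr by (simp_all add: comp_def)

lemma AE_marks: "AE \<omega> in seq_law. P \<omega> \<Longrightarrow> AE \<omega> in M. P (marks \<omega>)"
  using AE_distrD[OF marks_measurable(2)] unfolding marks_distr .

lemma solved_Gamma: "solved \<omega> \<Longrightarrow> Y (\<Sum>i=1..n. T i \<omega>) \<omega> = fwd F.cmap n (marks \<omega>) (Y 0 \<omega>)"
  unfolding solved_def by blast

text \<open>The chain is driven by marks independent of \<open>Y 0\<close>, so the law of its path
  is determined by the initial law. Comparing the first coordinate of the chain with that of its
  shift by one gives invariance, and the invariant law is unique.\<close>

lemma stationary_iff:
  "strictly_stationary M (\<lambda>n \<omega>. Y (\<Sum>i=1..n. T i \<omega>) \<omega>) \<longleftrightarrow> distr M borel (Y 0) = distr M borel (\<lambda>\<omega>. C_limit (marks \<omega>))"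
proof -
  let ?\<mu> = "distr M borel (Y 0)"
  let ?path = "Pi\<^sub>M UNIV (\<lambda>_::nat. borel :: (real^('q::_)) measure)"
  \<comment> \<open>V is the measurable version of the chain; the state read at random times agrees
    with it almost surely and is measurable on the completion.\<close>
  define V where "V k \<omega> = (\<lambda>n. fwd F.cmap (n + k) (marks \<omega>) (Y 0 \<omega>))" for k \<omega>
  define YG where "YG k \<omega> = (\<lambda>n. Y (\<Sum>i=1..n + k. T i \<omega>) \<omega>)" for k \<omega>
  have prob: "prob_space ?\<mu>" by (rule prob_space_distr) simp
  have path_meas: "(\<lambda>(y, \<omega>) n. fwd F.cmap (n + k) \<omega> y) \<in> borel \<Otimes>\<^sub>M seq_law \<rightarrow>\<^sub>M ?path" for k
    using F.C.fwd_path_measurable[of snd "borel \<Otimes>\<^sub>M seq_law" fst k] by (simp add: F_P case_prod_unfold)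
  have Vm: "V k \<in> M \<rightarrow>\<^sub>M ?path" for k
    unfolding V_def using F.C.fwd_path_measurable[of marks M "Y 0" k] marks_measurable(2) by (simp add: F_P)
  have int: "(\<integral>\<^sup>+\<omega>. G (V k \<omega>) \<partial>M) = (\<integral>\<^sup>+y. \<integral>\<^sup>+\<omega>. G (\<lambda>n. fwd F.cmap (n + k) \<omega> y) \<partial>seq_law \<partial>?\<mu>)"
    if "G \<in> borel_measurable ?path" for G k
    using nn_integral_initial_marks[OF measurable_compose[OF path_meas[of k] that]] by (simp add: V_def)
  have AE: "AE \<omega> in M. YG k \<omega> = V k \<omega>" for k
    using AE_solved by eventually_elim (simp only: YG_def V_def solved_Gamma)
  have YG: "distr (completion M) ?path (YG k) = distr M ?path (V k)" for k
    by (rule completion_AE_eq(2)[OF Vm AE]) (simp add: space_PiM)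
  have comp: "(\<lambda>\<omega>. Y (\<Sum>i=1..n. T i \<omega>) \<omega>) \<in> borel_measurable (completion M)" for n
  proof (rule completion_AE_eq(1)[OF _ _ space_borel])
    show "(\<lambda>\<omega>. V 0 \<omega> n) \<in> borel_measurable M" by (rule measurable_compose[OF Vm]) simp
    show "AE \<omega> in M. Y (\<Sum>i=1..n. T i \<omega>) \<omega> = V 0 \<omega> n"
      using AE[of 0] by eventually_elim (metis YG_def add_0_right)
  qed
  have stat: "strictly_stationary M (\<lambda>n \<omega>. Y (\<Sum>i=1..n. T i \<omega>) \<omega>) \<longleftrightarrow> (\<forall>k. distr M ?path (V k) = distr M ?path (V 0))"
    unfolding strictly_stationary_def using comp YG[unfolded YG_def] YG[of 0, unfolded YG_def] by simp
  have "(\<forall>k. distr M ?path (V k) = distr M ?path (V 0)) \<longleftrightarrow> F.C.invariant ?\<mu>"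
  proof
    assume eq: "\<forall>k. distr M ?path (V k) = distr M ?path (V 0)"
    show "F.C.invariant ?\<mu>" unfolding F.C.invariant_def
    proof (intro conjI ballI prob)
      fix g :: "real^('q::_) \<Rightarrow> ennreal" assume g[measurable]: "g \<in> borel_measurable borel"
      interpret S: prob_space seq_law by (rule seq_law)
      have G: "(\<lambda>x. g (x 0)) \<in> borel_measurable ?path" by measurable
      have "(\<integral>\<^sup>+y. \<integral>\<^sup>+s. g (F.cmap s y) \<partial>F.law \<partial>?\<mu>) = (\<integral>\<^sup>+\<omega>. g (V 1 \<omega> 0) \<partial>M)"
      proof -
        have "(\<integral>\<^sup>+\<omega>. g (F.cmap (\<omega> 0) y) \<partial>F.P) = (\<integral>\<^sup>+s. g (F.cmap s y) \<partial>F.law)" for y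
        proof -
          interpret P: prob_space F.P by (rule F.prob_space_P)
          have "(\<integral>\<^sup>+\<omega>. g (F.cmap (\<omega> 0) y) \<partial>F.P) = (\<integral>\<^sup>+s. \<integral>\<^sup>+\<omega>. g (F.cmap (case_nat s \<omega> 0) y) \<partial>F.P \<partial>F.law)"
            by (rule nn_integral_PiM_iter[OF F.law(1)]) measurable
          then show ?thesis by (simp add: P.emeasure_space_1)
        qed
        then show ?thesis using int[OF G, of 1] by (simp add: F_P)
      qed
      also have "\<dots> = (\<integral>\<^sup>+x. g (x 0) \<partial>distr M ?path (V 1))" by (rule nn_integral_distr[OF Vm, symmetric]) (use G in simp)
      also have "\<dots> = (\<integral>\<^sup>+x. g (x 0) \<partial>distr M ?path (V 0))" using eq by metis
      also have "\<dots> = (\<integral>\<^sup>+\<omega>. g (V 0 \<omega> 0) \<partial>M)" by (rule nn_integral_distr[OF Vm]) (use G in simp)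
      also have "\<dots> = (\<integral>\<^sup>+y. g y \<partial>?\<mu>)" by (simp add: V_def nn_integral_distr)
      finally show "(\<integral>\<^sup>+y. \<integral>\<^sup>+s. g (F.cmap s y) \<partial>F.law \<partial>?\<mu>) = (\<integral>\<^sup>+y. g y \<partial>?\<mu>)" .
    qed simp
  next
    assume inv: "F.C.invariant ?\<mu>"
    show "\<forall>k. distr M ?path (V k) = distr M ?path (V 0)"
    proof (intro allI distr_eqI_nn_integral[OF Vm Vm])
      fix k and G :: "(nat \<Rightarrow> real^('q::_)) \<Rightarrow> ennreal" assume G: "G \<in> borel_measurable ?path"
      show "(\<integral>\<^sup>+\<omega>. G (V k \<omega>) \<partial>M) = (\<integral>\<^sup>+\<omega>. G (V 0 \<omega>) \<partial>M)"
        unfolding int[OF G] using F.C.invariant_fwd_path[OF inv G, of k] by (simp add: F_P)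
    qed
  qed
  then show ?thesis unfolding stat C_invariant_iff limit_distr .
qed

text \<open>The backward composition starts from the given state moved along the flow through the
  incomplete gap; this start stays bounded because l < 0, and the products forget it.\<close>

lemma last_jump_state_tendsto:
  "AE \<omega> in seq_law. \<forall>y. ((\<lambda>t. last_jump_state t \<omega> y) \<longlongrightarrow> Q_limit \<omega>) at_top"
  using AE_Q_limit F.AE_reg[unfolded F_P]
proof eventually_elim
  case (elim \<omega>)
  define P where "P n = mprod (map (\<lambda>j. Q_mat (\<omega> j)) [0..<n])" for n
  define f where "f t = flow (t - F.arrival (F.cnt t \<omega>) \<omega>)" for t
  have Q: "bwd F.qmap n \<omega> x = bwd F.qmap n \<omega> 0 + P n *v x" for n x
    unfolding qmap_affine bwd_affine P_def by simp
  \<comment> \<open>Decay on the finitely many unit vectors is uniform decay on bounded sets, as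
    required for a vector that changes with t.\<close>
  have P_axis: "(\<lambda>n. \<Sum>i\<in>UNIV. norm (P n *v axis i 1)) \<longlonglongrightarrow> 0"
    by (rule tendsto_null_sum) (use elim(1) in \<open>auto simp: P_def intro!: tendsto_norm_zero\<close>)
  have P_le: "norm (P n *v x) \<le> norm x * (\<Sum>i\<in>UNIV. norm (P n *v axis i 1))" for n and x :: "real^('q::_)"
  proof -
    have "P n *v x = (\<Sum>i\<in>UNIV. x $ i *\<^sub>R (P n *v axis i 1))"
      by (subst matrix_mult_sum) (simp add: matrix_vector_mult_basis scalar_mult_eq_scaleR)
    also have "norm \<dots> \<le> (\<Sum>i\<in>UNIV. norm x * norm (P n *v axis i 1))"
      by (rule sum_norm_le) (auto intro!: mult_right_mono component_le_norm_cart)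
    finally show ?thesis by (simp add: sum_distrib_left)
  qed
  obtain k where k: "k > 0" "\<And>v. norm v \<le> k * nrm v" using norm_le_nrm by blast
  have cnt: "filterlim (\<lambda>t. F.cnt t \<omega>) at_top at_top" by (rule F.cnt_at_top) fact
  show ?case
  proof
    fix y
    have f_le: "norm (f t y) \<le> k * nrm y" if "t \<ge> 0" for t
    proof -
      have "t - F.arrival (F.cnt t \<omega>) \<omega> \<ge> 0"
        using F.between_iff[OF elim(3) that, of "F.cnt t \<omega>"] unfolding F.between_def by simp
      then have "nrm (f t y) \<le> exp (l * (t - F.arrival (F.cnt t \<omega>) \<omega>)) * nrm y"
        unfolding f_def flow_def by (rule nrm_mexp)
      also have "\<dots> \<le> 1 * nrm y"
        using l_neg \<open>t - _ \<ge> 0\<close> by (intro mult_right_mono nrm_nonneg) (simp add: mult_nonpos_nonneg)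
      finally have "k * nrm (f t y) \<le> k * nrm y" using k(1) by simp
      then show ?thesis using k(2)[of "f t y"] by linarith
    qed
    have 1: "((\<lambda>t. P (F.cnt t \<omega>) *v f t y) \<longlongrightarrow> 0) at_top"
    proof (rule Lim_null_comparison)
      show "\<forall>\<^sub>F t in at_top. norm (P (F.cnt t \<omega>) *v f t y) \<le> k * nrm y * (\<Sum>i\<in>UNIV. norm (P (F.cnt t \<omega>) *v axis i 1))"
        using eventually_ge_at_top[of 0]
      proof eventually_elim
        case (elim t)
        show ?case by (rule order_trans[OF P_le mult_right_mono[OF f_le[OF elim]]]) (simp add: sum_nonneg)
      qed
      show "((\<lambda>t. k * nrm y * (\<Sum>i\<in>UNIV. norm (P (F.cnt t \<omega>) *v axis i 1))) \<longlongrightarrow> 0) at_top"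
        using tendsto_mult_left[OF filterlim_compose[OF P_axis cnt], of "k * nrm y"] by simp
    qed
    have 2: "((\<lambda>t. bwd F.qmap (F.cnt t \<omega>) \<omega> 0) \<longlongrightarrow> Q_limit \<omega>) at_top"
      by (rule filterlim_compose[OF _ cnt]) (use elim(2) in blast)
    have "last_jump_state t \<omega> y = bwd F.qmap (F.cnt t \<omega>) \<omega> 0 + P (F.cnt t \<omega>) *v f t y" for t
      unfolding last_jump_state_def f_def[symmetric] by (rule Q)
    then show "((\<lambda>t. last_jump_state t \<omega> y) \<longlongrightarrow> Q_limit \<omega>) at_top"
      using tendsto_add[OF 2 1] by (simp only: add_0_right)
  qed
qed

text \<open>At each fixed time the state has the law of \<open>last_jump_state\<close>, which
  converges almost surely; dominated convergence gives convergence in distribution.\<close>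

lemma limit_law: "limit_law_at_top M Y (distr seq_law borel Q_limit)"
  unfolding limit_law_at_top_def
proof (intro conjI allI impI)
  show "prob_space (distr seq_law borel Q_limit)"
    by (rule prob_space.prob_space_distr[OF seq_law(1) limit_measurable(2)])
  fix f :: "real^('q::_) \<Rightarrow> real" assume f: "continuous_on UNIV f \<and> bounded (range f)"
  then have fm[measurable]: "f \<in> borel_measurable borel" by (intro borel_measurable_continuous_onI) blast
  obtain K where K: "\<And>x. norm (f x) \<le> K" using f unfolding bounded_iff by auto
  note [measurable] = marks_measurable(2)
  have "(\<lambda>\<omega>. (Y 0 \<omega>, marks \<omega>)) \<in> M \<rightarrow>\<^sub>M borel \<Otimes>\<^sub>M seq_law" by measurable
  from measurable_compose[OF this state_measurable(3)]
  have lm: "(\<lambda>\<omega>. last_jump_state t (marks \<omega>) (Y 0 \<omega>)) \<in> borel_measurable M" for t by simp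
  have qm: "(\<lambda>\<omega>. Q_limit (marks \<omega>)) \<in> borel_measurable M" by measurable
  have "((\<lambda>t. \<integral>\<omega>. f (last_jump_state t (marks \<omega>) (Y 0 \<omega>)) \<partial>M) \<longlongrightarrow> (\<integral>\<omega>. f (Q_limit (marks \<omega>)) \<partial>M)) at_top"
  proof (rule integral_dominated_convergence_at_top[where w = "\<lambda>_. K"])
    show "AE \<omega> in M. ((\<lambda>t. f (last_jump_state t (marks \<omega>) (Y 0 \<omega>))) \<longlongrightarrow> f (Q_limit (marks \<omega>))) at_top"
      using AE_marks[OF last_jump_state_tendsto]
    proof eventually_elim
      case (elim \<omega>)
      have "isCont f (Q_limit (marks \<omega>))" using f by (simp add: continuous_on_eq_continuous_at)
      then show ?case using elim by (intro isCont_tendsto_compose[of _ f]) auto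
    qed
  qed (use K lm qm fm in \<open>auto intro: measurable_compose\<close>)
  moreover have "(\<integral>\<omega>. f (Q_limit (marks \<omega>)) \<partial>M) = (\<integral>x. f x \<partial>distr seq_law borel Q_limit)"
    unfolding limit_distr(2)[symmetric] by (rule integral_distr[OF qm fm, symmetric])
  moreover have "\<forall>\<^sub>F t in at_top. (\<integral>\<omega>. f (last_jump_state t (marks \<omega>) (Y 0 \<omega>)) \<partial>M) = (\<integral>\<omega>. f (Y t \<omega>) \<partial>M)"
    using eventually_ge_at_top[of 0]
  proof eventually_elim
    case (elim t)
    have "(\<integral>\<omega>. f (Y t \<omega>) \<partial>M) = (\<integral>x. f x \<partial>distr M borel (Y t))"
      by (rule integral_distr[OF Y_measurable[OF elim] fm, symmetric])
    also have "\<dots> = (\<integral>\<omega>. f (last_jump_state t (marks \<omega>) (Y 0 \<omega>)) \<partial>M)"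
      unfolding state_law_eq(2)[OF elim] by (rule integral_distr[OF lm fm])
    finally show ?case by simp
  qed
  ultimately show "((\<lambda>t. \<integral>\<omega>. f (Y t \<omega>) \<partial>M) \<longlongrightarrow> (\<integral>x. f x \<partial>distr seq_law borel Q_limit)) at_top"
    by (simp only: Lim_transform_eventually)
qed simp

text \<open>One more gap turns the invariant law of the chain after jumps into an invariant law of
  the chain before jumps, and uniqueness identifies the latter.\<close>

lemma flow_limit_law:
  "distr seq_law borel Q_limit = distr (gap_law \<Otimes>\<^sub>M distr seq_law borel C_limit) borel (\<lambda>(u, x). flow u x)"
proof -
  have "F.C.invariant (distr seq_law borel C_limit)" unfolding C_invariant_iff ..
  from F.invariant_flow[OF this] show ?thesis
    unfolding Q_invariant_iff F.gap_def gap_law_def by simp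
qed

text \<open>The product measure supplies an independent gap even if M itself carries none.\<close>

lemma limit_law_product:
  "distr seq_law borel Q_limit =
    distr (distr M borel (T 1) \<Otimes>\<^sub>M M) borel (\<lambda>(u, \<omega>). mexp (u *\<^sub>R B) *v C_limit (marks \<omega>))"
proof -
  note [measurable] = marks_measurable(2) flow_measurable
  note [measurable_cong] = gap_law(2)
  have cm: "(\<lambda>\<omega>. C_limit (marks \<omega>)) \<in> borel_measurable M" by measurable
  interpret D: prob_space "distr M borel (\<lambda>\<omega>. C_limit (marks \<omega>))" by (rule prob_space_distr[OF cm])
  have "distr gap_law borel (\<lambda>u. u) \<Otimes>\<^sub>M distr M borel (\<lambda>\<omega>. C_limit (marks \<omega>)) =
      distr (gap_law \<Otimes>\<^sub>M M) (borel \<Otimes>\<^sub>M borel) (\<lambda>(u, \<omega>). (u, C_limit (marks \<omega>)))"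
    by (rule pair_measure_distr[OF _ cm]) (simp_all add: measurable_cong_sets[OF gap_law(2) refl], unfold_locales)
  moreover have "distr gap_law borel (\<lambda>u. u) = gap_law"
    using distr_id2[OF gap_law(2)[symmetric]] by simp
  ultimately have "distr seq_law borel Q_limit =
      distr (distr (gap_law \<Otimes>\<^sub>M M) (borel \<Otimes>\<^sub>M borel) (\<lambda>(u, \<omega>). (u, C_limit (marks \<omega>)))) borel (\<lambda>(u, x). flow u x)"
    unfolding flow_limit_law limit_distr(1)[symmetric] by simp
  also have "\<dots> = distr (gap_law \<Otimes>\<^sub>M M) borel ((\<lambda>(u, x). flow u x) \<circ> (\<lambda>(u, \<omega>). (u, C_limit (marks \<omega>))))"
    by (rule distr_distr) measurable
  finally show ?thesis unfolding gap_law(3) by (simp add: comp_def case_prod_unfold flow_def)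
qed

lemma limit_law_realised:
  assumes T': "indep_rvs M borel T' (\<Pi>\<^sub>M i\<in>UNIV. borel) (\<lambda>\<omega> i. (T i \<omega>, Z i \<omega>))"
    and law: "distr M borel T' = distr M borel (T 1)"
  shows "distr seq_law borel Q_limit = distr M borel (\<lambda>\<omega>. mexp (T' \<omega> *\<^sub>R B) *v C_limit (marks \<omega>))"
proof -
  note D = indep_rvsD[OF prob_space_axioms T']
  note [measurable] = marks_measurable(2) flow_measurable D(1)
  have cm: "(\<lambda>\<omega>. C_limit (marks \<omega>)) \<in> borel_measurable M" by measurable
  \<comment> \<open>The series uses the pairs from index 1 on, while T' is independent of the whole
    family including index 0; the shift reads the former off the latter.\<close>
  define h where "h x = C_limit (\<lambda>i. x (Suc i))" for x :: "nat \<Rightarrow> real \<times> real"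
  have h: "h \<in> borel_measurable (\<Pi>\<^sub>M i\<in>UNIV. borel)"
  proof -
    have "(\<lambda>x i. x (Suc i)) \<in> (\<Pi>\<^sub>M i\<in>UNIV. borel) \<rightarrow>\<^sub>M (Pi\<^sub>M UNIV (\<lambda>_::nat. borel :: (real \<times> real) measure))" by measurable
    then have "(\<lambda>x i. x (Suc i)) \<in> (\<Pi>\<^sub>M i\<in>UNIV. borel) \<rightarrow>\<^sub>M seq_law"
      by (simp add: measurable_cong_sets[OF refl seq_law(2)])
    from measurable_compose[OF this limit_measurable(1)] show ?thesis unfolding h_def .
  qed
  have hm: "h (\<lambda>i. (T i \<omega>, Z i \<omega>)) = C_limit (marks \<omega>)" for \<omega> by (simp add: h_def marks_def)
  have "distr M (borel \<Otimes>\<^sub>M borel) (\<lambda>\<omega>. (T' \<omega>, C_limit (marks \<omega>))) = distr M borel T' \<Otimes>\<^sub>M distr M borel (\<lambda>\<omega>. C_limit (marks \<omega>))"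
  proof (rule distr_Pair_eqI[OF D(1) cm])
    fix A :: "real set" and A' :: "(real^('q::_)) set" assume A: "A \<in> sets borel" "A' \<in> sets borel"
    have "h -` A' \<inter> space (\<Pi>\<^sub>M i\<in>UNIV. borel) \<in> sets (\<Pi>\<^sub>M i\<in>UNIV. borel)" by (rule measurable_sets[OF h A(2)])
    from D(3)[OF A(1) this]
    show "emeasure M {\<omega>\<in>space M. T' \<omega> \<in> A \<and> C_limit (marks \<omega>) \<in> A'} =
        emeasure M {\<omega>\<in>space M. T' \<omega> \<in> A} * emeasure M {\<omega>\<in>space M. C_limit (marks \<omega>) \<in> A'}"
      by (simp add: space_PiM hm)
  qed
  then have "distr seq_law borel Q_limit = distr (distr M (borel \<Otimes>\<^sub>M borel) (\<lambda>\<omega>. (T' \<omega>, C_limit (marks \<omega>)))) borel (\<lambda>(u, x). flow u x)"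
    unfolding flow_limit_law limit_distr(1)[symmetric] law gap_law(3) by simp
  also have "\<dots> = distr M borel ((\<lambda>(u, x). flow u x) \<circ> (\<lambda>\<omega>. (T' \<omega>, C_limit (marks \<omega>))))"
    by (rule distr_distr) measurable
  finally show ?thesis by (simp add: comp_def flow_def)
qed

end

section \<open>Explicit formulas in the notation of the theorem\<close>

context cogarch_finite
begin

abbreviation pair :: "nat \<Rightarrow> 'w \<Rightarrow> real \<times> real" where
  "pair i \<omega> \<equiv> (T i \<omega>, Z i \<omega>)"

lemma marks_pair: "marks \<omega> = (\<lambda>i. pair (Suc i) \<omega>)"
  by (simp add: marks_def)

lemma compound_poisson:
  "AE \<omega> in M. \<forall>t\<ge>0. finite {s \<in> {0<..t}. jump (path \<omega>) s \<noteq> 0} \<and>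
    disc_qv (path \<omega>) t = (\<Sum>i=1..jump_count (path \<omega>) t. Z i \<omega>)"
  using AE_good
proof eventually_elim
  case (elim \<omega>)
  interpret jump_path "path \<omega>" using elim unfolding good_def by blast
  have Z: "Z i \<omega> = (jump (path \<omega>) (jt i))\<^sup>2" if "i \<ge> 1" for i
    using elim that unfolding good_def by (metis Suc_le_D One_nat_def)
  show ?case
  proof (intro allI impI conjI)
    fix t :: real assume t: "t \<ge> 0"
    have "{s \<in> {0<..t}. jump (path \<omega>) s \<noteq> 0} = jumps (path \<omega>) \<inter> {..t}" by (auto simp: jumps_def)
    then show "finite {s \<in> {0<..t}. jump (path \<omega>) s \<noteq> 0}" using finite_jumps by simp
    show "disc_qv (path \<omega>) t = (\<Sum>i=1..jump_count (path \<omega>) t. Z i \<omega>)"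
      unfolding disc_qv_eq_sum[OF t] by (rule sum.cong) (simp_all add: Z)
  qed
qed

lemma fwd_Suc_affine:
  "fwd F.cmap (Suc n) (marks \<omega>) x = C_mat (pair (Suc n) \<omega>) *v fwd F.cmap n (marks \<omega>) x + D_vec (pair (Suc n) \<omega>)"
  unfolding fwd.simps marks_pair by (simp only: cmap_affine)

lemma state_recurrence:
  "AE \<omega> in M. \<forall>n. Y (\<Sum>i=1..n + 1. T i \<omega>) \<omega> = C_mat (pair (n + 1) \<omega>) *v Y (\<Sum>i=1..n. T i \<omega>) \<omega> + D_vec (pair (n + 1) \<omega>)"
  using AE_solved
proof eventually_elim
  case (elim \<omega>)
  then have "Y (\<Sum>i=1..n. T i \<omega>) \<omega> = fwd F.cmap n (marks \<omega>) (Y 0 \<omega>)" for n unfolding solved_def by blast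
  then show ?case unfolding Suc_eq_plus1[symmetric] by (simp only: fwd_Suc_affine simp_thms)
qed

lemma state_explicit:
  "AE \<omega> in M. \<forall>t>0. Y t \<omega> = (let n = jump_count (path \<omega>) t in
    mexp ((t - (\<Sum>i=1..n. T i \<omega>)) *\<^sub>R B) *v
      ((if n \<noteq> 0 then D_vec (pair n \<omega>) else 0)
       + (\<Sum>i\<in>{i. i + 2 \<le> n}. mprod (map (\<lambda>j. C_mat (pair j \<omega>)) (rev [n - i ..< n + 1])) *v D_vec (pair (n - i - 1) \<omega>))
       + mprod (map (\<lambda>j. C_mat (pair j \<omega>)) (rev [1 ..< n + 1])) *v Y 0 \<omega>))"
  using AE_solved
proof eventually_elim
  case (elim \<omega>)
  then have 1: "Y t \<omega> = flow (t - (\<Sum>i=1..jump_count (path \<omega>) t. T i \<omega>)) (fwd F.cmap (jump_count (path \<omega>) t) (marks \<omega>) (Y 0 \<omega>))"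
    if "t > 0" for t using that unfolding solved_def by (metis less_imp_le)
  have 2: "fwd F.cmap n (marks \<omega>) (Y 0 \<omega>) = (if n \<noteq> 0 then D_vec (pair n \<omega>) else 0)
       + (\<Sum>i\<in>{i. i + 2 \<le> n}. mprod (map (\<lambda>j. C_mat (pair j \<omega>)) (rev [n - i ..< n + 1])) *v D_vec (pair (n - i - 1) \<omega>))
       + mprod (map (\<lambda>j. C_mat (pair j \<omega>)) (rev [1 ..< n + 1])) *v fwd F.cmap 0 (marks \<omega>) (Y 0 \<omega>)" for n
    by (rule affine_recurrence_solution[of "\<lambda>n. fwd F.cmap n (marks \<omega>) (Y 0 \<omega>)" "\<lambda>n. C_mat (pair n \<omega>)" "\<lambda>n. D_vec (pair n \<omega>)", OF fwd_Suc_affine])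
  show ?case unfolding Let_def
  proof (intro allI impI)
    fix t :: real assume t: "t > 0"
    show "Y t \<omega> = mexp ((t - (\<Sum>i=1..jump_count (path \<omega>) t. T i \<omega>)) *\<^sub>R B) *v
      ((if jump_count (path \<omega>) t \<noteq> 0 then D_vec (pair (jump_count (path \<omega>) t) \<omega>) else 0)
       + (\<Sum>i\<in>{i. i + 2 \<le> jump_count (path \<omega>) t}.
            mprod (map (\<lambda>j. C_mat (pair j \<omega>)) (rev [jump_count (path \<omega>) t - i ..< jump_count (path \<omega>) t + 1])) *v
              D_vec (pair (jump_count (path \<omega>) t - i - 1) \<omega>))
       + mprod (map (\<lambda>j. C_mat (pair j \<omega>)) (rev [1 ..< jump_count (path \<omega>) t + 1])) *v Y 0 \<omega>)"
      unfolding 1[OF t] 2[unfolded fwd.simps(1)] flow_def ..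
  qed
qed

lemma state_law:
  assumes "t > 0"
  shows "eq_in_law M (Y t) (\<lambda>\<omega>. let n = jump_count (path \<omega>) t in
    mexp ((t - (\<Sum>i=1..n. T i \<omega>)) *\<^sub>R B) *v
      ((if n \<noteq> 0 then D_vec (pair 1 \<omega>) else 0)
       + (\<Sum>i\<in>{1..n - 1}. mprod (map (\<lambda>j. C_mat (pair j \<omega>)) [1 ..< i + 1]) *v D_vec (pair (i + 1) \<omega>))
       + mprod (map (\<lambda>j. C_mat (pair j \<omega>)) [1 ..< n + 1]) *v Y 0 \<omega>))"
proof (rule eq_in_law_bwd_state)
  show "AE \<omega> in M. (let n = jump_count (path \<omega>) t in
    mexp ((t - (\<Sum>i=1..n. T i \<omega>)) *\<^sub>R B) *v
      ((if n \<noteq> 0 then D_vec (pair 1 \<omega>) else 0)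
       + (\<Sum>i\<in>{1..n - 1}. mprod (map (\<lambda>j. C_mat (pair j \<omega>)) [1 ..< i + 1]) *v D_vec (pair (i + 1) \<omega>))
       + mprod (map (\<lambda>j. C_mat (pair j \<omega>)) [1 ..< n + 1]) *v Y 0 \<omega>)) = bwd_state t (marks \<omega>) (Y 0 \<omega>)"
    using AE_good
  proof eventually_elim
    case (elim \<omega>)
    have "bwd F.cmap n (marks \<omega>) (Y 0 \<omega>) = (if n \<noteq> 0 then D_vec (pair 1 \<omega>) else 0)
       + (\<Sum>i\<in>{1..n - 1}. mprod (map (\<lambda>j. C_mat (pair j \<omega>)) [1 ..< i + 1]) *v D_vec (pair (i + 1) \<omega>))
       + mprod (map (\<lambda>j. C_mat (pair j \<omega>)) [1 ..< n + 1]) *v Y 0 \<omega>" for n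
      unfolding cmap_affine marks_pair by (rule bwd_affine'[where s = "\<lambda>i. pair i \<omega>"])
    then show ?case
      unfolding bwd_state_def flow_def arrival_marks cnt_marks[OF elim less_imp_le[OF assms]] Let_def by (simp only:)
  qed
qed (use assms in simp)

end

context cogarch_stable
begin

lemma C_limit_marks:
  "C_limit (marks \<omega>) = (\<Sum>i. mprod (map (\<lambda>j. C_mat (pair j \<omega>)) [1..<i+1]) *v D_vec (pair (i+1) \<omega>))"
  "AE \<omega> in M. summable (\<lambda>i. norm (mprod (map (\<lambda>j. C_mat (pair j \<omega>)) [1..<i+1]) *v D_vec (pair (i+1) \<omega>)))"
proof -
  \<comment> \<open>The marks are numbered from 0 and the pairs from 1, hence the shifted list of
    indices.\<close>
  have eq: "mprod (map (\<lambda>j. C_mat (marks \<omega> j)) [0..<i]) *v D_vec (marks \<omega> i) =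
      mprod (map (\<lambda>j. C_mat (pair j \<omega>)) [1..<i+1]) *v D_vec (pair (i+1) \<omega>)" for i \<omega>
  proof -
    have "map (\<lambda>j. C_mat (pair (Suc j) \<omega>)) [0..<i] = map (\<lambda>j. C_mat (pair j \<omega>)) [1..<i+1]"
      by (simp add: map_Suc_upt[symmetric] comp_def del: upt_Suc)
    then show ?thesis unfolding marks_pair by simp
  qed
  show "C_limit (marks \<omega>) = (\<Sum>i. mprod (map (\<lambda>j. C_mat (pair j \<omega>)) [1..<i+1]) *v D_vec (pair (i+1) \<omega>))"
    unfolding C_limit_def eq ..
  show "AE \<omega> in M. summable (\<lambda>i. norm (mprod (map (\<lambda>j. C_mat (pair j \<omega>)) [1..<i+1]) *v D_vec (pair (i+1) \<omega>)))"
    using AE_marks[OF AE_C_limit(1)] unfolding eq .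
qed

end

text \<open>The entry of e a' in row q and column p is \<open>\<alpha> p\<close>. A nonzero matrix
  has positive operator norm, and the estimates divide by that norm.\<close>

lemma outer_last_unit_nonzero:
  fixes \<alpha> :: "nat \<Rightarrow> real"
  assumes p: "1 \<le> p" "p \<le> CARD('q::{finite,linorder})" and \<alpha>: "\<alpha> p \<noteq> 0"
  shows "outer last_unit (coeff_vec \<alpha>) \<noteq> (0 :: real^('q::_)^('q::_))"
proof
  assume 0: "outer last_unit (coeff_vec \<alpha>) = (0 :: real^('q::_)^('q::_))"
  have "p \<in> pos ` (UNIV :: 'q set)" "CARD('q) \<in> pos ` (UNIV :: 'q set)"
    using bij_betw_imp_surj_on[OF bij_betw_pos[where 'q = 'q]] p by auto
  then obtain i j :: 'q where ij: "p = pos j" "CARD('q) = pos i" by blast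
  have "outer last_unit (coeff_vec \<alpha>) $ i $ j = (0 :: real)" unfolding 0 by simp
  then show False using ij \<alpha> by (simp add: outer_def last_unit_def coeff_vec_def)
qed

text \<open>An equivalence with a single law says at once that this law solves the equation and that
  no other does. The integral is compared in \<open>ereal\<close>, so that an infinite value fails
  the condition.\<close>

theorem theorem3p5:
  fixes M :: "'w measure" and p :: nat and \<alpha> \<beta> :: "nat \<Rightarrow> real"
    and B :: "real^('q::{finite,linorder})^('q::_)" and a e :: "real^('q::_)"
    and L :: "real \<Rightarrow> 'w \<Rightarrow> real" and \<nu> :: "real measure"
    and Y :: "real \<Rightarrow> 'w \<Rightarrow> real^('q::_)"
    and N :: "real \<Rightarrow> 'w \<Rightarrow> nat" and T Z \<Gamma> :: "nat \<Rightarrow> 'w \<Rightarrow> real"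
    and C :: "nat \<Rightarrow> 'w \<Rightarrow> real^('q::_)^('q::_)" and D :: "nat \<Rightarrow> 'w \<Rightarrow> real^('q::_)"
    and Yhat :: "'w \<Rightarrow> real^('q::_)" and Q :: "'w \<Rightarrow> real^('q::_)^('q::_)" and R :: "'w \<Rightarrow> real^('q::_)"
  assumes M: "prob_space M"
    and p: "1 \<le> p" "p \<le> CARD('q)"
    and \<alpha>: "\<alpha> 0 > 0" "\<alpha> p \<noteq> 0" "\<forall>i\<in>{p<..CARD('q)}. \<alpha> i = 0"
    and \<beta>: "\<beta> CARD('q) \<noteq> 0"
    and B: "B = companion \<beta>" and a: "a = coeff_vec \<alpha>" and e: "e = last_unit"
    and L: "levy_process M L" "has_levy_measure M L \<nu>" "emeasure \<nu> UNIV \<noteq> 0"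
    and Y: "cogarch_state M B a (\<alpha> 0) L Y"
    and fin: "emeasure \<nu> UNIV < \<infinity>"
    and N: "\<And>t \<omega>. N t \<omega> = jump_count (\<lambda>s. L s \<omega>) t"
    and TZ_measurable: "\<And>i. T i \<in> borel_measurable M" "\<And>i. Z i \<in> borel_measurable M"
    and T: "AE \<omega> in M. \<forall>i\<ge>1. T i \<omega> = jump_time (\<lambda>s. L s \<omega>) i - jump_time (\<lambda>s. L s \<omega>) (i - 1)"
    and Z: "AE \<omega> in M. \<forall>i\<ge>1. Z i \<omega> = (jump (\<lambda>s. L s \<omega>) (jump_time (\<lambda>s. L s \<omega>) i))\<^sup>2"
    and TZ0_indep: "indep_rvs M borel (\<lambda>\<omega>. (T 0 \<omega>, Z 0 \<omega>))
          (\<Pi>\<^sub>M i\<in>{1..}. borel) (\<lambda>\<omega>. \<lambda>i\<in>{1..}. (T i \<omega>, Z i \<omega>))"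
    and TZ0_law: "distr M borel (\<lambda>\<omega>. (T 0 \<omega>, Z 0 \<omega>)) = distr M borel (\<lambda>\<omega>. (T 1 \<omega>, Z 1 \<omega>))"
    and C: "\<And>i \<omega>. C i \<omega> = (mat 1 + Z i \<omega> *\<^sub>R outer e a) ** mexp (T i \<omega> *\<^sub>R B)"
    and D: "\<And>i \<omega>. D i \<omega> = (\<alpha> 0 * Z i \<omega>) *\<^sub>R e"
    and \<Gamma>: "\<And>n \<omega>. \<Gamma> n \<omega> = (\<Sum>i=1..n. T i \<omega>)"
    and Yhat: "\<And>\<omega>. Yhat \<omega> = (\<Sum>i. mprod (map (\<lambda>j. C j \<omega>) [1..<i+1]) *v D (i+1) \<omega>)"
    and Q: "\<And>\<omega>. Q \<omega> = mexp (T 0 \<omega> *\<^sub>R B) ** (mat 1 + Z 0 \<omega> *\<^sub>R outer e a)"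
    and R: "\<And>\<omega>. R \<omega> = (\<alpha> 0 * Z 0 \<omega>) *\<^sub>R (mexp (T 0 \<omega> *\<^sub>R B) *v e)"
  shows
    \<comment> \<open>(a)\<close>
    "(AE \<omega> in M. \<forall>t\<ge>0. finite {s \<in> {0<..t}. jump (\<lambda>u. L u \<omega>) s \<noteq> 0} \<and>
        disc_qv (\<lambda>u. L u \<omega>) t = (\<Sum>i=1..N t \<omega>. Z i \<omega>))
   \<and> (AE \<omega> in M. \<forall>n. Y (\<Gamma> (n+1) \<omega>) \<omega> = C (n+1) \<omega> *v Y (\<Gamma> n \<omega>) \<omega> + D (n+1) \<omega>)
   \<and> (AE \<omega> in M. \<forall>t>0. Y t \<omega> =
        mexp ((t - \<Gamma> (N t \<omega>) \<omega>) *\<^sub>R B) *v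
          ((if N t \<omega> \<noteq> 0 then D (N t \<omega>) \<omega> else 0)
           + (\<Sum>i\<in>{i. i + 2 \<le> N t \<omega>}.
                mprod (map (\<lambda>j. C j \<omega>) (rev [N t \<omega> - i ..< N t \<omega> + 1])) *v D (N t \<omega> - i - 1) \<omega>)
           + mprod (map (\<lambda>j. C j \<omega>) (rev [1 ..< N t \<omega> + 1])) *v Y 0 \<omega>))
   \<and> (\<forall>t>0. eq_in_law M (Y t) (\<lambda>\<omega>.
        mexp ((t - \<Gamma> (N t \<omega>) \<omega>) *\<^sub>R B) *v
          ((if N t \<omega> \<noteq> 0 then D 1 \<omega> else 0)
           + (\<Sum>i\<in>{1..N t \<omega> - 1}. mprod (map (\<lambda>j. C j \<omega>) [1 ..< i + 1]) *v D (i+1) \<omega>)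
           + mprod (map (\<lambda>j. C j \<omega>) [1 ..< N t \<omega> + 1]) *v Y 0 \<omega>)))
   \<and> \<comment> \<open>(b)\<close>
     (card (eigenvalues (map_matrix complex_of_real B)) = CARD('q) \<and>
      (\<exists>(r::ereal) (S :: complex^('q::_)^('q::_)). 1 \<le> r \<and> invertible S \<and>
         diagonal_matrix (matrix_inv S ** map_matrix complex_of_real B ** S) \<and>
         enn2ereal (\<integral>\<^sup>+y. ennreal (ln (1 + matrix_Lr_norm r
             (matrix_inv S ** map_matrix complex_of_real (outer e a) ** S) * y\<^sup>2)) \<partial>\<nu>)
           < ereal (- spectral_abscissa B))
      \<longrightarrow>
        (AE \<omega> in M. summable (\<lambda>i. norm (mprod (map (\<lambda>j. C j \<omega>) [1..<i+1]) *v D (i+1) \<omega>)))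
      \<and> Yhat \<in> borel_measurable M
      \<and> (\<forall>\<pi>. solves_affine_fixed_point M (C 1) (D 1) \<pi> \<longleftrightarrow> \<pi> = distr M borel Yhat)
      \<and> (strictly_stationary M (\<lambda>n \<omega>. Y (\<Gamma> n \<omega>) \<omega>) \<longleftrightarrow> distr M borel (Y 0) = distr M borel Yhat)
      \<and> (\<exists>\<mu>. limit_law_at_top M Y \<mu>
           \<and> \<mu> = distr (distr M borel (T 1) \<Otimes>\<^sub>M M) borel (\<lambda>(u, \<omega>). mexp (u *\<^sub>R B) *v Yhat \<omega>)
           \<and> (\<forall>T'. T' \<in> borel_measurable M
                \<and> indep_rvs M borel T' (\<Pi>\<^sub>M i\<in>UNIV. borel) (\<lambda>\<omega> i. (T i \<omega>, Z i \<omega>))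
                \<and> distr M borel T' = distr M borel (T 1)
                \<longrightarrow> \<mu> = distr M borel (\<lambda>\<omega>. mexp (T' \<omega> *\<^sub>R B) *v Yhat \<omega>))
           \<and> (\<forall>\<pi>. solves_affine_fixed_point M Q R \<pi> \<longleftrightarrow> \<pi> = \<mu>)))"
proof -
  interpret cogarch_finite M L \<nu> T Z B a "\<alpha> 0" Y
    by (intro cogarch_finite.intro levy_finite.intro levy_finite_axioms.intro cogarch_finite_axioms.intro;
        fact M L Y fin TZ_measurable T Z)
  have CD: "C = (\<lambda>i \<omega>. C_mat (pair i \<omega>))" "D = (\<lambda>i \<omega>. D_vec (pair i \<omega>))"
    by (intro ext, simp add: C D C_mat_def D_vec_def e)+
  have QR: "Q = (\<lambda>\<omega>. Q_mat (pair 0 \<omega>))" "R = (\<lambda>\<omega>. R_vec (pair 0 \<omega>))"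
    by (intro ext, simp add: Q R Q_mat_def R_vec_def e)+
  have \<Gamma>': "\<Gamma> = (\<lambda>n \<omega>. \<Sum>i=1..n. T i \<omega>)" and N': "N = (\<lambda>t \<omega>. jump_count (path \<omega>) t)"
    by (intro ext, simp only: \<Gamma> N)+
  have b: "(AE \<omega> in M. summable (\<lambda>i. norm (mprod (map (\<lambda>j. C j \<omega>) [1..<i+1]) *v D (i+1) \<omega>)))
      \<and> Yhat \<in> borel_measurable M
      \<and> (\<forall>\<pi>. solves_affine_fixed_point M (C 1) (D 1) \<pi> \<longleftrightarrow> \<pi> = distr M borel Yhat)
      \<and> (strictly_stationary M (\<lambda>n \<omega>. Y (\<Gamma> n \<omega>) \<omega>) \<longleftrightarrow> distr M borel (Y 0) = distr M borel Yhat)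
      \<and> (\<exists>\<mu>. limit_law_at_top M Y \<mu>
           \<and> \<mu> = distr (distr M borel (T 1) \<Otimes>\<^sub>M M) borel (\<lambda>(u, \<omega>). mexp (u *\<^sub>R B) *v Yhat \<omega>)
           \<and> (\<forall>T'. T' \<in> borel_measurable M
                \<and> indep_rvs M borel T' (\<Pi>\<^sub>M i\<in>UNIV. borel) (\<lambda>\<omega> i. (T i \<omega>, Z i \<omega>))
                \<and> distr M borel T' = distr M borel (T 1)
                \<longrightarrow> \<mu> = distr M borel (\<lambda>\<omega>. mexp (T' \<omega> *\<^sub>R B) *v Yhat \<omega>))
           \<and> (\<forall>\<pi>. solves_affine_fixed_point M Q R \<pi> \<longleftrightarrow> \<pi> = \<mu>))"
    if eig: "card (eigenvalues (map_matrix complex_of_real B)) = CARD('q)"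
    and ex: "\<exists>(r::ereal) (S :: complex^('q::_)^('q::_)). 1 \<le> r \<and> invertible S \<and>
         diagonal_matrix (matrix_inv S ** map_matrix complex_of_real B ** S) \<and>
         enn2ereal (\<integral>\<^sup>+y. ennreal (ln (1 + matrix_Lr_norm r
             (matrix_inv S ** map_matrix complex_of_real (outer e a) ** S) * y\<^sup>2)) \<partial>\<nu>)
           < ereal (- spectral_abscissa B)"
  proof -
    obtain r and S :: "complex^('q::_)^('q::_)" where r: "1 \<le> r" and S: "invertible S"
      and diag: "diagonal_matrix (matrix_inv S ** map_matrix complex_of_real B ** S)"
      and drift: "enn2ereal (\<integral>\<^sup>+y. ennreal (ln (1 + matrix_Lr_norm r
             (matrix_inv S ** map_matrix complex_of_real (outer e a) ** S) * y\<^sup>2)) \<partial>\<nu>) < ereal (- spectral_abscissa B)"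
      using ex by blast
    \<comment> \<open>An infinite set has cardinality 0, so the prescribed positive number of
      eigenvalues gives finiteness, on which the maximum in \<open>spectral_abscissa\<close>
      relies.\<close>
    have finite: "finite (eigenvalues (map_matrix complex_of_real B))"
      by (rule card_ge_0_finite) (simp add: eig)
    note norm = diagonalizing_norm(1-3,6,7)[OF r S diag finite]
      diagonalizing_norm(4)[OF r S diag finite, where F = "outer last_unit a"]
      diagonalizing_norm(5)[OF r S diag finite, where F = "outer last_unit a",
        OF outer_last_unit_nonzero[OF p, where \<alpha> = \<alpha>, OF \<alpha>(2), folded a]]
    interpret cogarch_stable M L \<nu> T Z B a "\<alpha> 0" Y "\<lambda>v. vec_Lr_norm r (matrix_inv S *v cvec v)"
      "matrix_Lr_norm r (matrix_inv S ** map_matrix complex_of_real (outer last_unit a) ** S)" "spectral_abscissa B"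
      by (rule cogarch_stable.intro[OF cogarch_finite_axioms], rule cogarch_stable_axioms.intro; fact norm drift[unfolded e])
    have Yhat': "Yhat = (\<lambda>\<omega>. C_limit (marks \<omega>))"
      by (intro ext, simp only: Yhat CD C_limit_marks(1))
    have meas: "Yhat \<in> borel_measurable M"
      unfolding Yhat' by (rule measurable_compose[OF marks_measurable(2) limit_measurable(1)])
    have pair_meas: "pair i \<in> borel_measurable M" for i by measurable
    have sum: "AE \<omega> in M. summable (\<lambda>i. norm (mprod (map (\<lambda>j. C j \<omega>) [1..<i+1]) *v D (i+1) \<omega>))"
      unfolding CD by (rule C_limit_marks(2))
    have fix_C: "solves_affine_fixed_point M (C 1) (D 1) \<pi> \<longleftrightarrow> \<pi> = distr M borel Yhat" for \<pi>
      unfolding CD Yhat' limit_distr(1) by (rule fixed_point_iff(1)[OF pair_meas refl])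
    have stat: "strictly_stationary M (\<lambda>n \<omega>. Y (\<Gamma> n \<omega>) \<omega>) \<longleftrightarrow> distr M borel (Y 0) = distr M borel Yhat"
      unfolding \<Gamma>' Yhat' by (rule stationary_iff)
    have fix_Q: "solves_affine_fixed_point M Q R \<pi> \<longleftrightarrow> \<pi> = distr seq_law borel Q_limit" for \<pi>
      unfolding QR by (rule fixed_point_iff(2)[OF pair_meas TZ0_law])
    show ?thesis
      using sum meas fix_C stat fix_Q limit_law limit_law_product limit_law_realised
      unfolding Yhat' by blast
  qed
  show ?thesis
    using compound_poisson state_recurrence state_explicit state_law b
    unfolding CD \<Gamma>' N' Let_def by (intro conjI) blast+
qed

end
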